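(* Let $\Psi=(\psi_0,\psi_1,\psi_2):S^2\to F_{2,2,1}$ be a primitive immersion of constant curvature with respect to at least one $\mathrm{U}(5)$-invariant metric on $F_{2,2,1}$, where $\psi_0:S^2\to G_2(\mathbb{C}^5)$ is a linearly full holomorphic map with first and second $\partial'$-Gauss bundles $\psi_1$ and $\psi_2$. Then $\Psi$ is unitarily congruent to the curve $$\left(V_0^2\oplus V_0^1,\;V_1^2\oplus V_1^1,\;V_2^2\right),$$ where $\mathbb{C}^5=\mathbb{C}^3\oplus\mathbb{C}^2$ (orthogonal), the Veronese sequence $V_0^2,V_1^2,V_2^2$ takes values in the projective space of $\mathbb{C}^3$ and $V_0^1,V_1^1$ in the projective space of $\mathbb{C}^2$. Moreover, for a $\mathrm{U}(5)$-invariant metric on $F_{2,2,1}$ with parameters $\lambda_0,\lambda_1,\lambda_2$, the metric induced by $\Psi$ on $S^2$ has curvature $$K(\Psi)=\frac{4}{3\lambda_0+2\lambda_1}.$$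
   Context: **Grassmannians and Gauss bundles.** $\mathbb{C}^n$ carries its standard Hermitian inner product; $G_k(\mathbb{C}^n)$ is the Grassmannian of $k$-dimensional complex subspaces, a Hermitian symmetric space with its (unique up to scale) $\mathrm{U}(n)$-invariant metric and with $T^{1,0}_LG_k(\mathbb{C}^n)\cong\mathrm{Hom}(L,L^\perp)$; $\mathbb{C}P^n=G_1(\mathbb{C}^{n+1})$. A smooth map $\psi:M\to G_k(\mathbb{C}^n)$ from a Riemann surface is identified with the rank-$k$ subbundle of $M\times\mathbb{C}^n$ whose fibre at $x$ is $\psi(x)$. It is linearly full if it is not contained in $M\times W$ for any proper subspace $W\subsetneq\mathbb{C}^n$. In a local complex coordinate $z$, the $\partial'$-second fundamental form is $A'_\psi:\psi\to\psi^\perp$, $A'_\psi(v)=\pi_{\psi^\perp}(\partial_z v)$. If $\psi$ is harmonic (for instance holomorphic), $A'_\psi$ is holomorphic for the Koszul–Malgrange holomorphic structures, so its image extends across isolated points where the rank drops to a subbundle $\underline{\mathrm{Im}}\,A'_\psi$, the (first) $\partial'$-Gauss bundle of $\psi$, which is again harmonic. Put $\psi_0=\psi$ and, for $j\ge1$, let $\psi_j$ (the $j$-th $\partial'$-Gauss bundle of $\psi$) be the first $\partial'$-Gauss bundle of $\psi_{j-1}$. **Flag manifolds and primitive maps.** $F_{k_0,\dots,k_p}=\mathrm{U}(n)/(\mathrm{U}(k_0)\times\cdots\times\mathrm{U}(k_p))$ is the manifold of tuples $\Psi=(\psi_0,\dots,\psi_p)$ of mutually orthogonal subspaces with $\mathbb{C}^n=\psi_0\oplus\cdots\oplus\psi_p$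 and $\dim\psi_j=k_j$; $T^{\mathbb{C}}_\Psi F\cong\sum_{i\ne j}\mathrm{Hom}(\psi_i,\psi_j)$. Here $p>1$ and indices are taken modulo $p+1$. A smooth map $\Psi=(\psi_0,\dots,\psi_p):M\to F_{k_0,\dots,k_p}$ is primitive if $d\Psi(\partial/\partial z)$ takes values in $\sum_{j\in\mathbb{Z}_{p+1}}\mathrm{Hom}(\psi_j,\psi_{j+1})$ for every local complex coordinate $z$. **Invariant metrics.** The $\mathrm{U}(n)$-invariant metrics on $F_{k_0,\dots,k_p}$ are $g(\xi,\eta)=\sum_{i<j}\lambda_{ij}\,\mathrm{Re}\,\mathrm{tr}(\xi_{ij}\eta_{ij}^* )$ for real tangent vectors $\xi,\eta$ with components $\xi_{ij},\eta_{ij}\in\mathrm{Hom}(\psi_i,\psi_j)$, where $\lambda_{ij}=\lambda_{ji}>0$. Its parameters are $\lambda_j:=\lambda_{j,j+1}$, $j\in\mathbb{Z}_{p+1}$. For a primitive $\Psi$ one has $\Psi^*g=\sum_{j\in\mathbb{Z}_{p+1}}\lambda_j\gamma_j\,dz\,d\bar z$ with $\gamma_j=\mathrm{tr}\,A'_{\psi_j}(A'_{\psi_j})^*$. "$\Psi$ has constant curvature with respect to $g$" means that $\Psi^*g$ has constant Gaussian curvature $K(\Psi)$, where a metric $f\,dz\,d\bar z=f(dx^2+dy^2)$ has curvature $-\frac{2}{f}\partial_z\partial_{\bar z}\log f$. **Veronese sequence.** With $z$ the canonical coordinate on $\mathbb{C}=S^2\setminus\{\infty\}$, $V_0^n=V^n:S^2\to\mathbb{C}P^n$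 is $V^n(z)=[1,\sqrt{\binom n1}z,\dots,\sqrt{\binom nr}z^r,\dots,z^n]$, and $V_j^n:S^2\to\mathbb{C}P^n$ ($0\le j\le n$) is its $j$-th $\partial'$-Gauss bundle; the $V_j^n$ are mutually orthogonal lines spanning $\mathbb{C}^{n+1}$. **Congruence.** Maps $\Psi,\Psi'$ from $S^2$ to $F_{k_0,\dots,k_p}$ are unitarily congruent (as curves) if there are $u\in\mathrm{U}(n)$ and a biholomorphism $\varphi$ of $S^2$ with $\Psi=u\cdot(\Psi'\circ\varphi)$, where $u(\psi_0,\dots,\psi_p)=(u\psi_0,\dots,u\psi_p)$. In the curvature formula, $\Psi$ denotes the displayed model curve. *)

theory Defs
  imports "HOL-Analysis.Analysis"
begin

unbundle no fps_syntax

section \<open>The Riemann sphere\<close>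

datatype rsphere = Fin complex | Infty

definition chart0 :: "complex \<Rightarrow> rsphere" where
  "chart0 z = Fin z"

definition chart1 :: "complex \<Rightarrow> rsphere" where
  "chart1 w = (if w = 0 then Infty else Fin (1 / w))"

text \<open>Holomorphic maps from an open subset of the plane to the sphere: locally, the map is a
  holomorphic function read in one of the two standard parametrizations.\<close>

definition sphere_holomorphic_on :: "(complex \<Rightarrow> rsphere) \<Rightarrow> complex set \<Rightarrow> bool" where
  "sphere_holomorphic_on h U \<longleftrightarrow>
     (\<forall>z\<in>U. \<exists>V g. open V \<and> z \<in> V \<and> V \<subseteq> U \<and> g holomorphic_on V \<and>
        ((\<forall>w\<in>V. h w = chart0 (g w)) \<or> (\<forall>w\<in>V. h w = chart1 (g w))))"

text \<open>A local complex coordinate is given by its inverse, an injective holomorphic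
  parametrization \<open>c : U \<rightarrow> S\<^sup>2\<close>.\<close>

definition local_coord :: "complex set \<Rightarrow> (complex \<Rightarrow> rsphere) \<Rightarrow> bool" where
  "local_coord U c \<longleftrightarrow> open U \<and> inj_on c U \<and> sphere_holomorphic_on c U"

definition biholomorphism :: "(rsphere \<Rightarrow> rsphere) \<Rightarrow> bool" where
  "biholomorphism \<phi> \<longleftrightarrow> bij \<phi> \<and>
     (\<forall>\<theta>\<in>{\<phi>, inv \<phi>}. \<forall>c\<in>{chart0, chart1}. sphere_holomorphic_on (\<theta> \<circ> c) UNIV)"

section \<open>Differentiation\<close>

text \<open>\<open>C\<^sup>k\<close> in the real sense on an open set, by iterated partial derivatives in the
  directions \<open>1\<close> and \<open>\<i>\<close>.\<close>

primrec C_k_on :: "nat \<Rightarrow> complex set \<Rightarrow> (complex \<Rightarrow> 'a::real_normed_vector) \<Rightarrow> bool" where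
  "C_k_on 0 U f \<longleftrightarrow> continuous_on U f"
| "C_k_on (Suc k) U f \<longleftrightarrow> f differentiable_on U \<and>
     (\<forall>v\<in>{1, \<i>}. C_k_on k U (\<lambda>z. frechet_derivative f (at z) v))"

definition smooth_on :: "complex set \<Rightarrow> (complex \<Rightarrow> 'a::real_normed_vector) \<Rightarrow> bool" where
  "smooth_on U f \<longleftrightarrow> (\<forall>k. C_k_on k U f)"

definition del_z :: "(complex \<Rightarrow> complex) \<Rightarrow> complex \<Rightarrow> complex" where
  "del_z f z =
     (frechet_derivative f (at z) 1 - \<i> * frechet_derivative f (at z) \<i>) / 2"

definition del_zbar :: "(complex \<Rightarrow> complex) \<Rightarrow> complex \<Rightarrow> complex" where
  "del_zbar f z =
     (frechet_derivative f (at z) 1 + \<i> * frechet_derivative f (at z) \<i>) / 2"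

definition del_z_vec :: "(complex \<Rightarrow> complex^'n) \<Rightarrow> complex \<Rightarrow> complex^'n" where
  "del_z_vec s z = (\<chi> a. del_z (\<lambda>w. s w $ a) z)"

definition del_z_mat :: "(complex \<Rightarrow> complex^'n^'m) \<Rightarrow> complex \<Rightarrow> complex^'n^'m" where
  "del_z_mat F z = (\<chi> a b. del_z (\<lambda>w. F w $ a $ b) z)"

definition del_zbar_mat :: "(complex \<Rightarrow> complex^'n^'m) \<Rightarrow> complex \<Rightarrow> complex^'n^'m" where
  "del_zbar_mat F z = (\<chi> a b. del_zbar (\<lambda>w. F w $ a $ b) z)"

section \<open>Grassmannians\<close>

definition herm :: "complex^'n \<Rightarrow> complex^'n \<Rightarrow> complex" where
  "herm v w = (\<Sum>a\<in>UNIV. v $ a * cnj (w $ a))"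

definition adj :: "complex^'n^'m \<Rightarrow> complex^'m^'n" where
  "adj A = (\<chi> a b. cnj (A $ b $ a))"

definition unitary :: "complex^'n^'n \<Rightarrow> bool" where
  "unitary u \<longleftrightarrow> adj u ** u = mat 1 \<and> u ** adj u = mat 1"

definition grassmannian :: "nat \<Rightarrow> (complex^'n) set set" where
  "grassmannian k = {L. vec.subspace L \<and> vec.dim L = k}"

definition orth_proj :: "(complex^'n) set \<Rightarrow> complex^'n^'n" where
  "orth_proj L = (THE P. P ** P = P \<and> adj P = P \<and> range ((*v) P) = L)"

text \<open>The smooth structure of the Grassmannian is the one it inherits as a submanifold of the
  space of matrices, a subspace being identified with its orthogonal projection.\<close>

definition smooth_grass_map :: "nat \<Rightarrow> (rsphere \<Rightarrow> (complex^'n) set) \<Rightarrow> bool" where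
  "smooth_grass_map k \<psi> \<longleftrightarrow> (\<forall>x. \<psi> x \<in> grassmannian k) \<and>
     (\<forall>c\<in>{chart0, chart1}. smooth_on UNIV (\<lambda>z. orth_proj (\<psi> (c z))))"

definition linearly_full :: "(rsphere \<Rightarrow> (complex^'n) set) \<Rightarrow> bool" where
  "linearly_full \<psi> \<longleftrightarrow> \<not> (\<exists>W. vec.subspace W \<and> W \<noteq> UNIV \<and> (\<forall>x. \<psi> x \<subseteq> W))"

text \<open>The matrix of \<open>A'\<^sub>\<psi>\<close> at \<open>c z\<close> in the local coordinate \<open>c\<close>, extended by zero to
  \<open>\<psi>\<^sup>\<bottom>\<close>: the vector \<open>v\<close> in the fibre is extended to the local section \<open>w \<mapsto> P(w) v\<close>, where \<open>P\<close>
  is the orthogonal projection onto \<open>\<psi>\<close>. Lemma \<open>second_ff_section\<close> below shows that any other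
  local section through \<open>v\<close> gives the same value.\<close>

definition second_ff ::
    "(rsphere \<Rightarrow> (complex^'n) set) \<Rightarrow> (complex \<Rightarrow> rsphere) \<Rightarrow> complex \<Rightarrow> complex^'n^'n" where
  "second_ff \<psi> c z =
     (mat 1 - orth_proj (\<psi> (c z))) ** del_z_mat (\<lambda>w. orth_proj (\<psi> (c w))) z
       ** orth_proj (\<psi> (c z))"

lemma second_ff_section:
  fixes \<psi> :: "rsphere \<Rightarrow> (complex^'n) set" and s :: "complex \<Rightarrow> complex^'n"
  assumes P: "(\<lambda>w. orth_proj (\<psi> (c w))) differentiable (at z)"
    and s: "s differentiable (at z)"
    and sec: "\<forall>\<^sub>F w in nhds z. orth_proj (\<psi> (c w)) *v s w = s w"
    and idem: "orth_proj (\<psi> (c z)) ** orth_proj (\<psi> (c z)) = orth_proj (\<psi> (c z))"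
  shows "second_ff \<psi> c z *v s z = (mat 1 - orth_proj (\<psi> (c z))) *v del_z_vec s z"
proof -
  define P where "P = (\<lambda>w. orth_proj (\<psi> (c w)))"
  have nth: "(\<lambda>w. f w $ a) differentiable (at z)" if "f differentiable (at z)"
    for f :: "complex \<Rightarrow> 'x::real_normed_vector^'n" and a
    using that bounded_linear.has_derivative[OF bounded_linear_vec_nth[of a], of f _ "at z"]
    unfolding differentiable_def by blast
  have dP: "(\<lambda>w. P w $ a $ b) differentiable (at z)" for a b
    using P unfolding P_def by (intro nth)
  have ds: "(\<lambda>w. s w $ b) differentiable (at z)" for b
    using s by (intro nth)
  have eq: "\<forall>\<^sub>F w in nhds z. (\<Sum>b\<in>UNIV. P w $ a $ b * s w $ b) = s w $ a" for a
    using sec by eventually_elim (simp add: P_def matrix_vector_mult_def vec_eq_iff)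
  have fd: "frechet_derivative (\<lambda>w. s w $ a) (at z) h =
      (\<Sum>b\<in>UNIV. P z $ a $ b * frechet_derivative (\<lambda>w. s w $ b) (at z) h
        + frechet_derivative (\<lambda>w. P w $ a $ b) (at z) h * s z $ b)" for a h
  proof -
    have "((\<lambda>w. \<Sum>b\<in>UNIV. P w $ a $ b * s w $ b) has_derivative
        (\<lambda>h. \<Sum>b\<in>UNIV. P z $ a $ b * frechet_derivative (\<lambda>w. s w $ b) (at z) h
          + frechet_derivative (\<lambda>w. P w $ a $ b) (at z) h * s z $ b)) (at z)"
      using dP ds by (intro has_derivative_sum has_derivative_mult)
        (simp_all add: frechet_derivative_works)
    moreover have "\<forall>\<^sub>F w in at z. (\<Sum>b\<in>UNIV. P w $ a $ b * s w $ b) = s w $ a"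
      using eq[of a] by (simp add: eventually_nhds_conv_at)
    ultimately have "((\<lambda>w. s w $ a) has_derivative
        (\<lambda>h. \<Sum>b\<in>UNIV. P z $ a $ b * frechet_derivative (\<lambda>w. s w $ b) (at z) h
          + frechet_derivative (\<lambda>w. P w $ a $ b) (at z) h * s z $ b)) (at z)"
      by (rule has_derivative_transform_eventually)
        (use eventually_nhds_x_imp_x[OF eq[of a]] in auto)
    then show ?thesis
      by (metis (no_types, lifting) frechet_derivative_at)
  qed
  have alg: "(p * d\<^sub>1 + e\<^sub>1 * t - \<i> * (p * d\<^sub>2 + e\<^sub>2 * t)) / 2 =
      p * ((d\<^sub>1 - \<i> * d\<^sub>2) / 2) + (e\<^sub>1 - \<i> * e\<^sub>2) / 2 * t" for p d\<^sub>1 d\<^sub>2 e\<^sub>1 e\<^sub>2 t :: complex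
    by (simp add: field_simps)
  have comp: "del_z (\<lambda>w. s w $ a) z = (\<Sum>b\<in>UNIV. P z $ a $ b * del_z (\<lambda>w. s w $ b) z)
      + (\<Sum>b\<in>UNIV. del_z (\<lambda>w. P w $ a $ b) z * s z $ b)" for a
  proof -
    let ?D = "\<lambda>h b. P z $ a $ b * frechet_derivative (\<lambda>w. s w $ b) (at z) h
        + frechet_derivative (\<lambda>w. P w $ a $ b) (at z) h * s z $ b"
    have "del_z (\<lambda>w. s w $ a) z = (sum (?D 1) UNIV - \<i> * sum (?D \<i>) UNIV) / 2"
      unfolding del_z_def fd[of a 1] fd[of a \<i>] ..
    also have "\<dots> = (\<Sum>b\<in>UNIV. (?D 1 b - \<i> * ?D \<i> b) / 2)"
      by (simp only: sum_distrib_left sum_subtractf[symmetric] sum_divide_distrib)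
    also have "\<dots> = (\<Sum>b\<in>UNIV. P z $ a $ b * del_z (\<lambda>w. s w $ b) z
        + del_z (\<lambda>w. P w $ a $ b) z * s z $ b)"
      unfolding del_z_def by (intro sum.cong refl alg)
    finally show ?thesis
      by (simp only: sum.distrib)
  qed
  have vec: "del_z_vec s z = P z *v del_z_vec s z + del_z_mat P z *v s z"
    by (simp add: vec_eq_iff del_z_vec_def del_z_mat_def matrix_vector_mult_def) (intro allI comp)
  have "(mat 1 - P z) *v del_z_vec s z =
      (mat 1 - P z) *v (P z *v del_z_vec s z) + (mat 1 - P z) *v (del_z_mat P z *v s z)"
    by (subst vec) (rule matrix_vector_right_distrib)
  moreover have "(mat 1 - P z) *v (P z *v v) = 0" for v
    using idem
    by (simp only: P_def matrix_vector_mult_diff_rdistrib matrix_vector_mul_lid)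
      (simp add: matrix_vector_mul_assoc)
  moreover have "P z *v s z = s z"
    using eventually_nhds_x_imp_x[OF sec] by (simp add: P_def)
  ultimately show ?thesis
    unfolding second_ff_def matrix_vector_mul_assoc[symmetric] P_def by simp
qed

text \<open>Since \<open>T\<^sup>1\<^sup>,\<^sup>0 = Hom(\<psi>, \<psi>\<^sup>\<bottom>)\<close>, the map is holomorphic iff the component in this space of the
  derivative along \<open>\<partial>/\<partial>z\<close>-bar vanishes.\<close>

definition holomorphic_grass_map :: "nat \<Rightarrow> (rsphere \<Rightarrow> (complex^'n) set) \<Rightarrow> bool" where
  "holomorphic_grass_map k \<psi> \<longleftrightarrow> smooth_grass_map k \<psi> \<and>
     (\<forall>U c. local_coord U c \<longrightarrow> (\<forall>z\<in>U.
        (mat 1 - orth_proj (\<psi> (c z))) ** del_zbar_mat (\<lambda>w. orth_proj (\<psi> (c w))) z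
          ** orth_proj (\<psi> (c z)) = 0))"

text \<open>The smooth subbundle agreeing with the image of \<open>A'\<^sub>\<psi>\<close> away from isolated points; it is
  unique by continuity whenever it exists.\<close>

definition is_gauss_bundle ::
    "(rsphere \<Rightarrow> (complex^'n) set) \<Rightarrow> (rsphere \<Rightarrow> (complex^'n) set) \<Rightarrow> bool" where
  "is_gauss_bundle \<psi> \<phi> \<longleftrightarrow> (\<exists>k. smooth_grass_map k \<phi>) \<and>
     (\<forall>U c. local_coord U c \<longrightarrow>
        {z \<in> U. (*v) (second_ff \<psi> c z) ` \<psi> (c z) \<noteq> \<phi> (c z)} sparse_in U)"

definition gauss_bundle :: "(rsphere \<Rightarrow> (complex^'n) set) \<Rightarrow> rsphere \<Rightarrow> (complex^'n) set" where
  "gauss_bundle \<psi> = (THE \<phi>. is_gauss_bundle \<psi> \<phi>)"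

section \<open>Flag manifolds and primitive maps\<close>

text \<open>Points of \<open>F\<^bsub>k\<^sub>0,\<dots>,k\<^sub>p\<^esub>\<close> are lists of length \<open>p + 1\<close>.\<close>

definition flag_manifold :: "nat list \<Rightarrow> (complex^'n) set list set" where
  "flag_manifold ks = {F. length F = length ks \<and>
     (\<forall>i<length ks. F ! i \<in> grassmannian (ks ! i)) \<and>
     (\<forall>i<length ks. \<forall>j<length ks. i \<noteq> j \<longrightarrow> (\<forall>v\<in>F ! i. \<forall>w\<in>F ! j. herm v w = 0)) \<and>
     vec.span (\<Union>(set F)) = UNIV}"

definition smooth_flag_map :: "nat list \<Rightarrow> (rsphere \<Rightarrow> (complex^'n) set list) \<Rightarrow> bool" where
  "smooth_flag_map ks \<Psi> \<longleftrightarrow> (\<forall>x. \<Psi> x \<in> flag_manifold ks) \<and>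
     (\<forall>i<length ks. smooth_grass_map (ks ! i) (\<lambda>x. \<Psi> x ! i))"

text \<open>The component in \<open>Hom(\<psi>\<^sub>i, \<psi>\<^sub>j)\<close> of \<open>d\<Psi>(X)\<close>, for a real tangent vector \<open>X\<close> of the
  coordinate domain, and of \<open>d\<Psi>(\<partial>/\<partial>z)\<close>; again extended by zero to a matrix.\<close>

definition tangent_comp ::
    "(rsphere \<Rightarrow> (complex^'n) set list) \<Rightarrow> (complex \<Rightarrow> rsphere) \<Rightarrow> complex \<Rightarrow> complex
      \<Rightarrow> nat \<Rightarrow> nat \<Rightarrow> complex^'n^'n" where
  "tangent_comp \<Psi> c z X i j =
     orth_proj (\<Psi> (c z) ! j)
       ** frechet_derivative (\<lambda>w. orth_proj (\<Psi> (c w) ! i)) (at z) X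
       ** orth_proj (\<Psi> (c z) ! i)"

definition del_z_comp ::
    "(rsphere \<Rightarrow> (complex^'n) set list) \<Rightarrow> (complex \<Rightarrow> rsphere) \<Rightarrow> complex
      \<Rightarrow> nat \<Rightarrow> nat \<Rightarrow> complex^'n^'n" where
  "del_z_comp \<Psi> c z i j =
     orth_proj (\<Psi> (c z) ! j) ** del_z_mat (\<lambda>w. orth_proj (\<Psi> (c w) ! i)) z
       ** orth_proj (\<Psi> (c z) ! i)"

definition primitive :: "nat list \<Rightarrow> (rsphere \<Rightarrow> (complex^'n) set list) \<Rightarrow> bool" where
  "primitive ks \<Psi> \<longleftrightarrow> smooth_flag_map ks \<Psi> \<and>
     (\<forall>U c. local_coord U c \<longrightarrow> (\<forall>z\<in>U. \<forall>i<length ks. \<forall>j<length ks.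
        i \<noteq> j \<and> j \<noteq> Suc i mod length ks \<longrightarrow> del_z_comp \<Psi> c z i j = 0))"

definition immersion :: "nat list \<Rightarrow> (rsphere \<Rightarrow> (complex^'n) set list) \<Rightarrow> bool" where
  "immersion ks \<Psi> \<longleftrightarrow> smooth_flag_map ks \<Psi> \<and>
     (\<forall>U c. local_coord U c \<longrightarrow> (\<forall>z\<in>U. \<forall>X.
        (\<forall>i<length ks. \<forall>j<length ks. i \<noteq> j \<longrightarrow> tangent_comp \<Psi> c z X i j = 0) \<longrightarrow> X = 0))"

section \<open>Invariant metrics and curvature\<close>

text \<open>The invariant metrics on \<open>F\<^bsub>k\<^sub>0,\<dots>,k\<^sub>p\<^esub>\<close> are represented by their coefficients
  \<open>\<lambda>\<^sub>i\<^sub>j\<close>.\<close>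

definition invariant_metric :: "nat list \<Rightarrow> (nat \<Rightarrow> nat \<Rightarrow> real) \<Rightarrow> bool" where
  "invariant_metric ks \<Lambda> \<longleftrightarrow> (\<forall>i<length ks. \<forall>j<length ks. i \<noteq> j \<longrightarrow>
     \<Lambda> i j = \<Lambda> j i \<and> \<Lambda> i j > 0)"

definition metric_param :: "nat list \<Rightarrow> (nat \<Rightarrow> nat \<Rightarrow> real) \<Rightarrow> nat \<Rightarrow> real" where
  "metric_param ks \<Lambda> j = \<Lambda> j (Suc j mod length ks)"

definition flag_metric ::
    "nat list \<Rightarrow> (nat \<Rightarrow> nat \<Rightarrow> real) \<Rightarrow> (nat \<Rightarrow> nat \<Rightarrow> complex^'n^'n)
      \<Rightarrow> (nat \<Rightarrow> nat \<Rightarrow> complex^'n^'n) \<Rightarrow> real" where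
  "flag_metric ks \<Lambda> \<xi> \<eta> =
     (\<Sum>j<length ks. \<Sum>i<j. \<Lambda> i j * Re (trace (\<xi> i j ** adj (\<eta> i j))))"

definition conformal_curvature :: "(complex \<Rightarrow> real) \<Rightarrow> complex \<Rightarrow> real" where
  "conformal_curvature f z =
     - 2 / f z * Re (del_z (del_zbar (\<lambda>w. of_real (ln (f w)))) z)"

text \<open>The pulled back metric is \<open>f (dx\<^sup>2 + dy\<^sup>2)\<close> in every local coordinate, with \<open>f > 0\<close>, and its
  Gaussian curvature is the constant \<open>\<kappa>\<close>.\<close>

definition has_constant_curvature ::
    "nat list \<Rightarrow> (nat \<Rightarrow> nat \<Rightarrow> real) \<Rightarrow> (rsphere \<Rightarrow> (complex^'n) set list) \<Rightarrow> real \<Rightarrow> bool" where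
  "has_constant_curvature ks \<Lambda> \<Psi> \<kappa> \<longleftrightarrow>
     (\<forall>U c. local_coord U c \<longrightarrow> (\<exists>f. \<forall>z\<in>U. f z > 0 \<and>
        (\<forall>X Y. flag_metric ks \<Lambda> (tangent_comp \<Psi> c z X) (tangent_comp \<Psi> c z Y) = f z * (X \<bullet> Y)) \<and>
        conformal_curvature f z = \<kappa>))"

section \<open>Congruence\<close>

definition unitarily_congruent ::
    "(rsphere \<Rightarrow> (complex^'n) set list) \<Rightarrow> (rsphere \<Rightarrow> (complex^'n) set list) \<Rightarrow> bool" where
  "unitarily_congruent \<Psi> \<Psi>' \<longleftrightarrow>
     (\<exists>u \<phi>. unitary u \<and> biholomorphism \<phi> \<and> (\<forall>x. \<Psi> x = map ((`) ((*v) u)) (\<Psi>' (\<phi> x))))"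

section \<open>Veronese sequence\<close>

text \<open>The copy of \<open>\<complex>\<^bsup>n+1\<^esup>\<close> in which the sequence takes values is the span of the orthonormal
  vectors \<open>e 0, \<dots>, e n\<close>. The value at infinity is the limit of the lines \<open>V\<^sup>n(z)\<close>.\<close>

fun veronese :: "nat \<Rightarrow> (nat \<Rightarrow> complex^'m) \<Rightarrow> rsphere \<Rightarrow> (complex^'m) set" where
  "veronese n e (Fin z) =
     vec.span {\<Sum>r\<le>n. (of_real (sqrt (real (n choose r))) * z ^ r) *s e r}"
| "veronese n e Infty = vec.span {e n}"

definition veronese_seq ::
    "nat \<Rightarrow> (nat \<Rightarrow> complex^'m) \<Rightarrow> nat \<Rightarrow> rsphere \<Rightarrow> (complex^'m) set" where
  "veronese_seq n e j = (gauss_bundle ^^ j) (veronese n e)"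

text \<open>The index type \<open>5\<close> consists of \<open>0, 1, 2, 3, 4\<close> (modulo 5). The first three standard basis
  vectors span \<open>\<complex>\<^sup>3\<close> and the last two \<open>\<complex>\<^sup>2\<close>; \<open>+\<close> is the sum of subspaces.\<close>

definition basis5 :: "nat \<Rightarrow> complex^5" where
  "basis5 r = axis (of_nat r) 1"

definition model_curve :: "rsphere \<Rightarrow> (complex^5) set list" where
  "model_curve x =
     (let V2 = veronese_seq 2 basis5; V1 = veronese_seq 1 (\<lambda>r. basis5 (3 + r))
      in [V2 0 x + V1 0 x, V2 1 x + V1 1 x, V2 2 x])"

end

theory Submission
  imports Defs "HOL-Complex_Analysis.Complex_Analysis"
begin

text \<open>Let \<open>P\<^sub>i\<close> be the orthogonal projection onto \<open>\<psi>\<^sub>i\<close>. Holomorphy and primitivity say that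
  \<open>\<psi>\<^sub>0\<close> is holomorphic, \<open>\<psi>\<^sub>2\<close> is antiholomorphic and \<open>P\<^sub>2 \<partial>P\<^sub>0 = 0\<close>, so the induced metric is
  \<open>\<lambda>\<^sub>0 \<bar>\<partial>P\<^sub>0\<bar>\<^sup>2 + \<lambda>\<^sub>1 \<bar>\<partial>P\<^sub>2\<bar>\<^sup>2\<close>. By compactness of the sphere, \<open>\<psi>\<^sub>0\<close> is given by a polynomial
  decomposable bivector \<open>W\<close> and the conjugate of \<open>\<psi>\<^sub>2\<close> by a polynomial vector \<open>G\<close>; the two terms of
  the metric are the pull-backs of the Fubini-Study metric by \<open>W\<close> and \<open>G\<close>, that is
  \<open>\<partial>\<partial>\<close>-bar of \<open>log \<bar>W\<bar>\<^sup>2\<close> and \<open>log \<bar>G\<bar>\<^sup>2\<close>. Constant curvature forces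
  \<open>\<bar>W\<bar>\<^bsup>2a\<^esup> \<bar>G\<bar>\<^bsup>2b\<^esup>\<close> to be a power of \<open>1 + \<bar>z\<bar>\<^sup>2\<close> after an affine change of coordinate,
  and polarization shows that each of \<open>\<bar>W\<bar>\<^sup>2\<close> and \<open>\<bar>G\<bar>\<^sup>2\<close> is such a power. As in Calabi's
  rigidity theorem, \<open>G\<close> is then a Veronese curve of some degree at most 4 in an orthonormal frame;
  since \<open>W\<close> annihilates \<open>G\<close> and its derivative, a comparison of coefficients in each degree leaves
  only the model curve if \<open>\<psi>\<^sub>0\<close> is full and its Gauss bundle has rank two.\<close>

text \<open>The weights of the two Fubini-Study terms are arbitrary positive reals, so |W|^(2a)
  |G|^(2b) has no integral exponents. Logarithmic derivatives, which are rational in z and cnj z,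
  therefore replace powers, and positivity separates the factors: after polarization a zero of
  either kernel in z, for fixed v, is a pole of the weighted sum with positive residue, and the only
  pole available lies at 1 + z * cnj v = 0. The degree of G is at most 4 because a Veronese curve of
  degree d needs d + 1 orthonormal vectors in \<complex>^5. In degrees 0 and 1 the bivector W
  annihilates a constant vector, against fullness. In degrees 3 and 4 fullness leaves only a cone
  over a twisted cubic and a tangent developable, whose second fundamental form has rank one at
  most. In degree 2 the plane psi_0 joins the points of a conic to those of a disjoint line, which
  is the model. The coefficients are compared at antipodal points, where the kernel (1 + z * cnj
  v)^d vanishes, and for small d through degree bounds, which express regularity at infinity. The
  constants 3 and 2 in the curvature are the degrees of W and G in the model.\<close>

unbundle no Formal_Power_Series.fps_syntax

section \<open>Wirtinger derivatives\<close>

text \<open>Every real-linear map of the plane is \<open>p * h + q * cnj h\<close> for unique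
  \<open>p\<close> and \<open>q\<close>; carrying both coefficients at once turns the computation of
  \<partial> and \<partial>-bar derivatives into rules on pairs.\<close>

definition has_wirt :: "(complex \<Rightarrow> complex) \<Rightarrow> complex \<Rightarrow> complex \<Rightarrow> complex \<Rightarrow> bool" where
  "has_wirt f p q z \<longleftrightarrow> (f has_derivative (\<lambda>h. p * h + q * cnj h)) (at z)"

lemma has_wirt_del:
  assumes "has_wirt f p q z"
  shows "del_z f z = p" "del_zbar f z = q"
proof -
  have fd: "frechet_derivative f (at z) = (\<lambda>h. p * h + q * cnj h)"
    using frechet_derivative_at[OF assms[unfolded has_wirt_def]] by simp
  show "del_z f z = p" "del_zbar f z = q"
    unfolding del_z_def del_zbar_def fd by (simp_all add: algebra_simps)
qed

lemma has_wirt_unique: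
  assumes "has_wirt f p q z" "has_wirt f p' q' z"
  shows "p = p'" "q = q'"
  using has_wirt_del[OF assms(1)] has_wirt_del[OF assms(2)] by auto

lemma differentiable_has_wirt:
  assumes "f differentiable (at z)"
  shows "has_wirt f (del_z f z) (del_zbar f z) z"
proof -
  define D where "D = frechet_derivative f (at z)"
  have D: "(f has_derivative D) (at z)"
    using assms by (simp add: D_def frechet_derivative_works)
  then have lin: "linear D"
    using has_derivative_linear by blast
  have "D h = del_z f z * h + del_zbar f z * cnj h" for h
  proof -
    have "D h = D (Re h *\<^sub>R 1 + Im h *\<^sub>R \<i>)"
      by (metis complex_eq mult.commute scaleR_conv_of_real mult.right_neutral)
    also have "\<dots> = Re h *\<^sub>R D 1 + Im h *\<^sub>R D \<i>"
      using lin by (simp add: linear_add linear_scale)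
    also have "\<dots> = of_real (Re h) * D 1 + of_real (Im h) * D \<i>"
      by (simp add: scaleR_conv_of_real)
    also have "\<dots> = del_z f z * h + del_zbar f z * cnj h"
    proof -
      have "\<i> * of_real (Im h) = (h - cnj h) / 2" "of_real (Re h) = (h + cnj h) / 2"
        by (simp_all add: complex_eq_iff)
      then have e: "of_real (Im h) = - \<i> * ((h - cnj h) / 2)" "of_real (Re h) = (h + cnj h) / 2"
        by (metis (no_types, opaque_lifting) complex_i_mult_minus mult_minus_left mult.assoc minus_minus, blast)
      show ?thesis
        unfolding e del_z_def del_zbar_def D_def[symmetric] by (simp add: field_simps)
    qed
    finally show ?thesis .
  qed
  then have "D = (\<lambda>h. del_z f z * h + del_zbar f z * cnj h)"
    by blast
  with D show ?thesis
    by (simp add: has_wirt_def)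
qed

lemma has_wirt_differentiable: "has_wirt f p q z \<Longrightarrow> f differentiable (at z)"
  unfolding has_wirt_def differentiable_def by blast

lemma has_wirt_continuous: "has_wirt f p q z \<Longrightarrow> isCont f z"
  unfolding has_wirt_def by (rule has_derivative_continuous)

lemma has_wirt_eq: "has_wirt f p q z \<Longrightarrow> p = p' \<Longrightarrow> q = q' \<Longrightarrow> has_wirt f p' q' z"
  by simp

lemma has_wirt_const: "has_wirt (\<lambda>_. c) 0 0 z"
  by (simp add: has_wirt_def)

lemma has_wirt_add:
  assumes "has_wirt f p q z" "has_wirt g p' q' z"
  shows "has_wirt (\<lambda>w. f w + g w) (p + p') (q + q') z"
  using has_derivative_add[OF assms[unfolded has_wirt_def]]
  by (simp add: has_wirt_def algebra_simps)

lemma has_wirt_minus: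
  assumes "has_wirt f p q z"
  shows "has_wirt (\<lambda>w. - f w) (- p) (- q) z"
  using has_derivative_minus[OF assms[unfolded has_wirt_def]]
  by (simp add: has_wirt_def algebra_simps)

lemma has_wirt_diff:
  assumes "has_wirt f p q z" "has_wirt g p' q' z"
  shows "has_wirt (\<lambda>w. f w - g w) (p - p') (q - q') z"
  using has_derivative_diff[OF assms[unfolded has_wirt_def]]
  by (simp add: has_wirt_def algebra_simps)

lemma has_wirt_mult:
  assumes "has_wirt f p q z" "has_wirt g p' q' z"
  shows "has_wirt (\<lambda>w. f w * g w) (p * g z + f z * p') (q * g z + f z * q') z"
  using has_derivative_mult[OF assms[unfolded has_wirt_def]]
  by (simp add: has_wirt_def algebra_simps)

lemma has_wirt_cmult:
  assumes "has_wirt f p q z"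
  shows "has_wirt (\<lambda>w. c * f w) (c * p) (c * q) z"
  using has_wirt_mult[OF has_wirt_const assms] by simp

lemma has_wirt_sum:
  assumes "\<And>i. i \<in> I \<Longrightarrow> has_wirt (f i) (p i) (q i) z"
  shows "has_wirt (\<lambda>w. \<Sum>i\<in>I. f i w) (\<Sum>i\<in>I. p i) (\<Sum>i\<in>I. q i) z"
  using assms
proof (induction I rule: infinite_finite_induct)
  case (insert x F)
  then show ?case
    by (simp add: has_wirt_add)
qed (simp_all add: has_wirt_const)

lemma has_wirt_cnj:
  assumes "has_wirt f p q z"
  shows "has_wirt (\<lambda>w. cnj (f w)) (cnj q) (cnj p) z"
  using has_derivative_cnj[OF assms[unfolded has_wirt_def]]
  by (simp add: has_wirt_def algebra_simps)

lemma has_wirt_compose: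
  assumes "has_wirt f p q z" "(g has_field_derivative d) (at (f z))"
  shows "has_wirt (\<lambda>w. g (f w)) (d * p) (d * q) z"
  using has_derivative_compose[OF assms(1)[unfolded has_wirt_def]
      assms(2)[unfolded has_field_derivative_def]]
  by (simp add: has_wirt_def algebra_simps)

lemma has_wirt_field: "(g has_field_derivative d) (at z) \<Longrightarrow> has_wirt g d 0 z"
  by (simp add: has_wirt_def has_field_derivative_def)

lemma has_wirt_field_iff: "has_wirt g d 0 z \<longleftrightarrow> (g has_field_derivative d) (at z)"
  by (simp add: has_wirt_def has_field_derivative_def)

lemma has_wirt_precompose:
  assumes "has_wirt f p q (g z)" "(g has_field_derivative d) (at z)"
  shows "has_wirt (\<lambda>w. f (g w)) (p * d) (q * cnj d) z"
  using has_derivative_compose[OF assms(2)[unfolded has_field_derivative_def]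
      assms(1)[unfolded has_wirt_def]]
  by (simp add: has_wirt_def algebra_simps)

lemma has_wirt_inverse:
  assumes "has_wirt f p q z" "f z \<noteq> 0"
  shows "has_wirt (\<lambda>w. inverse (f w)) (- p / (f z)\<^sup>2) (- q / (f z)\<^sup>2) z"
  using has_wirt_compose[OF assms(1) DERIV_inverse[OF assms(2)]]
  by (simp add: field_simps power2_eq_square)

lemma has_wirt_divide:
  assumes "has_wirt f p q z" "has_wirt g p' q' z" "g z \<noteq> 0"
  shows "has_wirt (\<lambda>w. f w / g w) ((p * g z - f z * p') / (g z)\<^sup>2)
           ((q * g z - f z * q') / (g z)\<^sup>2) z"
  using has_wirt_mult[OF assms(1) has_wirt_inverse[OF assms(2,3)]] assms(3)
  by (simp add: divide_simps power2_eq_square)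

lemma has_wirt_transform:
  assumes "has_wirt f p q z" "open S" "z \<in> S" "\<And>w. w \<in> S \<Longrightarrow> f w = g w"
  shows "has_wirt g p q z"
  using has_derivative_transform_within_open[OF assms(1)[unfolded has_wirt_def] assms(2-4)]
  by (simp add: has_wirt_def)

lemma has_wirt_ln:
  fixes f :: "complex \<Rightarrow> real"
  assumes "has_wirt (\<lambda>w. of_real (f w)) p q z" "f z > 0"
  shows "has_wirt (\<lambda>w. of_real (ln (f w))) (p / of_real (f z)) (q / of_real (f z)) z"
proof -
  have "(Re \<circ> (\<lambda>w. of_real (f w)) has_derivative (\<lambda>h. Re (p * h + q * cnj h))) (at z)"
    unfolding o_def using assms(1) unfolding has_wirt_def by (rule has_derivative_Re)
  then have f: "(f has_derivative (\<lambda>h. Re (p * h + q * cnj h))) (at z)"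
    by (simp add: o_def)
  \<comment> \<open>A real function has a real differential; uniqueness of the derivative transfers
    this to \<open>p * h + q * cnj h\<close>, so the chain rule for the real \<open>ln\<close> can
    be read in complex form.\<close>
  have re: "complex_of_real (Re (p * h + q * cnj h)) = p * h + q * cnj h" for h
  proof -
    have "((\<lambda>w. complex_of_real (f w)) has_derivative (\<lambda>h. of_real (Re (p * h + q * cnj h)))) (at z)"
      using has_derivative_of_real[OF f] by simp
    from has_derivative_unique[OF this assms(1)[unfolded has_wirt_def]] show ?thesis
      by (simp only: fun_eq_iff)
  qed
  have "((\<lambda>w. ln (f w)) has_derivative (\<lambda>h. inverse (f z) * Re (p * h + q * cnj h))) (at z)"
    using has_derivative_ln[OF assms(2) f] by (simp add: field_simps)
  from has_derivative_of_real[OF this]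
  have "((\<lambda>w. complex_of_real (ln (f w))) has_derivative
      (\<lambda>h. of_real (inverse (f z)) * of_real (Re (p * h + q * cnj h)))) (at z)"
    by (simp only: of_real_mult)
  then show ?thesis
    unfolding re has_wirt_def by (simp add: field_simps add_divide_distrib)
qed

lemma has_wirt_poly: "has_wirt (poly p) (poly (pderiv p) z) 0 z"
  by (rule has_wirt_field) (rule poly_DERIV)

lemma has_wirt_cnj_poly: "has_wirt (\<lambda>w. cnj (poly p w)) 0 (cnj (poly (pderiv p) z)) z"
  using has_wirt_cnj[OF has_wirt_poly] by simp

text \<open>Functions with second Wirtinger derivatives; the mixed ones are required to agree, which
  spares an appeal to the symmetry of second derivatives.\<close>

definition wirt2 ::
    "(complex \<Rightarrow> complex) \<Rightarrow> (complex \<Rightarrow> complex) \<Rightarrow> (complex \<Rightarrow> complex) \<Rightarrow> (complex \<Rightarrow> complex) \<Rightarrow> bool" where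
  "wirt2 f p q b \<longleftrightarrow> (\<exists>a c. \<forall>z. has_wirt f (p z) (q z) z \<and> has_wirt p (a z) (b z) z \<and>
      has_wirt q (b z) (c z) z)"

definition wirt_smooth :: "(complex \<Rightarrow> complex) \<Rightarrow> bool" where
  "wirt_smooth f \<longleftrightarrow> (\<exists>p q b. wirt2 f p q b)"

lemma wirt_smoothI:
  assumes "\<And>z. has_wirt f (p z) (q z) z" "\<And>z. has_wirt p (a z) (b z) z"
    "\<And>z. has_wirt q (b z) (c z) z"
  shows "wirt_smooth f"
  unfolding wirt_smooth_def wirt2_def using assms by blast

lemma wirt_smoothE:
  assumes "wirt_smooth f"
  obtains p q a b c where "\<And>z. has_wirt f (p z) (q z) z" "\<And>z. has_wirt p (a z) (b z) z"
    "\<And>z. has_wirt q (b z) (c z) z"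
  using assms unfolding wirt_smooth_def wirt2_def by metis

lemma wirt_smooth_const: "wirt_smooth (\<lambda>_. c)"
  by (rule wirt_smoothI) (rule has_wirt_const)+

lemma wirt_smooth_add:
  assumes "wirt_smooth f" "wirt_smooth g"
  shows "wirt_smooth (\<lambda>z. f z + g z)"
proof -
  obtain p q a b c where f: "\<And>z. has_wirt f (p z) (q z) z" "\<And>z. has_wirt p (a z) (b z) z"
    "\<And>z. has_wirt q (b z) (c z) z" using wirt_smoothE[OF assms(1)] by blast
  obtain p' q' a' b' c' where g: "\<And>z. has_wirt g (p' z) (q' z) z" "\<And>z. has_wirt p' (a' z) (b' z) z"
    "\<And>z. has_wirt q' (b' z) (c' z) z" using wirt_smoothE[OF assms(2)] by blast
  show ?thesis
    by (rule wirt_smoothI) (rule has_wirt_add f g)+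
qed

lemma wirt_smooth_mult:
  assumes "wirt_smooth f" "wirt_smooth g"
  shows "wirt_smooth (\<lambda>z. f z * g z)"
proof -
  obtain p q a b c where f: "\<And>z. has_wirt f (p z) (q z) z" "\<And>z. has_wirt p (a z) (b z) z"
    "\<And>z. has_wirt q (b z) (c z) z" using wirt_smoothE[OF assms(1)] by blast
  obtain p' q' a' b' c' where g: "\<And>z. has_wirt g (p' z) (q' z) z" "\<And>z. has_wirt p' (a' z) (b' z) z"
    "\<And>z. has_wirt q' (b' z) (c' z) z" using wirt_smoothE[OF assms(2)] by blast
  show ?thesis
  proof (rule wirt_smoothI)
    fix z
    show "has_wirt (\<lambda>z. f z * g z) (p z * g z + f z * p' z) (q z * g z + f z * q' z) z"
      by (rule has_wirt_mult f g)+
    show "has_wirt (\<lambda>z. p z * g z + f z * p' z)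
      ((a z * g z + p z * p' z) + (p z * p' z + f z * a' z))
      ((b z * g z + p z * q' z) + (q z * p' z + f z * b' z)) z"
      by (rule has_wirt_add has_wirt_mult f g)+
    show "has_wirt (\<lambda>z. q z * g z + f z * q' z)
      ((b z * g z + p z * q' z) + (q z * p' z + f z * b' z))
      ((c z * g z + q z * q' z) + (q z * q' z + f z * c' z)) z"
      by (rule has_wirt_eq, (rule has_wirt_add has_wirt_mult f g)+) simp_all
  qed
qed

lemma wirt_smooth_inverse:
  assumes "wirt_smooth f" "\<And>z. f z \<noteq> 0"
  shows "wirt_smooth (\<lambda>z. inverse (f z))"
proof -
  obtain p q a b c where f: "\<And>z. has_wirt f (p z) (q z) z" "\<And>z. has_wirt p (a z) (b z) z"
    "\<And>z. has_wirt q (b z) (c z) z" using wirt_smoothE[OF assms(1)] by blast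
  have f2: "has_wirt (\<lambda>z. (f z)\<^sup>2) (2 * f z * p z) (2 * f z * q z) z" for z
    unfolding power2_eq_square by (rule has_wirt_eq, rule has_wirt_mult[OF f(1) f(1)]) simp_all
  show ?thesis
  proof (rule wirt_smoothI)
    fix z
    have n: "(f z)\<^sup>2 \<noteq> 0" using assms(2) by simp
    show "has_wirt (\<lambda>z. inverse (f z)) (- p z / (f z)\<^sup>2) (- q z / (f z)\<^sup>2) z"
      by (rule has_wirt_inverse f assms)+
    show "has_wirt (\<lambda>z. - p z / (f z)\<^sup>2)
       ((- a z * (f z)\<^sup>2 - (- p z) * (2 * f z * p z)) / ((f z)\<^sup>2)\<^sup>2)
       ((- b z * (f z)\<^sup>2 - (- p z) * (2 * f z * q z)) / ((f z)\<^sup>2)\<^sup>2) z"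
      by (rule has_wirt_divide has_wirt_minus f f2 n)+
    show "has_wirt (\<lambda>z. - q z / (f z)\<^sup>2)
       ((- b z * (f z)\<^sup>2 - (- p z) * (2 * f z * q z)) / ((f z)\<^sup>2)\<^sup>2)
       ((- c z * (f z)\<^sup>2 - (- q z) * (2 * f z * q z)) / ((f z)\<^sup>2)\<^sup>2) z"
      by (rule has_wirt_eq, (rule has_wirt_divide has_wirt_minus f f2 n)+) (simp_all add: ac_simps)
  qed
qed

lemma wirt_smooth_divide:
  assumes "wirt_smooth f" "wirt_smooth g" "\<And>z. g z \<noteq> 0"
  shows "wirt_smooth (\<lambda>z. f z / g z)"
  using wirt_smooth_mult[OF assms(1) wirt_smooth_inverse[OF assms(2,3)]] by (simp add: field_simps)

lemma wirt_smooth_cmult: "wirt_smooth f \<Longrightarrow> wirt_smooth (\<lambda>z. c * f z)"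
  by (rule wirt_smooth_mult[OF wirt_smooth_const])

lemma wirt_smooth_sum:
  assumes "\<And>i. i \<in> I \<Longrightarrow> wirt_smooth (f i)"
  shows "wirt_smooth (\<lambda>z. \<Sum>i\<in>I. f i z)"
  using assms
proof (induction I rule: infinite_finite_induct)
  case (insert x F)
  then show ?case
    by (simp add: wirt_smooth_add)
qed (simp_all add: wirt_smooth_const)

lemma wirt_smooth_poly: "wirt_smooth (poly p)"
  by (rule wirt_smoothI) (rule has_wirt_poly has_wirt_const)+

lemma wirt_smooth_cnj_poly: "wirt_smooth (\<lambda>z. cnj (poly p z))"
  by (rule wirt_smoothI) (rule has_wirt_cnj_poly has_wirt_const)+

section \<open>Metrics of constant curvature on the sphere\<close>

lemma tendsto_reciprocal_at_infinity:
  fixes f :: "complex \<Rightarrow> complex"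
  assumes "isCont f 0"
  shows "((\<lambda>z. f (1 / z)) \<longlongrightarrow> f 0) at_infinity"
proof -
  have "((\<lambda>z::complex. 1 / z) \<longlongrightarrow> 0) at_infinity"
    using tendsto_inverse_0[where 'a = complex] by (simp add: inverse_eq_divide[abs_def])
  from isCont_tendsto_compose[OF _ this, of f] assms show ?thesis
    by simp
qed

lemma deriv_reciprocal: "z \<noteq> 0 \<Longrightarrow> ((\<lambda>w::complex. 1 / w) has_field_derivative - (1 / z\<^sup>2)) (at z)"
  by (auto intro!: derivative_eq_intros simp: power2_eq_square divide_simps)

lemma holomorphic_wirt:
  assumes "\<And>z. \<exists>p. has_wirt f p 0 z"
  shows "f holomorphic_on UNIV"
  unfolding holomorphic_on_def field_differentiable_def using assms
  by (metis has_wirt_field_iff)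

text \<open>The Schwarzian \<open>- (\<ell>\<^sub>z + \<ell>\<^sup>2 / 2)\<close> of the metric is a holomorphic quadratic differential
  on the sphere, hence zero.\<close>

lemma constant_curvature_schwarzian:
  fixes f fh :: "complex \<Rightarrow> real" and l lh p :: "complex \<Rightarrow> complex" and k D :: real
  assumes fs: "wirt_smooth (\<lambda>z. of_real (f z))" and fpos: "\<And>z. f z > 0"
    and ls: "wirt_smooth l" and lw: "\<And>z. has_wirt l (p z) (of_real (k * f z)) z"
    and curv: "\<And>z. Re (del_z (del_zbar (\<lambda>w. of_real (ln (f w)))) z) = - k * f z"
    and fhs: "wirt_smooth (\<lambda>z. of_real (fh z))" and fhpos: "fh 0 > 0"
    and ff: "\<And>z. z \<noteq> 0 \<Longrightarrow> f z = fh (1 / z) / cmod z ^ 4"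
    and lhs: "wirt_smooth lh" and ll: "\<And>z. z \<noteq> 0 \<Longrightarrow> l z = of_real D / z - lh (1 / z) / z\<^sup>2"
  shows "D = 2" and "p z = - (l z)\<^sup>2 / 2"
proof -
  obtain f1 f2 fa fb fc where f: "\<And>z. has_wirt (\<lambda>z. of_real (f z)) (f1 z) (f2 z) z"
    "\<And>z. has_wirt f1 (fa z) (fb z) z" "\<And>z. has_wirt f2 (fb z) (fc z) z"
    using wirt_smoothE[OF fs] by blast
  have f21: "f2 = (\<lambda>z. cnj (f1 z))"
    using has_wirt_unique(2)[OF f(1) has_wirt_cnj[OF f(1), simplified]] by blast
  have fbr: "cnj (fb z) = fb z" for z
    using has_wirt_unique(1)[OF f(3)[unfolded f21] has_wirt_cnj[OF f(2)]] by simp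
  have fn: "complex_of_real (f z) \<noteq> 0" for z
    using fpos[of z] by simp
  define m where "m = (\<lambda>z. f1 z / of_real (f z))"
  define c where "c = (\<lambda>z. (fb z * of_real (f z) - f2 z * f1 z) / (of_real (f z))\<^sup>2)"
  \<comment> \<open>The curvature hypothesis only gives a real part. \<open>c\<close> is the mixed
    derivative of log \<open>f\<close>, which is real since \<open>f\<close> is, so nothing is
    lost.\<close>
  have cr: "cnj (c z) = c z" for z
    by (simp add: c_def f21 fbr mult.commute)
  have dl: "del_zbar (\<lambda>w. of_real (ln (f w))) = (\<lambda>z. f2 z / of_real (f z))"
    using has_wirt_del(2)[OF has_wirt_ln[OF f(1) fpos]] by blast
  have "del_z (\<lambda>z. f2 z / of_real (f z)) z = c z" for z
    using has_wirt_del(1)[OF has_wirt_divide[OF f(3) f(1) fn]] by (simp add: c_def)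
  then have "Re (c z) = - k * f z" for z
    using curv[of z] unfolding dl by simp
  then have ck: "c z = of_real (- k * f z)" for z
    using cr[of z] by (simp add: complex_eq_iff)
  have mw: "has_wirt m ((fa z * of_real (f z) - f1 z * f1 z) / (of_real (f z))\<^sup>2) (of_real (- k * f z)) z" for z
    unfolding m_def ck[symmetric] c_def
    by (rule has_wirt_eq, rule has_wirt_divide[OF f(2) f(1) fn]) (simp_all add: mult.commute)
  \<comment> \<open>\<partial> log \<open>f\<close> and \<open>l\<close> have opposite
    \<partial>-bar derivatives \<open>- k * f\<close> and \<open>k * f\<close>.\<close>
  have hol: "(\<lambda>z. m z + l z) holomorphic_on UNIV"
  proof (rule holomorphic_wirt)
    fix z
    show "\<exists>p. has_wirt (\<lambda>z. m z + l z) p 0 z"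
      using has_wirt_add[OF mw lw, of z] by (auto simp flip: of_real_add)
  qed
  obtain h1 h2 ha hb hc where h: "\<And>z. has_wirt (\<lambda>z. of_real (fh z)) (h1 z) (h2 z) z"
    "\<And>z. has_wirt h1 (ha z) (hb z) z" "\<And>z. has_wirt h2 (hb z) (hc z) z"
    using wirt_smoothE[OF fhs] by blast
  \<comment> \<open>The term - 2 / z comes from the holomorphic half of 1 / |z|^4, which is split
    into \<open>inverse (w\<^sup>2)\<close> and its conjugate to make it differentiable.\<close>
  have mz: "m z = - 2 / z - (h1 (1 / z) / of_real (fh (1 / z))) / z\<^sup>2" if "z \<noteq> 0" for z
  proof -
    have e: "of_real (fh (1 / w)) * (inverse (w\<^sup>2) * cnj (inverse (w\<^sup>2))) = complex_of_real (f w)"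
      if "w \<in> - {0}" for w
    proof -
      have "complex_of_real (cmod w ^ 4) = (w * cnj w)\<^sup>2"
        by (simp add: complex_norm_square[symmetric] power_mult[symmetric] flip: of_real_power)
      moreover have "fh (1 / w) = f w * cmod w ^ 4"
        using ff[of w] that by simp
      ultimately show ?thesis
        using that by (simp add: field_simps power2_eq_square del: of_real_power)
    qed
    have d: "((\<lambda>w. inverse (w\<^sup>2)) has_field_derivative (- 2 / z ^ 3)) (at z)"
      using that by (auto intro!: derivative_eq_intros simp: power2_eq_square power3_eq_cube divide_simps)
    have "has_wirt (\<lambda>w. of_real (fh (1 / w)) * (inverse (w\<^sup>2) * cnj (inverse (w\<^sup>2))))
      ((h1 (1 / z) * (- (1 / z\<^sup>2))) * (inverse (z\<^sup>2) * cnj (inverse (z\<^sup>2))) +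
        of_real (fh (1 / z)) * ((- 2 / z ^ 3) * cnj (inverse (z\<^sup>2)) + inverse (z\<^sup>2) * cnj 0))
      ((h2 (1 / z) * cnj (- (1 / z\<^sup>2))) * (inverse (z\<^sup>2) * cnj (inverse (z\<^sup>2))) +
        of_real (fh (1 / z)) * (0 * cnj (inverse (z\<^sup>2)) + inverse (z\<^sup>2) * cnj (- 2 / z ^ 3))) z"
      by (intro has_wirt_mult has_wirt_cnj has_wirt_field[OF d]
          has_wirt_precompose[OF h(1) deriv_reciprocal[OF that]])
    from has_wirt_transform[OF this _ _ e]
    have "f1 z = (h1 (1 / z) * (- (1 / z\<^sup>2))) * (inverse (z\<^sup>2) * cnj (inverse (z\<^sup>2))) +
        of_real (fh (1 / z)) * ((- 2 / z ^ 3) * cnj (inverse (z\<^sup>2)) + inverse (z\<^sup>2) * cnj 0)"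
      using has_wirt_unique(1)[OF f(1)] that by auto
    moreover have "fh (1 / z) \<noteq> 0"
      using ff[OF that] fpos[of z] by auto
    moreover note e[of z]
    ultimately show ?thesis
      using that fn[of z] unfolding m_def
      by (auto simp: divide_simps power2_eq_square power3_eq_cube) (simp add: algebra_simps eq_neg_iff_add_eq_0)
  qed
  define \<nu> where "\<nu> = (\<lambda>t. h1 t / of_real (fh t) + lh t)"
  obtain e1 e2 ea eb ec where e: "\<And>z. has_wirt lh (e1 z) (e2 z) z"
    "\<And>z. has_wirt e1 (ea z) (eb z) z" "\<And>z. has_wirt e2 (eb z) (ec z) z"
    using wirt_smoothE[OF lhs] by blast
  have "isCont \<nu> 0"
    unfolding \<nu>_def using fhpos
    by (intro continuous_intros has_wirt_continuous[OF h(1)] has_wirt_continuous[OF h(2)]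
          has_wirt_continuous[OF e(1)]) auto
  from tendsto_reciprocal_at_infinity[OF this]
  have nu: "((\<lambda>z. \<nu> (1 / z)) \<longlongrightarrow> \<nu> 0) at_infinity" .
  have inv: "((\<lambda>z::complex. 1 / z) \<longlongrightarrow> 0) at_infinity"
    using tendsto_inverse_0[where 'a = complex] by (simp add: inverse_eq_divide[abs_def])
  have nz: "\<forall>\<^sub>F z::complex in at_infinity. z \<noteq> 0"
    unfolding eventually_at_infinity by (rule exI[of _ 1]) auto
  \<comment> \<open>D - 2 is the residue of \<open>m + l\<close> at infinity: D from the pole of
    \<open>l\<close>, - 2 from the density. An entire function vanishing at infinity is zero, whence
    D = 2.\<close>
  have zml: "z * (m z + l z) = of_real (D - 2) - (1 / z) * \<nu> (1 / z)" if "z \<noteq> 0" for z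
    using that unfolding mz[OF that] ll[OF that] \<nu>_def by (simp add: field_simps power2_eq_square)
  have l1: "((\<lambda>z. of_real (D - 2) - (1 / z) * \<nu> (1 / z)) \<longlongrightarrow> of_real (D - 2) - 0 * \<nu> 0) at_infinity"
    by (intro tendsto_intros inv nu)
  have zt: "((\<lambda>z. z * (m z + l z)) \<longlongrightarrow> of_real (D - 2)) at_infinity"
  proof (rule Lim_transform_eventually)
    show "((\<lambda>z. of_real (D - 2) - (1 / z) * \<nu> (1 / z)) \<longlongrightarrow> of_real (D - 2)) at_infinity"
      using l1 by simp
    show "\<forall>\<^sub>F z in at_infinity. of_real (D - 2) - (1 / z) * \<nu> (1 / z) = z * (m z + l z)"
      using nz by eventually_elim (rule zml[symmetric])
  qed
  have "((\<lambda>z. (1 / z) * (z * (m z + l z))) \<longlongrightarrow> 0 * of_real (D - 2)) at_infinity"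
    by (intro tendsto_intros inv zt)
  then have "((\<lambda>z. (1 / z) * (z * (m z + l z))) \<longlongrightarrow> 0) at_infinity"
    by simp
  moreover have "\<forall>\<^sub>F z in at_infinity. (1 / z) * (z * (m z + l z)) = m z + l z"
    using nz by eventually_elim simp
  ultimately have "((\<lambda>z. m z + l z) \<longlongrightarrow> 0) at_infinity"
    by (rule Lim_transform_eventually)
  from Liouville_weak[OF hol this] have ml: "m z + l z = 0" for z .
  have "((\<lambda>z::complex. 0) \<longlongrightarrow> complex_of_real (D - 2)) at_infinity"
    using zt unfolding ml by simp
  then have "complex_of_real (D - 2) = 0"
    by (metis tendsto_unique trivial_limit_at_infinity tendsto_const)
  then show "D = 2"
    by (metis eq_iff_diff_eq_0 of_real_eq_0_iff)
  obtain l1 l2 la lb lc where L: "\<And>z. has_wirt l (l1 z) (l2 z) z"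
    "\<And>z. has_wirt l1 (la z) (lb z) z" "\<And>z. has_wirt l2 (lb z) (lc z) z"
    using wirt_smoothE[OF ls] by blast
  have p: "p = l1"
    using has_wirt_unique(1)[OF lw L(1)] by blast
  have l2: "l2 = (\<lambda>z. of_real k * of_real (f z))"
    using has_wirt_unique(2)[OF L(1) lw] by auto
  have lb: "lb z = of_real k * f1 z" for z
    using has_wirt_unique(1)[OF L(3)[unfolded l2] has_wirt_cmult[OF f(1)]] by blast
  have f1: "f1 z = - l z * of_real (f z)" for z
    using ml[of z] fn[of z] unfolding m_def by (simp add: field_simps eq_neg_iff_add_eq_0)
  \<comment> \<open>Once \<open>m\<close> is \<open>- l\<close>, the \<partial>-bar derivative of p
    + l^2 / 2 is k (f1 + l f) = 0. The function decays at infinity because every term of its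
    expansion contains a positive power of 1 / z.\<close>
  define Q where "Q = (\<lambda>z. p z + l z * l z * (1 / 2))"
  have "has_wirt Q (la z + ((l1 z * l z + l z * l1 z) * (1 / 2) + l z * l z * 0))
     (lb z + ((l2 z * l z + l z * l2 z) * (1 / 2) + l z * l z * 0)) z" for z
    unfolding Q_def p by (rule has_wirt_add has_wirt_mult has_wirt_const L)+
  moreover have "lb z + ((l2 z * l z + l z * l2 z) * (1 / 2) + l z * l z * 0) = 0" for z
    by (simp add: lb f1 l2)
  ultimately have holQ: "Q holomorphic_on UNIV"
    by (intro holomorphic_wirt) metis
  have pz: "p z = - of_real D / z\<^sup>2 + e1 (1 / z) * (1 / z) ^ 4 + 2 * lh (1 / z) * (1 / z) ^ 3" if "z \<noteq> 0" for z
  proof -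
    have d1: "((\<lambda>w. of_real D / w) has_field_derivative (- of_real D / z\<^sup>2)) (at z)"
      using that by (auto intro!: derivative_eq_intros simp: power2_eq_square divide_simps)
    have d2: "((\<lambda>w. inverse (w\<^sup>2)) has_field_derivative (- 2 / z ^ 3)) (at z)"
      using that by (auto intro!: derivative_eq_intros simp: power2_eq_square power3_eq_cube divide_simps)
    have "has_wirt (\<lambda>w. of_real D / w - lh (1 / w) * inverse (w\<^sup>2))
       (- of_real D / z\<^sup>2 - ((e1 (1 / z) * (- (1 / z\<^sup>2))) * inverse (z\<^sup>2) + lh (1 / z) * (- 2 / z ^ 3)))
       (0 - ((e2 (1 / z) * cnj (- (1 / z\<^sup>2))) * inverse (z\<^sup>2) + lh (1 / z) * 0)) z"
      by (intro has_wirt_diff has_wirt_mult has_wirt_field[OF d1] has_wirt_field[OF d2]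
          has_wirt_precompose[OF e(1) deriv_reciprocal[OF that]])
    from has_wirt_transform[OF this, of "- {0}" l] that ll
    have "has_wirt l (- of_real D / z\<^sup>2 - ((e1 (1 / z) * (- (1 / z\<^sup>2))) * inverse (z\<^sup>2) + lh (1 / z) * (- 2 / z ^ 3)))
       (0 - ((e2 (1 / z) * cnj (- (1 / z\<^sup>2))) * inverse (z\<^sup>2) + lh (1 / z) * 0)) z"
      by (auto simp: field_simps)
    from has_wirt_unique(1)[OF lw this] show ?thesis
      by (simp add: power_divide eval_nat_numeral field_simps)
  qed
  have ec0: "((\<lambda>z. lh (1 / z)) \<longlongrightarrow> lh 0) at_infinity" "((\<lambda>z. e1 (1 / z)) \<longlongrightarrow> e1 0) at_infinity"
    by (intro tendsto_reciprocal_at_infinity has_wirt_continuous[OF e(1)] has_wirt_continuous[OF e(2)])+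
  have lQ: "((\<lambda>z. (- of_real D * (1 / z)\<^sup>2 + e1 (1 / z) * (1 / z) ^ 4 + 2 * lh (1 / z) * (1 / z) ^ 3)
      + (of_real D * (1 / z) - lh (1 / z) * (1 / z)\<^sup>2) * (of_real D * (1 / z) - lh (1 / z) * (1 / z)\<^sup>2) * (1 / 2)) \<longlongrightarrow>
      (- of_real D * 0\<^sup>2 + e1 0 * 0 ^ 4 + 2 * lh 0 * 0 ^ 3)
      + (of_real D * 0 - lh 0 * 0\<^sup>2) * (of_real D * 0 - lh 0 * 0\<^sup>2) * (1 / 2)) at_infinity"
    by (intro tendsto_intros inv ec0)
  have "(Q \<longlongrightarrow> 0) at_infinity"
  proof (rule Lim_transform_eventually)
    show "((\<lambda>z. (- of_real D * (1 / z)\<^sup>2 + e1 (1 / z) * (1 / z) ^ 4 + 2 * lh (1 / z) * (1 / z) ^ 3)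
      + (of_real D * (1 / z) - lh (1 / z) * (1 / z)\<^sup>2) * (of_real D * (1 / z) - lh (1 / z) * (1 / z)\<^sup>2) * (1 / 2)) \<longlongrightarrow> 0) at_infinity"
      using lQ by simp
    show "\<forall>\<^sub>F z in at_infinity. (- of_real D * (1 / z)\<^sup>2 + e1 (1 / z) * (1 / z) ^ 4 + 2 * lh (1 / z) * (1 / z) ^ 3)
      + (of_real D * (1 / z) - lh (1 / z) * (1 / z)\<^sup>2) * (of_real D * (1 / z) - lh (1 / z) * (1 / z)\<^sup>2) * (1 / 2) = Q z"
      using nz by eventually_elim (simp add: Q_def pz ll power_divide)
  qed
  from Liouville_weak[OF holQ this] have "Q z = 0" .
  then show "p z = - (l z)\<^sup>2 / 2"
    by (simp add: Q_def power2_eq_square eq_neg_iff_add_eq_0)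
qed

text \<open>Conjugation exchanges the two Wirtinger derivatives, so for a real-valued
  \<open>g\<close> holomorphy forces \<partial>g = 0 as well.\<close>

lemma real_valued_entire_const:
  fixes g :: "complex \<Rightarrow> complex"
  assumes "g holomorphic_on UNIV" "\<And>z. g z \<in> \<real>"
  obtains c :: real where "\<And>z. g z = of_real c"
proof -
  have "(g has_field_derivative 0) (at z)" for z
  proof -
    obtain d where d: "(g has_field_derivative d) (at z)"
      using assms(1) by (metis UNIV_I holomorphic_derivI open_UNIV)
    then have "has_wirt g d 0 z"
      by (rule has_wirt_field)
    moreover have "(\<lambda>w. cnj (g w)) = g"
      using assms(2) by (auto simp: Reals_cnj_iff)
    ultimately have "d = 0"
      using has_wirt_unique(1)[OF _ has_wirt_cnj[of g d 0 z]] by auto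
    with d show ?thesis by simp
  qed
  then obtain c where c: "\<And>z. g z = c"
    using has_field_derivative_zero_constant[OF convex_UNIV] by (metis UNIV_I)
  with assms(2)[of 0] show ?thesis
    by (metis Reals_cases that)
qed

text \<open>Here \<open>F\<close> is, up to a constant, \<open>f\<close> to the power \<open>- 1 / 2\<close>.\<close>

lemma constant_curvature_normal_form:
  fixes f fh F :: "complex \<Rightarrow> real" and l lh p :: "complex \<Rightarrow> complex" and k D :: real
  assumes fs: "wirt_smooth (\<lambda>z. of_real (f z))" and fpos: "\<And>z. f z > 0"
    and ls: "wirt_smooth l" and lw: "\<And>z. has_wirt l (p z) (of_real (k * f z)) z"
    and curv: "\<And>z. Re (del_z (del_zbar (\<lambda>w. of_real (ln (f w)))) z) = - k * f z"
    and fhs: "wirt_smooth (\<lambda>z. of_real (fh z))" and fhpos: "fh 0 > 0"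
    and ff: "\<And>z. z \<noteq> 0 \<Longrightarrow> f z = fh (1 / z) / cmod z ^ 4"
    and lhs: "wirt_smooth lh" and ll: "\<And>z. z \<noteq> 0 \<Longrightarrow> l z = of_real D / z - lh (1 / z) / z\<^sup>2"
    and Dk: "D > 0 \<Longrightarrow> k > 0"
    and Fw: "\<And>z. has_wirt (\<lambda>z. of_real (F z)) (l z * of_real (F z) / 2) (cnj (l z) * of_real (F z) / 2) z"
    and Fpos: "\<And>z. F z > 0"
  obtains r :: real and s :: complex where "k > 0" "r > 0"
    "\<And>z. l z = 2 * of_real r * cnj (of_real r * z + s) / of_real (1 + (cmod (of_real r * z + s))\<^sup>2)"
proof -
  note cs = constant_curvature_schwarzian[OF fs fpos ls lw curv fhs fhpos ff lhs ll]
  have k: "k > 0"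
    using cs(1) Dk by simp
  \<comment> \<open>By the Schwarzian identity \<partial>(l F) = (p + l^2 / 2) F = 0, so l F is
    antiholomorphic. Its conjugate has a real derivative and is therefore affine, which makes F a
    Hermitian quadratic polynomial.\<close>
  define E where "E = (\<lambda>z. cnj (l z * of_real (F z)))"
  define dE where "dE = (\<lambda>z. k * f z * F z + (cmod (l z))\<^sup>2 * F z / 2)"
  have Ew: "has_wirt E (of_real (dE z)) 0 z" for z
  proof -
    have "has_wirt (\<lambda>z. l z * of_real (F z)) (p z * of_real (F z) + l z * (l z * of_real (F z) / 2))
       (of_real (k * f z) * of_real (F z) + l z * (cnj (l z) * of_real (F z) / 2)) z"
      by (intro has_wirt_mult lw Fw)
    moreover have "p z * of_real (F z) + l z * (l z * of_real (F z) / 2) = 0"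
      by (simp add: cs(2) power2_eq_square)
    moreover have "of_real (k * f z) * of_real (F z) + l z * (cnj (l z) * of_real (F z) / 2) = of_real (dE z)"
    proof -
      have "l z * cnj (l z) = of_real ((cmod (l z))\<^sup>2)"
        by (metis complex_norm_square)
      then show ?thesis
        unfolding dE_def by (simp add: mult.assoc[symmetric])
    qed
    ultimately have "has_wirt (\<lambda>z. l z * of_real (F z)) 0 (of_real (dE z)) z"
      by simp
    from has_wirt_cnj[OF this] show ?thesis
      by (simp add: E_def)
  qed
  then have Ed: "(E has_field_derivative of_real (dE z)) (at z)" for z
    by (simp add: has_wirt_field_iff)
  have "deriv E holomorphic_on UNIV"
    using Ed by (intro holomorphic_deriv) (auto simp: holomorphic_on_open)
  moreover have dEd: "deriv E z = of_real (dE z)" for z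
    using Ed DERIV_imp_deriv by blast
  ultimately obtain g :: real where g: "\<And>z. deriv E z = of_real g"
    using real_valued_entire_const[of "deriv E"] by auto
  have gdE: "dE z = g" for z
    using g[of z] dEd[of z] by simp
  have gpos: "g > 0"
    unfolding gdE[of 0, symmetric] dE_def using k fpos[of 0] Fpos[of 0]
    by (intro add_pos_nonneg mult_pos_pos) auto
  have "((\<lambda>z. E z - of_real g * z) has_field_derivative 0) (at z)" for z
    using Ed[of z] by (auto intro!: derivative_eq_intros simp: gdE)
  then obtain e where e: "\<And>z. E z - of_real g * z = e"
    using has_field_derivative_zero_constant[OF convex_UNIV] by (metis UNIV_I)
  then have E: "E z = of_real g * z + e" for z
    by (metis diff_eq_eq add.commute)
  \<comment> \<open>F minus the quadratic polynomial with the same first derivatives.\<close>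
  define H where "H = (\<lambda>z. of_real (F z) - of_real (g / 2) * (z * cnj z) - (1 / 2) * (cnj e * z + e * cnj z))"
  have FwE: "has_wirt (\<lambda>z. of_real (F z)) (cnj (E z) / 2) (E z / 2) z" for z
    using Fw[of z] by (simp add: E_def)
  have id: "has_wirt (\<lambda>z. z) 1 0 z" "has_wirt cnj 0 1 z" for z
    using has_wirt_cnj[OF has_wirt_field[OF DERIV_ident]] has_wirt_field[OF DERIV_ident] by auto
  have "has_wirt H 0 0 z" for z
  proof -
    have "has_wirt (\<lambda>z. of_real (F z) - of_real (g / 2) * (z * cnj z) - (1 / 2) * (cnj e * z + e * cnj z))
        (cnj (E z) / 2 - of_real (g / 2) * (1 * cnj z + z * 0) - (1 / 2) * (cnj e * 1 + e * 0))
        (E z / 2 - of_real (g / 2) * (0 * cnj z + z * 1) - (1 / 2) * (cnj e * 0 + e * 1)) z"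
      by (intro has_wirt_diff has_wirt_mult has_wirt_add has_wirt_cmult FwE id)
    then show ?thesis
      unfolding H_def by (rule has_wirt_eq) (simp_all add: E algebra_simps)
  qed
  then have "(H has_field_derivative 0) (at z)" for z
    by (simp add: has_wirt_field_iff)
  then obtain al where "\<And>z. H z = al"
    using has_field_derivative_zero_constant[OF convex_UNIV] by (metis UNIV_I)
  then have F: "of_real (F z) = of_real (g / 2) * (z * cnj z) + (cnj e * z + e * cnj z) / 2 + al" for z
    unfolding H_def by (simp add: algebra_simps)
  define de where "de = F (- e / of_real g)"
  have de: "de > 0"
    using Fpos by (simp add: de_def)
  have al: "of_real de = al - e * cnj e / of_real (2 * g)"
    unfolding de_def F using gpos by (simp add: field_simps)
  have Fz: "of_real (F z) = of_real de + of_real (g / 2) * ((z + e / of_real g) * cnj (z + e / of_real g))" for z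
    unfolding F al using gpos by (simp add: field_simps)
  define r where "r = sqrt (g / (2 * de))"
  have r: "r > 0" "r\<^sup>2 = g / (2 * de)"
    using gpos de by (simp_all add: r_def)
  define s where "s = of_real r * e / of_real g"
  have rs: "of_real r * z + s = of_real r * (z + e / of_real g)" for z
    by (simp add: s_def algebra_simps)
  have F2: "F z = de * (1 + (cmod (of_real r * z + s))\<^sup>2)" for z
  proof -
    have "complex_of_real (F z) = of_real (de + g / 2 * (cmod (z + e / of_real g))\<^sup>2)"
      unfolding Fz complex_norm_square[symmetric] by simp
    then have "F z = de + g / 2 * (cmod (z + e / of_real g))\<^sup>2"
      using of_real_eq_iff by blast
    also have "g / 2 = de * r\<^sup>2"
      using r de by simp
    finally show ?thesis
      unfolding rs norm_mult power_mult_distrib by (simp add: algebra_simps)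
  qed
  have "l z = 2 * of_real r * cnj (of_real r * z + s) / of_real (1 + (cmod (of_real r * z + s))\<^sup>2)" for z
  proof -
    have "l z * of_real (F z) = cnj (E z)"
      by (simp add: E_def)
    then have "l z = cnj (E z) / of_real (F z)"
      using Fpos[of z] by (simp add: eq_divide_eq)
    also have "E z = of_real g * (z + e / of_real g)"
      using gpos by (simp add: E algebra_simps)
    also have "of_real g * (z + e / of_real g) = of_real (2 * de * r) * (of_real r * z + s)"
    proof -
      have "of_real (2 * de * r) * of_real r = complex_of_real (2 * de * r\<^sup>2)"
        by (simp add: power2_eq_square)
      also have "2 * de * r\<^sup>2 = g"
        using r de by simp
      finally show ?thesis
        unfolding rs by (simp only: mult.assoc[symmetric])
    qed
    also have "cnj (of_real (2 * de * r) * (of_real r * z + s)) / of_real (F z) =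
        (of_real de * (2 * of_real r * cnj (of_real r * z + s))) /
        (of_real de * of_real (1 + (cmod (of_real r * z + s))\<^sup>2))"
      unfolding F2 of_real_mult complex_cnj_mult complex_cnj_complex_of_real by (simp only: ac_simps of_real_numeral)
    finally show ?thesis
      using de by (simp only: mult_divide_mult_cancel_left of_real_eq_0_iff)
  qed
  with k r(1) show ?thesis
    using that by blast
qed

section \<open>Metrics induced by polynomial vectors\<close>

text \<open>The polarization of |W|^2: polynomial in z and in cnj v. Keeping the two points apart is
  what allows divisibility arguments in z for fixed v.\<close>

definition pker :: "('a::finite \<Rightarrow> complex poly) \<Rightarrow> ('a \<Rightarrow> complex poly) \<Rightarrow> complex \<Rightarrow> complex \<Rightarrow> complex" where
  "pker U W z v = (\<Sum>i\<in>UNIV. poly (U i) z * cnj (poly (W i) v))"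

definition psq :: "('a::finite \<Rightarrow> complex poly) \<Rightarrow> complex \<Rightarrow> real" where
  "psq W z = (\<Sum>i\<in>UNIV. (cmod (poly (W i) z))\<^sup>2)"

definition vderiv :: "('a \<Rightarrow> complex poly) \<Rightarrow> 'a \<Rightarrow> complex poly" where
  "vderiv W i = pderiv (W i)"

definition nonvanishing :: "('a \<Rightarrow> complex poly) \<Rightarrow> bool" where
  "nonvanishing W \<longleftrightarrow> (\<forall>z. \<exists>i. poly (W i) z \<noteq> 0)"

text \<open>The pullback of the Fubini--Study metric by the curve \<open>[W]\<close>.\<close>

definition fubini :: "('a::finite \<Rightarrow> complex poly) \<Rightarrow> complex \<Rightarrow> real" where
  "fubini W z = (psq (vderiv W) z * psq W z - (cmod (pker (vderiv W) W z z))\<^sup>2) / (psq W z)\<^sup>2"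

text \<open>This is \<partial> log |W|^2. Its \<partial>-bar derivative is \<open>fubini\<close>,
  and it stays rational in z and cnj z, so that real combinations of it replace real powers of |W|^2
  and |G|^2.\<close>

definition dlog :: "('a::finite \<Rightarrow> complex poly) \<Rightarrow> complex \<Rightarrow> complex" where
  "dlog W z = pker (vderiv W) W z z / pker W W z z"

lemma pker_psq: "pker W W z z = of_real (psq W z)"
  unfolding pker_def psq_def of_real_sum complex_norm_square ..

lemma cnj_pker: "cnj (pker U W z v) = pker W U v z"
  unfolding pker_def by (simp add: mult.commute)

lemma psq_pos:
  assumes "nonvanishing W"
  shows "psq W z > 0"
proof -
  obtain i where "poly (W i) z \<noteq> 0"
    using assms by (auto simp: nonvanishing_def)
  then show ?thesis
    unfolding psq_def by (intro sum_pos2[of UNIV i]) auto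
qed

lemma has_wirt_pker:
  "has_wirt (\<lambda>z. pker U W z z) (pker (vderiv U) W z z) (pker U (vderiv W) z z) z"
proof -
  have "has_wirt (\<lambda>z. \<Sum>i\<in>UNIV. poly (U i) z * cnj (poly (W i) z))
    (\<Sum>i\<in>UNIV. poly (pderiv (U i)) z * cnj (poly (W i) z) + poly (U i) z * 0)
    (\<Sum>i\<in>UNIV. 0 * cnj (poly (W i) z) + poly (U i) z * cnj (poly (pderiv (W i)) z)) z"
    by (intro has_wirt_sum has_wirt_mult has_wirt_poly has_wirt_cnj_poly)
  then show ?thesis
    by (simp add: pker_def vderiv_def)
qed

lemma wirt_smooth_pker: "wirt_smooth (\<lambda>z. pker U W z z)"
  unfolding pker_def by (intro wirt_smooth_sum wirt_smooth_mult wirt_smooth_poly wirt_smooth_cnj_poly)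

lemma pker_nonzero: "nonvanishing W \<Longrightarrow> pker W W z z \<noteq> 0"
  using psq_pos[of W z] by (simp add: pker_psq)

lemma of_real_fubini:
  "of_real (fubini W z) = (pker (vderiv W) (vderiv W) z z * pker W W z z
     - pker (vderiv W) W z z * pker W (vderiv W) z z) / (pker W W z z)\<^sup>2"
proof -
  have "pker W (vderiv W) z z = cnj (pker (vderiv W) W z z)"
    by (simp add: cnj_pker)
  then have "pker (vderiv W) W z z * pker W (vderiv W) z z = of_real ((cmod (pker (vderiv W) W z z))\<^sup>2)"
    by (metis complex_norm_square)
  then show ?thesis
    by (simp add: fubini_def pker_psq)
qed

lemma wirt_smooth_fubini:
  assumes "nonvanishing W"
  shows "wirt_smooth (\<lambda>z. of_real (fubini W z))"
proof -
  have "wirt_smooth (\<lambda>z. (pker (vderiv W) (vderiv W) z z * pker W W z z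
     + (- 1) * (pker (vderiv W) W z z * pker W (vderiv W) z z)) / (pker W W z z * pker W W z z))"
    by (intro wirt_smooth_divide wirt_smooth_add wirt_smooth_cmult wirt_smooth_mult wirt_smooth_pker)
      (simp add: pker_nonzero[OF assms])
  then show ?thesis
    by (simp add: of_real_fubini power2_eq_square)
qed

lemma wirt_smooth_dlog: "nonvanishing W \<Longrightarrow> wirt_smooth (dlog W)"
  unfolding dlog_def[abs_def] by (intro wirt_smooth_divide wirt_smooth_pker pker_nonzero)

lemma has_wirt_dlog:
  assumes "nonvanishing W"
  shows "\<exists>p. has_wirt (dlog W) p (of_real (fubini W z)) z"
proof -
  have "has_wirt (dlog W) ((pker (vderiv (vderiv W)) W z z * pker W W z z - pker (vderiv W) W z z * pker (vderiv W) W z z) / (pker W W z z)\<^sup>2)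
    ((pker (vderiv W) (vderiv W) z z * pker W W z z - pker (vderiv W) W z z * pker W (vderiv W) z z) / (pker W W z z)\<^sup>2) z"
    unfolding dlog_def[abs_def] by (intro has_wirt_divide has_wirt_pker pker_nonzero assms)
  then show ?thesis
    unfolding of_real_fubini by blast
qed

definition vdeg :: "('a::finite \<Rightarrow> complex poly) \<Rightarrow> nat" where
  "vdeg W = Max (range (\<lambda>i. degree (W i)))"

text \<open>All components are reversed at the common degree \<open>vdeg W\<close>, so this is the
  same projective curve in the coordinate 1 / z at infinity.\<close>

definition vrev :: "('a::finite \<Rightarrow> complex poly) \<Rightarrow> 'a \<Rightarrow> complex poly" where
  "vrev W i = monom 1 (vdeg W - degree (W i)) * reflect_poly (W i)"

lemma degree_le_vdeg: "degree (W i) \<le> vdeg W"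
  unfolding vdeg_def by (rule Max_ge) auto

lemma poly_vrev: "t \<noteq> 0 \<Longrightarrow> poly (vrev W i) t = t ^ vdeg W * poly (W i) (1 / t)"
  using degree_le_vdeg[of W i]
  by (simp add: vrev_def poly_monom poly_reflect_poly_nz inverse_eq_divide flip: mult.assoc power_add)

lemma poly_vrev': "z \<noteq> 0 \<Longrightarrow> poly (W i) z = z ^ vdeg W * poly (vrev W i) (1 / z)"
  by (simp add: poly_vrev field_simps)

lemma vrev_nonvanishing:
  assumes "nonvanishing W"
  shows "nonvanishing (vrev W)"
  unfolding nonvanishing_def
proof
  fix t
  show "\<exists>i. poly (vrev W i) t \<noteq> 0"
  proof (cases "t = 0")
    case False
    then show ?thesis
      using assms by (simp add: poly_vrev nonvanishing_def)
  next
    case True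
    have "vdeg W \<in> range (\<lambda>i. degree (W i))"
      unfolding vdeg_def by (rule Max_in) auto
    then obtain i0 where i0: "degree (W i0) = vdeg W"
      by auto
    \<comment> \<open>The maximal degree may be attained by a zero component, whose degree is 0 by
      convention; then every component is constant and some nonzero one serves.\<close>
    obtain i where i: "W i \<noteq> 0" "degree (W i) = vdeg W"
    proof (cases "W i0 = 0")
      case True
      then have "vdeg W = 0"
        using i0 by simp
      moreover obtain i where "poly (W i) 0 \<noteq> 0"
        using assms by (auto simp: nonvanishing_def)
      moreover have "W i \<noteq> 0"
        using \<open>poly (W i) 0 \<noteq> 0\<close> by auto
      ultimately show ?thesis
        using that[of i] degree_le_vdeg[of W i] by simp
    qed (use i0 that in auto)
    then have "poly (vrev W i) 0 \<noteq> 0"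
      using leading_coeff_0_iff[of "W i"] by (simp add: vrev_def)
    with True show ?thesis by blast
  qed
qed

text \<open>From W(z) = z^d V(1 / z) with V the reversed vector: the factor |z|^(2 d) contributes d
  / z and the inner map 1 / z contributes the factor - 1 / z^2. The degree thus appears as the
  residue of \<open>dlog\<close> at infinity.\<close>

lemma dlog_vrev:
  assumes "nonvanishing W" "z \<noteq> 0"
  shows "dlog W z = of_nat (vdeg W) / z - dlog (vrev W) (1 / z) / z\<^sup>2"
proof -
  let ?V = "vrev W" and ?d = "vdeg W"
  have d: "poly (vderiv W i) z = z ^ ?d * (of_nat ?d / z * poly (?V i) (1 / z) - poly (vderiv ?V i) (1 / z) / z\<^sup>2)" for i
  proof -
    have "((\<lambda>z. z ^ ?d * poly (?V i) (1 / z)) has_field_derivative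
       (of_nat ?d * z ^ (?d - 1) * poly (?V i) (1 / z) + z ^ ?d * (poly (pderiv (?V i)) (1 / z) * (- (1 / z\<^sup>2))))) (at z)"
      using assms(2)
      by (auto intro!: derivative_eq_intros DERIV_chain'[OF deriv_reciprocal poly_DERIV, of z "?V i"] simp: field_simps power2_eq_square)
    moreover have "of_nat ?d * z ^ (?d - 1) * poly (?V i) (1 / z) + z ^ ?d * (poly (pderiv (?V i)) (1 / z) * (- (1 / z\<^sup>2)))
      = z ^ ?d * (of_nat ?d / z * poly (?V i) (1 / z) - poly (vderiv ?V i) (1 / z) / z\<^sup>2)"
    proof (cases ?d)
      case (Suc n)
      then have e: "of_nat ?d * z ^ (?d - 1) = z ^ ?d * (of_nat ?d / z)"
        using assms(2) by (simp add: field_simps)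
      show ?thesis
        unfolding e vderiv_def by (simp add: algebra_simps)
    qed (simp add: vderiv_def)
    ultimately have *: "((\<lambda>z. z ^ ?d * poly (?V i) (1 / z)) has_field_derivative
       z ^ ?d * (of_nat ?d / z * poly (?V i) (1 / z) - poly (vderiv ?V i) (1 / z) / z\<^sup>2)) (at z)"
      by (rule DERIV_cong)
    have "(poly (W i) has_field_derivative
       z ^ ?d * (of_nat ?d / z * poly (?V i) (1 / z) - poly (vderiv ?V i) (1 / z) / z\<^sup>2)) (at z)"
      by (rule has_field_derivative_transform_within_open[OF *, of "- {0}"])
        (use assms(2) in \<open>auto simp: poly_vrev'[symmetric]\<close>)
    from DERIV_unique[OF poly_DERIV this] show ?thesis
      by (simp only: vderiv_def)
  qed
  let ?c = "z ^ ?d * cnj (z ^ ?d)"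
  have k1: "pker W W z z = ?c * pker ?V ?V (1 / z) (1 / z)"
    unfolding pker_def sum_distrib_left using assms(2)
    by (intro sum.cong refl) (simp add: poly_vrev'[OF assms(2), of W])
  have k2: "pker (vderiv W) W z z = ?c * (of_nat ?d / z * pker ?V ?V (1 / z) (1 / z)
      - pker (vderiv ?V) ?V (1 / z) (1 / z) / z\<^sup>2)"
    unfolding pker_def sum_distrib_left sum_subtractf[symmetric] sum_divide_distrib d using assms(2)
    by (intro sum.cong refl) (simp add: poly_vrev'[OF assms(2), of W] algebra_simps)
  have "?c \<noteq> 0"
    using assms(2) by simp
  then have "dlog W z = (of_nat ?d / z * pker ?V ?V (1 / z) (1 / z)
      - pker (vderiv ?V) ?V (1 / z) (1 / z) / z\<^sup>2) / pker ?V ?V (1 / z) (1 / z)"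
    unfolding dlog_def k1 k2 by (rule nonzero_mult_divide_mult_cancel_left)
  then show ?thesis
    using pker_nonzero[OF vrev_nonvanishing[OF assms(1)], of "1 / z"]
    by (simp add: dlog_def diff_divide_distrib)
qed

text \<open>Apply \<partial>-bar to the transformation rule of \<open>dlog\<close>; the term
  \<open>vdeg W / z\<close> is holomorphic and drops out.\<close>

lemma fubini_vrev:
  assumes "nonvanishing W" "z \<noteq> 0"
  shows "fubini W z = fubini (vrev W) (1 / z) / cmod z ^ 4"
proof -
  obtain p where p: "has_wirt (dlog W) p (of_real (fubini W z)) z"
    using has_wirt_dlog[OF assms(1)] by blast
  obtain q where q: "has_wirt (dlog (vrev W)) q (of_real (fubini (vrev W) (1 / z))) (1 / z)"
    using has_wirt_dlog[OF vrev_nonvanishing[OF assms(1)]] by blast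
  have d1: "((\<lambda>w. of_nat (vdeg W) / w) has_field_derivative (- of_nat (vdeg W) / z\<^sup>2)) (at z)"
    using assms(2) by (auto intro!: derivative_eq_intros simp: power2_eq_square divide_simps)
  have d2: "((\<lambda>w. inverse (w\<^sup>2)) has_field_derivative (- 2 / z ^ 3)) (at z)"
    using assms(2) by (auto intro!: derivative_eq_intros simp: power2_eq_square power3_eq_cube divide_simps)
  have "has_wirt (\<lambda>w. of_nat (vdeg W) / w - dlog (vrev W) (1 / w) * inverse (w\<^sup>2))
     (- of_nat (vdeg W) / z\<^sup>2 - (q * (- (1 / z\<^sup>2)) * inverse (z\<^sup>2) + dlog (vrev W) (1 / z) * (- 2 / z ^ 3)))
     (0 - ((of_real (fubini (vrev W) (1 / z)) * cnj (- (1 / z\<^sup>2))) * inverse (z\<^sup>2) + dlog (vrev W) (1 / z) * 0)) z"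
    by (rule has_wirt_diff[OF has_wirt_field[OF d1] has_wirt_mult[OF has_wirt_precompose[OF q
        deriv_reciprocal[OF assms(2)]] has_wirt_field[OF d2]]])
  from has_wirt_transform[OF this, of "- {0}" "dlog W"]
  have "has_wirt (dlog W) (- of_nat (vdeg W) / z\<^sup>2 - (q * (- (1 / z\<^sup>2)) * inverse (z\<^sup>2) + dlog (vrev W) (1 / z) * (- 2 / z ^ 3)))
     (0 - ((of_real (fubini (vrev W) (1 / z)) * cnj (- (1 / z\<^sup>2))) * inverse (z\<^sup>2) + dlog (vrev W) (1 / z) * 0)) z"
    using assms by (auto simp: dlog_vrev field_simps)
  from has_wirt_unique(2)[OF p this]
  have "of_real (fubini W z) = complex_of_real (fubini (vrev W) (1 / z)) * (cnj (inverse (z\<^sup>2)) * inverse (z\<^sup>2))"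
    by (simp add: field_simps)
  also have "cnj (inverse (z\<^sup>2)) * inverse (z\<^sup>2) = of_real (1 / cmod z ^ 4)"
  proof -
    have "complex_of_real (cmod z ^ 4) = (z * cnj z)\<^sup>2"
      by (simp add: complex_norm_square[symmetric] power_mult[symmetric] flip: of_real_power)
    then show ?thesis
      using assms(2) by (simp add: field_simps power2_eq_square del: of_real_power)
  qed
  finally have "complex_of_real (fubini W z) = of_real (fubini (vrev W) (1 / z) / cmod z ^ 4)"
    by simp
  then show ?thesis
    using of_real_eq_iff by blast
qed

text \<open>The normal form applies with l = k (l0 \<partial> log |W|^2 + l1 \<partial> log |G|^2),
  for which D = a deg W + b deg G, and with F = |W|^a |G|^b. The hypothesis \<open>inf\<close> is
  positivity of the metric density at infinity.\<close>

lemma constant_curvature_dlog: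
  fixes W :: "'a::finite \<Rightarrow> complex poly" and G :: "'b::finite \<Rightarrow> complex poly"
  assumes W: "nonvanishing W" and G: "nonvanishing G" and l: "l0 > 0" "l1 > 0"
    and f: "\<And>z. f z = l0 * fubini W z + l1 * fubini G z" and fpos: "\<And>z. f z > 0"
    and curv: "\<And>z. conformal_curvature f z = \<kappa>"
    and inf: "l0 * fubini (vrev W) 0 + l1 * fubini (vrev G) 0 > 0"
  obtains r :: real and s a b where "a > 0" "b > 0" "r > 0"
    "\<And>z. of_real a * dlog W z + of_real b * dlog G z =
      2 * of_real r * cnj (of_real r * z + s) / of_real (1 + (cmod (of_real r * z + s))\<^sup>2)"
proof -
  \<comment> \<open>Half the curvature, because K = - (2 / f) \<partial>\<partial>-bar log
    f.\<close>
  define k where "k = \<kappa> / 2"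
  define a where "a = k * l0"
  define b where "b = k * l1"
  define l where "l = (\<lambda>z. of_real a * dlog W z + of_real b * dlog G z)"
  define F where "F = (\<lambda>z. exp ((a * ln (psq W z) + b * ln (psq G z)) / 2))"
  obtain pW where pW: "\<And>z. has_wirt (dlog W) (pW z) (of_real (fubini W z)) z"
    using has_wirt_dlog[OF W] by metis
  obtain pG where pG: "\<And>z. has_wirt (dlog G) (pG z) (of_real (fubini G z)) z"
    using has_wirt_dlog[OF G] by metis
  have lw: "has_wirt l (of_real a * pW z + of_real b * pG z) (of_real (k * f z)) z" for z
    unfolding l_def by (rule has_wirt_eq, (rule has_wirt_add has_wirt_cmult pW pG)+)
      (simp_all add: f a_def b_def algebra_simps)
  have lnw: "has_wirt (\<lambda>z. of_real (ln (psq V z))) (dlog V z) (cnj (dlog V z)) z" if "nonvanishing V"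
    for V :: "'c::finite \<Rightarrow> complex poly" and z
    using has_wirt_ln[OF has_wirt_pker[of V V z, unfolded pker_psq[of V]] psq_pos[OF that]]
    by (simp add: dlog_def pker_psq cnj_pker)
  have Fw: "has_wirt (\<lambda>z. of_real (F z)) (l z * of_real (F z) / 2) (cnj (l z) * of_real (F z) / 2) z" for z
  proof -
    have "has_wirt (\<lambda>z. exp ((1 / 2) * (of_real a * of_real (ln (psq W z)) + of_real b * of_real (ln (psq G z)))))
      (exp ((1 / 2) * (of_real a * of_real (ln (psq W z)) + of_real b * of_real (ln (psq G z)))) *
         ((1 / 2) * (of_real a * dlog W z + of_real b * dlog G z)))
      (exp ((1 / 2) * (of_real a * of_real (ln (psq W z)) + of_real b * of_real (ln (psq G z)))) *
         ((1 / 2) * (of_real a * cnj (dlog W z) + of_real b * cnj (dlog G z)))) z"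
      by (intro has_wirt_compose[OF _ DERIV_exp] has_wirt_cmult has_wirt_add lnw W G)
    moreover have "exp ((1 / 2) * (of_real a * of_real (ln (psq W z)) + of_real b * of_real (ln (psq G z)))) = complex_of_real (F z)" for z
      unfolding F_def exp_of_real[symmetric] by simp
    ultimately show ?thesis
      by (simp add: l_def mult.commute)
  qed
  have c: "Re (del_z (del_zbar (\<lambda>w. of_real (ln (f w)))) z) = - k * f z" for z
    using curv[of z] fpos[of z] by (simp add: conformal_curvature_def k_def field_simps)
  have smooth: "wirt_smooth (\<lambda>z. of_real (l0 * fubini U z + l1 * fubini V z))"
    if "nonvanishing U" "nonvanishing V" for U :: "'c::finite \<Rightarrow> complex poly" and V :: "'d::finite \<Rightarrow> complex poly"
    unfolding of_real_add of_real_mult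
    by (intro wirt_smooth_add wirt_smooth_cmult wirt_smooth_fubini that)
  obtain r s where "k > 0" "r > 0"
    "\<And>z. l z = 2 * of_real r * cnj (of_real r * z + s) / of_real (1 + (cmod (of_real r * z + s))\<^sup>2)"
  proof (rule constant_curvature_normal_form)
    show "wirt_smooth (\<lambda>z. of_real (f z))"
      unfolding f by (rule smooth[OF W G])
    show "wirt_smooth l"
      unfolding l_def by (intro wirt_smooth_add wirt_smooth_cmult wirt_smooth_dlog W G)
    show "wirt_smooth (\<lambda>z. of_real (l0 * fubini (vrev W) z + l1 * fubini (vrev G) z))"
      by (rule smooth[OF vrev_nonvanishing[OF W] vrev_nonvanishing[OF G]])
    show "wirt_smooth (\<lambda>z. of_real a * dlog (vrev W) z + of_real b * dlog (vrev G) z)"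
      by (intro wirt_smooth_add wirt_smooth_cmult wirt_smooth_dlog vrev_nonvanishing W G)
    show "f z = (l0 * fubini (vrev W) (1 / z) + l1 * fubini (vrev G) (1 / z)) / cmod z ^ 4" if "z \<noteq> 0" for z
      unfolding f fubini_vrev[OF W that] fubini_vrev[OF G that] by (simp add: add_divide_distrib)
    show "l z = of_real (a * vdeg W + b * vdeg G) / z -
        (of_real a * dlog (vrev W) (1 / z) + of_real b * dlog (vrev G) (1 / z)) / z\<^sup>2" if "z \<noteq> 0" for z
      unfolding l_def dlog_vrev[OF W that] dlog_vrev[OF G that]
      by (simp add: add_divide_distrib algebra_simps)
    \<comment> \<open>D is \<open>k\<close> times a nonnegative combination of degrees, so a
      positive D forces \<open>k\<close> to be positive.\<close>
    show "k > 0" if "a * vdeg W + b * vdeg G > 0"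
    proof (rule ccontr)
      assume "\<not> k > 0"
      then have "a * vdeg W \<le> 0" "b * vdeg G \<le> 0"
        unfolding a_def b_def using l by (auto intro!: mult_nonpos_nonneg)
      with that show False by simp
    qed
    show "F z > 0" for z
      by (simp add: F_def)
  qed (use lw Fw c fpos inf that in auto)
  then show ?thesis
    using that[of a b r s] l by (simp add: a_def b_def l_def)
qed

text \<open>A function of two variables that is holomorphic in each is determined by its restriction
  to the antidiagonal.\<close>

lemma zero_on_reals_imp_zero:
  assumes "h holomorphic_on UNIV" "\<And>x::real. h (of_real x) = 0"
  shows "h z = 0"
proof (rule analytic_continuation[OF assms(1), of "range of_real" 0])
  show "(0::complex) islimpt range of_real"
    unfolding islimpt_approachable
  proof (intro allI impI)
    fix e :: real assume "e > 0"
    then show "\<exists>x'\<in>range of_real. x' \<noteq> 0 \<and> dist x' (0::complex) < e"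
      by (intro bexI[of _ "of_real (e / 2)"] rangeI) simp_all
  qed
qed (use assms in auto)

lemma polarization:
  fixes \<Phi> :: "complex \<Rightarrow> complex \<Rightarrow> complex"
  assumes x: "\<And>y. (\<lambda>x. \<Phi> (x + y) (x - y)) holomorphic_on UNIV"
    and y: "\<And>x. (\<lambda>y. \<Phi> (x + y) (x - y)) holomorphic_on UNIV"
    and 0: "\<And>z. \<Phi> z (cnj z) = 0"
  shows "\<Phi> z w = 0"
proof -
  \<comment> \<open>For real x and t the pair (x + i t, x - i t) is (z, cnj z). The identity is
    extended from real to complex x first, then from real to complex t.\<close>
  have 1: "\<Phi> (x + \<i> * of_real t) (x - \<i> * of_real t) = 0" for x and t :: real
  proof (rule zero_on_reals_imp_zero[OF x])
    fix x :: real
    have "Complex x t = of_real x + \<i> * of_real t" "cnj (Complex x t) = of_real x - \<i> * of_real t"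
      by (simp_all add: complex_eq_iff)
    with 0[of "Complex x t"] show "\<Phi> (of_real x + \<i> * of_real t) (of_real x - \<i> * of_real t) = 0"
      by simp
  qed
  have "(\<lambda>y. \<Phi> (x + \<i> * y) (x - \<i> * y)) holomorphic_on UNIV" for x
    using holomorphic_on_compose_gen[OF _ y[of x], of "\<lambda>y. \<i> * y" UNIV]
    by (simp add: o_def holomorphic_intros)
  from zero_on_reals_imp_zero[OF this 1]
  have "\<Phi> ((z + w) / 2 + \<i> * ((z - w) / (2 * \<i>))) ((z + w) / 2 - \<i> * ((z - w) / (2 * \<i>))) = 0" .
  moreover have "(z + w) / 2 + \<i> * ((z - w) / (2 * \<i>)) = z" "(z + w) / 2 - \<i> * ((z - w) / (2 * \<i>)) = w"
    by (simp_all add: field_simps)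
  ultimately show ?thesis
    by simp
qed

text \<open>Dividing by p q s gives a p' / p + b q' / q = t / s. At a zero of p the left side has a
  pole of residue a m + b n, where m > 0 and n \<ge> 0 are the orders of p and q; this is positive,
  so s must vanish there.\<close>

lemma poly_log_derivative_root:
  fixes p q s t :: "complex poly" and a b :: real
  assumes "p \<noteq> 0" "q \<noteq> 0" "a > 0" "b > 0"
    and eq: "smult (of_real a) (pderiv p * q * s) + smult (of_real b) (pderiv q * p * s) = t * p * q"
    and root: "poly p x = 0"
  shows "poly s x = 0"
proof -
  define X where "X = [:-x, 1:]"
  have X: "X \<noteq> 0" "poly X x = 0" "pderiv X = 1"
    by (simp_all add: X_def pderiv_pCons)
  define m n where "m = order x p" and "n = order x q"
  obtain p1 where p1: "p = X ^ m * p1" "poly p1 x \<noteq> 0"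
    using order_decomp[OF assms(1), of x] unfolding m_def X_def by (auto simp: dvd_def poly_eq_0_iff_dvd)
  obtain q1 where q1: "q = X ^ n * q1" "poly q1 x \<noteq> 0"
    using order_decomp[OF assms(2), of x] unfolding n_def X_def by (auto simp: dvd_def poly_eq_0_iff_dvd)
  have m: "m \<noteq> 0"
    using root assms(1) order_root[of p x] by (simp add: m_def)
  \<comment> \<open>Multiplying by X restores the factor that differentiation loses, so X^(m + n)
    can be cancelled from the whole identity and the rest evaluated at x. This avoids division and
    covers n = 0.\<close>
  have dX: "X * pderiv (X ^ k * u) = X ^ k * (smult (of_nat k) u + X * pderiv u)" for k u
  proof (cases k)
    case (Suc n)
    have "pderiv (X ^ k) = smult (of_nat k) (X ^ n)"
      unfolding Suc pderiv_power_Suc X(3) by simp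
    then have "X * pderiv (X ^ k) = smult (of_nat k) (X ^ k)"
      by (simp add: Suc)
    then have "u * (X * pderiv (X ^ k)) = smult (of_nat k) (u * X ^ k)"
      by simp
    then show ?thesis
      unfolding pderiv_mult by (simp add: algebra_simps)
  qed simp
  have "X ^ (m + n) * (smult (of_real a) ((smult (of_nat m) p1 + X * pderiv p1) * q1 * s)
        + smult (of_real b) ((smult (of_nat n) q1 + X * pderiv q1) * p1 * s))
     = X * (smult (of_real a) (pderiv p * q * s) + smult (of_real b) (pderiv q * p * s))"
  proof -
    have "X * (smult (of_real a) (pderiv p * q * s) + smult (of_real b) (pderiv q * p * s))
      = smult (of_real a) ((X * pderiv p) * q * s) + smult (of_real b) ((X * pderiv q) * p * s)"
      by (simp add: algebra_simps)
    then show ?thesis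
      unfolding p1(1) q1(1) dX by (simp add: algebra_simps power_add smult_add_right)
  qed
  also have "\<dots> = X ^ (m + n) * (X * t * p1 * q1)"
    unfolding eq unfolding p1(1) q1(1) by (simp add: algebra_simps power_add)
  finally have "smult (of_real a) ((smult (of_nat m) p1 + X * pderiv p1) * q1 * s)
        + smult (of_real b) ((smult (of_nat n) q1 + X * pderiv q1) * p1 * s) = X * t * p1 * q1"
    using X(1) by simp
  from arg_cong[OF this, of "\<lambda>u. poly u x"]
  have "of_real (a * m + b * n) * (poly p1 x * poly q1 x) * poly s x = 0"
    by (simp add: X algebra_simps)
  moreover have "a * m + b * n > 0"
    using assms m by (intro add_pos_nonneg mult_pos_pos) auto
  ultimately show ?thesis
    using p1(2) q1(2) by (metis mult_eq_0_iff of_real_eq_0_iff less_irrefl)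
qed

text \<open>By the fundamental theorem of algebra, a polynomial whose only possible root is - 1 / c
  is a constant times a power of the corresponding linear factor; for c = 0 the hypothesis excludes
  roots altogether.\<close>

lemma poly_single_root:
  fixes p :: "complex poly"
  assumes "p \<noteq> 0" "\<And>x. poly p x = 0 \<Longrightarrow> 1 + x * c = 0"
  shows "\<exists>k. \<forall>z. poly p z = poly p 0 * (1 + z * c) ^ k"
proof -
  have const: "\<forall>z. poly q z = poly q 0" if "\<And>x. poly q x \<noteq> 0" for q :: "complex poly"
  proof -
    have "degree q = 0"
    proof (rule ccontr)
      assume "degree q \<noteq> 0"
      moreover from this have "coeff q (degree q) \<noteq> 0"
        by (metis degree_0 leading_coeff_0_iff)
      ultimately have "\<exists>i\<in>{1..degree q}. coeff q i \<noteq> 0"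
        by (intro bexI[of _ "degree q"]) auto
      then obtain z where "(\<Sum>i\<le>degree q. coeff q i * z ^ i) = 0"
        using fundamental_theorem_of_algebra[of "coeff q" "degree q"] by blast
      with that[of z] show False
        by (simp add: poly_altdef)
    qed
    then obtain a where "q = [:a:]"
      by (rule degree_eq_zeroE)
    then show ?thesis
      by simp
  qed
  show ?thesis
  proof (cases "c = 0")
    case True
    then have "poly p x \<noteq> 0" for x
      using assms(2) by fastforce
    from const[OF this] show ?thesis
      by (auto intro: exI[of _ 0])
  next
    case False
    define x where "x = - 1 / c"
    obtain q where q: "p = [:-x, 1:] ^ order x p * q" "poly q x \<noteq> 0"
      using order_decomp[OF assms(1), of x] by (auto simp: dvd_def poly_eq_0_iff_dvd)
    have "poly q y \<noteq> 0" for y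
    proof
      assume "poly q y = 0"
      then have "poly p y = 0"
        by (subst q) simp
      then have "1 + y * c = 0"
        by (rule assms(2))
      then have "y * c = - 1"
        by (metis add.commute add_eq_0_iff)
      then have "y = x"
        using False by (simp add: x_def field_simps)
      with q \<open>poly q y = 0\<close> show False
        by simp
    qed
    from const[OF this] have q0: "poly q z = poly q 0" for z
      by blast
    have "poly p z = (z - x) ^ order x p * poly q 0" for z
      by (subst q(1)) (simp add: q0[of z])
    moreover have "z - x = (1 + z * c) * (- x)" for z
      using False by (simp add: x_def field_simps)
    ultimately have "poly p z = (1 + z * c) ^ order x p * ((- x) ^ order x p * poly q 0)" for z
      by (simp only: power_mult_distrib mult.assoc)
    from this this[of 0] show ?thesis
      by (intro exI[of _ "order x p"]) simp
  qed
qed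

lemma poly_pker_left: "poly (\<Sum>i\<in>UNIV. smult (cnj (poly (W i) v)) (U i)) z = pker U W z v"
  by (simp add: pker_def poly_sum mult.commute)

lemma pderiv_sum_poly: "pderiv (\<Sum>i\<in>I. f i) = (\<Sum>i\<in>I. pderiv (f i))"
  by (induction I rule: infinite_finite_induct) (simp_all add: pderiv_add)

lemma pderiv_pker_left:
  "pderiv (\<Sum>i\<in>UNIV. smult (cnj (poly (W i) v)) (U i)) = (\<Sum>i\<in>UNIV. smult (cnj (poly (W i) v)) (vderiv U i))"
  by (simp add: pderiv_sum_poly pderiv_smult vderiv_def)

lemma pker_cnj_right: "pker U W z (cnj w) = (\<Sum>i\<in>UNIV. poly (U i) z * poly (map_poly cnj (W i)) w)"
  by (simp only: pker_def poly_cnj complex_cnj_cnj)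

text \<open>Cleared of denominators, the hypothesis is an identity in z and cnj z and polarizes. For
  fixed v the kernel of W is a polynomial in z with roots only at 1 + z * cnj v = 0, hence a
  multiple of a power of this factor; Hermitian symmetry then makes the exponent independent of
  v.\<close>

theorem kernel_power:
  fixes W :: "'a::finite \<Rightarrow> complex poly" and G :: "'b::finite \<Rightarrow> complex poly"
  assumes W: "nonvanishing W" and G: "nonvanishing G" and ab: "a > 0" "b > 0"
    and eq: "\<And>z. of_real a * dlog W z + of_real b * dlog G z = 2 * cnj z / of_real (1 + (cmod z)\<^sup>2)"
  shows "\<exists>c>0. \<exists>d. \<forall>z v. pker W W z v = of_real c * (1 + z * cnj v) ^ d"
proof -
  define \<Phi> where "\<Phi> = (\<lambda>z w. (of_real a * pker (vderiv W) W z (cnj w) * pker G G z (cnj w)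
      + of_real b * pker (vderiv G) G z (cnj w) * pker W W z (cnj w)) * (1 + z * w)
      - 2 * w * pker W W z (cnj w) * pker G G z (cnj w))"
  have P: "\<Phi> z w = 0" for z w
  proof (rule polarization[of \<Phi>])
    show "(\<lambda>x. \<Phi> (x + y) (x - y)) holomorphic_on UNIV" for y
      unfolding \<Phi>_def pker_cnj_right by (intro holomorphic_intros)
    show "(\<lambda>y. \<Phi> (x + y) (x - y)) holomorphic_on UNIV" for x
      unfolding \<Phi>_def pker_cnj_right by (intro holomorphic_intros)
    fix z
    have n: "pker W W z z \<noteq> 0" "pker G G z z \<noteq> 0" "complex_of_real (1 + (cmod z)\<^sup>2) \<noteq> 0"
      using pker_nonzero W G by (auto simp only: of_real_eq_0_iff add_nonneg_eq_0_iff zero_le_one zero_le_power2 one_neq_zero)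
    have s: "1 + z * cnj z = of_real (1 + (cmod z)\<^sup>2)"
      by (simp only: of_real_add of_real_1 complex_norm_square)
    have "(of_real a * pker (vderiv W) W z z * pker G G z z
      + of_real b * pker (vderiv G) G z z * pker W W z z) * (of_real (1 + (cmod z)\<^sup>2)) =
      2 * cnj z * (pker W W z z * pker G G z z)"
      using eq[of z] n unfolding dlog_def by (simp add: divide_simps)
    then show "\<Phi> z (cnj z) = 0"
      unfolding \<Phi>_def s by (simp add: algebra_simps)
  qed
  have k: "\<exists>k. \<forall>z. pker W W z v = pker W W 0 v * (1 + z * cnj v) ^ k" for v
  proof -
    define p where "p = (\<Sum>i\<in>UNIV. smult (cnj (poly (W i) v)) (W i))"
    define q where "q = (\<Sum>i\<in>UNIV. smult (cnj (poly (G i) v)) (G i))"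
    have p: "poly p z = pker W W z v" "poly (pderiv p) z = pker (vderiv W) W z v" for z
      unfolding p_def pderiv_pker_left poly_pker_left by simp_all
    have q: "poly q z = pker G G z v" "poly (pderiv q) z = pker (vderiv G) G z v" for z
      unfolding q_def pderiv_pker_left poly_pker_left by simp_all
    have n: "p \<noteq> 0" "q \<noteq> 0"
      using p(1)[of v] q(1)[of v] pker_nonzero W G by fastforce+
    have "smult (of_real a) (pderiv p * q * [:1, cnj v:]) + smult (of_real b) (pderiv q * p * [:1, cnj v:])
        = [:2 * cnj v:] * p * q"
    proof (rule poly_eq_poly_eq_iff[THEN iffD1], rule ext)
      show "poly (smult (of_real a) (pderiv p * q * [:1, cnj v:]) + smult (of_real b) (pderiv q * p * [:1, cnj v:])) z
        = poly ([:2 * cnj v:] * p * q) z" for z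
        using P[of z "cnj v"] unfolding \<Phi>_def by (simp add: p q algebra_simps)
    qed
    from poly_log_derivative_root[OF n ab this] have "1 + x * cnj v = 0" if "poly p x = 0" for x
      using that by simp
    from poly_single_root[OF n(1) this] show ?thesis
      unfolding p by blast
  qed
  define c where "c = psq W 0"
  \<comment> \<open>At v = 0 the factor is 1 whatever the exponent, so the kernel is constant in z;
    by symmetry this fixes the leading constant for every v.\<close>
  have c0: "pker W W z 0 = of_real c" for z
    using k[of 0] by (auto simp: pker_psq c_def)
  have "pker W W 0 v = of_real c" for v
    using c0[of v] cnj_pker[of W W v 0] by simp
  then obtain k where k: "\<And>z v. pker W W z v = of_real c * (1 + z * cnj v) ^ k v"
    using k by metis
  have c: "c > 0"
    using psq_pos[OF W] by (simp add: c_def)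
  \<comment> \<open>Symmetry equates two powers of 1 + z * cnj v with exponents \<open>k v\<close>
    and \<open>k z\<close>; a modulus greater than 1 separates exponents.\<close>
  have kk: "k z = k v" if "cmod (1 + z * cnj v) > 1" for z v
  proof -
    have "(1 + z * cnj v) ^ k v = (1 + z * cnj v) ^ k z"
      using k[of z v] k[of v z] cnj_pker[of W W v z] c by (simp add: mult.commute)
    then have "cmod (1 + z * cnj v) ^ k v = cmod (1 + z * cnj v) ^ k z"
      by (metis norm_power)
    then show ?thesis
      using that by (metis power_inject_exp)
  qed
  have "pker W W z v = of_real c * (1 + z * cnj v) ^ k 1" for z v
  proof (cases "v = 0")
    case False
    \<comment> \<open>A large natural number is linked both to v and to 1, since |1 + n cnj v| > 1
      and 1 + n > 1.\<close>
    obtain n :: nat where n: "n > 2 / cmod v"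
      using reals_Archimedean2 by blast
    then have n0: "n > 0"
      using False by (metis divide_nonneg_nonneg gr0I norm_ge_zero not_less of_nat_0 zero_le_numeral)
    have "cmod (of_nat n * cnj v) > 2"
      using n False by (simp add: norm_mult divide_less_eq)
    then have "cmod (1 + of_nat n * cnj v) > 1"
      using norm_triangle_ineq2[of "of_nat n * cnj v" "-1"] by (simp add: add.commute)
    then have "k (of_nat n) = k v"
      by (rule kk)
    moreover have "k (of_nat n) = k 1"
    proof (rule kk)
      have "1 + of_nat n * cnj 1 = (of_nat (Suc n) :: complex)" by simp
      then show "cmod (1 + of_nat n * cnj 1) > 1"
        using n0 by (simp only: norm_of_nat)
    qed
    ultimately show ?thesis
      using k by simp
  qed (simp add: c0)
  with c show ?thesis by blast
qed

section \<open>Polynomial bivectors with power kernel\<close>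

text \<open>The condition pairs each z with its antipode - 1 / cnj z. A nonzero p has finitely many
  roots, so some z avoids them together with their antipodes.\<close>

lemma antipodal_zero:
  fixes p :: "complex poly"
  assumes "\<And>z v. 1 + z * cnj v = 0 \<Longrightarrow> poly p z * cnj (poly p v) = 0"
  shows "p = 0"
proof (rule ccontr)
  assume p: "p \<noteq> 0"
  let ?R = "{z. poly p z = 0}" and ?h = "\<lambda>z. - 1 / cnj z"
  have fin: "finite (?R \<union> ?h ` ?R \<union> {0})"
    using poly_roots_finite[OF p] by simp
  obtain z where z: "z \<notin> ?R \<union> ?h ` ?R \<union> {0}"
    using ex_new_if_finite[OF infinite_UNIV_char_0 fin] by (rule exE)
  have "1 + z * cnj (?h z) = 0"
    using z by simp
  from assms[OF this] have "poly p (?h z) = 0"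
    using z by simp
  moreover have "?h (?h z) = z"
    using z by simp
  ultimately have "z \<in> ?h ` ?R"
    by (metis (mono_tags, lifting) imageI mem_Collect_eq)
  with z show False by simp
qed

text \<open>For z \<noteq> 0 the factor vanishes at the single point v = - 1 / cnj z, and continuity
  in v fills it in; for z = 0 the factor is 1.\<close>

lemma cancel_power:
  fixes X Y :: "complex \<Rightarrow> complex \<Rightarrow> complex"
  assumes eq: "\<And>z v. (1 + z * cnj v) ^ k * X z v = (1 + z * cnj v) ^ k * Y z v"
    and X: "\<And>z. continuous_on UNIV (X z)" and Y: "\<And>z. continuous_on UNIV (Y z)"
  shows "X z v = Y z v"
proof (cases "z = 0")
  case True
  then show ?thesis
    using eq[of 0 v] by simp
next
  case False
  define T where "T = {v. X z v - Y z v = 0}"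
  have cont: "continuous_on UNIV (\<lambda>v. X z v - Y z v)"
    by (intro continuous_intros X Y)
  have "closed T"
    unfolding T_def using continuous_closed_preimage_constant[OF cont closed_UNIV, of 0] by simp
  moreover have "- {- 1 / cnj z} \<subseteq> T"
  proof
    fix v assume "v \<in> - {- 1 / cnj z}"
    then have "1 + z * cnj v \<noteq> 0"
      using False by (metis ComplI add.commute add_eq_0_iff complex_cnj_cnj complex_cnj_minus
          complex_cnj_mult complex_cnj_one complex_cnj_zero_iff minus_minus insertI1
          nonzero_mult_div_cancel_left ComplD)
    then show "v \<in> T"
      using eq[of z v] by (simp add: T_def)
  qed
  then have "closure (- {- 1 / cnj z}) \<subseteq> closure T"
    by (rule closure_mono)
  ultimately have "v \<in> T"
    by (auto simp: closure_complement)
  then show ?thesis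
    by (simp add: T_def)
qed

lemma degree_monom_mult_le_imp_zero:
  fixes p :: "complex poly"
  assumes "degree (monom 1 n * p) \<le> m" "m < n"
  shows "p = 0"
  using assms by (metis (no_types, lifting) degree_monom_eq degree_mult_eq leD le_add1 le_trans
      monom_eq_0_iff one_neq_zero)

lemma degree_monom_mult_le_imp_const:
  fixes p :: "complex poly"
  assumes "degree (monom 1 n * p) \<le> n"
  obtains c where "p = [:c:]"
proof (cases "p = 0")
  case False
  then have "degree p = 0"
    using assms by (simp add: degree_mult_eq degree_monom_eq)
  then show ?thesis
    using that degree_eq_zeroE by blast
qed (use that[of 0] in simp)

text \<open>Binomial weights turn the coordinates adapted to a Veronese curve into orthonormal ones.\<close>

definition bwt :: "nat \<Rightarrow> nat \<Rightarrow> nat" where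
  "bwt d i = (if i \<le> d then d choose i else 1)"

lemma bwt_values:
  "bwt 2 0 = 1" "bwt 2 1 = 2" "bwt 2 2 = 1" "bwt 2 3 = 1" "bwt 2 4 = 1"
  "bwt 3 0 = 1" "bwt 3 1 = 3" "bwt 3 2 = 3" "bwt 3 3 = 1" "bwt 3 4 = 1"
  "bwt 4 0 = 1" "bwt 4 1 = 4" "bwt 4 2 = 6" "bwt 4 3 = 4" "bwt 4 4 = 1"
  by (simp_all add: bwt_def eval_nat_numeral)

lemma upto_values:
  "{..2::nat} = {0, 1, 2}" "{..3::nat} = {0, 1, 2, 3}" "{..4::nat} = {0, 1, 2, 3, 4}"
  by auto

lemma choose_values:
  "2 choose 0 = (1::nat)" "2 choose 1 = 2" "2 choose 2 = 1"
  "3 choose 0 = 1" "3 choose 1 = 3" "3 choose 2 = 3" "3 choose 3 = 1"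
  "4 choose 0 = 1" "4 choose 1 = 4" "4 choose 2 = 6" "4 choose 3 = 4" "4 choose 4 = 1"
  by (simp_all add: eval_nat_numeral)

lemmas power_expand = power2_eq_square power3_eq_cube power4_eq_xxxx

text \<open>The kernel of the bivector when \<open>M\<close> holds its components in an orthonormal
  frame divided by the square roots of the weights. The sum runs over ordered pairs, hence the
  constant 2 k in the locale below.\<close>

definition bikernel :: "nat \<Rightarrow> (nat \<Rightarrow> nat \<Rightarrow> complex poly) \<Rightarrow> complex \<Rightarrow> complex \<Rightarrow> complex" where
  "bikernel d M z v = (\<Sum>i<5. \<Sum>j<5. of_nat (bwt d i * bwt d j) * (poly (M i j) z * cnj (poly (M i j) v)))"

lemma sum_lessThan_5: "(\<Sum>i<5. g i) = g 0 + g 1 + g 2 + g 3 + (g (4::nat) :: 'a::comm_monoid_add)"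
  by (simp add: eval_nat_numeral add.assoc)

lemma all_less_5: "(\<forall>i<5. P i) \<longleftrightarrow> P 0 \<and> P 1 \<and> P 2 \<and> P 3 \<and> P (4::nat)"
proof -
  have "i < 5 \<longleftrightarrow> i = 0 \<or> i = 1 \<or> i = 2 \<or> i = 3 \<or> i = 4" for i :: nat
    by linarith
  then show ?thesis
    by auto
qed

lemma double_cancel: "2 * (x :: complex) = of_real (2 * k) * y \<Longrightarrow> x = of_real k * y"
  by simp

text \<open>Separates the coefficients of the nine products of a, b, c with a', b', c', so that one
  large identity splits into small ones in which these variables no longer occur.\<close>

lemma bilinear_collect:
  fixes a b c a' b' c' :: "'a::comm_ring_1"
  shows "(\<Sum>(w, p, q, r, p', q', r')\<leftarrow>L. w * ((p * a + q * b + r * c) * (p' * a' + q' * b' + r' * c'))) =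
    (\<Sum>(w, p, q, r, p', q', r')\<leftarrow>L. w * (p * p')) * (a * a') + (\<Sum>(w, p, q, r, p', q', r')\<leftarrow>L. w * (q * q')) * (b * b') +
    (\<Sum>(w, p, q, r, p', q', r')\<leftarrow>L. w * (r * r')) * (c * c') +
    ((\<Sum>(w, p, q, r, p', q', r')\<leftarrow>L. w * (p * q')) * (a * b') + (\<Sum>(w, p, q, r, p', q', r')\<leftarrow>L. w * (q * p')) * (b * a')) +
    ((\<Sum>(w, p, q, r, p', q', r')\<leftarrow>L. w * (p * r')) * (a * c') + (\<Sum>(w, p, q, r, p', q', r')\<leftarrow>L. w * (r * p')) * (c * a')) +
    ((\<Sum>(w, p, q, r, p', q', r')\<leftarrow>L. w * (q * r')) * (b * c') + (\<Sum>(w, p, q, r, p', q', r')\<leftarrow>L. w * (r * q')) * (c * b'))"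
  by (induction L) (auto simp: algebra_simps)

text \<open>\<open>M\<close> stands for the bivector W in a frame adapted to G of degree
  \<open>d\<close>: by \<open>ann0\<close> and \<open>ann1\<close> it annihilates the Veronese curve
  and its derivative, by \<open>kernel\<close> its squared norm is a power of 1 + |z|^2, and
  \<open>deg\<close> encodes its behaviour at infinity.\<close>

locale power_bivector =
  fixes M :: "nat \<Rightarrow> nat \<Rightarrow> complex poly" and k :: real and d d0 :: nat
  assumes anti: "M j i = - M i j"
    and ann0: "i < 5 \<Longrightarrow> (\<Sum>j\<le>d. of_nat (d choose j) * z ^ j * poly (M i j) z) = 0"
    and ann1: "i < 5 \<Longrightarrow> (\<Sum>j\<le>d. of_nat (d choose j) * (of_nat j * z ^ (j - 1)) * poly (M i j) z) = 0"
    and kernel: "bikernel d M z v = of_real (2 * k) * (1 + z * cnj v) ^ d0"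
    and kpos: "k > 0"
    and deg: "i < 5 \<Longrightarrow> j < 5 \<Longrightarrow> degree (M i j) \<le> d0"
begin

lemma diag: "M i i = 0"
  using anti[of i i] by (metis (no_types) equation_minus_iff add.inverse_neutral eq_neg_iff_add_eq_0
      mult_2 mult_eq_0_iff zero_neq_numeral)

lemma diag_poly: "poly (M i i) z = 0"
  by (simp add: diag)

lemma anti_poly: "poly (M j i) z = - poly (M i j) z"
  using anti[of j i] by simp

end

context power_bivector
begin

lemmas lower = anti_poly[of 1 0, unfolded One_nat_def] anti_poly[of 2 0] anti_poly[of 3 0] anti_poly[of 4 0]
  anti_poly[of 2 1, unfolded One_nat_def] anti_poly[of 3 1, unfolded One_nat_def]
  anti_poly[of 4 1, unfolded One_nat_def] anti_poly[of 3 2] anti_poly[of 4 2] anti_poly[of 4 3]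

end

section \<open>Bivectors annihilated by a conic and its derivative\<close>

locale power_bivector2 = power_bivector M k 2 d0 for M k d0
begin

lemma rel: "i < 5 \<Longrightarrow> poly (M i 1) z = - z * poly (M i 2) z"
    "i < 5 \<Longrightarrow> poly (M i 0) z = z\<^sup>2 * poly (M i 2) z"
proof -
  assume i: "i < 5"
  have *: "poly (M i 0) z + 2 * z * poly (M i 1) z + z\<^sup>2 * poly (M i 2) z = 0"
    "2 * poly (M i 1) z + 2 * z * poly (M i 2) z = 0"
    using ann0[OF i, of z] ann1[OF i, of z]
    by (simp_all add: upto_values choose_values[unfolded One_nat_def] power_expand algebra_simps)
  then show "poly (M i 1) z = - z * poly (M i 2) z"
    by algebra
  with *(1) show "poly (M i 0) z = z\<^sup>2 * poly (M i 2) z"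
    by algebra
qed

lemma entries:
  "poly (M 0 1) z = 0" "poly (M 0 2) z = 0" "poly (M 1 2) z = 0"
  "poly (M 0 3) z = z\<^sup>2 * poly (M 2 3) z" "poly (M 1 3) z = - z * poly (M 2 3) z"
  "poly (M 0 4) z = z\<^sup>2 * poly (M 2 4) z" "poly (M 1 4) z = - z * poly (M 2 4) z"
proof -
  show 02: "poly (M 0 2) z = 0" "poly (M 1 2) z = 0"
    using rel[of 2 z] anti_poly[of 0 2 z] anti_poly[of 1 2 z] by (simp_all add: diag_poly)
  then show "poly (M 0 1) z = 0"
    using rel[of 0 z] by (simp add: diag_poly)
  show "poly (M 0 3) z = z\<^sup>2 * poly (M 2 3) z" "poly (M 1 3) z = - z * poly (M 2 3) z"
    using rel[of 3 z] anti_poly[of 0 3 z] anti_poly[of 1 3 z] anti_poly[of 2 3 z] by simp_all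
  show "poly (M 0 4) z = z\<^sup>2 * poly (M 2 4) z" "poly (M 1 4) z = - z * poly (M 2 4) z"
    using rel[of 4 z] anti_poly[of 0 4 z] anti_poly[of 1 4 z] anti_poly[of 2 4 z] by simp_all
qed

text \<open>The bivector is s ^ (p e_3 + q e_4) + r e_3 ^ e_4, with s = (z^2, - z, 1, 0, 0) the dual
  conic and p, q, r the entries (2,3), (2,4), (3,4). The weights 1, 2, 1 give s the kernel (1 + z *
  cnj v)^2.\<close>

lemma kernel2: "(1 + z * cnj v)\<^sup>2 * (poly (M 2 3) z * cnj (poly (M 2 3) v) + poly (M 2 4) z * cnj (poly (M 2 4) v))
    + poly (M 3 4) z * cnj (poly (M 3 4) v) = of_real k * (1 + z * cnj v) ^ d0"
proof -
  have "2 * ((1 + z * cnj v)\<^sup>2 * (poly (M 2 3) z * cnj (poly (M 2 3) v) + poly (M 2 4) z * cnj (poly (M 2 4) v))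
    + poly (M 3 4) z * cnj (poly (M 3 4) v)) = bikernel 2 M z v"
    unfolding bikernel_def sum_lessThan_5
    by (simp add: diag_poly entries[unfolded One_nat_def] bwt_values[unfolded One_nat_def] lower
       power_expand algebra_simps)
  then show ?thesis
    unfolding kernel by (rule double_cancel)
qed

text \<open>For d0 \<ge> 2 the antipodal pairs kill the entry (3,4) and the square cancels. For d0 <
  2 the entries z^2 p and z^2 q exceed the degree bound unless they vanish.\<close>

lemma cases2:
  "M 2 3 = 0 \<and> M 2 4 = 0 \<or> M 3 4 = 0 \<and> d0 \<ge> 2 \<and>
    (\<forall>z v. poly (M 2 3) z * cnj (poly (M 2 3) v) + poly (M 2 4) z * cnj (poly (M 2 4) v)
      = of_real k * (1 + z * cnj v) ^ (d0 - 2))"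
proof (cases "d0 \<ge> 2")
  case False
  have "M 0 3 = monom 1 2 * M 2 3" "M 0 4 = monom 1 2 * M 2 4"
    by (rule poly_eq_poly_eq_iff[THEN iffD1], rule ext, simp add: entries[unfolded One_nat_def] poly_monom)+
  then show ?thesis
    using degree_monom_mult_le_imp_zero[of 2 _ d0] deg[of 0 3] deg[of 0 4] False by simp
next
  case True
  then obtain e where e: "d0 = 2 + e"
    using le_Suc_ex by blast
  have r: "M 3 4 = 0"
  proof (rule antipodal_zero)
    fix z v :: complex assume "1 + z * cnj v = 0"
    then show "poly (M 3 4) z * cnj (poly (M 3 4) v) = 0"
      using kernel2[of z v] by (simp add: e)
  qed
  define X where "X = (\<lambda>z v. poly (M 2 3) z * cnj (poly (M 2 3) v) + poly (M 2 4) z * cnj (poly (M 2 4) v))"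
  define Y where "Y = (\<lambda>z v. of_real k * (1 + z * cnj v) ^ e)"
  have "poly (M 2 3) z * cnj (poly (M 2 3) v) + poly (M 2 4) z * cnj (poly (M 2 4) v)
      = of_real k * (1 + z * cnj v) ^ e" for z v
  proof (rule cancel_power[where k = 2 and X = X and Y = Y, unfolded X_def Y_def])
    show "(1 + z * cnj v)\<^sup>2 * (poly (M 2 3) z * cnj (poly (M 2 3) v) + poly (M 2 4) z * cnj (poly (M 2 4) v))
      = (1 + z * cnj v)\<^sup>2 * (of_real k * (1 + z * cnj v) ^ e)" for z v
      using kernel2[of z v] by (simp add: r e power_add power2_eq_square mult.left_commute)
  qed (intro continuous_intros)+
  with r True e show ?thesis by simp
qed

end

section \<open>Bivectors annihilated by a twisted cubic and its derivative\<close>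

locale power_bivector3 = power_bivector M k 3 d0 for M k d0
begin

lemma rel: "i < 5 \<Longrightarrow> poly (M i 1) z = - 2 * z * poly (M i 2) z - z\<^sup>2 * poly (M i 3) z"
    "i < 5 \<Longrightarrow> poly (M i 0) z = 3 * z\<^sup>2 * poly (M i 2) z + 2 * z ^ 3 * poly (M i 3) z"
proof -
  assume i: "i < 5"
  have *: "poly (M i 0) z + 3 * z * poly (M i 1) z + 3 * z\<^sup>2 * poly (M i 2) z + z ^ 3 * poly (M i 3) z = 0"
    "3 * poly (M i 1) z + 6 * z * poly (M i 2) z + 3 * z\<^sup>2 * poly (M i 3) z = 0"
    using ann0[OF i, of z] ann1[OF i, of z]
    by (simp_all add: upto_values choose_values[unfolded One_nat_def] power_expand algebra_simps)
  then show 1: "poly (M i 1) z = - 2 * z * poly (M i 2) z - z\<^sup>2 * poly (M i 3) z"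
    by algebra
  show "poly (M i 0) z = 3 * z\<^sup>2 * poly (M i 2) z + 2 * z ^ 3 * poly (M i 3) z"
    using *(1) unfolding 1 by algebra
qed

text \<open>The annihilator of the cubic and its derivative in the first four coordinates is spanned
  by the dual cubic s = (- z^3, z^2, - z, 1) and s'. The polynomials \<open>a\<close>,
  \<open>b\<close>, \<open>c\<close> are the coefficients of the bivector along s ^ s', s ^ e_4 and
  s' ^ e_4.\<close>

definition a where "a = M 2 3"
definition b where "b = M 3 4"
definition c where "c = - M 2 4 - monom 1 1 * M 3 4"

lemma entries:
  "poly (M 2 3) z = poly a z" "poly (M 3 4) z = poly b z" "poly (M 2 4) z = - z * poly b z - poly c z"
  "poly (M 0 3) z = 3 * z\<^sup>2 * poly a z" "poly (M 1 3) z = - 2 * z * poly a z"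
  "poly (M 0 4) z = - (z ^ 3) * poly b z - 3 * z\<^sup>2 * poly c z" "poly (M 1 4) z = z\<^sup>2 * poly b z + 2 * z * poly c z"
  "poly (M 1 2) z = z\<^sup>2 * poly a z" "poly (M 0 2) z = - 2 * z ^ 3 * poly a z" "poly (M 0 1) z = z ^ 4 * poly a z"
proof -
  show 23: "poly (M 2 3) z = poly a z" and 34: "poly (M 3 4) z = poly b z"
    and 24: "poly (M 2 4) z = - z * poly b z - poly c z"
    by (simp_all add: a_def b_def c_def poly_monom)
  show 13: "poly (M 0 3) z = 3 * z\<^sup>2 * poly a z" "poly (M 1 3) z = - 2 * z * poly a z"
    using rel[of 3 z] anti_poly[of 0 3 z] anti_poly[of 1 3 z] anti_poly[of 2 3 z] 23
    by (simp_all add: diag_poly)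
  show "poly (M 0 4) z = - (z ^ 3) * poly b z - 3 * z\<^sup>2 * poly c z" "poly (M 1 4) z = z\<^sup>2 * poly b z + 2 * z * poly c z"
    using rel[of 4 z] anti_poly[of 0 4 z] anti_poly[of 1 4 z] anti_poly[of 2 4 z] anti_poly[of 3 4 z] 24 34
    by (simp_all add: algebra_simps power_expand)
  show "poly (M 1 2) z = z\<^sup>2 * poly a z" "poly (M 0 2) z = - 2 * z ^ 3 * poly a z"
    using rel[of 2 z] anti_poly[of 0 2 z] anti_poly[of 1 2 z] 23 by (simp_all add: diag_poly)
  then show "poly (M 0 1) z = z ^ 4 * poly a z"
    using rel(1)[of 0 z] 13 by (simp add: power_expand diag_poly algebra_simps)
qed

lemma kernel3: "(1 + z * cnj v) * (3 * (1 + z * cnj v) ^ 3 * (poly a z * cnj (poly a v)) + (1 + z * cnj v) ^ 2 * (poly b z * cnj (poly b v))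
   + 3 * (1 + z * cnj v) * (z * (poly b z * cnj (poly c v)) + cnj v * (poly c z * cnj (poly b v)))
   + 3 * (1 + 3 * (z * cnj v)) * (poly c z * cnj (poly c v))) = of_real k * (1 + z * cnj v) ^ d0"
   (is "?L z v = _")
proof -
  have "2 * ?L z v = bikernel 3 M z v"
    unfolding bikernel_def sum_lessThan_5
    by (simp add: diag_poly entries[unfolded One_nat_def] bwt_values[unfolded One_nat_def] lower
       power_expand algebra_simps)
  then show ?thesis
    unfolding kernel by (rule double_cancel)
qed

text \<open>Antipodal pairs kill \<open>c\<close> when d0 \<ge> 2 and also \<open>b\<close> when d0
  \<ge> 4; degree bounds settle d0 \<le> 1 and d0 = 3, and d0 = 2 is contradictory. What survives
  lies in the first four coordinates or is a multiple of s ^ e_4, the cone over the dual cubic with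
  vertex e_4.\<close>

lemma cases3:
  "(\<forall>i<5. \<forall>j<5. M i j = 0) \<or> (\<forall>i<5. M i 4 = 0) \<or>
   (\<forall>z. poly (M 0 3) z = 0 \<and> poly (M 1 3) z = 0 \<and> poly (M 2 3) z = 0 \<and> poly (M 1 2) z = 0 \<and>
     poly (M 0 2) z = 0 \<and> poly (M 0 1) z = 0 \<and> poly (M 3 4) z = poly b z \<and> poly (M 2 4) z = - z * poly b z \<and>
     poly (M 0 4) z = - (z ^ 3) * poly b z \<and> poly (M 1 4) z = z\<^sup>2 * poly b z)"
proof -
  have c0: "c = 0" if "d0 \<ge> 2"
  proof (rule antipodal_zero)
    define e where "e = d0 - 2"
    have e: "d0 = 1 + Suc e"
      using that by (simp add: e_def)
    define X where "X = (\<lambda>z v. 3 * (1 + z * cnj v) ^ 3 * (poly a z * cnj (poly a v)) + (1 + z * cnj v) ^ 2 * (poly b z * cnj (poly b v))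
       + 3 * (1 + z * cnj v) * (z * (poly b z * cnj (poly c v)) + cnj v * (poly c z * cnj (poly b v)))
       + 3 * (1 + 3 * (z * cnj v)) * (poly c z * cnj (poly c v)))"
    define Y where "Y = (\<lambda>z v. of_real k * (1 + z * cnj v) ^ Suc e)"
    have eq: "X z v = Y z v" for z v
      unfolding X_def Y_def
    proof (rule cancel_power[where k = 1 and X = X and Y = Y, unfolded X_def Y_def])
      show "(1 + z * cnj v) ^ 1 * (3 * (1 + z * cnj v) ^ 3 * (poly a z * cnj (poly a v)) + (1 + z * cnj v) ^ 2 * (poly b z * cnj (poly b v))
       + 3 * (1 + z * cnj v) * (z * (poly b z * cnj (poly c v)) + cnj v * (poly c z * cnj (poly b v)))
       + 3 * (1 + 3 * (z * cnj v)) * (poly c z * cnj (poly c v))) = (1 + z * cnj v) ^ 1 * (of_real k * (1 + z * cnj v) ^ Suc e)" for z v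
        using kernel3[of z v] unfolding e power_add power_one_right by (simp only: mult.left_commute)
    qed (intro continuous_intros)+
    fix z v :: complex assume s: "1 + z * cnj v = 0"
    then have t: "z * cnj v = - 1"
      by (metis add.commute add_eq_0_iff)
    \<comment> \<open>At 1 + z * cnj v = 0 only the last summand is left, with the factor 3 (1 - 3)
      = - 6.\<close>
    show "poly c z * cnj (poly c v) = 0"
      using eq[of z v] by (simp add: X_def Y_def s t)
  qed
  consider "d0 \<le> 1" | "d0 = 2" | "d0 = 3" | "d0 \<ge> 4"
    by linarith
  then show ?thesis
  proof cases
    case 1
    have "M 0 4 = monom 1 2 * (- monom 1 1 * b - 3 * c)" "M 1 4 = monom 1 1 * (monom 1 1 * b + 2 * c)"
      "M 0 3 = monom 1 2 * (3 * a)"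
      by (rule poly_eq_poly_eq_iff[THEN iffD1], rule ext,
          simp add: entries[unfolded One_nat_def] poly_monom algebra_simps power_expand)+
    then have d: "degree (monom 1 2 * (- monom 1 1 * b - 3 * c)) \<le> d0"
      "degree (monom 1 1 * (monom 1 1 * b + 2 * c)) \<le> d0" "degree (monom 1 2 * (3 * a)) \<le> d0"
      using deg[of 0 4] deg[of 1 4] deg[of 0 3] by auto
    have e: "- monom 1 1 * b - 3 * c = 0" "degree (monom 1 1 * (monom 1 1 * b + 2 * c)) \<le> 1" "3 * a = 0"
      using d(2) 1 degree_monom_mult_le_imp_zero[OF d(1)] degree_monom_mult_le_imp_zero[OF d(3)] by linarith+
    obtain x where x: "monom 1 1 * b + 2 * c = [:x:]"
      using degree_monom_mult_le_imp_const[OF e(2)] by blast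
    have bc: "- z * poly b z - 3 * poly c z = 0" "z * poly b z + 2 * poly c z = x" "poly a z = 0" for z
      using arg_cong[OF e(1), of "\<lambda>p. poly p z"] arg_cong[OF x, of "\<lambda>p. poly p z"] arg_cong[OF e(3), of "\<lambda>p. poly p z"]
      by (simp_all add: poly_monom)
    have "x = 0"
      using bc[of 0] by simp
    then have c: "poly c z = 0" for z
      using bc[of z] by (simp add: algebra_simps) algebra
    have "monom 1 1 * b = 0"
      using x c \<open>x = 0\<close> by (metis add.right_neutral mult_zero_right pCons_0_0 poly_all_0_iff_0)
    then have "b = 0"
      by simp
    then have "\<forall>i<5. \<forall>j<5. \<forall>z. poly (M i j) z = 0"
      by (simp add: all_less_5 bc(3) c entries[unfolded One_nat_def] lower diag_poly)
    then show ?thesis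
      by (simp add: poly_all_0_iff_0)
  next
    case 2
    define X where "X = (\<lambda>z v. 3 * (1 + z * cnj v)\<^sup>2 * (poly a z * cnj (poly a v)) + (1 + z * cnj v) * (poly b z * cnj (poly b v)))"
    define Y where "Y = (\<lambda>(_ :: complex) (_ :: complex). complex_of_real k)"
    have "X z v = Y z v" for z v
      unfolding X_def Y_def
    proof (rule cancel_power[where k = 2 and X = X and Y = Y, unfolded X_def Y_def])
      show "(1 + z * cnj v)\<^sup>2 * (3 * (1 + z * cnj v)\<^sup>2 * (poly a z * cnj (poly a v)) + (1 + z * cnj v) * (poly b z * cnj (poly b v)))
        = (1 + z * cnj v)\<^sup>2 * of_real k" for z v
        using kernel3[of z v] c0 2 by (simp add: power_expand algebra_simps)
    qed (intro continuous_intros)+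
    \<comment> \<open>1 and - 1 are antipodal: the left side vanishes there, but after cancelling
      all d0 = 2 factors the right side is the constant k > 0.\<close>
    from this[of 1 "- 1"] show ?thesis
      using kpos by (simp add: X_def Y_def)
  next
    case 3
    have "M 0 1 = monom 1 4 * a"
      by (rule poly_eq_poly_eq_iff[THEN iffD1], rule ext, simp add: entries[unfolded One_nat_def] poly_monom)
    then have "a = 0"
      using degree_monom_mult_le_imp_zero[of 4 a 3] deg[of 0 1] 3 by simp
    then show ?thesis
      using c0 3 entries by simp
  next
    case 4
    define e where "e = d0 - 4"
    have e: "d0 = 3 + Suc e"
      using 4 by (simp add: e_def)
    define X where "X = (\<lambda>z v. 3 * (1 + z * cnj v) * (poly a z * cnj (poly a v)) + poly b z * cnj (poly b v))"
    define Y where "Y = (\<lambda>z v. of_real k * (1 + z * cnj v) ^ Suc e)"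
    have eq: "X z v = Y z v" for z v
      unfolding X_def Y_def
    proof (rule cancel_power[where k = 3 and X = X and Y = Y, unfolded X_def Y_def])
      show "(1 + z * cnj v) ^ 3 * (3 * (1 + z * cnj v) * (poly a z * cnj (poly a v)) + poly b z * cnj (poly b v))
        = (1 + z * cnj v) ^ 3 * (of_real k * (1 + z * cnj v) ^ Suc e)" for z v
        using kernel3[of z v] c0 4 unfolding e power_add by (simp add: power_expand algebra_simps)
    qed (intro continuous_intros)+
    have "poly b z * cnj (poly b v) = 0" if "1 + z * cnj v = 0" for z v
      using eq[of z v] unfolding X_def Y_def that by simp
    then have "b = 0"
      by (rule antipodal_zero)
    then have "\<forall>i<5. \<forall>z. poly (M i 4) z = 0"
      using c0 4 by (simp add: all_less_5 entries[unfolded One_nat_def] diag_poly)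
    then show ?thesis
      by (simp add: poly_all_0_iff_0)
  qed
qed

end

section \<open>Bivectors annihilated by a rational normal quartic and its derivative\<close>

locale power_bivector4 = power_bivector M k 4 d0 for M k d0
begin

lemma rel: "i < 5 \<Longrightarrow> poly (M i 1) z = - 3 * z * poly (M i 2) z - 3 * z\<^sup>2 * poly (M i 3) z - z ^ 3 * poly (M i 4) z"
    "i < 5 \<Longrightarrow> poly (M i 0) z = 6 * z\<^sup>2 * poly (M i 2) z + 8 * z ^ 3 * poly (M i 3) z + 3 * z ^ 4 * poly (M i 4) z"
proof -
  assume i: "i < 5"
  have *: "poly (M i 0) z + 4 * z * poly (M i 1) z + 6 * z\<^sup>2 * poly (M i 2) z + 4 * z ^ 3 * poly (M i 3) z + z ^ 4 * poly (M i 4) z = 0"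
    "4 * poly (M i 1) z + 12 * z * poly (M i 2) z + 12 * z\<^sup>2 * poly (M i 3) z + 4 * z ^ 3 * poly (M i 4) z = 0"
    using ann0[OF i, of z] ann1[OF i, of z]
    by (simp_all add: upto_values choose_values[unfolded One_nat_def] power_expand algebra_simps)
  then show 1: "poly (M i 1) z = - 3 * z * poly (M i 2) z - 3 * z\<^sup>2 * poly (M i 3) z - z ^ 3 * poly (M i 4) z"
    by algebra
  show "poly (M i 0) z = 6 * z\<^sup>2 * poly (M i 2) z + 8 * z ^ 3 * poly (M i 3) z + 3 * z ^ 4 * poly (M i 4) z"
    using *(1) unfolding 1 by algebra
qed

text \<open>With s = (z^4, - z^3, z^2, - z, 1) the dual quartic, the annihilator of the curve and
  its derivative is spanned by s, s' and s''. The coefficients \<open>a\<close>, \<open>b\<close>,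
  \<open>c\<close> along s ^ s', s ^ s'', s' ^ s'' are read off from the entries (3,4), (2,4),
  (2,3).\<close>

definition a where "a = M 3 4"
definition b where "b = smult (- 1 / 2) (M 2 4) - monom 1 1 * M 3 4"
definition c where "c = smult (1 / 2) (M 2 3 + monom 1 1 * M 2 4 + monom 1 2 * M 3 4)"

lemma entries:
  "poly (M 3 4) z = poly a z"
  "poly (M 2 4) z = - 2 * z * poly a z - 2 * poly b z"
  "poly (M 2 3) z = z\<^sup>2 * poly a z + 2 * z * poly b z + 2 * poly c z"
  "poly (M 1 4) z = 3 * z\<^sup>2 * poly a z + 6 * z * poly b z"
  "poly (M 0 4) z = - 4 * z ^ 3 * poly a z - 12 * z\<^sup>2 * poly b z"
  "poly (M 1 3) z = - 2 * z ^ 3 * poly a z - 6 * z\<^sup>2 * poly b z - 6 * z * poly c z"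
  "poly (M 0 3) z = 3 * z ^ 4 * poly a z + 12 * z ^ 3 * poly b z + 12 * z\<^sup>2 * poly c z"
  "poly (M 1 2) z = z ^ 4 * poly a z + 4 * z ^ 3 * poly b z + 6 * z\<^sup>2 * poly c z"
  "poly (M 0 2) z = - 2 * z ^ 5 * poly a z - 10 * z ^ 4 * poly b z - 16 * z ^ 3 * poly c z"
  "poly (M 0 1) z = z ^ 6 * poly a z + 6 * z ^ 5 * poly b z + 12 * z ^ 4 * poly c z"
proof -
  have e5: "z ^ 5 = z ^ 2 * z ^ 3" "z ^ 6 = z ^ 3 * z ^ 3"
    by (simp_all flip: power_add)
  show 34: "poly (M 3 4) z = poly a z"
    by (simp add: a_def)
  show 24: "poly (M 2 4) z = - 2 * z * poly a z - 2 * poly b z"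
    by (simp add: a_def b_def poly_monom)
  show 23: "poly (M 2 3) z = z\<^sup>2 * poly a z + 2 * z * poly b z + 2 * poly c z"
    by (simp add: a_def b_def c_def poly_monom power2_eq_square algebra_simps)
  note A = anti_poly[of _ _ z]
  have i0: "0 < (5::nat)" and i2: "2 < (5::nat)" and i3: "3 < (5::nat)" and i4: "4 < (5::nat)"
    by simp_all
  show 14: "poly (M 1 4) z = 3 * z\<^sup>2 * poly a z + 6 * z * poly b z"
    and 04: "poly (M 0 4) z = - 4 * z ^ 3 * poly a z - 12 * z\<^sup>2 * poly b z"
    unfolding A[of 1 4] A[of 0 4] rel(1)[OF i4] rel(2)[OF i4] A[of 4 2] A[of 4 3] 24 34 diag_poly
    by (simp_all add: power_expand algebra_simps)
  show 13: "poly (M 1 3) z = - 2 * z ^ 3 * poly a z - 6 * z\<^sup>2 * poly b z - 6 * z * poly c z"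
    and 03: "poly (M 0 3) z = 3 * z ^ 4 * poly a z + 12 * z ^ 3 * poly b z + 12 * z\<^sup>2 * poly c z"
    unfolding A[of 1 3] A[of 0 3] rel(1)[OF i3] rel(2)[OF i3] A[of 3 2] 23 34 diag_poly
    by (simp_all add: power_expand algebra_simps)
  show 12: "poly (M 1 2) z = z ^ 4 * poly a z + 4 * z ^ 3 * poly b z + 6 * z\<^sup>2 * poly c z"
    and 02: "poly (M 0 2) z = - 2 * z ^ 5 * poly a z - 10 * z ^ 4 * poly b z - 16 * z ^ 3 * poly c z"
    unfolding A[of 1 2] A[of 0 2] rel(1)[OF i2] rel(2)[OF i2] 23 24 diag_poly
    by (simp_all add: e5 power_expand algebra_simps)
  show "poly (M 0 1) z = z ^ 6 * poly a z + 6 * z ^ 5 * poly b z + 12 * z ^ 4 * poly c z"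
    unfolding rel(1)[OF i0] 02 03 04
    by (simp add: e5 power_expand algebra_simps)
qed

lemma kernel4: "(1 + z * cnj v)\<^sup>2 * (4 * (1 + z * cnj v) ^ 4 * (poly a z * cnj (poly a v))
   + 24 * (1 + z * cnj v) ^ 3 * (z * (poly a z * cnj (poly b v)) + cnj v * (poly b z * cnj (poly a v)))
   + 24 * (1 + z * cnj v)\<^sup>2 * (1 + 6 * (z * cnj v)) * (poly b z * cnj (poly b v))
   + 48 * (1 + z * cnj v)\<^sup>2 * (z\<^sup>2 * (poly a z * cnj (poly c v)) + (cnj v)\<^sup>2 * (poly c z * cnj (poly a v)))
   + (1 + z * cnj v) * (96 + 288 * (z * cnj v)) * (z * (poly b z * cnj (poly c v)) + cnj v * (poly c z * cnj (poly b v)))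
   + 96 * (1 + 4 * (z * cnj v) + 6 * (z * cnj v)\<^sup>2) * (poly c z * cnj (poly c v))) = of_real k * (1 + z * cnj v) ^ d0"
   (is "?L = _")
proof -
  define w where "w = cnj v"
  \<comment> \<open>Coefficients of a, b, c in the entries (i,j) with i < j, in lexicographic order;
    the numbers 4, 6, 4, 1, 24, ... zipped to them are products of two of the weights 1, 4, 6, 4,
    1.\<close>
  let ?rows = "\<lambda>z :: complex. [(z ^ 6, 6 * z ^ 5, 12 * z ^ 4), (- 2 * z ^ 5, - 10 * z ^ 4, - 16 * z ^ 3),
    (3 * z ^ 4, 12 * z ^ 3, 12 * z ^ 2), (- 4 * z ^ 3, - 12 * z ^ 2, 0), (z ^ 4, 4 * z ^ 3, 6 * z ^ 2),
    (- 2 * z ^ 3, - 6 * z ^ 2, - 6 * z), (3 * z ^ 2, 6 * z, 0), (z ^ 2, 2 * z, 2), (- 2 * z, - 2, 0), (1, 0, 0)]"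
  let ?L10 = "map (\<lambda>(w, (p, q, r), p', q', r'). (w, p, q, r, p', q', r'))
    (zip [4, 6, 4, 1, 24, 16, 4, 24, 6, 4] (zip (?rows z) (?rows w)))"
  have "bikernel 4 M z v = 2 * (4 * (poly (M 0 1) z * cnj (poly (M 0 1) v)) + 6 * (poly (M 0 2) z * cnj (poly (M 0 2) v))
    + 4 * (poly (M 0 3) z * cnj (poly (M 0 3) v)) + poly (M 0 4) z * cnj (poly (M 0 4) v)
    + 24 * (poly (M 1 2) z * cnj (poly (M 1 2) v)) + 16 * (poly (M 1 3) z * cnj (poly (M 1 3) v))
    + 4 * (poly (M 1 4) z * cnj (poly (M 1 4) v)) + 24 * (poly (M 2 3) z * cnj (poly (M 2 3) v))
    + 6 * (poly (M 2 4) z * cnj (poly (M 2 4) v)) + 4 * (poly (M 3 4) z * cnj (poly (M 3 4) v)))"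
    unfolding bikernel_def sum_lessThan_5
    by (simp add: diag_poly bwt_values[unfolded One_nat_def] lower)
  also have "\<dots> = 2 * (\<Sum>(u, p, q, r, p', q', r')\<leftarrow>?L10. u * ((p * poly a z + q * poly b z + r * poly c z) *
      (p' * cnj (poly a v) + q' * cnj (poly b v) + r' * cnj (poly c v))))"
    by (simp add: entries[unfolded One_nat_def] w_def add.assoc) (simp add: algebra_simps)
  also have "\<dots> = 2 * (4 * (1 + z * w) ^ 6 * (poly a z * cnj (poly a v)) + 24 * (1 + z * w) ^ 4 * (1 + 6 * (z * w)) * (poly b z * cnj (poly b v))
    + 96 * (1 + z * w) ^ 2 * (1 + 4 * (z * w) + 6 * (z * w)\<^sup>2) * (poly c z * cnj (poly c v))
    + (24 * z * (1 + z * w) ^ 5 * (poly a z * cnj (poly b v)) + 24 * w * (1 + z * w) ^ 5 * (poly b z * cnj (poly a v)))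
    + (48 * z\<^sup>2 * (1 + z * w) ^ 4 * (poly a z * cnj (poly c v)) + 48 * w\<^sup>2 * (1 + z * w) ^ 4 * (poly c z * cnj (poly a v)))
    + (z * (1 + z * w) ^ 3 * (96 + 288 * (z * w)) * (poly b z * cnj (poly c v)) + w * (1 + z * w) ^ 3 * (96 + 288 * (z * w)) * (poly c z * cnj (poly b v))))"
    unfolding bilinear_collect
  proof (intro arg_cong2[where f = "(+)"] arg_cong2[where f = "(*)"] refl)
    show "(\<Sum>(w, p, q, r, p', q', r')\<leftarrow>?L10. w * (p * p')) = 4 * (1 + z * w) ^ 6"
      "(\<Sum>(w, p, q, r, p', q', r')\<leftarrow>?L10. w * (q * q')) = 24 * (1 + z * w) ^ 4 * (1 + 6 * (z * w))"
      "(\<Sum>(w, p, q, r, p', q', r')\<leftarrow>?L10. w * (r * r')) = 96 * (1 + z * w) ^ 2 * (1 + 4 * (z * w) + 6 * (z * w)\<^sup>2)"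
      "(\<Sum>(w, p, q, r, p', q', r')\<leftarrow>?L10. w * (p * q')) = 24 * z * (1 + z * w) ^ 5"
      "(\<Sum>(w, p, q, r, p', q', r')\<leftarrow>?L10. w * (q * p')) = 24 * w * (1 + z * w) ^ 5"
      "(\<Sum>(w, p, q, r, p', q', r')\<leftarrow>?L10. w * (p * r')) = 48 * z\<^sup>2 * (1 + z * w) ^ 4"
      "(\<Sum>(w, p, q, r, p', q', r')\<leftarrow>?L10. w * (r * p')) = 48 * w\<^sup>2 * (1 + z * w) ^ 4"
      "(\<Sum>(w, p, q, r, p', q', r')\<leftarrow>?L10. w * (q * r')) = z * (1 + z * w) ^ 3 * (96 + 288 * (z * w))"
      "(\<Sum>(w, p, q, r, p', q', r')\<leftarrow>?L10. w * (r * q')) = w * (1 + z * w) ^ 3 * (96 + 288 * (z * w))"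
      by (simp_all, algebra+)
  qed
  also have "\<dots> = 2 * ?L"
  proof -
    have regroup: "2 * (4 * s ^ 6 * A + 24 * s ^ 4 * u * B + 96 * s\<^sup>2 * y * C + (24 * z * s ^ 5 * D + 24 * w * s ^ 5 * E)
        + (48 * z\<^sup>2 * s ^ 4 * F + 48 * w\<^sup>2 * s ^ 4 * G) + (z * s ^ 3 * x * H + w * s ^ 3 * x * K))
      = 2 * (s\<^sup>2 * (4 * s ^ 4 * A + 24 * s ^ 3 * (z * D + w * E) + 24 * s\<^sup>2 * u * B
        + 48 * s\<^sup>2 * (z\<^sup>2 * F + w\<^sup>2 * G) + s * x * (z * H + w * K) + 96 * y * C))"
      for s u x y A B C D E F G H K :: complex
      by (simp add: eval_nat_numeral algebra_simps)
    show ?thesis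
      unfolding w_def[symmetric] by (rule regroup)
  qed
  finally show ?thesis
    unfolding kernel by (rule double_cancel[OF sym])
qed

text \<open>What survives is a multiple of s ^ s', the tangent developable of the dual quartic. On
  antipodal pairs \<open>c\<close> dies for d0 \<ge> 3 and \<open>b\<close> for d0 \<ge> 5; below
  these bounds the degrees of the entries with small indices leave no bivector.\<close>

lemma cases4:
  "(\<forall>i<5. \<forall>j<5. M i j = 0) \<or> b = 0 \<and> c = 0"
proof -
  have e5: "x ^ 5 = x ^ 2 * x ^ 3" "x ^ 6 = x ^ 3 * x ^ 3" for x :: complex
    by (simp_all flip: power_add)
  have zero: "\<forall>i<5. \<forall>j<5. M i j = 0" if "a = 0" "b = 0" "c = 0"
  proof -
    have "\<forall>i<5. \<forall>j<5. \<forall>z. poly (M i j) z = 0"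
      by (simp add: all_less_5 that entries[unfolded One_nat_def] lower diag_poly)
    then show ?thesis
      by (simp add: poly_all_0_iff_0)
  qed
  have M: "M 0 1 = monom 1 4 * (monom 1 2 * a + 6 * monom 1 1 * b + 12 * c)"
    "M 0 2 = monom 1 3 * (- 2 * monom 1 2 * a - 10 * monom 1 1 * b - 16 * c)"
    "M 0 3 = monom 1 2 * (3 * monom 1 2 * a + 12 * monom 1 1 * b + 12 * c)"
    "M 1 2 = monom 1 2 * (monom 1 2 * a + 4 * monom 1 1 * b + 6 * c)"
    by (rule poly_eq_poly_eq_iff[THEN iffD1], rule ext,
        simp add: entries[unfolded One_nat_def] poly_monom e5 power_expand algebra_simps)+
  consider "d0 \<le> 2" | "d0 \<ge> 3"
    by linarith
  then show ?thesis
  proof cases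
    case 1
    have "degree (monom 1 4 * (monom 1 2 * a + 6 * monom 1 1 * b + 12 * c)) \<le> d0"
      "degree (monom 1 3 * (- 2 * monom 1 2 * a - 10 * monom 1 1 * b - 16 * c)) \<le> d0"
      using deg[of 0 1] deg[of 0 2] M(1,2) by auto
    note this[THEN degree_monom_mult_le_imp_zero]
    then have e: "monom 1 2 * a + 6 * monom 1 1 * b + 12 * c = 0" "- 2 * monom 1 2 * a - 10 * monom 1 1 * b - 16 * c = 0"
      using 1 by linarith+
    have "degree (monom 1 2 * (3 * monom 1 2 * a + 12 * monom 1 1 * b + 12 * c)) \<le> 2"
      "degree (monom 1 2 * (monom 1 2 * a + 4 * monom 1 1 * b + 6 * c)) \<le> 2"
      using deg[of 0 3] deg[of 1 2] 1 M(3,4) by auto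
    then obtain x y where "3 * monom 1 2 * a + 12 * monom 1 1 * b + 12 * c = [:x:]"
      "monom 1 2 * a + 4 * monom 1 1 * b + 6 * c = [:y:]"
      using degree_monom_mult_le_imp_const by metis
    from arg_cong[OF e(1), of "\<lambda>p. poly p _"] arg_cong[OF e(2), of "\<lambda>p. poly p _"] arg_cong[OF this(1), of "\<lambda>p. poly p _"]
      arg_cong[OF this(2), of "\<lambda>p. poly p _"]
    have eqs: "z\<^sup>2 * poly a z + 6 * z * poly b z + 12 * poly c z = 0" "- 2 * z\<^sup>2 * poly a z - 10 * z * poly b z - 16 * poly c z = 0"
      "3 * z\<^sup>2 * poly a z + 12 * z * poly b z + 12 * poly c z = x" "z\<^sup>2 * poly a z + 4 * z * poly b z + 6 * poly c z = y" for z
      by (simp_all add: poly_monom algebra_simps)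
    \<comment> \<open>At z = 0 the equations force both constants to vanish; the remaining linear
      system in c, z b, z^2 a has only the zero solution.\<close>
    have c0: "poly c 0 = 0" "x = 0" "y = 0"
      using eqs[of 0] by simp_all
    have "2 * poly c z = 0" "z * poly b z = 0" "z\<^sup>2 * poly a z = 0" for z
      using eqs[of z] c0 by algebra+
    then have "c = 0" "monom 1 1 * b = 0" "monom 1 2 * a = 0"
      by (auto simp: poly_monom simp flip: poly_all_0_iff_0)
    then show ?thesis
      using zero by simp
  next
    case 2
    have c0: "c = 0"
    proof (rule antipodal_zero)
      define e where "e = d0 - 3"
      have e: "d0 = 2 + Suc e"
        using 2 by (simp add: e_def)
      define X where "X = (\<lambda>z v. 4 * (1 + z * cnj v) ^ 4 * (poly a z * cnj (poly a v))
   + 24 * (1 + z * cnj v) ^ 3 * (z * (poly a z * cnj (poly b v)) + cnj v * (poly b z * cnj (poly a v)))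
   + 24 * (1 + z * cnj v)\<^sup>2 * (1 + 6 * (z * cnj v)) * (poly b z * cnj (poly b v))
   + 48 * (1 + z * cnj v)\<^sup>2 * (z\<^sup>2 * (poly a z * cnj (poly c v)) + (cnj v)\<^sup>2 * (poly c z * cnj (poly a v)))
   + (1 + z * cnj v) * (96 + 288 * (z * cnj v)) * (z * (poly b z * cnj (poly c v)) + cnj v * (poly c z * cnj (poly b v)))
   + 96 * (1 + 4 * (z * cnj v) + 6 * (z * cnj v)\<^sup>2) * (poly c z * cnj (poly c v)))"
      define Y where "Y = (\<lambda>z v. of_real k * (1 + z * cnj v) ^ Suc e)"
      have eq: "X z v = Y z v" for z v
      proof (rule cancel_power[where k = 2 and X = X and Y = Y])
        show "(1 + z * cnj v)\<^sup>2 * X z v = (1 + z * cnj v)\<^sup>2 * Y z v" for z v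
          using kernel4[of z v] unfolding X_def Y_def e power_add by (simp only: mult.left_commute)
      qed (unfold X_def Y_def, (intro continuous_intros)+)
      fix z v :: complex assume s: "1 + z * cnj v = 0"
      then have t: "z * cnj v = - 1"
        by (metis add.commute add_eq_0_iff)
      \<comment> \<open>At an antipodal pair the factor of the c-term is 96 (1 - 4 + 6), which is
        not zero.\<close>
      show "poly c z * cnj (poly c v) = 0"
        using eq[of z v] by (simp add: X_def Y_def s t)
    qed
    consider "d0 \<le> 4" | "d0 \<ge> 5"
      by linarith
    then show ?thesis
    proof cases
      case 1
      have M': "M 0 1 = monom 1 5 * (monom 1 1 * a + 6 * b)" "M 0 2 = monom 1 4 * (- 2 * monom 1 1 * a - 10 * b)"
        by (rule poly_eq_poly_eq_iff[THEN iffD1], rule ext,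
            simp add: entries[unfolded One_nat_def] c0 poly_monom e5 power_expand algebra_simps)+
      have e: "monom 1 1 * a + 6 * b = 0"
      proof (rule degree_monom_mult_le_imp_zero)
        show "degree (monom 1 5 * (monom 1 1 * a + 6 * b)) \<le> d0"
          using deg[of 0 1] M'(1) by simp
      qed (use 1 in simp)
      have "degree (monom 1 4 * (- 2 * monom 1 1 * a - 10 * b)) \<le> 4"
        using deg[of 0 2] 1 M'(2) by auto
      then obtain x where "- 2 * monom 1 1 * a - 10 * b = [:x:]"
        using degree_monom_mult_le_imp_const by metis
      from arg_cong[OF e, of "\<lambda>p. poly p _"] arg_cong[OF this, of "\<lambda>p. poly p _"]
      have eqs: "z * poly a z + 6 * poly b z = 0" "- 2 * z * poly a z - 10 * poly b z = x" for z
        by (simp_all add: poly_monom)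
      have x: "x = 0"
        using eqs[of 0] by simp
      have "2 * poly b z = 0" "z * poly a z = 0" for z
        using eqs[of z] x by algebra+
      then have "b = 0" "monom 1 1 * a = 0"
        by (auto simp: poly_monom simp flip: poly_all_0_iff_0)
      then show ?thesis
        using c0 zero by simp
    next
      case 2
      define e where "e = d0 - 5"
      have e: "d0 = 4 + Suc e"
        using 2 by (simp add: e_def)
      define X where "X = (\<lambda>z v. 4 * (1 + z * cnj v)\<^sup>2 * (poly a z * cnj (poly a v))
   + 24 * (1 + z * cnj v) * (z * (poly a z * cnj (poly b v)) + cnj v * (poly b z * cnj (poly a v)))
   + 24 * (1 + 6 * (z * cnj v)) * (poly b z * cnj (poly b v)))"
      define Y where "Y = (\<lambda>z v. of_real k * (1 + z * cnj v) ^ Suc e)"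
      have eq: "X z v = Y z v" for z v
      proof (rule cancel_power[where k = 4 and X = X and Y = Y])
        fix z v
        define s where "s = 1 + z * cnj v"
        show "(1 + z * cnj v) ^ 4 * X z v = (1 + z * cnj v) ^ 4 * Y z v"
          using kernel4[of z v] unfolding X_def Y_def e c0 power_add s_def[symmetric]
          by (simp add: power_expand algebra_simps)
      qed (unfold X_def Y_def, (intro continuous_intros)+)
      have "b = 0"
      proof (rule antipodal_zero)
        fix z v :: complex assume s: "1 + z * cnj v = 0"
        then have t: "z * cnj v = - 1"
          by (metis add.commute add_eq_0_iff)
        \<comment> \<open>Here the remaining factor is 24 (1 - 6).\<close>
        show "poly b z * cnj (poly b v) = 0"
          using eq[of z v] by (simp add: X_def Y_def s t)
      qed
      with c0 show ?thesis by simp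
    qed
  qed
qed

end

section \<open>Hermitian linear algebra\<close>

lemma herm_add_left: "herm (x + y) z = herm x z + herm y z"
  by (simp add: herm_def algebra_simps sum.distrib)

lemma herm_diff_left: "herm (x - y) z = herm x z - herm y z"
  by (simp add: herm_def algebra_simps sum_subtractf)

lemma herm_minus_left: "herm (- x) z = - herm x z"
  by (simp add: herm_def sum_negf)

lemma herm_scale_left: "herm (c *s x) z = c * herm x z"
  by (simp add: herm_def algebra_simps sum_distrib_left)

lemma herm_cnj: "cnj (herm x y) = herm y x"
  by (simp add: herm_def mult.commute)

lemma herm_add_right: "herm z (x + y) = herm z x + herm z y"
  by (simp add: herm_def algebra_simps sum.distrib)

lemma herm_scale_right: "herm z (c *s x) = cnj c * herm z x"
  by (simp add: herm_def algebra_simps sum_distrib_left)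

lemma herm_minus_right: "herm z (- x) = - herm z x"
  by (simp add: herm_def sum_negf)

lemma herm_self: "herm x x = of_real (\<Sum>a\<in>UNIV. (cmod (x $ a))\<^sup>2)"
  unfolding herm_def of_real_sum complex_norm_square ..

lemma herm_self_pos: "x \<noteq> 0 \<Longrightarrow> (\<Sum>a\<in>UNIV. (cmod (x $ a))\<^sup>2) > 0"
proof -
  assume "x \<noteq> 0"
  then obtain a where "x $ a \<noteq> 0"
    by (auto simp: vec_eq_iff)
  then show ?thesis
    by (intro sum_pos2[of UNIV a]) auto
qed

lemma herm_eq_0_iff: "herm x x = 0 \<longleftrightarrow> x = 0"
proof
  assume "herm x x = 0"
  then have "(\<Sum>a\<in>UNIV. (cmod (x $ a))\<^sup>2) = 0"
    unfolding herm_self of_real_eq_0_iff .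
  then show "x = 0"
    using herm_self_pos[of x] by auto
qed (simp add: herm_def)

section \<open>Orthonormal frames\<close>

definition orthonormal_upto :: "nat \<Rightarrow> (nat \<Rightarrow> complex^'n) \<Rightarrow> bool" where
  "orthonormal_upto k u \<longleftrightarrow> (\<forall>i<k. \<forall>j<k. herm (u i) (u j) = (if i = j then 1 else 0))"

text \<open>A square matrix whose rows are the conjugates of the given vectors, padded by at least
  one zero row, is singular; a normalized kernel vector is orthogonal to all of them.\<close>

lemma orthonormal_extend_step:
  fixes u :: "nat \<Rightarrow> complex^'n"
  assumes "orthonormal_upto k u" "k < CARD('n)"
  obtains x where "orthonormal_upto (Suc k) (u(k := x))"
proof -
  obtain h where h: "bij_betw h {0..<CARD('n)} (UNIV :: 'n set)"
    using ex_bij_betw_nat_finite[of "UNIV :: 'n set"] by auto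
  define g where "g = the_inv_into {0..<CARD('n)} h"
  have gh: "g (h i) = i" if "i < CARD('n)" for i
    unfolding g_def using h that by (simp add: the_inv_into_f_f bij_betw_def)
  define A :: "complex^'n^'n" where "A = (\<chi> i a. if g i < k then cnj (u (g i) $ a) else 0)"
  have "row (h k) A = 0"
    by (simp add: row_def A_def gh assms vec_eq_iff)
  then have "det A = 0"
    by (rule det_zero_row(2))
  then have "\<not> (\<exists>B. B ** A = mat 1)"
    by (metis invertible_det_nz invertible_left_inverse)
  then obtain y where y: "A *v y = 0" "y \<noteq> 0"
    unfolding matrix_left_invertible_ker by blast
  have yu: "herm y (u i) = 0" if "i < k" for i
  proof -
    have "i < CARD('n)"
      using that assms by simp
    with arg_cong[OF y(1), of "\<lambda>v. v $ h i"] that show ?thesis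
      by (simp add: matrix_vector_mult_def A_def gh herm_def mult.commute)
  qed
  define r where "r = sqrt (\<Sum>a\<in>UNIV. (cmod (y $ a))\<^sup>2)"
  have r: "r > 0" "herm y y = of_real (r\<^sup>2)"
    using herm_self_pos[OF y(2)] by (simp_all add: r_def herm_self)
  define x where "x = of_real (1 / r) *s y"
  have "herm x x = 1"
    using r by (simp add: x_def herm_scale_left herm_scale_right power2_eq_square)
  moreover have xu: "herm x (u i) = 0" if "i < k" for i
    using yu[OF that] by (simp add: x_def herm_scale_left)
  moreover have "herm (u i) x = 0" if "i < k" for i
    using xu[OF that] herm_cnj[of x "u i"] by simp
  ultimately have "orthonormal_upto (Suc k) (u(k := x))"
    using assms(1) by (auto simp: orthonormal_upto_def less_Suc_eq)
  then show ?thesis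
    by (rule that)
qed

lemma orthonormal_extend:
  fixes u :: "nat \<Rightarrow> complex^'n"
  assumes "orthonormal_upto k u" "k \<le> CARD('n)"
  obtains u' where "orthonormal_upto CARD('n) u'" "\<And>i. i < k \<Longrightarrow> u' i = u i"
proof -
  have "\<exists>u'. orthonormal_upto CARD('n) u' \<and> (\<forall>i<k. u' i = u i)"
    using assms(2,1)
  proof (induction k arbitrary: u rule: inc_induct)
    case base
    then show ?case by auto
  next
    case (step k)
    obtain x where x: "orthonormal_upto (Suc k) (u(k := x))"
      using orthonormal_extend_step[OF step.prems step.hyps(2)] by blast
    from step.IH[OF this] show ?case
      by (metis fun_upd_other less_Suc_eq less_irrefl)
  qed
  then show ?thesis
    using that by blast
qed

text \<open>A left inverse of a square matrix is also a right inverse.\<close>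

lemma orthonormal_complete:
  fixes u :: "nat \<Rightarrow> complex^'n"
  assumes "orthonormal_upto CARD('n) u"
  shows "(\<Sum>i<CARD('n). u i $ a * cnj (u i $ b)) = (if a = b then 1 else 0)"
proof -
  obtain h where h: "bij_betw h {0..<CARD('n)} (UNIV :: 'n set)"
    using ex_bij_betw_nat_finite[of "UNIV :: 'n set"] by auto
  define g where "g = the_inv_into {0..<CARD('n)} h"
  have gh: "g (h i) = i" if "i < CARD('n)" for i
    unfolding g_def using h that by (simp add: the_inv_into_f_f bij_betw_def)
  have hg: "h (g j) = j" for j
    unfolding g_def using h by (simp add: f_the_inv_into_f_bij_betw)
  have g: "g j < CARD('n)" for j
    unfolding g_def using h by (metis UNIV_I atLeastLessThan_iff bij_betw_the_inv_into bij_betwE)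
  define A :: "complex^'n^'n" where "A = (\<chi> a j. u (g j) $ a)"
  define B :: "complex^'n^'n" where "B = (\<chi> j a. cnj (u (g j) $ a))"
  have "(\<Sum>k\<in>UNIV. cnj (u (g i) $ k) * u (g j) $ k) = (if i = j then 1 else 0)" for i j
  proof -
    have "(\<Sum>k\<in>UNIV. cnj (u (g i) $ k) * u (g j) $ k) = herm (u (g j)) (u (g i))"
      by (simp add: herm_def mult.commute)
    also have "\<dots> = (if g j = g i then 1 else 0)"
      using assms g by (simp add: orthonormal_upto_def)
    finally show ?thesis
      using hg by metis
  qed
  then have "B ** A = mat 1"
    by (simp add: matrix_matrix_mult_def A_def B_def mat_def vec_eq_iff)
  then have "A ** B = mat 1"
    using matrix_left_right_inverse by blast
  from arg_cong[OF this, of "\<lambda>X. X $ a $ b"]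
  have "(\<Sum>j\<in>UNIV. u (g j) $ a * cnj (u (g j) $ b)) = (if a = b then 1 else 0)"
    by (simp add: matrix_matrix_mult_def A_def B_def mat_def)
  also have "(\<Sum>j\<in>UNIV. u (g j) $ a * cnj (u (g j) $ b)) = (\<Sum>i\<in>{0..<CARD('n)}. u i $ a * cnj (u i $ b))"
    using sum.reindex_bij_betw[OF h, of "\<lambda>j. u (g j) $ a * cnj (u (g j) $ b)"] by (simp add: gh)
  finally show ?thesis
    by (simp add: lessThan_atLeast0)
qed

text \<open>The coefficients pair u_i with x bilinearly, as contraction of a bivector with frame
  vectors requires; this is harmless because the conjugate of an orthonormal frame is
  orthonormal.\<close>

lemma parseval:
  fixes u :: "nat \<Rightarrow> complex^'n"
  assumes "orthonormal_upto CARD('n) u"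
  shows "(\<Sum>i<CARD('n). (\<Sum>a\<in>UNIV. u i $ a * x a) * cnj (\<Sum>b\<in>UNIV. u i $ b * y b)) = (\<Sum>a\<in>UNIV. x a * cnj (y a))"
proof -
  have "(\<Sum>i<CARD('n). (\<Sum>a\<in>UNIV. u i $ a * x a) * cnj (\<Sum>b\<in>UNIV. u i $ b * y b))
    = (\<Sum>i<CARD('n). \<Sum>a\<in>UNIV. \<Sum>b\<in>UNIV. (u i $ a * cnj (u i $ b)) * (x a * cnj (y b)))"
    by (simp add: sum_product mult_ac)
  also have "\<dots> = (\<Sum>a\<in>UNIV. \<Sum>b\<in>UNIV. (\<Sum>i<CARD('n). u i $ a * cnj (u i $ b)) * (x a * cnj (y b)))"
    by (subst sum.swap, intro sum.cong refl, subst sum.swap) (simp add: sum_distrib_right)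
  also have "\<dots> = (\<Sum>a\<in>UNIV. x a * cnj (y a))"
    by (simp add: orthonormal_complete[OF assms] if_distrib[of "\<lambda>c. c * _"] cong: if_cong)
  finally show ?thesis .
qed

text \<open>A further unit vector orthogonal to a complete frame would have norm 0 by
  Parseval.\<close>

lemma orthonormal_upto_le:
  fixes u :: "nat \<Rightarrow> complex^'n"
  assumes "orthonormal_upto k u"
  shows "k \<le> CARD('n)"
proof (rule ccontr)
  let ?N = "CARD('n)"
  assume "\<not> k \<le> ?N"
  then have *: "orthonormal_upto ?N u" "herm (u ?N) (u ?N) = 1" "i < ?N \<Longrightarrow> herm (u i) (u ?N) = 0" for i
    using assms by (auto simp: orthonormal_upto_def)
  have "(\<Sum>a\<in>UNIV. u i $ a * cnj (u ?N $ a)) = 0" if "i < ?N" for i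
    using *(3)[OF that] by (simp add: herm_def)
  with parseval[OF *(1), of "\<lambda>a. cnj (u ?N $ a)" "\<lambda>a. cnj (u ?N $ a)"] *(2) show False
    by (simp add: herm_def mult.commute)
qed

section \<open>Rigidity\<close>

text \<open>Calabi: the coefficient vectors of a curve with kernel \<open>c (1 + z w)\<^sup>d\<close> are orthogonal.\<close>

lemma power_kernel_coeffs:
  fixes P :: "'a::finite \<Rightarrow> complex poly"
  assumes "\<And>z v. pker P P z v = of_real c * (1 + z * cnj v) ^ d"
  shows "(\<Sum>i\<in>UNIV. coeff (P i) k * cnj (coeff (P i) l)) = (if k = l then of_real (c * (d choose k)) else 0)"
proof -
  have 1: "(\<Sum>i\<in>UNIV. coeff (P i) k * cnj (poly (P i) v)) = of_real (c * (d choose k)) * cnj v ^ k" for v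
  proof -
    have "(\<Sum>i\<in>UNIV. smult (cnj (poly (P i) v)) (P i)) = smult (of_real c) ([:1, cnj v:] ^ d)"
      by (rule poly_eq_poly_eq_iff[THEN iffD1], rule ext) (simp add: poly_pker_left assms poly_power)
    from arg_cong[OF this, of "\<lambda>p. coeff p k"]
    have "(\<Sum>i\<in>UNIV. coeff (P i) k * cnj (poly (P i) v)) = of_real c * coeff ([:1, cnj v:] ^ d) k"
      by (simp add: coeff_sum mult.commute)
    also have "coeff ([:1, cnj v:] ^ d) k = of_nat (d choose k) * cnj v ^ k"
    proof (cases "k \<le> d")
      case False
      then have "degree ([:1, cnj v:] ^ d) < k"
        using degree_power_le[of "[:1, cnj v:]" d] by (auto split: if_splits)
      with False show ?thesis
        by (simp add: coeff_eq_0 binomial_eq_0)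
    qed (simp add: coeff_linear_poly_power)
    finally show ?thesis
      by simp
  qed
  have "(\<Sum>i\<in>UNIV. smult (cnj (coeff (P i) k)) (P i)) = smult (of_real (c * (d choose k))) (monom 1 k)"
  proof (rule poly_eq_poly_eq_iff[THEN iffD1], rule ext)
    fix v
    have "(\<Sum>i\<in>UNIV. cnj (coeff (P i) k) * poly (P i) v) = of_real (c * (d choose k)) * v ^ k"
      using arg_cong[OF 1[of v], of cnj] by simp
    then show "poly (\<Sum>i\<in>UNIV. smult (cnj (coeff (P i) k)) (P i)) v = poly (smult (of_real (c * (d choose k))) (monom 1 k)) v"
      by (simp add: poly_sum poly_monom)
  qed
  from arg_cong[OF this, of "\<lambda>p. cnj (coeff p l)"] show ?thesis
    by (simp add: coeff_sum)
qed

text \<open>For k > d the diagonal relation makes the squared norm of the k-th coefficient vector a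
  multiple of a vanishing binomial coefficient.\<close>

lemma power_kernel_degree:
  fixes P :: "'a::finite \<Rightarrow> complex poly"
  assumes "\<And>z v. pker P P z v = of_real c * (1 + z * cnj v) ^ d"
  shows "degree (P i) \<le> d"
proof (rule degree_le, intro allI impI)
  fix k assume "d < k"
  then have "(\<Sum>i\<in>UNIV. coeff (P i) k * cnj (coeff (P i) k)) = 0"
    using power_kernel_coeffs[OF assms, of k k] by (simp add: binomial_eq_0)
  then have "complex_of_real (\<Sum>i\<in>UNIV. (cmod (coeff (P i) k))\<^sup>2) = 0"
    by (simp only: of_real_sum complex_norm_square)
  then have "(\<Sum>i\<in>UNIV. (cmod (coeff (P i) k))\<^sup>2) = 0"
    using of_real_eq_0_iff by blast
  then show "coeff (P i) k = 0"
    by (subst (asm) sum_nonneg_eq_0_iff) auto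
qed

text \<open>Normalizing the orthogonal coefficient vectors gives d + 1 orthonormal ones, so d is
  smaller than the dimension of the target. This later bounds the degree of G and that of the ruling
  of the plane.\<close>

lemma power_kernel_frame:
  fixes P :: "'n::finite \<Rightarrow> complex poly"
  assumes "\<And>z v. pker P P z v = of_real c * (1 + z * cnj v) ^ d" "c > 0"
  obtains u :: "nat \<Rightarrow> complex^'n" where "orthonormal_upto (Suc d) u"
    "\<And>i z. poly (P i) z = of_real (sqrt c) * (\<Sum>r\<le>d. of_real (sqrt (d choose r)) * z ^ r * u r $ i)"
proof -
  define s where "s = (\<lambda>r. sqrt (c * (d choose r)))"
  define u :: "nat \<Rightarrow> complex^'n" where "u = (\<lambda>r. \<chi> i. coeff (P i) r / of_real (s r))"
  have s: "s r > 0" if "r \<le> d" for r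
    using that assms(2) by (simp add: s_def)
  have "herm (u k) (u l) = (if k = l then 1 else 0)" if "k \<le> d" "l \<le> d" for k l
  proof -
    have "herm (u k) (u l) = (\<Sum>i\<in>UNIV. coeff (P i) k * cnj (coeff (P i) l)) / (of_real (s k) * of_real (s l))"
      by (simp add: herm_def u_def sum_divide_distrib)
    also have "\<dots> = (if k = l then 1 else 0)"
      using s[OF that(1)] assms(2) that(1) unfolding power_kernel_coeffs[OF assms(1)]
      by (auto simp: s_def simp flip: of_real_mult)
    finally show ?thesis .
  qed
  then have "orthonormal_upto (Suc d) u"
    by (simp add: orthonormal_upto_def)
  moreover have "poly (P i) z = of_real (sqrt c) * (\<Sum>r\<le>d. of_real (sqrt (d choose r)) * z ^ r * u r $ i)" for i z
  proof -
    have "poly (P i) z = (\<Sum>r\<le>d. coeff (P i) r * z ^ r)"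
    proof -
      have "(\<Sum>r\<le>degree (P i). coeff (P i) r * z ^ r) = (\<Sum>r\<le>d. coeff (P i) r * z ^ r)"
        using power_kernel_degree[OF assms(1)] by (intro sum.mono_neutral_left) (auto simp: coeff_eq_0)
      then show ?thesis
        by (simp add: poly_altdef)
    qed
    also have "\<dots> = (\<Sum>r\<le>d. of_real (s r) * z ^ r * u r $ i)"
      by (intro sum.cong refl) (use s in \<open>fastforce simp: u_def\<close>)
    finally show ?thesis
      by (simp add: s_def real_sqrt_mult sum_distrib_left mult_ac)
  qed
  ultimately show ?thesis
    by (rule that)
qed

text \<open>Read as a skew matrix, a nonzero decomposable bivector has as range the plane that it
  represents.\<close>

definition mat_poly :: "('n \<times> 'n \<Rightarrow> complex poly) \<Rightarrow> complex \<Rightarrow> complex^'n^'n" where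
  "mat_poly W z = (\<chi> a b. poly (W (a, b)) z)"

text \<open>For a bivector \<open>W\<close> representing a holomorphic plane bundle, degeneracy means that the
  \<open>\<partial>'\<close>-second fundamental form of the bundle has rank at most one.\<close>

definition degenerate :: "('n::finite \<times> 'n \<Rightarrow> complex poly) \<Rightarrow> complex \<Rightarrow> bool" where
  "degenerate W z \<longleftrightarrow> (\<exists>y. \<forall>x. \<exists>t v. mat_poly (vderiv W) z *v x = t *s y + mat_poly W z *v v)"

definition dotp :: "('n::finite \<Rightarrow> complex poly) \<Rightarrow> complex \<Rightarrow> complex^'n \<Rightarrow> complex" where
  "dotp F z x = (\<Sum>b\<in>UNIV. poly (F b) z * x $ b)"

definition vec_poly :: "('n \<Rightarrow> complex poly) \<Rightarrow> complex \<Rightarrow> complex^'n" where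
  "vec_poly F z = (\<chi> a. poly (F a) z)"

text \<open>For W = B F ^ K the derivative is, modulo the plane, governed by F' and K' alone. One of
  the two directions is lost: F' lies in the plane when K = F' (tangent developable), and K'
  vanishes when K is constant (cone).\<close>

lemma degenerateI:
  fixes W :: "'n::finite \<times> 'n \<Rightarrow> complex poly"
  assumes W: "\<And>a b. W (a, b) = B * (F a * K b - F b * K a)" and n: "poly (W (a0, b0)) z \<noteq> 0"
    and FK: "vderiv F = K \<or> vderiv K = (\<lambda>_. 0)"
  shows "degenerate W z"
proof -
  define f k f' k' where "f = vec_poly F z" and "k = vec_poly K z" and "f' = vec_poly (vderiv F) z"
    and "k' = vec_poly (vderiv K) z"
  define b b' where "b = poly B z" and "b' = poly (pderiv B) z"
  have Wx: "mat_poly W z *v x = b *s (dotp K z x *s f - dotp F z x *s k)" for x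
    by (simp add: vec_eq_iff matrix_vector_mult_def mat_poly_def W dotp_def vec_poly_def f_def k_def b_def
        sum_distrib_left sum_distrib_right sum_subtractf[symmetric] algebra_simps)
  have Wx': "mat_poly (vderiv W) z *v x = b' *s (dotp K z x *s f - dotp F z x *s k) +
      b *s (dotp K z x *s f' + dotp (vderiv K) z x *s f - dotp (vderiv F) z x *s k - dotp F z x *s k')" for x
    by (simp add: vec_eq_iff matrix_vector_mult_def mat_poly_def W dotp_def vec_poly_def f_def k_def f'_def k'_def b_def b'_def
        vderiv_def pderiv_mult pderiv_diff sum_distrib_left sum_distrib_right sum_subtractf[symmetric] sum.distrib[symmetric] algebra_simps)
  define D where "D = f $ a0 * k $ b0 - f $ b0 * k $ a0"
  have bD: "b * D \<noteq> 0"
    using n by (simp add: W b_def D_def f_def k_def vec_poly_def)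
  have col: "mat_poly W z *v axis c 1 = b *s (k $ c *s f - f $ c *s k)" for c
    unfolding Wx by (simp add: dotp_def axis_def f_def k_def vec_poly_def if_distrib cong: if_cong)
  \<comment> \<open>The columns \<open>a0\<close> and \<open>b0\<close> of the skew matrix are
    combinations of \<open>f\<close> and \<open>k\<close> with a nonzero determinant, so
    \<open>f\<close> and \<open>k\<close> lie in its range.\<close>
  have f: "(b * D) *s f = mat_poly W z *v (f $ a0 *s axis b0 1 - f $ b0 *s axis a0 1)"
    unfolding matrix_vector_mult_diff_distrib vec.scale[symmetric] matrix_vector_mult_scaleR vector_scalar_commute col
    by (simp add: vec_eq_iff D_def algebra_simps)
  have k: "(b * D) *s k = mat_poly W z *v (k $ a0 *s axis b0 1 - k $ b0 *s axis a0 1)"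
    unfolding matrix_vector_mult_diff_distrib vector_scalar_commute col
    by (simp add: vec_eq_iff D_def algebra_simps)
  have span: "\<exists>v. s *s f + t *s k = mat_poly W z *v v" for s t
  proof -
    have "s *s f + t *s k = (s / (b * D)) *s ((b * D) *s f) + (t / (b * D)) *s ((b * D) *s k)"
      using bD by (simp add: vec_eq_iff)
    then show ?thesis
      unfolding f k vector_scalar_commute[symmetric] matrix_vector_right_distrib[symmetric] by blast
  qed
  show ?thesis
    unfolding degenerate_def
  proof (cases "vderiv F = K")
    case True
    then have "f' = k"
      by (simp add: f'_def k_def)
    have "\<exists>t v. mat_poly (vderiv W) z *v x = t *s k' + mat_poly W z *v v" for x
    proof -
      have "mat_poly (vderiv W) z *v x = (- b * dotp F z x) *s k' +
        ((b' * dotp K z x + b * dotp (vderiv K) z x) *s f +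
         (b * dotp K z x - b' * dotp F z x - b * dotp (vderiv F) z x) *s k)"
        unfolding Wx' \<open>f' = k\<close> by (simp add: vec_eq_iff algebra_simps)
      with span show ?thesis by metis
    qed
    then show "\<exists>y. \<forall>x. \<exists>t v. mat_poly (vderiv W) z *v x = t *s y + mat_poly W z *v v"
      by blast
  next
    case False
    then have K: "vderiv K = (\<lambda>_. 0)"
      using FK by blast
    then have k': "k' = 0" "dotp (vderiv K) z x = 0" for x
      by (simp_all add: k'_def vec_poly_def dotp_def vec_eq_iff)
    have "\<exists>t v. mat_poly (vderiv W) z *v x = t *s f' + mat_poly W z *v v" for x
    proof -
      have "mat_poly (vderiv W) z *v x = (b * dotp K z x) *s f' +
        ((b' * dotp K z x) *s f + (- b' * dotp F z x - b * dotp (vderiv F) z x) *s k)"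
        unfolding Wx' k' by (simp add: vec_eq_iff algebra_simps)
      with span show ?thesis by metis
    qed
    then show "\<exists>y. \<forall>x. \<exists>t v. mat_poly (vderiv W) z *v x = t *s y + mat_poly W z *v v"
      by blast
  qed
qed


lemma degree_sum_smult_le:
  fixes f :: "'a \<Rightarrow> complex poly"
  assumes "\<And>i. i \<in> I \<Longrightarrow> degree (f i) \<le> d"
  shows "degree (\<Sum>i\<in>I. smult (c i) (f i)) \<le> d"
  using assms by (induction I rule: infinite_finite_induct)
    (auto intro!: degree_add_le intro: order_trans[OF degree_smult_le])

text \<open>The frame is dictated by G: its normalized coefficient vectors, completed to a basis. In
  it the conditions on W are those of \<open>power_bivector\<close>, and the degree of G decides: 0
  and 1 contradict \<open>full\<close>, 3 and 4 contradict \<open>full\<close> or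
  \<open>nondeg\<close>.\<close>

theorem bivector_rigidity:
  fixes W :: "5 \<times> 5 \<Rightarrow> complex poly" and G :: "5 \<Rightarrow> complex poly"
  assumes anti: "\<And>a b. W (b, a) = - W (a, b)"
    and WG: "\<And>z a. (\<Sum>b\<in>UNIV. poly (W (a, b)) z * poly (G b) z) = 0"
    and WG': "\<And>z a. (\<Sum>b\<in>UNIV. poly (W (a, b)) z * poly (vderiv G b) z) = 0"
    and kW: "\<And>z v. pker W W z v = of_real c0 * (1 + z * cnj v) ^ d0" and c0: "c0 > 0"
    and kG: "\<And>z v. pker G G z v = of_real c1 * (1 + z * cnj v) ^ d1" and c1: "c1 > 0"
    and full: "\<And>n. (\<And>z. mat_poly W z *v n = 0) \<Longrightarrow> n = 0"
    and nondeg: "\<exists>z. \<not> degenerate W z"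
  obtains u :: "nat \<Rightarrow> complex^5" and \<kappa> \<mu> :: complex
  where "orthonormal_upto 5 u" "\<kappa> \<noteq> 0" "\<mu> \<noteq> 0"
    "\<And>z a. poly (G a) z = \<mu> * (cnj (u 2 $ a) - of_real (sqrt 2) * z * cnj (u 1 $ a) + z\<^sup>2 * cnj (u 0 $ a))"
    "\<And>z a b. poly (W (a, b)) z = \<kappa> *
      ((u 0 $ a + of_real (sqrt 2) * z * u 1 $ a + z\<^sup>2 * u 2 $ a) * (u 3 $ b + z * u 4 $ b)
      - (u 0 $ b + of_real (sqrt 2) * z * u 1 $ b + z\<^sup>2 * u 2 $ b) * (u 3 $ a + z * u 4 $ a))"
proof -
  have C5: "CARD(5) = 5"
    by simp
  obtain w0 :: "nat \<Rightarrow> complex^5" where w0: "orthonormal_upto (Suc d1) w0"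
    "\<And>i z. poly (G i) z = of_real (sqrt c1) * (\<Sum>r\<le>d1. of_real (sqrt (d1 choose r)) * z ^ r * w0 r $ i)"
    using power_kernel_frame[OF kG c1] by blast
  have d1: "d1 \<le> 4"
    using orthonormal_upto_le[OF w0(1)] by simp
  obtain w :: "nat \<Rightarrow> complex^5" where w: "orthonormal_upto 5 w" "\<And>i. i < Suc d1 \<Longrightarrow> w i = w0 i"
    using orthonormal_extend[OF w0(1) orthonormal_upto_le[OF w0(1)]] unfolding C5 by blast
  \<comment> \<open>Square roots of the weights; for indices beyond the degree they are 1 by the
    convention in \<open>bwt\<close>.\<close>
  define n :: "nat \<Rightarrow> complex" where "n = (\<lambda>i. of_real (sqrt (bwt d1 i)))"
  have n0: "n i \<noteq> 0" for i
    by (simp add: n_def bwt_def)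
  have n2: "n i * n i = of_nat (bwt d1 i)" "cnj (n i) = n i" for i
    by (simp_all add: n_def flip: of_real_mult)
  have G: "poly (G b) z = of_real (sqrt c1) * (\<Sum>r\<le>d1. n r * z ^ r * w r $ b)" for b z
    unfolding w0(2) by (intro arg_cong2[where f = "(*)"] refl sum.cong) (auto simp: n_def bwt_def w(2))
  have G': "poly (vderiv G b) z = of_real (sqrt c1) * (\<Sum>r\<le>d1. n r * (of_nat r * z ^ (r - 1)) * w r $ b)" for b z
  proof -
    have "((\<lambda>z. of_real (sqrt c1) * (\<Sum>r\<le>d1. n r * z ^ r * w r $ b)) has_field_derivative
       of_real (sqrt c1) * (\<Sum>r\<le>d1. n r * (of_nat r * z ^ (r - 1)) * w r $ b)) (at z)"
      by (auto intro!: derivative_eq_intros sum.cong simp: mult_ac)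
    then have "(poly (G b) has_field_derivative
       of_real (sqrt c1) * (\<Sum>r\<le>d1. n r * (of_nat r * z ^ (r - 1)) * w r $ b)) (at z)"
      unfolding G[symmetric] .
    from DERIV_unique[OF poly_DERIV this] show ?thesis
      by (simp add: vderiv_def)
  qed
  \<comment> \<open>Components of W in the conjugate frame, obtained by bilinear contraction with
    the vectors w_i; \<open>M\<close> divides them by the roots of the weights so that binomial
    coefficients appear in \<open>ann0\<close> and \<open>ann1\<close>.\<close>
  define N :: "nat \<Rightarrow> nat \<Rightarrow> complex \<Rightarrow> complex" where
    "N = (\<lambda>i j z. \<Sum>a\<in>UNIV. w i $ a * (\<Sum>b\<in>UNIV. w j $ b * poly (W (a, b)) z))"
  define M :: "nat \<Rightarrow> nat \<Rightarrow> complex poly" where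
    "M = (\<lambda>i j. \<Sum>a\<in>UNIV. smult (w i $ a / n i) (\<Sum>b\<in>UNIV. smult (w j $ b / n j) (W (a, b))))"
  have M: "poly (M i j) z = N i j z / (n i * n j)" for i j z
    by (simp add: M_def N_def poly_sum sum_distrib_left sum_distrib_right sum_divide_distrib mult_ac)
  have NM: "N i j z = n i * n j * poly (M i j) z" for i j z
    using n0 by (simp add: M)
  have Nanti: "N j i z = - N i j z" for i j z
  proof -
    have "N j i z = (\<Sum>a\<in>UNIV. \<Sum>b\<in>UNIV. w j $ a * (w i $ b * poly (W (a, b)) z))"
      by (simp add: N_def sum_distrib_left)
    also have "\<dots> = (\<Sum>b\<in>UNIV. \<Sum>a\<in>UNIV. w j $ a * (w i $ b * poly (W (a, b)) z))"
      by (rule sum.swap)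
    also have "\<dots> = (\<Sum>b\<in>UNIV. \<Sum>a\<in>UNIV. - (w i $ b * (w j $ a * poly (W (b, a)) z)))"
      by (intro sum.cong refl) (subst anti, simp)
    also have "\<dots> = - N i j z"
      by (simp add: N_def sum_distrib_left sum_negf)
    finally show ?thesis .
  qed
  have Manti: "M j i = - M i j" for i j
    by (rule poly_eq_poly_eq_iff[THEN iffD1], rule ext) (simp add: M Nanti[of j i] mult.commute)
  have Wrec: "poly (W (a, b)) z = (\<Sum>i<5. \<Sum>j<5. N i j z * (cnj (w i $ a) * cnj (w j $ b)))" for a b z
  proof -
    have p: "(\<Sum>i<5. (\<Sum>c\<in>UNIV. w i $ c * x c) * cnj (w i $ a)) = x a" for x :: "5 \<Rightarrow> complex" and a
      using parseval[of w x "\<lambda>c. if c = a then 1 else 0"] w(1)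
      by (simp add: C5 if_distrib[of "\<lambda>c. _ * c"] if_distrib[of cnj] cong: if_cong)
    have "(\<Sum>i<5. \<Sum>j<5. N i j z * (cnj (w i $ a) * cnj (w j $ b))) =
      (\<Sum>j<5. (\<Sum>i<5. (\<Sum>c\<in>UNIV. w i $ c * (\<Sum>d\<in>UNIV. w j $ d * poly (W (c, d)) z)) * cnj (w i $ a)) * cnj (w j $ b))"
      by (subst sum.swap) (simp add: N_def sum_distrib_right mult.assoc)
    then show ?thesis
      unfolding p by simp
  qed
  have col: "mat_poly W z *v w j = (\<chi> a. \<Sum>i<5. n i * n j * poly (M i j) z * cnj (w i $ a))" for j z
  proof -
    have p: "(\<Sum>i<5. (\<Sum>c\<in>UNIV. w i $ c * x c) * cnj (w i $ a)) = x a" for x :: "5 \<Rightarrow> complex" and a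
      using parseval[of w x "\<lambda>c. if c = a then 1 else 0"] w(1)
      by (simp add: C5 if_distrib[of "\<lambda>c. _ * c"] if_distrib[of cnj] cong: if_cong)
    show ?thesis
      unfolding NM[symmetric] N_def p
      by (simp add: vec_eq_iff matrix_vector_mult_def mat_poly_def mult.commute)
  qed
  have wn: "w i \<noteq> 0" if "i < 5" for i
  proof
    assume "w i = 0"
    then have "herm (w i) (w i) = 0"
      by (simp add: herm_def)
    with w(1) that show False
      by (simp add: orthonormal_upto_def)
  qed
  \<comment> \<open>A vanishing column means that W annihilates a fixed frame vector, which fullness
    excludes.\<close>
  have nocol: False if "j < 5" "\<And>i. i < 5 \<Longrightarrow> M i j = 0" for j
  proof -
    have "mat_poly W z *v w j = 0" for z
      unfolding col using that by (simp add: vec_eq_iff)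
    then show False
      using full wn[OF that(1)] by blast
  qed
  have ann: "(\<Sum>j\<le>d1. of_nat (d1 choose j) * e j * poly (M i j) z) = 0"
    if "\<And>a. (\<Sum>b\<in>UNIV. poly (W (a, b)) z * (of_real (sqrt c1) * (\<Sum>r\<le>d1. n r * e r * w r $ b))) = 0" for e i z
  proof -
    have "(\<Sum>j\<le>d1. of_nat (d1 choose j) * e j * poly (M i j) z) = (\<Sum>j\<le>d1. n j * e j * N i j z / n i)"
    proof (intro sum.cong refl)
      fix j assume "j \<in> {..d1}"
      then have "of_nat (d1 choose j) = n j * n j"
        by (simp add: n2 bwt_def)
      then show "of_nat (d1 choose j) * e j * poly (M i j) z = n j * e j * N i j z / n i"
        using n0[of j] by (simp add: M)
    qed
    also have "\<dots> = (\<Sum>a\<in>UNIV. w i $ a * (\<Sum>b\<in>UNIV. poly (W (a, b)) z * (\<Sum>r\<le>d1. n r * e r * w r $ b))) / n i"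
    proof -
      have "(\<Sum>j\<le>d1. n j * e j * N i j z) = (\<Sum>j\<le>d1. \<Sum>a\<in>UNIV. \<Sum>b\<in>UNIV. w i $ a * (poly (W (a, b)) z * (n j * e j * w j $ b)))"
        by (simp add: N_def sum_distrib_left mult_ac)
      also have "\<dots> = (\<Sum>a\<in>UNIV. \<Sum>b\<in>UNIV. \<Sum>j\<le>d1. w i $ a * (poly (W (a, b)) z * (n j * e j * w j $ b)))"
        by (subst sum.swap, intro sum.cong refl, rule sum.swap)
      finally show ?thesis
        by (simp add: sum_distrib_left flip: sum_divide_distrib)
    qed
    also have "\<dots> = 0"
    proof -
      have "of_real (sqrt c1) * (\<Sum>b\<in>UNIV. poly (W (a, b)) z * (\<Sum>r\<le>d1. n r * e r * w r $ b)) = 0" for a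
        using that[of a] by (simp add: sum_distrib_left mult_ac)
      then show ?thesis
        using c1 by simp
    qed
    finally show ?thesis .
  qed
  interpret power_bivector M "c0 / 2" d1 d0
  proof
    show "M j i = - M i j" for i j
      by (rule Manti)
    show "(\<Sum>j\<le>d1. of_nat (d1 choose j) * z ^ j * poly (M i j) z) = 0" for i z
      by (rule ann) (use WG[of _ z] in \<open>simp add: G\<close>)
    show "(\<Sum>j\<le>d1. of_nat (d1 choose j) * (of_nat j * z ^ (j - 1)) * poly (M i j) z) = 0" for i z
      by (rule ann) (use WG'[of _ z] in \<open>simp add: G'\<close>)
    show "c0 / 2 > 0"
      using c0 by simp
    show "bikernel d1 M z v = of_real (2 * (c0 / 2)) * (1 + z * cnj v) ^ d0" for z v
    proof -
      have "bikernel d1 M z v = (\<Sum>i<5. \<Sum>j<5. N i j z * cnj (N i j v))"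
        unfolding bikernel_def NM complex_cnj_mult n2(2) of_nat_mult n2(1)[symmetric] by (simp add: mult_ac)
      also have "\<dots> = (\<Sum>j<5. \<Sum>i<5. (\<Sum>a\<in>UNIV. w i $ a * (\<Sum>b\<in>UNIV. w j $ b * poly (W (a, b)) z)) *
          cnj (\<Sum>a\<in>UNIV. w i $ a * (\<Sum>b\<in>UNIV. w j $ b * poly (W (a, b)) v)))"
        unfolding N_def by (rule sum.swap)
      also have "\<dots> = (\<Sum>j<5. \<Sum>a\<in>UNIV. (\<Sum>b\<in>UNIV. w j $ b * poly (W (a, b)) z) * cnj (\<Sum>b\<in>UNIV. w j $ b * poly (W (a, b)) v))"
        by (simp only: parseval[of w, unfolded C5, OF w(1)])
      also have "\<dots> = (\<Sum>a\<in>UNIV. \<Sum>j<5. (\<Sum>b\<in>UNIV. w j $ b * poly (W (a, b)) z) * cnj (\<Sum>b\<in>UNIV. w j $ b * poly (W (a, b)) v))"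
        by (rule sum.swap)
      also have "\<dots> = (\<Sum>a\<in>UNIV. \<Sum>b\<in>UNIV. poly (W (a, b)) z * cnj (poly (W (a, b)) v))"
        by (simp only: parseval[of w, unfolded C5, OF w(1)])
      also have "\<dots> = pker W W z v"
        unfolding pker_def by (simp add: sum.cartesian_product flip: UNIV_Times_UNIV)
      finally show ?thesis
        by (simp add: kW)
    qed
    show "degree (M i j) \<le> d0" for i j
      unfolding M_def by (intro degree_sum_smult_le power_kernel_degree[OF kW])
  qed
  have Wne: "\<exists>a b. poly (W (a, b)) z \<noteq> 0" for z
  proof (rule ccontr)
    assume "\<not> ?thesis"
    then have "pker W W z z = 0"
      unfolding pker_def by (intro sum.neutral) (auto simp: split_paired_all)
    moreover have "1 + z * cnj z = of_real (1 + (cmod z)\<^sup>2)"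
      by (simp only: of_real_add of_real_1 complex_norm_square)
    ultimately have "complex_of_real c0 * of_real (1 + (cmod z)\<^sup>2) ^ d0 = 0"
      unfolding kW by simp
    then have "c0 = 0 \<or> 1 + (cmod z)\<^sup>2 = 0"
      by (auto simp only: mult_eq_0_iff power_eq_0_iff of_real_eq_0_iff)
    then show False
      using c0 by (simp add: add_nonneg_eq_0_iff)
  qed
  have nzero: False if "\<forall>i<5. \<forall>j<5. M i j = 0"
    using nocol[of 0] that by simp
  consider "d1 = 0" | "d1 = 1" | "d1 = 2" | "d1 = 3" | "d1 = 4"
    using d1 by linarith
  then show ?thesis
  proof cases
    case 1
    \<comment> \<open>A constant G is itself a frame vector up to scale; in degree one its
      derivative is.\<close>
    then have "\<forall>z. poly (M i 0) z = 0" if "i < 5" for i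
      using ann0[OF that] by simp
    then show ?thesis
      using nocol[of 0] by (simp add: poly_all_0_iff_0)
  next
    case 2
    then have "\<forall>z. poly (M i 1) z = 0" if "i < 5" for i
      using ann1[OF that] by simp
    then show ?thesis
      using nocol[of 1] by (simp add: poly_all_0_iff_0)
  next
    case 3
    have "power_bivector M (c0 / 2) 2 d0"
      using power_bivector_axioms 3 by simp
    then interpret p2: power_bivector2 M "c0 / 2" d0
      by (rule power_bivector2.intro)
    have nv: "n 0 = 1" "n (Suc 0) = of_real (sqrt 2)" "n 2 = 1" "n 3 = 1" "n 4 = 1"
      using 3 bwt_values(1-5) by (simp_all add: n_def)
    have not23: "\<not> (M 2 3 = 0 \<and> M 2 4 = 0)"
    proof
      assume z: "M 2 3 = 0 \<and> M 2 4 = 0"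
      have "\<forall>i<5. \<forall>z. poly (M i 0) z = 0"
        by (simp add: all_less_5 z p2.entries[unfolded One_nat_def] lower diag_poly)
      then show False
        using nocol[of 0] by (simp add: poly_all_0_iff_0)
    qed
    define e where "e = d0 - 2"
    have r0: "M 3 4 = 0" and pq: "\<And>z v. poly (M 2 3) z * cnj (poly (M 2 3) v) + poly (M 2 4) z * cnj (poly (M 2 4) v)
        = of_real (c0 / 2) * (1 + z * cnj v) ^ e"
      using p2.cases2 not23 unfolding e_def by blast+
    \<comment> \<open>The remaining two entries form a curve in \<complex>^2 with a power kernel, so
      the coefficient argument applies once more; at most two orthonormal vectors fit there, whence
      e \<le> 1.\<close>
    define P where "P = (\<lambda>t. if t then M 2 3 else M 2 4)"
    have kP: "pker P P z v = of_real (c0 / 2) * (1 + z * cnj v) ^ e" for z v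
      using pq[of z v] by (simp add: pker_def P_def UNIV_bool add.commute)
    have c2: "c0 / 2 > 0"
      using c0 by simp
    obtain t :: "nat \<Rightarrow> complex^bool" where t: "orthonormal_upto (Suc e) t"
      "\<And>i z. poly (P i) z = of_real (sqrt (c0 / 2)) * (\<Sum>r\<le>e. of_real (sqrt (e choose r)) * z ^ r * t r $ i)"
      using power_kernel_frame[OF kP c2] by blast
    define \<kappa> where "\<kappa> = complex_of_real (sqrt (c0 / 2))"
    have ht: "t i $ True * cnj (t j $ True) + t i $ False * cnj (t j $ False) = (if i = j then 1 else 0)" if "i \<le> e" "j \<le> e" for i j
      using t(1) that unfolding orthonormal_upto_def herm_def by (simp add: UNIV_bool add.commute less_Suc_eq_le)
    have hw: "herm (w i) (w j) = (if i = j then 1 else 0)" if "i < 5" "j < 5" for i j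
      using w(1) that by (simp add: orthonormal_upto_def)
    have "e \<le> 1"
      using orthonormal_upto_le[OF t(1)] by simp
    then consider "e = 0" | "e = 1"
      by linarith
    then show ?thesis
    proof cases
      case 1
      \<comment> \<open>For e = 0 the second direction of the plane is a constant combination of the
        conjugates of w_3 and w_4; \<open>x\<close> is the combination of w_3 and w_4 that pairs to
        zero with it.\<close>
      define x where "x = t 0 $ False *s w 3 - t 0 $ True *s w 4"
      have p: "poly (M 2 3) z = \<kappa> * t 0 $ True" "poly (M 2 4) z = \<kappa> * t 0 $ False" for z
        using t(2)[of True z] t(2)[of False z] 1 by (simp_all add: P_def \<kappa>_def)
      have "mat_poly W z *v x = 0" for z
        unfolding x_def matrix_vector_mult_diff_distrib vector_scalar_commute col sum_lessThan_5
        by (simp add: vec_eq_iff nv p2.entries[unfolded One_nat_def] lower diag_poly r0 p algebra_simps)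
      then have "x = 0"
        by (rule full)
      then have "herm x (w 3) = 0" "herm x (w 4) = 0"
        by (simp_all add: herm_def)
      then have "t 0 $ False = 0" "t 0 $ True = 0"
        by (simp_all add: x_def herm_diff_left herm_minus_left herm_scale_left hw)
      with ht[of 0 0] show ?thesis
        by simp
    next
      case 2
      have p: "poly (M 2 3) z = \<kappa> * (t 0 $ True + z * t 1 $ True)" "poly (M 2 4) z = \<kappa> * (t 0 $ False + z * t 1 $ False)" for z
        using t(2)[of True z] t(2)[of False z] 2 by (simp_all add: P_def \<kappa>_def)
      define cv :: "complex^5 \<Rightarrow> complex^5" where "cv = (\<lambda>x. \<chi> a. cnj (x $ a))"
      have hcv: "herm (cv (w i)) (cv (w j)) = (if i = j then 1 else 0)" if "i < 5" "j < 5" for i j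
      proof -
        have "herm (cv (w i)) (cv (w j)) = cnj (herm (w i) (w j))"
          by (simp add: herm_def cv_def)
        then show ?thesis
          by (simp add: hw that)
      qed
      \<comment> \<open>W lives on the conjugate frame. The dual conic (z^2, - z, 1) runs through
        w_0, w_1, w_2 in reverse order with a sign in the middle, and the curve in \<complex>^2
        supplies u_3 and u_4.\<close>
      define u :: "nat \<Rightarrow> complex^5" where "u = (\<lambda>i. if i = 0 then cv (w 2) else if i = 1 then - 1 *s cv (w 1)
        else if i = 2 then cv (w 0) else if i = 3 then t 0 $ True *s cv (w 3) + t 0 $ False *s cv (w 4)
        else t 1 $ True *s cv (w 3) + t 1 $ False *s cv (w 4))"
      have u: "u 0 = cv (w 2)" "u 1 = - 1 *s cv (w 1)" "u 2 = cv (w 0)"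
        "u 3 = t 0 $ True *s cv (w 3) + t 0 $ False *s cv (w 4)"
        "u 4 = t 1 $ True *s cv (w 3) + t 1 $ False *s cv (w 4)"
        by (simp_all add: u_def)
      show ?thesis
      proof (rule that[of u \<kappa> "of_real (sqrt c1)"])
        show "orthonormal_upto 5 u"
          unfolding orthonormal_upto_def all_less_5 u
          using ht[of 0 0] ht[of 0 1] ht[of 1 0] ht[of 1 1] 2
          by (simp add: herm_add_left herm_add_right herm_scale_left herm_scale_right
              herm_minus_left herm_minus_right hcv mult.commute)
        show "\<kappa> \<noteq> 0" "complex_of_real (sqrt c1) \<noteq> 0"
          using c0 c1 by (simp_all add: \<kappa>_def)
        show "poly (G a) z = of_real (sqrt c1) * (cnj (u 2 $ a) - of_real (sqrt 2) * z * cnj (u 1 $ a) + z\<^sup>2 * cnj (u 0 $ a))" for z a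
          unfolding G u 3 by (simp add: upto_values nv cv_def add_ac)
        show "poly (W (a, b)) z = \<kappa> *
          ((u 0 $ a + of_real (sqrt 2) * z * u 1 $ a + z\<^sup>2 * u 2 $ a) * (u 3 $ b + z * u 4 $ b)
          - (u 0 $ b + of_real (sqrt 2) * z * u 1 $ b + z\<^sup>2 * u 2 $ b) * (u 3 $ a + z * u 4 $ a))" for z a b
          unfolding Wrec[of a b] NM sum_lessThan_5 u
          by (simp add: nv p2.entries[unfolded One_nat_def] lower diag_poly r0 p cv_def algebra_simps)
      qed
    qed
  next
    case 4
    have "power_bivector M (c0 / 2) 3 d0"
      using power_bivector_axioms 4 by simp
    then interpret p3: power_bivector3 M "c0 / 2" d0
      by (rule power_bivector3.intro)
    have nv: "n 4 = 1"
      using 4 bwt_values(10) by (simp add: n_def)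
    have zs: "poly (M 0 3) z = 0" "poly (M 1 3) z = 0" "poly (M 2 3) z = 0" "poly (M 1 2) z = 0"
     "poly (M 0 2) z = 0" "poly (M 0 1) z = 0" "poly (M 3 4) z = poly p3.b z" "poly (M 2 4) z = - z * poly p3.b z"
     "poly (M 0 4) z = - (z ^ 3) * poly p3.b z" "poly (M 1 4) z = z\<^sup>2 * poly p3.b z" for z
      using p3.cases3 nzero nocol[of 4] by auto
    \<comment> \<open>The dual twisted cubic in the original coordinates; \<open>K\<close> is the
      constant vertex of the cone.\<close>
    define F where "F = (\<lambda>a. [: n 3 * cnj (w 3 $ a), - n 2 * cnj (w 2 $ a), n 1 * cnj (w 1 $ a), - n 0 * cnj (w 0 $ a) :])"
    define K where "K = (\<lambda>a. [: cnj (w 4 $ a) :])"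
    have WF: "W (a, b) = p3.b * (F a * K b - F b * K a)" for a b
      by (rule poly_eq_poly_eq_iff[THEN iffD1], rule ext, unfold Wrec[of a b] NM sum_lessThan_5)
        (simp add: nv zs[unfolded One_nat_def] lower diag_poly F_def K_def power_expand algebra_simps)
    have "vderiv K = (\<lambda>_. 0)"
      by (simp add: vderiv_def[abs_def] K_def pderiv_pCons)
    then have "degenerate W z" for z
      using degenerateI[where F = F and K = K and B = p3.b, OF WF] Wne[of z] by blast
    with nondeg show ?thesis by blast
  next
    case 5
    have "power_bivector M (c0 / 2) 4 d0"
      using power_bivector_axioms 5 by simp
    then interpret p4: power_bivector4 M "c0 / 2" d0
      by (rule power_bivector4.intro)
    have e5: "x ^ 5 = x\<^sup>2 * x ^ 3" "x ^ 6 = x ^ 3 * x ^ 3" for x :: complex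
      by (simp_all flip: power_add)
    have bc: "p4.b = 0" "p4.c = 0"
      using p4.cases4 nzero by auto
    \<comment> \<open>The dual quartic in the original coordinates; W turns out to be a multiple of
      F ^ F'.\<close>
    define F where "F = (\<lambda>a. [: n 4 * cnj (w 4 $ a), - n 3 * cnj (w 3 $ a), n 2 * cnj (w 2 $ a), - n 1 * cnj (w 1 $ a), n 0 * cnj (w 0 $ a) :])"
    have WF: "W (a, b) = p4.a * (F a * vderiv F b - F b * vderiv F a)" for a b
      by (rule poly_eq_poly_eq_iff[THEN iffD1], rule ext, unfold Wrec[of a b] NM sum_lessThan_5)
        (simp add: p4.entries[unfolded One_nat_def] bc lower diag_poly F_def vderiv_def pderiv_pCons e5 power_expand algebra_simps)
    have "degenerate W z" for z
      using degenerateI[where F = F and K = "vderiv F" and B = p4.a, OF WF] Wne[of z] by blast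
    with nondeg show ?thesis by blast
  qed
qed

section \<open>Algebraicity of holomorphic line bundles on the sphere\<close>

lemma norm_poly_le:
  fixes p :: "complex poly"
  shows "\<exists>B\<ge>0. \<forall>z. 1 \<le> cmod z \<longrightarrow> cmod (poly p z) \<le> B * cmod z ^ degree p"
proof (intro exI conjI allI impI)
  show "(\<Sum>i\<le>degree p. cmod (coeff p i)) \<ge> 0"
    by (intro sum_nonneg) simp
  fix z :: complex assume z: "1 \<le> cmod z"
  have "cmod (poly p z) \<le> (\<Sum>i\<le>degree p. cmod (coeff p i * z ^ i))"
    unfolding poly_altdef by (rule norm_sum)
  also have "\<dots> \<le> (\<Sum>i\<le>degree p. cmod (coeff p i) * cmod z ^ degree p)"
    unfolding norm_mult norm_power using z by (intro sum_mono mult_left_mono power_increasing) auto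
  finally show "cmod (poly p z) \<le> (\<Sum>i\<le>degree p. cmod (coeff p i)) * cmod z ^ degree p"
    by (simp add: sum_distrib_right)
qed

lemma eq_off_finite:
  fixes f g :: "complex \<Rightarrow> complex"
  assumes "continuous_on UNIV f" "continuous_on UNIV g" "finite Z" "\<And>z. z \<notin> Z \<Longrightarrow> f z = g z"
  shows "f z = g z"
proof -
  define T where "T = {z. f z - g z = 0}"
  have "continuous_on UNIV (\<lambda>z. f z - g z)"
    using assms by (intro continuous_intros)
  then have "closed T"
    unfolding T_def using continuous_closed_preimage_constant[OF _ closed_UNIV, of "\<lambda>z. f z - g z" 0] by simp
  moreover have "- Z \<subseteq> T"
    using assms(4) by (auto simp: T_def)
  moreover have "closure (- Z) = UNIV"
    using assms(3) by (simp add: closure_complement empty_interior_finite)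
  ultimately have "T = UNIV"
    by (metis closure_closed closure_mono top.extremum_uniqueI)
  then have "z \<in> T"
    by simp
  then show ?thesis
    by (simp add: T_def)
qed

text \<open>\<open>Q z\<close> is a positive multiple of the orthogonal projection onto a line varying holomorphically
  with \<open>z\<close>, and \<open>L\<close> is its value at infinity.\<close>

locale holomorphic_line =
  fixes Q :: "complex \<Rightarrow> 'i::finite \<Rightarrow> 'i \<Rightarrow> complex" and L :: "'i \<Rightarrow> 'i \<Rightarrow> complex"
  assumes rank1: "Q z I J * Q z K M = Q z I M * Q z K J"
    and hermitian: "Q z J I = cnj (Q z I J)"
    and nonzero: "\<exists>J. Q z J J \<noteq> 0"
    and diff: "(\<lambda>z. Q z I J) differentiable (at z)"
    and dbar: "Q z J J * del_zbar (\<lambda>z. Q z I J) z = Q z I J * del_zbar (\<lambda>z. Q z J J) z"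
    and lim: "((\<lambda>z. Q z I J) \<longlongrightarrow> L I J) at_infinity"
    and lim_nonzero: "\<exists>J. L J J \<noteq> 0"
begin

lemma continuous: "continuous_on UNIV (\<lambda>z. Q z I J)"
  using diff by (auto simp: continuous_on_eq_continuous_at intro: differentiable_imp_continuous_within)

text \<open>Affine coordinates of the line where its J-th coordinate is 1. The assumption
  \<open>dbar\<close> says that the numerator of their \<partial>-bar derivative in the quotient
  rule vanishes.\<close>

definition ratio :: "'i \<Rightarrow> 'i \<Rightarrow> complex \<Rightarrow> complex" where
  "ratio J I z = Q z I J / Q z J J"

lemma open_nonzero: "open {z. Q z J J \<noteq> 0}"
proof -
  have "closed {z. Q z J J = 0}"
    using continuous_closed_preimage_constant[OF continuous closed_UNIV, of J J 0] by simp
  then show ?thesis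
    by (simp add: closed_def Collect_neg_eq)
qed

lemma ratio_holomorphic:
  assumes "\<And>z. z \<in> S \<Longrightarrow> Q z J J \<noteq> 0"
  shows "ratio J I holomorphic_on S"
proof -
  have "ratio J I field_differentiable (at z within S)" if "z \<in> S" for z
  proof -
    have "has_wirt (ratio J I) ((del_z (\<lambda>z. Q z I J) z * Q z J J - Q z I J * del_z (\<lambda>z. Q z J J) z) / (Q z J J)\<^sup>2)
      ((del_zbar (\<lambda>z. Q z I J) z * Q z J J - Q z I J * del_zbar (\<lambda>z. Q z J J) z) / (Q z J J)\<^sup>2) z"
      unfolding ratio_def[abs_def]
      by (intro has_wirt_divide differentiable_has_wirt diff assms that)
    moreover have "del_zbar (\<lambda>z. Q z I J) z * Q z J J - Q z I J * del_zbar (\<lambda>z. Q z J J) z = 0"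
      using dbar[of z J I] by (simp add: mult.commute)
    ultimately show ?thesis
      unfolding has_wirt_field_iff[symmetric] field_differentiable_def
      by (metis (no_types, lifting) DERIV_subset div_0 has_wirt_field_iff subset_UNIV)
  qed
  then show ?thesis
    by (simp add: holomorphic_on_def)
qed

lemma ratio_zero_iff:
  assumes "Q z K K \<noteq> 0"
  shows "ratio K J z = 0 \<longleftrightarrow> Q z J J = 0"
proof -
  have "Q z J K * cnj (Q z J K) = Q z J J * Q z K K"
    using rank1[of z J K K J] hermitian[of z K J] by simp
  then show ?thesis
    using assms by (auto simp: ratio_def)
qed

lemma ratio_mult:
  assumes "Q z K K \<noteq> 0" "Q z J J \<noteq> 0"
  shows "ratio J I z * ratio K J z = ratio K I z"
  using rank1[of z I J J K] assms by (simp add: ratio_def field_simps)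

lemma ball_nonzero:
  obtains K r where "r > 0" "\<And>z. z \<in> ball z0 r \<Longrightarrow> Q z K K \<noteq> 0"
proof -
  obtain K where "Q z0 K K \<noteq> 0"
    using nonzero by blast
  then have "z0 \<in> {z. Q z K K \<noteq> 0}"
    by simp
  with open_nonzero[of K] obtain r where "r > 0" "ball z0 r \<subseteq> {z. Q z K K \<noteq> 0}"
    by (meson open_contains_ball)
  then show ?thesis
    using that[of r K] by blast
qed

text \<open>The centres of balls on which the J-th coordinate vanishes form an open set, closed by
  the identity theorem in a chart where another coordinate is nonzero. It is not the whole plane
  since the J-th coordinate is nonzero at infinity.\<close>

lemma not_locally_zero:
  assumes L: "L J J \<noteq> 0"
  shows "\<not> (\<exists>r>0. \<forall>z\<in>ball z0 r. Q z J J = 0)"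
proof -
  define A where "A = {z0. \<exists>r>0. \<forall>z\<in>ball z0 r. Q z J J = 0}"
  have "open A"
    unfolding open_contains_ball
  proof
    fix x assume "x \<in> A"
    then obtain r where r: "r > 0" "\<forall>z\<in>ball x r. Q z J J = 0"
      by (auto simp: A_def)
    have "ball x (r / 2) \<subseteq> A"
    proof
      fix y assume "y \<in> ball x (r / 2)"
      then have "w \<in> ball x r" if "w \<in> ball y (r / 2)" for w
        using that dist_triangle[of x w y] by simp
      then have "\<forall>z\<in>ball y (r / 2). Q z J J = 0"
        using r(2) by blast
      then show "y \<in> A"
        unfolding A_def using half_gt_zero[OF r(1)] by blast
    qed
    then show "\<exists>e>0. ball x e \<subseteq> A"
      using r by (intro exI[of _ "r / 2"]) auto
  qed
  moreover have "closed A"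
    unfolding closed_limpt
  proof (intro allI impI)
    fix x assume x: "x islimpt A"
    obtain K r where K: "r > 0" "\<And>z. z \<in> ball x r \<Longrightarrow> Q z K K \<noteq> 0"
      using ball_nonzero by blast
    obtain y where y: "y \<in> A" "y \<in> ball x r"
      using x K(1) unfolding islimpt_approachable by (metis dist_commute mem_ball)
    then obtain s where s: "s > 0" "\<forall>z\<in>ball y s. Q z J J = 0"
      by (auto simp: A_def)
    have hol: "ratio K J holomorphic_on ball x r"
      by (rule ratio_holomorphic[OF K(2)])
    have "ratio K J z = 0" if "z \<in> ball x r" for z
    proof (rule analytic_continuation_open[OF _ _ _ _ _ hol])
      show "open (ball x r \<inter> ball y s)" "ball x r \<inter> ball y s \<noteq> {}"
        using y s by (auto intro!: exI[of _ y])
      show "(\<lambda>_. 0) holomorphic_on ball x r"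
        by simp
      show "ratio K J w = 0" if "w \<in> ball x r \<inter> ball y s" for w
        using that s K(2) by (simp add: ratio_zero_iff)
    qed (use that in auto)
    then have "\<forall>z\<in>ball x r. Q z J J = 0"
      using ratio_zero_iff K(2) by blast
    with K(1) show "x \<in> A"
      by (auto simp: A_def)
  qed
  moreover have "A \<noteq> UNIV"
  proof
    assume "A = UNIV"
    then have "z \<in> A" for z
      by simp
    then have z: "Q z J J = 0" for z
      unfolding A_def using centre_in_ball by blast
    have "((\<lambda>z::complex. 0) \<longlongrightarrow> L J J) at_infinity"
      using lim[of J J] unfolding z .
    from tendsto_unique[OF trivial_limit_at_infinity this tendsto_const] L show False
      by simp
  qed
  ultimately have "A = {}"
    using clopen[of A] by blast
  then show ?thesis
    by (auto simp: A_def)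
qed

text \<open>The local order of the pole of the meromorphic section \<open>ratio J\<close>.\<close>

lemma local_pole:
  assumes L: "L J J \<noteq> 0"
  shows "\<exists>r>0. \<exists>n h. \<forall>I. h I holomorphic_on ball z0 r \<and>
    (\<forall>z\<in>ball z0 r - {z0}. Q z J J \<noteq> 0 \<and> (z - z0) ^ n * ratio J I z = h I z)"
proof -
  obtain K r where K: "r > 0" "\<And>z. z \<in> ball z0 r \<Longrightarrow> Q z K K \<noteq> 0"
    using ball_nonzero by blast
  have hol: "ratio K I holomorphic_on ball z0 r" for I
    by (rule ratio_holomorphic[OF K(2)])
  \<comment> \<open>Relative to a coordinate K that is nonzero nearby, the pole order of
    \<open>ratio J\<close> is the vanishing order of \<open>ratio K J\<close>.\<close>
  obtain n g s where g: "s > 0" "ball z0 s \<subseteq> ball z0 r" "g holomorphic_on ball z0 s"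
    "\<And>z. z \<in> ball z0 s \<Longrightarrow> ratio K J z = (z - z0) ^ n * g z" "\<And>z. z \<in> ball z0 s \<Longrightarrow> g z \<noteq> 0"
  proof (cases "ratio K J z0 = 0")
    case True
    have "\<not> ratio K J constant_on ball z0 r"
    proof
      assume "ratio K J constant_on ball z0 r"
      then have "\<forall>z\<in>ball z0 r. ratio K J z = 0"
        using True K(1) unfolding constant_on_def by force
      then have "\<forall>z\<in>ball z0 r. Q z J J = 0"
        using ratio_zero_iff K(2) by blast
      with not_locally_zero[OF L, of z0] K(1) show False
        by blast
    qed
    from holomorphic_factor_zero_nonconstant[OF hol _ _ _ True this] K(1) show ?thesis
      using that by (metis centre_in_ball connected_ball open_ball)
  next
    case False
    have "continuous_on (ball z0 r) (ratio K J)"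
      by (rule holomorphic_on_imp_continuous_on[OF hol])
    then have "open {z \<in> ball z0 r. ratio K J z \<noteq> 0}"
      using continuous_open_preimage[of "ball z0 r" "ratio K J" "- {0}"]
      by (simp add: vimage_def Int_def conj_commute open_Compl)
    moreover have "z0 \<in> {z \<in> ball z0 r. ratio K J z \<noteq> 0}"
      using False K(1) by simp
    ultimately obtain s where s: "s > 0" "ball z0 s \<subseteq> {z \<in> ball z0 r. ratio K J z \<noteq> 0}"
      by (meson open_contains_ball)
    show ?thesis
    proof (rule that[of s "ratio K J" 0])
      show "ratio K J holomorphic_on ball z0 s"
        by (rule holomorphic_on_subset[OF hol]) (use s in auto)
    qed (use s in auto)
  qed
  have "ratio K J z \<noteq> 0" if "z \<in> ball z0 s - {z0}" for z
    using that g by auto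
  then have nz: "Q z J J \<noteq> 0" if "z \<in> ball z0 s - {z0}" for z
    using that g(2) ratio_zero_iff K(2) by blast
  show ?thesis
  proof (intro exI[of _ s] exI[of _ n] exI[of _ "\<lambda>I z. ratio K I z / g z"] conjI allI ballI)
    show "s > 0" by fact
    fix I
    show "(\<lambda>z. ratio K I z / g z) holomorphic_on ball z0 s"
      using g by (intro holomorphic_intros holomorphic_on_subset[OF hol]) auto
    fix z assume z: "z \<in> ball z0 s - {z0}"
    show "Q z J J \<noteq> 0"
      by (rule nz[OF z])
    have "ratio J I z * ratio K J z = ratio K I z"
      using z g(2) K(2) nz by (intro ratio_mult) auto
    then show "(z - z0) ^ n * ratio J I z = ratio K I z / g z"
      using z g by (simp add: field_simps)
  qed
qed

text \<open>With J nonzero at infinity, \<open>ratio J\<close> has finitely many poles. Multiplied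
  by a suitable polynomial it becomes entire, and since it is bounded near infinity the product has
  polynomial growth, so Liouville's theorem makes it a polynomial.\<close>

lemma algebraic_section:
  obtains W where "\<exists>I. W I \<noteq> 0" "\<And>z I J K. poly (W I) z * Q z K J = poly (W K) z * Q z I J"
proof -
  obtain J where L: "L J J \<noteq> 0"
    using lim_nonzero by blast
  obtain r n h where loc: "\<And>z0. r z0 > 0" "\<And>z0 I. h z0 I holomorphic_on ball z0 (r z0)"
    "\<And>z0 z. z \<in> ball z0 (r z0) - {z0} \<Longrightarrow> Q z J J \<noteq> 0"
    "\<And>z0 z I. z \<in> ball z0 (r z0) - {z0} \<Longrightarrow> (z - z0) ^ n z0 * ratio J I z = h z0 I z"
    using local_pole[OF L] by metis
  define Z where "Z = {z. Q z J J = 0}"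
  have closedZ: "closed Z"
    unfolding Z_def using continuous_closed_preimage_constant[OF continuous closed_UNIV, of J J 0] by simp
  have "\<forall>\<^sub>F z in at_infinity. Q z J J \<noteq> 0"
    using tendsto_imp_eventually_ne[OF lim L] .
  then obtain R1 where R1: "\<And>z. cmod z \<ge> R1 \<Longrightarrow> Q z J J \<noteq> 0"
    by (auto simp: eventually_at_infinity)
  have "bounded Z"
    unfolding bounded_iff Z_def using R1 by (metis linear mem_Collect_eq)
  have finZ: "finite Z"
  proof (rule ccontr)
    assume "infinite Z"
    then obtain x where "x islimpt Z"
      using Heine_Borel_imp_Bolzano_Weierstrass[of Z Z] \<open>bounded Z\<close> closedZ
      by (auto simp: compact_eq_bounded_closed)
    then obtain y where "y \<in> Z" "y \<noteq> x" "dist y x < r x"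
      using loc(1)[of x] unfolding islimpt_approachable by blast
    then have "y \<in> ball x (r x) - {x}"
      by (simp add: dist_commute)
    with loc(3) \<open>y \<in> Z\<close> show False
      by (auto simp: Z_def)
  qed
  define D where "D = (\<lambda>S. \<Prod>x\<in>S. [:-x, 1:] ^ n x)"
  \<comment> \<open>At a pole the value is filled in from the local holomorphic extension, times the
    factors of the other poles.\<close>
  define T where "T = (\<lambda>I z. if z \<in> Z then poly (D (Z - {z})) z * h z I z else poly (D Z) z * ratio J I z)"
  have Thol: "T I holomorphic_on UNIV" for I
  proof -
    have "\<exists>S. open S \<and> z \<in> S \<and> T I holomorphic_on S" for z
    proof (cases "z \<in> Z")
      case True
      have "T I w = poly (D (Z - {z})) w * h z I w" if "w \<in> ball z (r z)" for w
      proof (cases "w = z")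
        case False
        then have w: "w \<in> ball z (r z) - {z}"
          using that by simp
        then have "w \<notin> Z"
          using loc(3) by (auto simp: Z_def)
        have "D Z = [:-z, 1:] ^ n z * D (Z - {z})"
          unfolding D_def by (rule prod.remove[OF finZ True])
        then show ?thesis
          using \<open>w \<notin> Z\<close> loc(4)[OF w, of I] by (simp add: T_def poly_power mult_ac)
      qed (simp add: T_def True)
      moreover have "(\<lambda>w. poly (D (Z - {z})) w * h z I w) holomorphic_on ball z (r z)"
        by (intro holomorphic_intros loc(2))
      ultimately have "T I holomorphic_on ball z (r z)"
        using holomorphic_cong by (metis (no_types, lifting))
      then show ?thesis
        using loc(1) by (intro exI[of _ "ball z (r z)"]) auto
    next
      case False
      have "(\<lambda>w. poly (D Z) w * ratio J I w) holomorphic_on - Z"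
        by (intro holomorphic_intros ratio_holomorphic) (simp add: Z_def)
      then have "T I holomorphic_on - Z"
        by (rule holomorphic_transform) (simp add: T_def)
      then show ?thesis
        using False closedZ by (intro exI[of _ "- Z"]) auto
    qed
    then show ?thesis
      by (metis (no_types, lifting) UNIV_I analytic_on_def analytic_imp_holomorphic analytic_on_holomorphic holomorphic_on_open holomorphic_on_def at_within_open open_UNIV)
  qed
  obtain B0 where B0: "B0 \<ge> 0" "\<And>z. 1 \<le> cmod z \<Longrightarrow> cmod (poly (D Z) z) \<le> B0 * cmod z ^ degree (D Z)"
    using norm_poly_le by metis
  have "\<exists>p. \<forall>z. T I z = poly p z" for I
  proof -
    have "((\<lambda>z. Q z I J / Q z J J) \<longlongrightarrow> L I J / L J J) at_infinity"
      by (intro tendsto_intros lim L)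
    then have "\<forall>\<^sub>F z in at_infinity. dist (Q z I J / Q z J J) (L I J / L J J) < 1"
      by (rule tendstoD) simp
    then obtain R2 where R2: "\<And>z. cmod z \<ge> R2 \<Longrightarrow> dist (ratio J I z) (L I J / L J J) < 1"
      by (auto simp: eventually_at_infinity ratio_def)
    define B1 where "B1 = 1 + cmod (L I J / L J J)"
    have bound: "cmod (T I z) \<le> (B0 * B1) * cmod z ^ degree (D Z)" if z: "cmod z \<ge> max 1 (max R1 R2)" for z
    proof -
      have "cmod (ratio J I z) \<le> B1"
        using R2[of z] z norm_triangle_sub[of "ratio J I z" "L I J / L J J"] by (simp add: B1_def dist_norm)
      moreover have "z \<notin> Z"
        using R1[of z] z by (simp add: Z_def)
      moreover have "cmod (poly (D Z) z) \<le> B0 * cmod z ^ degree (D Z)"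
        using B0(2) z by simp
      ultimately have "cmod (poly (D Z) z) * cmod (ratio J I z) \<le> (B0 * cmod z ^ degree (D Z)) * B1"
        using B0(1) by (intro mult_mono) auto
      with \<open>z \<notin> Z\<close> show ?thesis
        by (simp add: T_def norm_mult mult_ac)
    qed
    have "T I z = (\<Sum>k\<le>degree (D Z). (deriv ^^ k) (T I) 0 / fact k * z ^ k)" for z
      by (rule Liouville_polynomial[OF Thol bound])
    then have "T I z = poly (\<Sum>k\<le>degree (D Z). monom ((deriv ^^ k) (T I) 0 / fact k) k) z" for z
      by (simp add: poly_sum poly_monom)
    then show ?thesis
      by blast
  qed
  then obtain W where W: "\<And>I z. T I z = poly (W I) z"
    by metis
  have rel: "poly (W I) z * Q z K M = poly (W K) z * Q z I M" for I K M z
  proof (rule eq_off_finite[where f = "\<lambda>z. poly (W I) z * Q z K M" and g = "\<lambda>z. poly (W K) z * Q z I M", OF _ _ finZ])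
    show "continuous_on UNIV (\<lambda>z. poly (W I) z * Q z K M)" "continuous_on UNIV (\<lambda>z. poly (W K) z * Q z I M)"
      by (intro continuous_intros continuous)+
    show "poly (W I) z * Q z K M = poly (W K) z * Q z I M" if "z \<notin> Z" for z
      using that rank1[of z I J K M] by (simp add: W[symmetric] T_def ratio_def Z_def field_simps)
  qed
  have "\<exists>z. z \<notin> Z"
    using ex_new_if_finite[OF infinite_UNIV_char_0 finZ] .
  then obtain z where z: "z \<notin> Z" by blast
  have "poly (D Z) z \<noteq> 0"
    using z finZ by (auto simp: D_def poly_prod poly_power)
  then have "poly (W J) z \<noteq> 0"
    using z by (simp add: W[symmetric] T_def ratio_def Z_def)
  then have "W J \<noteq> 0"
    by auto
  with rel show ?thesis
    using that by blast
qed

text \<open>A polynomial representative of least total degree has no common zero, since a common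
  linear factor could be divided out.\<close>

theorem algebraic:
  obtains W where "nonvanishing W" "\<And>z I J K. poly (W I) z * Q z K J = poly (W K) z * Q z I J"
proof -
  define ok where "ok = (\<lambda>W. (\<exists>I. W I \<noteq> 0) \<and> (\<forall>z I J K. poly (W I) z * Q z K J = poly (W K) z * Q z I J))"
  have "\<exists>W. ok W"
    using algebraic_section unfolding ok_def by metis
  then obtain W where W: "ok W" "\<And>V. ok V \<Longrightarrow> (\<Sum>I\<in>UNIV. degree (W I)) \<le> (\<Sum>I\<in>UNIV. degree (V I))"
    using ex_has_least_nat[of ok _ "\<lambda>W. \<Sum>I\<in>UNIV. degree (W I)"] by blast
  have "nonvanishing W"
  proof (rule ccontr)
    assume "\<not> nonvanishing W"
    then obtain x where x: "\<And>I. poly (W I) x = 0"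
      by (auto simp: nonvanishing_def)
    then have "\<forall>I. \<exists>v. W I = [:-x, 1:] * v"
      by (simp add: poly_eq_0_iff_dvd dvd_def)
    then obtain V where V: "\<And>I. W I = [:-x, 1:] * V I"
      by metis
    obtain I0 where I0: "W I0 \<noteq> 0"
      using W(1) by (auto simp: ok_def)
    then have "V I0 \<noteq> 0"
      using V[of I0] by auto
    have "poly (V I) z * Q z K M = poly (V K) z * Q z I M" for I K M z
    proof (rule eq_off_finite[where Z = "{x}" and f = "\<lambda>z. poly (V I) z * Q z K M" and g = "\<lambda>z. poly (V K) z * Q z I M"])
      show "continuous_on UNIV (\<lambda>z. poly (V I) z * Q z K M)" "continuous_on UNIV (\<lambda>z. poly (V K) z * Q z I M)"
        by (intro continuous_intros continuous)+
      show "poly (V I) z * Q z K M = poly (V K) z * Q z I M" if "z \<notin> {x}" for z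
      proof -
        have "(z - x) * (poly (V I) z * Q z K M) = (z - x) * (poly (V K) z * Q z I M)"
        proof -
          have "poly (W I) z * Q z K M = poly (W K) z * Q z I M"
            using W(1) by (simp add: ok_def)
          moreover have "poly (W J) z = (z - x) * poly (V J) z" for J
            by (subst V) (simp add: algebra_simps)
          ultimately show ?thesis
            by (simp add: mult.assoc)
        qed
        then show ?thesis
          using that by simp
      qed
    qed simp
    with \<open>V I0 \<noteq> 0\<close> have "ok V"
      unfolding ok_def by blast
    have deg: "degree (W I) = (if V I = 0 then 0 else Suc (degree (V I)))" for I
      by (simp add: V[of I] degree_mult_eq del: mult_pCons_left)
    have "(\<Sum>I\<in>UNIV. degree (V I)) < (\<Sum>I\<in>UNIV. degree (W I))"
      by (rule sum_strict_mono_ex1) (use deg \<open>V I0 \<noteq> 0\<close> in auto)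
    with W(2)[OF \<open>ok V\<close>] show False
      by simp
  qed
  then show ?thesis
    using that W(1) by (auto simp: ok_def)
qed

end

section \<open>Orthogonal projections\<close>

lemma adj_nth: "adj A $ a $ b = cnj (A $ b $ a)"
  by (simp add: adj_def)

lemma adj_mult: "adj (A ** B) = adj B ** adj A"
  by (simp add: vec_eq_iff adj_def matrix_matrix_mult_def mult.commute)

lemma adj_add: "adj (A + B) = adj A + adj B"
  by (simp add: vec_eq_iff adj_def)

lemma adj_adj: "adj (adj A) = A"
  by (simp add: vec_eq_iff adj_def)

lemma adj_zero: "adj 0 = 0"
  by (simp add: vec_eq_iff adj_def)

lemma herm_adj: "herm (A *v x) y = herm x (adj A *v y)"
proof -
  have "herm (A *v x) y = (\<Sum>a\<in>UNIV. \<Sum>b\<in>UNIV. A $ a $ b * x $ b * cnj (y $ a))"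
    by (simp add: herm_def matrix_vector_mult_def sum_distrib_right)
  also have "\<dots> = (\<Sum>b\<in>UNIV. \<Sum>a\<in>UNIV. A $ a $ b * x $ b * cnj (y $ a))"
    by (rule sum.swap)
  also have "\<dots> = herm x (adj A *v y)"
    by (simp add: herm_def matrix_vector_mult_def adj_nth sum_distrib_left mult_ac)
  finally show ?thesis .
qed

lemma herm_diff_right: "herm z (x - y) = herm z x - herm z y"
  by (simp add: herm_def algebra_simps sum_subtractf)

lemma herm_right_unique:
  assumes "\<And>x. herm x y = herm x z"
  shows "y = z"
proof -
  have "herm (y - z) (y - z) = herm (y - z) y - herm (y - z) z"
    by (rule herm_diff_right)
  then have "herm (y - z) (y - z) = 0"
    using assms[of "y - z"] by simp
  then show ?thesis
    by (simp add: herm_eq_0_iff)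
qed

lemma mat_commute: "A ** mat c = mat c ** (A :: complex^'n^'n)"
  by (simp add: vec_eq_iff matrix_matrix_mult_def mat_def if_distrib[of "\<lambda>c. c * _"] if_distrib[of "\<lambda>c. _ * c"] mult.commute cong: if_cong)

lemma mat_mult_nth: "(mat c ** A) $ a $ b = c * (A :: complex^'n^'m) $ a $ b"
  by (simp add: matrix_matrix_mult_def mat_def if_distrib[of "\<lambda>c. c * _"] cong: if_cong)

lemma matrix_sub_rdistrib: "(A - B) ** C = A ** C - B ** (C :: complex^'n^'m)"
  by (simp add: vec_eq_iff matrix_matrix_mult_def sum_subtractf algebra_simps)

lemma matrix_add_rdistrib: "(A + B) ** C = A ** C + B ** (C :: complex^'n^'m)"
  by (simp add: vec_eq_iff matrix_matrix_mult_def sum.distrib algebra_simps)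

lemma matrix_minus_left: "(- A) ** B = - (A ** (B :: complex^'n^'m))"
  by (simp add: vec_eq_iff matrix_matrix_mult_def sum_negf)

lemma matrix_minus_right: "A ** (- B) = - (A ** (B :: complex^'n^'m))"
  by (simp add: vec_eq_iff matrix_matrix_mult_def sum_negf)

lemma matrix_sub_ldistrib: "C ** (A - B) = C ** A - C ** (B :: complex^'n^'m)"
  by (simp add: vec_eq_iff matrix_matrix_mult_def sum_subtractf algebra_simps)

lemma inner_complex_herm: "(x :: complex^'n) \<bullet> y = Re (herm x y)"
  by (simp add: inner_vec_def herm_def inner_complex_def)

definition projection :: "complex^'n^'n \<Rightarrow> (complex^'n) set \<Rightarrow> bool" where
  "projection P L \<longleftrightarrow> P ** P = P \<and> adj P = P \<and> range ((*v) P) = L"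

lemma projection_fix: "projection P L \<Longrightarrow> v \<in> L \<longleftrightarrow> P *v v = v"
  unfolding projection_def by (metis (no_types, lifting) matrix_vector_mul_assoc rangeE rangeI)

lemma projection_in: "projection P L \<Longrightarrow> P *v v \<in> L"
  unfolding projection_def by blast

text \<open>Two projections with the same range absorb each other, P Q = Q and Q P = P; taking
  adjoints in one relation identifies them.\<close>

lemma projection_unique:
  assumes "projection P L" "projection Q L"
  shows "P = Q"
proof -
  have absorb: "A ** B = B" if "projection A L" "projection B L" for A B
  proof -
    have "(A ** B) *v x = B *v x" for x
      using projection_fix[OF that(1)] projection_in[OF that(2)] by (simp flip: matrix_vector_mul_assoc)
    then show ?thesis
      by (simp add: matrix_eq)
  qed
  have "P ** Q = Q" "Q ** P = P"
    using absorb assms by auto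
  from arg_cong[OF this(1), of adj] this(2) assms show ?thesis
    unfolding projection_def adj_mult by metis
qed

lemma orth_proj_eqI: "projection P L \<Longrightarrow> orth_proj L = P"
  unfolding orth_proj_def by (rule the_equality) (auto simp: projection_def intro: projection_unique[unfolded projection_def])

text \<open>Built from the real orthogonal decomposition. A complex subspace is stable under
  multiplication by i, so real orthogonality to it is already Hermitian orthogonality.\<close>

lemma projection_exists:
  fixes L :: "(complex^'n) set"
  assumes L: "vec.subspace L"
  shows "\<exists>P. projection P L"
proof -
  have scale: "r *\<^sub>R x = complex_of_real r *s x" for r and x :: "complex^'n"
    unfolding vec_eq_iff vector_scaleR_component vector_smult_component by (simp add: scaleR_conv_of_real)
  have "subspace L"
    unfolding subspace_def scale using L by (auto simp: vec.subspace_def)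
  then have span: "span L = L"
    by (simp add: span_eq_iff)
  have ex: "\<exists>y. y \<in> L \<and> (\<forall>l\<in>L. herm (x - y) l = 0)" for x
  proof -
    obtain y z where yz: "y \<in> span L" "\<And>w. w \<in> span L \<Longrightarrow> orthogonal z w" "x = y + z"
      using orthogonal_subspace_decomp_exists by blast
    have "herm (x - y) l = 0" if l: "l \<in> L" for l
    proof -
      have "\<i> *s l \<in> L"
        using l L by (simp add: vec.subspace_def)
      then have "Re (herm z l) = 0" "Re (herm z (\<i> *s l)) = 0"
        using yz(2) l unfolding span orthogonal_def inner_complex_herm by auto
      then show ?thesis
        using yz(3) by (simp add: herm_scale_right complex_eq_iff)
    qed
    with yz(1) show ?thesis
      unfolding span by blast
  qed
  then obtain f where f: "\<And>x. f x \<in> L" "\<And>x l. l \<in> L \<Longrightarrow> herm (x - f x) l = 0"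
    by metis
  have uniq: "f x = y" if "y \<in> L" "\<And>l. l \<in> L \<Longrightarrow> herm (x - y) l = 0" for x y
  proof -
    have d: "f x - y \<in> L"
      using f(1) that(1) L by (simp add: vec.subspace_diff)
    have "herm (f x - y) (f x - y) = herm (x - y) (f x - y) - herm (x - f x) (f x - y)"
      by (simp add: herm_diff_left)
    also have "\<dots> = 0"
      using f(2)[OF d] that(2)[OF d] by simp
    finally show ?thesis
      by (simp add: herm_eq_0_iff)
  qed
  have f_add: "f (x + y) = f x + f y" for x y
  proof (rule uniq)
    show "f x + f y \<in> L" using f(1) L by (simp add: vec.subspace_add)
    show "herm (x + y - (f x + f y)) l = 0" if "l \<in> L" for l
      using f(2)[OF that, of x] f(2)[OF that, of y] by (simp add: herm_diff_left herm_add_left)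
  qed
  have f_scale: "f (c *s x) = c *s f x" for c x
  proof (rule uniq)
    show "c *s f x \<in> L" using f(1) L by (simp add: vec.subspace_scale)
    show "herm (c *s x - c *s f x) l = 0" if "l \<in> L" for l
      using f(2)[OF that, of x] by (simp add: herm_diff_left herm_scale_left flip: right_diff_distrib)
  qed
  have lin: "Vector_Spaces.linear (*s) (*s) f"
    by unfold_locales (simp_all add: f_add f_scale)
  define P where "P = matrix f"
  have P: "P *v x = f x" for x
    unfolding P_def using matrix_works[OF lin] .
  have fL: "f y = y" if "y \<in> L" for y
    by (rule uniq) (use that in \<open>simp_all add: herm_def\<close>)
  have "projection P L"
    unfolding projection_def
  proof (intro conjI)
    show "P ** P = P"
      unfolding matrix_eq by (simp add: P fL f(1) flip: matrix_vector_mul_assoc)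
    have sym: "herm (f x) y = herm x (f y)" for x y
    proof -
      have "herm (f x) y = herm (f x) (f y)"
        using f(2)[OF f(1), of y x] herm_cnj[of "f x" y] herm_cnj[of "f x" "f y"]
        by (metis eq_iff_diff_eq_0 herm_cnj herm_diff_left)
      also have "\<dots> = herm x (f y)"
        using f(2)[OF f(1), of x y] by (simp add: herm_diff_left)
      finally show ?thesis .
    qed
    show "adj P = P"
      unfolding matrix_eq
    proof
      fix y
      show "adj P *v y = P *v y"
        by (rule herm_right_unique) (metis P herm_adj sym)
    qed
    show "range ((*v) P) = L"
      unfolding P using f(1) fL by (auto simp: image_iff) metis
  qed
  then show ?thesis by blast
qed

lemma projection_orth_proj: "vec.subspace L \<Longrightarrow> projection (orth_proj L) L"
  using projection_exists orth_proj_eqI by metis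

lemma projection_orthogonal:
  assumes "projection P L" "projection Q M" "\<And>v w. v \<in> L \<Longrightarrow> w \<in> M \<Longrightarrow> herm v w = 0"
  shows "P ** Q = 0"
proof -
  have "herm x ((P ** Q) *v y) = herm x 0" for x y
  proof -
    have "herm x ((P ** Q) *v y) = herm (P *v x) (Q *v y)"
      using assms(1) by (simp add: herm_adj projection_def flip: matrix_vector_mul_assoc)
    also have "\<dots> = 0"
      by (rule assms(3)) (intro projection_in[OF assms(1)] projection_in[OF assms(2)])+
    finally show ?thesis
      by (simp add: herm_def)
  qed
  then show ?thesis
    unfolding matrix_eq using herm_right_unique by (metis matrix_vector_mult_0)
qed

text \<open>The fixed vectors of P + Q + R form a subspace that contains the three summands.\<close>

lemma projection_sum_span:
  assumes P: "projection P L" "projection Q M" "projection R N"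
    and orth: "P ** Q = 0" "P ** R = 0" "Q ** R = 0"
    and span: "vec.span (L \<union> M \<union> N) = UNIV"
  shows "P + Q + R = mat 1"
proof -
  have orth': "Q ** P = 0" "R ** P = 0" "R ** Q = 0"
    using arg_cong[OF orth(1), of adj] arg_cong[OF orth(2), of adj] arg_cong[OF orth(3), of adj] P
    by (simp_all add: adj_mult adj_zero projection_def)
  define S where "S = P + Q + R"
  have "S *v v = v" if v: "v \<in> L \<union> M \<union> N" for v
  proof -
    consider "v \<in> L" | "v \<in> M" | "v \<in> N"
      using v by blast
    then show ?thesis
    proof cases
      case 1
      then have v: "P *v v = v"
        using projection_fix[OF P(1)] by blast
      then have "Q *v v = (Q ** P) *v v" "R *v v = (R ** P) *v v"
        by (simp_all flip: matrix_vector_mul_assoc)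
      with v show ?thesis
        by (simp add: S_def matrix_vector_mult_add_rdistrib orth')
    next
      case 2
      then have v: "Q *v v = v"
        using projection_fix[OF P(2)] by blast
      then have "P *v v = (P ** Q) *v v" "R *v v = (R ** Q) *v v"
        by (simp_all flip: matrix_vector_mul_assoc)
      with v show ?thesis
        by (simp add: S_def matrix_vector_mult_add_rdistrib orth orth')
    next
      case 3
      then have v: "R *v v = v"
        using projection_fix[OF P(3)] by blast
      then have "P *v v = (P ** R) *v v" "Q *v v = (Q ** R) *v v"
        by (simp_all flip: matrix_vector_mul_assoc)
      with v show ?thesis
        by (simp add: S_def matrix_vector_mult_add_rdistrib orth)
    qed
  qed
  moreover have "vec.subspace {v. S *v v = v}"
    by (auto simp: vec.subspace_def matrix_vector_right_distrib vector_scalar_commute)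
  ultimately have "vec.span (L \<union> M \<union> N) \<subseteq> {v. S *v v = v}"
    by (intro vec.span_minimal) auto
  then show ?thesis
    unfolding span S_def[symmetric] by (auto simp: matrix_eq)
qed

lemma flag_projections:
  assumes "[L0, L1, L2] \<in> flag_manifold [k0, k1, k2]"
  shows "projection (orth_proj L0) L0" "projection (orth_proj L1) L1" "projection (orth_proj L2) L2"
    "orth_proj L0 ** orth_proj L2 = 0" "orth_proj L0 ** orth_proj L1 = 0" "orth_proj L1 ** orth_proj L2 = 0"
    "orth_proj L0 + orth_proj L1 + orth_proj L2 = mat 1"
    "vec.dim L0 = k0" "vec.dim L1 = k1" "vec.dim L2 = k2"
proof -
  have all3: "(\<forall>i<Suc (Suc (Suc 0)). Q i) \<longleftrightarrow> Q 0 \<and> Q (Suc 0) \<and> Q (Suc (Suc 0))" for Q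
    by (auto simp: less_Suc_eq)
  have g: "vec.subspace L0" "vec.subspace L1" "vec.subspace L2"
    and dims: "vec.dim L0 = k0" "vec.dim L1 = k1" "vec.dim L2 = k2"
    and orth: "\<And>v w. v \<in> L0 \<Longrightarrow> w \<in> L1 \<Longrightarrow> herm v w = 0" "\<And>v w. v \<in> L0 \<Longrightarrow> w \<in> L2 \<Longrightarrow> herm v w = 0"
      "\<And>v w. v \<in> L1 \<Longrightarrow> w \<in> L2 \<Longrightarrow> herm v w = 0"
    and span: "vec.span (L0 \<union> (L1 \<union> L2)) = UNIV"
    using assms by (simp_all add: flag_manifold_def grassmannian_def all3)
  show P: "projection (orth_proj L0) L0" "projection (orth_proj L1) L1" "projection (orth_proj L2) L2"
    by (intro projection_orth_proj g)+
  show o: "orth_proj L0 ** orth_proj L2 = 0" "orth_proj L0 ** orth_proj L1 = 0" "orth_proj L1 ** orth_proj L2 = 0"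
    by (rule projection_orthogonal[OF P(1,3)], erule (1) orth, rule projection_orthogonal[OF P(1,2)], erule (1) orth,
        rule projection_orthogonal[OF P(2,3)], erule (1) orth)
  show "orth_proj L0 + orth_proj L1 + orth_proj L2 = mat 1"
    by (rule projection_sum_span[OF P o(2,1,3)]) (simp add: span Un_assoc)
  show "vec.dim L0 = k0" "vec.dim L1 = k1" "vec.dim L2 = k2"
    by (fact dims)+
qed

section \<open>Wirtinger derivatives of matrix-valued maps\<close>

definition has_wirt_mat ::
    "(complex \<Rightarrow> complex^'n^'m) \<Rightarrow> complex^'n^'m \<Rightarrow> complex^'n^'m \<Rightarrow> complex \<Rightarrow> bool" where
  "has_wirt_mat F A B z \<longleftrightarrow> (\<forall>a b. has_wirt (\<lambda>w. F w $ a $ b) (A $ a $ b) (B $ a $ b) z)"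

lemma has_wirt_mat_del:
  assumes "has_wirt_mat F A B z"
  shows "del_z_mat F z = A" "del_zbar_mat F z = B"
  using assms unfolding has_wirt_mat_def del_z_mat_def del_zbar_mat_def
  by (auto simp: vec_eq_iff intro: has_wirt_del)

lemma has_wirt_mat_unique:
  "has_wirt_mat F A B z \<Longrightarrow> has_wirt_mat F A' B' z \<Longrightarrow> A = A'"
  "has_wirt_mat F A B z \<Longrightarrow> has_wirt_mat F A' B' z \<Longrightarrow> B = B'"
  by (metis has_wirt_mat_del)+

lemma has_wirt_mat_const: "has_wirt_mat (\<lambda>_. A) 0 0 z"
  by (simp add: has_wirt_mat_def has_wirt_const)

lemma has_wirt_mat_add:
  "has_wirt_mat F A B z \<Longrightarrow> has_wirt_mat G A' B' z \<Longrightarrow> has_wirt_mat (\<lambda>w. F w + G w) (A + A') (B + B') z"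
  by (simp add: has_wirt_mat_def has_wirt_add)

lemma has_wirt_mat_diff:
  "has_wirt_mat F A B z \<Longrightarrow> has_wirt_mat G A' B' z \<Longrightarrow> has_wirt_mat (\<lambda>w. F w - G w) (A - A') (B - B') z"
  by (simp add: has_wirt_mat_def has_wirt_diff)

lemma has_wirt_mat_mult:
  assumes "has_wirt_mat F A B z" "has_wirt_mat G A' B' z"
  shows "has_wirt_mat (\<lambda>w. F w ** G w) (A ** G z + F z ** A') (B ** G z + F z ** B') z"
  unfolding has_wirt_mat_def
proof (intro allI)
  fix a b
  have "has_wirt (\<lambda>w. \<Sum>k\<in>UNIV. F w $ a $ k * G w $ k $ b)
    (\<Sum>k\<in>UNIV. A $ a $ k * G z $ k $ b + F z $ a $ k * A' $ k $ b)
    (\<Sum>k\<in>UNIV. B $ a $ k * G z $ k $ b + F z $ a $ k * B' $ k $ b) z"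
    using assms by (intro has_wirt_sum has_wirt_mult) (auto simp: has_wirt_mat_def)
  then show "has_wirt (\<lambda>w. (F w ** G w) $ a $ b) ((A ** G z + F z ** A') $ a $ b) ((B ** G z + F z ** B') $ a $ b) z"
    by (simp add: matrix_matrix_mult_def sum.distrib)
qed

lemma has_wirt_mat_adj:
  assumes "has_wirt_mat F A B z"
  shows "has_wirt_mat (\<lambda>w. adj (F w)) (adj B) (adj A) z"
  using assms by (auto simp: has_wirt_mat_def adj_nth intro: has_wirt_cnj)

lemma has_wirt_mat_transform:
  assumes "has_wirt_mat F A B z" "open S" "z \<in> S" "\<And>w. w \<in> S \<Longrightarrow> F w = G w"
  shows "has_wirt_mat G A B z"
  unfolding has_wirt_mat_def
proof (intro allI)
  fix a b
  have "has_wirt (\<lambda>w. F w $ a $ b) (A $ a $ b) (B $ a $ b) z"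
    using assms(1) by (simp add: has_wirt_mat_def)
  from has_wirt_transform[OF this assms(2,3)] show "has_wirt (\<lambda>w. G w $ a $ b) (A $ a $ b) (B $ a $ b) z"
    by (simp add: assms(4))
qed

lemma has_wirt_mat_precompose:
  assumes "has_wirt_mat F A B (g z)" "(g has_field_derivative d) (at z)"
  shows "has_wirt_mat (\<lambda>w. F (g w)) (mat d ** A) (mat (cnj d) ** B) z"
  unfolding has_wirt_mat_def
proof (intro allI)
  fix a b
  have "has_wirt (\<lambda>w. F w $ a $ b) (A $ a $ b) (B $ a $ b) (g z)"
    using assms(1) by (simp add: has_wirt_mat_def)
  from has_wirt_precompose[OF this assms(2)]
  show "has_wirt (\<lambda>w. F (g w) $ a $ b) ((mat d ** A) $ a $ b) ((mat (cnj d) ** B) $ a $ b) z"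
    by (simp add: mat_mult_nth mult.commute)
qed

lemma differentiable_vec_nth:
  assumes "f differentiable (at z)"
  shows "(\<lambda>w. f w $ a) differentiable (at z)"
  using assms bounded_linear.has_derivative[OF bounded_linear_vec_nth[of a], of f _ "at z"]
  unfolding differentiable_def by blast

lemma differentiable_has_wirt_mat:
  fixes F :: "complex \<Rightarrow> complex^'n^'m"
  assumes "F differentiable (at z)"
  shows "has_wirt_mat F (del_z_mat F z) (del_zbar_mat F z) z"
  unfolding has_wirt_mat_def del_z_mat_def del_zbar_mat_def
  using differentiable_has_wirt[OF differentiable_vec_nth[OF differentiable_vec_nth[OF assms]]] by simp

lemma has_wirt_mat_differentiable:
  fixes F :: "complex \<Rightarrow> complex^'n^'m"
  assumes "has_wirt_mat F A B z"
  shows "(F has_derivative (\<lambda>h. mat h ** A + mat (cnj h) ** B)) (at z)"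
proof -
  have c: "((\<lambda>w. F w $ a $ b) has_derivative (\<lambda>h. (mat h ** A + mat (cnj h) ** B) $ a $ b)) (at z)" for a b
    using assms by (simp add: has_wirt_mat_def has_wirt_def mat_mult_nth mult.commute)
  have v: "(G has_derivative G') (at z)" if "\<And>i. ((\<lambda>w. G w $ i) has_derivative (\<lambda>h. G' h $ i)) (at z)"
    for G :: "complex \<Rightarrow> ('b::euclidean_space)^'c" and G'
    unfolding has_derivative_componentwise_within[of G]
    by (auto simp: Basis_vec_def inner_axis intro: has_derivative_inner_left that)
  show ?thesis
    by (intro v c)
qed

lemma has_wirt_mat_frechet:
  fixes F :: "complex \<Rightarrow> complex^'n^'m"
  assumes "has_wirt_mat F A B z"
  shows "frechet_derivative F (at z) X = mat X ** A + mat (cnj X) ** B"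
  by (simp add: frechet_derivative_at[OF has_wirt_mat_differentiable[OF assms], symmetric])

definition frob :: "complex^'n^'m \<Rightarrow> real" where
  "frob A = (\<Sum>a\<in>UNIV. \<Sum>b\<in>UNIV. (cmod (A $ a $ b))\<^sup>2)"

lemma trace_adj: "trace (A ** adj A) = of_real (frob A)"
  unfolding trace_def matrix_matrix_mult_def frob_def of_real_sum complex_norm_square
  by (simp add: adj_nth)

lemma trace_zero: "trace 0 = 0"
  by (simp add: trace_def)

lemma trace_scale: "trace ((mat x ** A) ** adj (mat y ** A)) = x * cnj y * of_real (frob A)"
proof -
  have "trace ((mat x ** A) ** adj (mat y ** A)) = x * cnj y * trace (A ** adj A)"
    by (simp add: trace_def matrix_matrix_mult_def[of "mat x ** A"] matrix_matrix_mult_def[of A] mat_mult_nth adj_nth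
        sum_distrib_left mult_ac)
  then show ?thesis
    by (simp add: trace_adj)
qed

text \<open>The identities satisfied at a point by the derivatives of the projections \<open>P0\<close>, \<open>P1\<close>, \<open>P2\<close>
  of a primitive flag with holomorphic \<open>\<psi>\<^sub>0\<close> (and then antiholomorphic \<open>\<psi>\<^sub>2\<close>).\<close>

locale primitive_point =
  fixes P0 P1 P2 :: "complex \<Rightarrow> complex^'n^'n" and z and V and A0 B0 A2 B2
  assumes V: "open V" "z \<in> V"
    and proj: "\<And>w. w \<in> V \<Longrightarrow> P0 w ** P0 w = P0 w" "\<And>w. w \<in> V \<Longrightarrow> P2 w ** P2 w = P2 w"
      "\<And>w. w \<in> V \<Longrightarrow> adj (P0 w) = P0 w" "\<And>w. w \<in> V \<Longrightarrow> adj (P2 w) = P2 w"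
      "\<And>w. w \<in> V \<Longrightarrow> P2 w ** P0 w = 0" "\<And>w. w \<in> V \<Longrightarrow> P1 w = mat 1 - P0 w - P2 w"
    and D0: "has_wirt_mat P0 A0 B0 z" and D2: "has_wirt_mat P2 A2 B2 z"
    and hol: "B0 ** P0 z = 0" and antihol: "A2 ** P2 z = 0" and prim: "P2 z ** A0 = 0"
begin

lemma D1: "has_wirt_mat P1 (- A0 - A2) (- B0 - B2) z"
proof -
  have "has_wirt_mat (\<lambda>w. mat 1 - P0 w - P2 w) (0 - A0 - A2) (0 - B0 - B2) z"
    by (intro has_wirt_mat_diff has_wirt_mat_const D0 D2)
  from has_wirt_mat_transform[OF this V] show ?thesis
    by (simp add: proj)
qed

lemma adj0: "B0 = adj A0"
proof -
  have "has_wirt_mat P0 (adj B0) (adj A0) z"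
    by (rule has_wirt_mat_transform[OF has_wirt_mat_adj[OF D0] V]) (simp add: proj)
  from has_wirt_mat_unique(2)[OF D0 this] show ?thesis .
qed

lemma adj2: "B2 = adj A2"
proof -
  have "has_wirt_mat P2 (adj B2) (adj A2) z"
    by (rule has_wirt_mat_transform[OF has_wirt_mat_adj[OF D2] V]) (simp add: proj)
  from has_wirt_mat_unique(2)[OF D2 this] show ?thesis .
qed

lemma P0A0: "P0 z ** A0 = 0"
  using arg_cong[OF hol, of adj] V proj by (simp add: adj_mult adj_zero adj0 adj_adj)

lemma P2B2: "P2 z ** B2 = 0"
  using arg_cong[OF antihol, of adj] V proj by (simp add: adj_mult adj_zero adj2 adj_adj)

text \<open>Differentiate P0 P0 = P0; in each derivative one of the two terms is killed by
  holomorphy.\<close>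

lemma prod0: "A0 = A0 ** P0 z" "B0 = P0 z ** B0"
proof -
  have "has_wirt_mat P0 (A0 ** P0 z + P0 z ** A0) (B0 ** P0 z + P0 z ** B0) z"
    by (rule has_wirt_mat_transform[OF has_wirt_mat_mult[OF D0 D0] V]) (simp add: proj)
  from has_wirt_mat_unique(1)[OF D0 this] has_wirt_mat_unique(2)[OF D0 this]
  show "A0 = A0 ** P0 z" "B0 = P0 z ** B0"
    by (simp_all add: P0A0 hol)
qed

lemma prod2: "A2 = P2 z ** A2" "B2 = B2 ** P2 z"
proof -
  have "has_wirt_mat P2 (A2 ** P2 z + P2 z ** A2) (B2 ** P2 z + P2 z ** B2) z"
    by (rule has_wirt_mat_transform[OF has_wirt_mat_mult[OF D2 D2] V]) (simp add: proj)
  from has_wirt_mat_unique(1)[OF D2 this] has_wirt_mat_unique(2)[OF D2 this]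
  show "A2 = P2 z ** A2" "B2 = B2 ** P2 z"
    by (simp_all add: P2B2 antihol)
qed

text \<open>Differentiating P2 P0 = 0 turns the primitivity condition on psi_0 into one on
  psi_2.\<close>

lemma A2P0: "A2 ** P0 z = 0"
proof -
  have "has_wirt_mat (\<lambda>_. 0) (A2 ** P0 z + P2 z ** A0) (B2 ** P0 z + P2 z ** B0) z"
    by (rule has_wirt_mat_transform[OF has_wirt_mat_mult[OF D2 D0] V]) (simp add: proj)
  from has_wirt_mat_unique(1)[OF has_wirt_mat_const this] show ?thesis
    by (simp add: prim)
qed

text \<open>The identities above leave X A0 in Hom(psi_0, psi_1), - X A2 in Hom(psi_1, psi_2) and
  nothing in Hom(psi_0, psi_2). These are complex linear in X, so the pulled back metric is
  conformal.\<close>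

lemma flag_metric_eq:
  assumes "\<And>w. orth_proj (\<Psi> (c w) ! 0) = P0 w" "\<And>w. orth_proj (\<Psi> (c w) ! 1) = P1 w"
    "\<And>w. orth_proj (\<Psi> (c w) ! 2) = P2 w"
  shows "flag_metric [k0, k1, k2] \<Lambda> (tangent_comp \<Psi> c z X) (tangent_comp \<Psi> c z Y) =
    (\<Lambda> 0 1 * frob A0 + \<Lambda> 1 2 * frob A2) * (X \<bullet> Y)"
proof -
  have P2P0: "P2 z ** P0 z = 0" and P1: "P1 z = mat 1 - P0 z - P2 z"
    using proj V by auto
  have P2B0: "P2 z ** B0 = 0"
    by (subst prod0(2)) (simp add: matrix_mul_assoc P2P0)
  have P1A0: "P1 z ** A0 = A0"
    by (simp add: P1 matrix_sub_rdistrib P0A0 prim)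
  have P1B0: "P1 z ** B0 = 0"
    by (simp add: P1 matrix_sub_rdistrib P2B0 prod0(2)[symmetric])
  have A2P1: "A2 ** P1 z = A2"
    by (simp add: P1 matrix_sub_ldistrib A2P0 antihol)
  have B2P1: "B2 ** P1 z = 0"
  proof -
    have "P2 z ** P1 z = 0"
      using proj V by (simp add: P1 matrix_sub_ldistrib P2P0)
    then show ?thesis
      by (subst prod2(2)) (simp add: matrix_mul_assoc[symmetric])
  qed
  have t01: "tangent_comp \<Psi> c z X 0 1 = mat X ** A0" for X
  proof -
    have "tangent_comp \<Psi> c z X 0 1 = P1 z ** (mat X ** A0 + mat (cnj X) ** B0) ** P0 z"
      unfolding tangent_comp_def assms has_wirt_mat_frechet[OF D0] ..
    also have "\<dots> = mat X ** (P1 z ** A0) ** P0 z + mat (cnj X) ** (P1 z ** B0) ** P0 z"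
      by (simp add: matrix_add_ldistrib matrix_add_rdistrib matrix_mul_assoc mat_commute)
    finally show ?thesis
      by (simp add: P1A0 P1B0 matrix_mul_assoc[symmetric] prod0(1)[symmetric])
  qed
  have t02: "tangent_comp \<Psi> c z X 0 2 = 0" for X
  proof -
    have "tangent_comp \<Psi> c z X 0 2 = P2 z ** (mat X ** A0 + mat (cnj X) ** B0) ** P0 z"
      unfolding tangent_comp_def assms has_wirt_mat_frechet[OF D0] ..
    also have "\<dots> = mat X ** (P2 z ** A0) ** P0 z + mat (cnj X) ** (P2 z ** B0) ** P0 z"
      by (simp add: matrix_add_ldistrib matrix_add_rdistrib matrix_mul_assoc mat_commute)
    finally show ?thesis
      by (simp add: prim P2B0)
  qed
  have t12: "tangent_comp \<Psi> c z X 1 2 = mat (- X) ** A2" for X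
  proof -
    have "tangent_comp \<Psi> c z X 1 2 = P2 z ** (mat X ** (- A0 - A2) + mat (cnj X) ** (- B0 - B2)) ** P1 z"
      unfolding tangent_comp_def assms has_wirt_mat_frechet[OF D1] ..
    also have "\<dots> = mat X ** (P2 z ** (- A0 - A2)) ** P1 z + mat (cnj X) ** (P2 z ** (- B0 - B2)) ** P1 z"
      by (simp add: matrix_add_ldistrib matrix_add_rdistrib matrix_mul_assoc mat_commute)
    also have "P2 z ** (- A0 - A2) = - A2"
      by (simp add: matrix_sub_ldistrib matrix_minus_right prim prod2(1)[symmetric])
    also have "P2 z ** (- B0 - B2) = 0"
      by (simp add: matrix_sub_ldistrib matrix_minus_right P2B0 P2B2)
    also have "mat X ** (- A2) ** P1 z = mat (- X) ** (A2 ** P1 z)"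
      by (simp add: vec_eq_iff mat_mult_nth matrix_mul_assoc[symmetric] matrix_minus_left)
    finally show ?thesis
      by (simp add: A2P1)
  qed
  have "flag_metric [k0, k1, k2] \<Lambda> (tangent_comp \<Psi> c z X) (tangent_comp \<Psi> c z Y) =
      \<Lambda> 0 1 * Re (trace (mat X ** A0 ** adj (mat Y ** A0))) + \<Lambda> 1 2 * Re (trace (mat (- X) ** A2 ** adj (mat (- Y) ** A2)))"
    using t01 t02 t12 by (simp add: flag_metric_def lessThan_Suc numeral_2_eq_2 trace_zero)
  then show ?thesis
    by (simp add: trace_scale inner_complex_def algebra_simps)
qed

end

section \<open>Projections defined by polynomial vectors and bivectors\<close>

lemma has_wirt_rank_one:
  fixes F :: "'a::finite \<Rightarrow> complex poly"
  assumes "nonvanishing F"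
  shows "has_wirt (\<lambda>z. poly (F I) z * cnj (poly (F J) z) / pker F F z z)
    ((poly (vderiv F I) z * pker F F z z - poly (F I) z * pker (vderiv F) F z z) * cnj (poly (F J) z) / (pker F F z z)\<^sup>2)
    (cnj ((poly (vderiv F J) z * pker F F z z - poly (F J) z * pker (vderiv F) F z z) * cnj (poly (F I) z) / (pker F F z z)\<^sup>2)) z"
proof -
  have "has_wirt (\<lambda>z. poly (F I) z * cnj (poly (F J) z) / pker F F z z)
    (((poly (pderiv (F I)) z * cnj (poly (F J) z) + poly (F I) z * 0) * pker F F z z
      - (poly (F I) z * cnj (poly (F J) z)) * pker (vderiv F) F z z) / (pker F F z z)\<^sup>2)
    (((0 * cnj (poly (F J) z) + poly (F I) z * cnj (poly (pderiv (F J)) z)) * pker F F z z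
      - (poly (F I) z * cnj (poly (F J) z)) * pker F (vderiv F) z z) / (pker F F z z)\<^sup>2) z"
    by (intro has_wirt_divide has_wirt_mult has_wirt_poly has_wirt_cnj_poly has_wirt_pker pker_nonzero assms)
  then show ?thesis
    by (rule has_wirt_eq) (simp_all add: vderiv_def cnj_pker algebra_simps)
qed

text \<open>The matrix is x F^* / |F|^4 with x = |F|^2 F' - <F', F> F, a multiple of the part of F'
  orthogonal to F; hence its squared norm is |x|^2 / |F|^6, the Fubini-Study density.\<close>

lemma rank_one_norm:
  fixes F :: "'a::finite \<Rightarrow> complex poly"
  assumes "nonvanishing F"
  shows "(\<Sum>I\<in>UNIV. \<Sum>J\<in>UNIV. (cmod ((poly (vderiv F I) z * pker F F z z - poly (F I) z * pker (vderiv F) F z z)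
      * cnj (poly (F J) z) / (pker F F z z)\<^sup>2))\<^sup>2) = fubini F z"
proof -
  define h A N where "h = pker F F z z" and "A = pker (vderiv F) F z z" and "N = pker (vderiv F) (vderiv F) z z"
  define x where "x = (\<lambda>I. poly (vderiv F I) z * h - poly (F I) z * A)"
  have h: "h \<noteq> 0" "cnj h = h"
    using pker_nonzero[OF assms] by (simp_all add: h_def cnj_pker)
  have hF: "(\<Sum>J\<in>UNIV. poly (F J) z * cnj (poly (F J) z)) = h" "(\<Sum>J\<in>UNIV. poly (vderiv F J) z * cnj (poly (F J) z)) = A"
    "(\<Sum>J\<in>UNIV. poly (vderiv F J) z * cnj (poly (vderiv F J) z)) = N"
    by (simp_all add: h_def A_def N_def pker_def)
  have hF': "(\<Sum>J\<in>UNIV. poly (F J) z * cnj (poly (vderiv F J) z)) = cnj A"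
    by (simp add: A_def cnj_pker) (simp add: pker_def)
  have "(\<Sum>I\<in>UNIV. x I * cnj (x I)) = h * h * N - h * cnj A * A - A * h * cnj A + A * cnj A * h"
  proof -
    have "(\<Sum>I\<in>UNIV. x I * cnj (x I)) = (\<Sum>I\<in>UNIV. (h * h) * (poly (vderiv F I) z * cnj (poly (vderiv F I) z))
       - (h * cnj A) * (poly (vderiv F I) z * cnj (poly (F I) z)) - (A * h) * (poly (F I) z * cnj (poly (vderiv F I) z))
       + (A * cnj A) * (poly (F I) z * cnj (poly (F I) z)))"
      by (intro sum.cong refl) (simp add: x_def h algebra_simps)
    then show ?thesis
      by (simp add: sum.distrib sum_subtractf flip: sum_distrib_left) (simp add: hF hF')
  qed
  then have xx: "(\<Sum>I\<in>UNIV. x I * cnj (x I)) = h * (h * N - A * cnj A)"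
    by (simp add: algebra_simps)
  have "complex_of_real (\<Sum>I\<in>UNIV. \<Sum>J\<in>UNIV. (cmod (x I * cnj (poly (F J) z) / h\<^sup>2))\<^sup>2) =
      (\<Sum>I\<in>UNIV. \<Sum>J\<in>UNIV. (x I * cnj (x I)) * (poly (F J) z * cnj (poly (F J) z))) / h ^ 4"
    unfolding of_real_sum complex_norm_square
    by (simp add: sum_divide_distrib h mult_ac flip: power_add)
  also have "\<dots> = (h * (h * N - A * cnj A)) * h / h ^ 4"
    unfolding sum_distrib_left[symmetric] sum_distrib_right[symmetric] hF xx ..
  also have "\<dots> = (N * h - A * cnj A) / h\<^sup>2"
    using h by (simp add: field_simps power2_eq_square power4_eq_xxxx)
  also have "\<dots> = of_real (fubini F z)"
    unfolding of_real_fubini h_def A_def N_def by (simp add: cnj_pker)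
  finally show ?thesis
    unfolding of_real_eq_iff by (simp add: x_def h_def A_def)
qed

section \<open>The metric of the Pluecker embedding\<close>

lemma bilinear_swap:
  fixes A :: "'a::finite \<Rightarrow> 'b::finite \<Rightarrow> complex" and B :: "'c::finite \<Rightarrow> 'd::finite \<Rightarrow> complex"
  shows "(\<Sum>i\<in>UNIV. \<Sum>j\<in>UNIV. \<Sum>k\<in>UNIV. \<Sum>l\<in>UNIV. A i k * B j l) = (\<Sum>i\<in>UNIV. \<Sum>k\<in>UNIV. A i k) * (\<Sum>j\<in>UNIV. \<Sum>l\<in>UNIV. B j l)"
proof -
  have "(\<Sum>i\<in>UNIV. \<Sum>j\<in>UNIV. \<Sum>k\<in>UNIV. \<Sum>l\<in>UNIV. A i k * B j l) = (\<Sum>i\<in>UNIV. \<Sum>j\<in>UNIV. (\<Sum>k\<in>UNIV. A i k) * (\<Sum>l\<in>UNIV. B j l))"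
    by (simp add: sum_product)
  then show ?thesis
    by (simp add: sum_product)
qed

lemma bilinear_cross:
  fixes A C :: "'a::finite \<Rightarrow> 'b::finite \<Rightarrow> complex" and B D :: "'c::finite \<Rightarrow> 'b \<Rightarrow> complex"
  shows "(\<Sum>i\<in>UNIV. \<Sum>j\<in>UNIV. \<Sum>k\<in>UNIV. \<Sum>l\<in>UNIV. (A i k * B j l) * (C i l * D j k))
    = (\<Sum>k\<in>UNIV. \<Sum>l\<in>UNIV. (\<Sum>i\<in>UNIV. A i k * C i l) * (\<Sum>j\<in>UNIV. B j l * D j k))"
proof -
  let ?t = "\<lambda>i j k l. (A i k * C i l) * (B j l * D j k)"
  have "(\<Sum>i\<in>UNIV. \<Sum>j\<in>UNIV. \<Sum>k\<in>UNIV. \<Sum>l\<in>UNIV. (A i k * B j l) * (C i l * D j k))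
     = (\<Sum>i\<in>UNIV. \<Sum>j\<in>UNIV. \<Sum>k\<in>UNIV. \<Sum>l\<in>UNIV. ?t i j k l)"
    by (simp add: mult_ac)
  also have "\<dots> = (\<Sum>i\<in>UNIV. \<Sum>k\<in>UNIV. \<Sum>j\<in>UNIV. \<Sum>l\<in>UNIV. ?t i j k l)"
    by (rule sum.cong[OF refl], rule sum.swap)
  also have "\<dots> = (\<Sum>k\<in>UNIV. \<Sum>i\<in>UNIV. \<Sum>j\<in>UNIV. \<Sum>l\<in>UNIV. ?t i j k l)"
    by (rule sum.swap)
  also have "\<dots> = (\<Sum>k\<in>UNIV. \<Sum>i\<in>UNIV. \<Sum>l\<in>UNIV. \<Sum>j\<in>UNIV. ?t i j k l)"
    by (rule sum.cong[OF refl], rule sum.cong[OF refl], rule sum.swap)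
  also have "\<dots> = (\<Sum>k\<in>UNIV. \<Sum>l\<in>UNIV. \<Sum>i\<in>UNIV. \<Sum>j\<in>UNIV. ?t i j k l)"
    by (rule sum.cong[OF refl], rule sum.swap)
  finally show ?thesis
    by (simp add: sum_product)
qed

text \<open>The Pluecker embedding is isometric: here \<open>X\<close> stands for the derivative \<open>\<partial>P\<close> of a family of
  orthogonal projections of rank two.\<close>

lemma pluecker_norm:
  fixes P X :: "complex^'n^'n"
  assumes P: "P ** P = P" "adj P = P" "trace P = 2" and X: "X ** P = X" "P ** X = 0"
  shows "(\<Sum>i\<in>UNIV. \<Sum>j\<in>UNIV. \<Sum>k\<in>UNIV. \<Sum>l\<in>UNIV.
      (cmod ((X $ i $ k * P $ j $ l + P $ i $ k * X $ j $ l) - (X $ i $ l * P $ j $ k + P $ i $ l * X $ j $ k)))\<^sup>2) = 4 * frob X"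
proof -
  have cP: "cnj (P $ i $ j) = P $ j $ i" for i j
    using P(2) adj_nth[of P j i] by simp
  have PP: "(\<Sum>j\<in>UNIV. P $ i $ j * P $ j $ k) = P $ i $ k" for i k
    using arg_cong[OF P(1), of "\<lambda>M. M $ i $ k"] by (simp add: matrix_matrix_mult_def)
  have XP: "(\<Sum>j\<in>UNIV. X $ i $ j * P $ j $ k) = X $ i $ k" for i k
    using arg_cong[OF X(1), of "\<lambda>M. M $ i $ k"] by (simp add: matrix_matrix_mult_def)
  have PX: "(\<Sum>j\<in>UNIV. P $ i $ j * X $ j $ k) = 0" for i k
    using arg_cong[OF X(2), of "\<lambda>M. M $ i $ k"] by (simp add: matrix_matrix_mult_def)
  have trP: "(\<Sum>i\<in>UNIV. P $ i $ i) = 2"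
    using P(3) by (simp add: trace_def)
  define f where "f = complex_of_real (frob X)"
  have XX: "(\<Sum>i\<in>UNIV. \<Sum>k\<in>UNIV. X $ i $ k * cnj (X $ i $ k)) = f"
    unfolding f_def frob_def of_real_sum complex_norm_square ..
  have PP2: "(\<Sum>i\<in>UNIV. \<Sum>k\<in>UNIV. P $ i $ k * cnj (P $ i $ k)) = 2"
    by (simp add: cP PP trP)
  have XPt: "(\<Sum>i\<in>UNIV. \<Sum>k\<in>UNIV. X $ i $ k * cnj (P $ i $ k)) = 0"
  proof -
    have "(\<Sum>i\<in>UNIV. \<Sum>k\<in>UNIV. X $ i $ k * P $ k $ i) = (\<Sum>k\<in>UNIV. \<Sum>i\<in>UNIV. P $ k $ i * X $ i $ k)"
      by (subst sum.swap) (simp add: mult.commute)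
    then show ?thesis
      by (simp add: cP PX)
  qed
  let ?S = "\<lambda>T. \<Sum>i\<in>UNIV. \<Sum>j\<in>UNIV. \<Sum>k\<in>UNIV. \<Sum>l\<in>UNIV. T i j k l :: complex"
  let ?T1 = "\<lambda>i j k l. X $ i $ k * P $ j $ l" and ?T2 = "\<lambda>i j k l. P $ i $ k * X $ j $ l"
  have s11: "?S (\<lambda>i j k l. ?T1 i j k l * cnj (?T1 i j k l)) = 2 * f"
    using bilinear_swap[of "\<lambda>i k. X $ i $ k * cnj (X $ i $ k)" "\<lambda>j l. P $ j $ l * cnj (P $ j $ l)"]
    unfolding XX PP2 by (simp add: mult_ac)
  have s22: "?S (\<lambda>i j k l. ?T2 i j k l * cnj (?T2 i j k l)) = 2 * f"
    using bilinear_swap[of "\<lambda>j l. P $ j $ l * cnj (P $ j $ l)" "\<lambda>i k. X $ i $ k * cnj (X $ i $ k)"]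
    unfolding XX PP2 by (simp add: mult_ac)
  have s12: "?S (\<lambda>i j k l. ?T1 i j k l * cnj (?T2 i j k l)) = 0"
    using bilinear_swap[of "\<lambda>i k. X $ i $ k * cnj (P $ i $ k)" "\<lambda>j l. P $ j $ l * cnj (X $ j $ l)"]
    unfolding XPt by (simp add: mult_ac)
  have sw: "?S (\<lambda>i j k l. T i j k l) = ?S (\<lambda>i j k l. T i j l k)" for T
    by (rule sum.cong[OF refl], rule sum.cong[OF refl], rule sum.swap)
  have s11': "?S (\<lambda>i j k l. ?T1 i j k l * cnj (?T1 i j l k)) = f"
  proof -
    have "?S (\<lambda>i j k l. ?T1 i j k l * cnj (?T1 i j l k)) =
      (\<Sum>k\<in>UNIV. \<Sum>l\<in>UNIV. (\<Sum>i\<in>UNIV. X $ i $ k * cnj (X $ i $ l)) * (\<Sum>j\<in>UNIV. P $ j $ l * cnj (P $ j $ k)))"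
      unfolding bilinear_cross[symmetric] by (simp add: mult_ac)
    also have "\<dots> = (\<Sum>k\<in>UNIV. \<Sum>l\<in>UNIV. (\<Sum>i\<in>UNIV. X $ i $ k * cnj (X $ i $ l)) * P $ k $ l)"
      using PP by (simp add: cP mult.commute)
    also have "\<dots> = (\<Sum>k\<in>UNIV. \<Sum>l\<in>UNIV. \<Sum>i\<in>UNIV. X $ i $ k * P $ k $ l * cnj (X $ i $ l))"
      by (simp add: sum_distrib_left sum_distrib_right mult_ac)
    also have "\<dots> = (\<Sum>l\<in>UNIV. \<Sum>k\<in>UNIV. \<Sum>i\<in>UNIV. X $ i $ k * P $ k $ l * cnj (X $ i $ l))"
      by (rule sum.swap)
    also have "\<dots> = (\<Sum>l\<in>UNIV. \<Sum>i\<in>UNIV. \<Sum>k\<in>UNIV. X $ i $ k * P $ k $ l * cnj (X $ i $ l))"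
      by (rule sum.cong[OF refl], rule sum.swap)
    also have "\<dots> = (\<Sum>i\<in>UNIV. \<Sum>l\<in>UNIV. X $ i $ l * cnj (X $ i $ l))"
      unfolding sum_distrib_right[symmetric] XP by (rule sum.swap)
    finally show ?thesis
      by (simp add: XX)
  qed
  have s22': "?S (\<lambda>i j k l. ?T2 i j k l * cnj (?T2 i j l k)) = f"
  proof -
    have "?S (\<lambda>i j k l. ?T2 i j k l * cnj (?T2 i j l k)) = ?S (\<lambda>i j k l. ?T1 j i k l * cnj (?T1 j i l k))"
      by (subst sw) (simp add: mult_ac)
    also have "\<dots> = ?S (\<lambda>i j k l. ?T1 i j k l * cnj (?T1 i j l k))"
      by (rule sum.swap)
    finally show ?thesis
      by (simp only: s11')
  qed
  have s12': "?S (\<lambda>i j k l. ?T1 i j k l * cnj (?T2 i j l k)) = 0"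
  proof -
    have "?S (\<lambda>i j k l. ?T1 i j k l * cnj (?T2 i j l k)) =
      (\<Sum>k\<in>UNIV. \<Sum>l\<in>UNIV. (\<Sum>i\<in>UNIV. X $ i $ k * cnj (P $ i $ l)) * (\<Sum>j\<in>UNIV. P $ j $ l * cnj (X $ j $ k)))"
      unfolding bilinear_cross[symmetric] by (simp add: mult_ac)
    then show ?thesis
      using PX by (simp add: cP mult.commute)
  qed
  have s21: "?S (\<lambda>i j k l. ?T2 i j k l * cnj (?T1 i j k l)) = 0"
    using arg_cong[OF s12, of cnj] by (simp add: mult.commute)
  have s21': "?S (\<lambda>i j k l. ?T2 i j k l * cnj (?T1 i j l k)) = 0"
    using arg_cong[OF s12', of cnj] by (subst sw) (simp add: mult.commute)
  \<comment> \<open>\<open>?U\<close> is the derivative of P tensor P. Antisymmetrizing its last two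
    indices gives 2 |U|^2 minus twice the product of U with its swap, that is 2 * 4 f - 2 * 2 f,
    where f is the squared norm of X.\<close>
  let ?U = "\<lambda>i j k l. ?T1 i j k l + ?T2 i j k l"
  have UU: "?S (\<lambda>i j k l. ?U i j k l * cnj (?U i j k l)) = 4 * f"
    using s11 s12 s21 s22 by (simp add: distrib_left distrib_right sum.distrib)
  have UU': "?S (\<lambda>i j k l. ?U i j k l * cnj (?U i j l k)) = 2 * f"
    using s11' s12' s21' s22' by (simp add: distrib_left distrib_right sum.distrib)
  have "?S (\<lambda>i j k l. (?U i j k l - ?U i j l k) * cnj (?U i j k l - ?U i j l k)) =
     ?S (\<lambda>i j k l. ?U i j k l * cnj (?U i j k l)) - ?S (\<lambda>i j k l. ?U i j k l * cnj (?U i j l k))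
     - (?S (\<lambda>i j k l. ?U i j l k * cnj (?U i j k l)) - ?S (\<lambda>i j k l. ?U i j l k * cnj (?U i j l k)))"
    unfolding complex_cnj_diff right_diff_distrib left_diff_distrib sum_subtractf by simp
  also have "?S (\<lambda>i j k l. ?U i j l k * cnj (?U i j k l)) = ?S (\<lambda>i j k l. ?U i j k l * cnj (?U i j l k))"
    by (rule sw)
  also have "?S (\<lambda>i j k l. ?U i j l k * cnj (?U i j l k)) = ?S (\<lambda>i j k l. ?U i j k l * cnj (?U i j k l))"
    by (rule sw[symmetric])
  finally have "?S (\<lambda>i j k l. (?U i j k l - ?U i j l k) * cnj (?U i j k l - ?U i j l k)) = of_real (4 * frob X)"
    unfolding UU UU' by (simp add: f_def)
  then have "complex_of_real (\<Sum>i\<in>UNIV. \<Sum>j\<in>UNIV. \<Sum>k\<in>UNIV. \<Sum>l\<in>UNIV. (cmod (?U i j k l - ?U i j l k))\<^sup>2) = of_real (4 * frob X)"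
    unfolding of_real_sum complex_norm_square .
  then show ?thesis
    unfolding of_real_eq_iff .
qed

context holomorphic_line
begin

text \<open>Proportionality to W in one index, combined with its conjugate in the other, makes Q a
  multiple of W W^*; the trace fixes the multiple.\<close>

lemma section_formula:
  assumes "\<And>I J K. poly (W I) z * Q z K J = poly (W K) z * Q z I J"
  shows "Q z I J * pker W W z z = poly (W I) z * cnj (poly (W J) z) * (\<Sum>K\<in>UNIV. Q z K K)"
proof -
  have "poly (W I) z * cnj (poly (W J) z) * Q z K K = (poly (W K) z * cnj (poly (W K) z)) * Q z I J" for K
  proof -
    have c: "cnj (poly (W J) z) * Q z I K = cnj (poly (W K) z) * Q z I J"
      using arg_cong[OF assms[of J K I], of cnj] by (simp flip: hermitian)
    have "poly (W I) z * cnj (poly (W J) z) * Q z K K = cnj (poly (W J) z) * (poly (W K) z * Q z I K)"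
      unfolding assms[of I K K, symmetric] by (simp only: mult_ac)
    also have "\<dots> = poly (W K) z * (cnj (poly (W J) z) * Q z I K)"
      by (simp only: mult_ac)
    finally show ?thesis
      unfolding c by (simp only: mult_ac)
  qed
  then show ?thesis
    by (simp add: pker_def sum_distrib_left sum_distrib_right mult.commute)
qed

end

text \<open>The matrix of the second exterior power on ordered pairs. For a projection onto a plane
  it is twice the projection onto the Pluecker line of the plane, hence has trace 2.\<close>

definition minors :: "complex^'n^'n \<Rightarrow> 'n \<times> 'n \<Rightarrow> 'n \<times> 'n \<Rightarrow> complex" where
  "minors P I J = P $ fst I $ fst J * P $ snd I $ snd J - P $ fst I $ snd J * P $ snd I $ fst J"

text \<open>The columns of P are combinations of a basis of L; since P fixes that basis, the
  coefficient vectors are dual to it and the trace is 1 + 1.\<close>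

lemma rank_two_decomposition:
  fixes P :: "complex^'n^'n"
  assumes P: "projection P L" and L: "vec.dim L = 2"
  obtains b1 b2 c1 c2 :: "complex^'n" where
    "\<And>i k. P $ i $ k = b1 $ i * c1 $ k + b2 $ i * c2 $ k" "trace P = 2" "L = vec.span {b1, b2}"
proof -
  have sub: "vec.subspace L"
  proof -
    have "L = {v. P *v v = v}"
      using projection_fix[OF P] by auto
    then show ?thesis
      by (auto simp: vec.subspace_def matrix_vector_right_distrib vector_scalar_commute)
  qed
  obtain B where B: "B \<subseteq> L" "vec.independent B" "L \<subseteq> vec.span B" "card B = 2"
    using vec.basis_exists[of L] L by metis
  then obtain b1 b2 where b: "B = {b1, b2}" "b1 \<noteq> b2"
    by (auto simp: card_2_iff)
  have span: "L = vec.span {b1, b2}"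
    using B b vec.span_subspace[OF _ _ sub] by blast
  have "\<exists>c d. P *v axis k 1 = c *s b1 + d *s b2" for k
  proof -
    have "P *v axis k 1 \<in> vec.span {b1, b2}"
      using projection_in[OF P] span by blast
    then obtain c where "P *v axis k 1 - c *s b1 \<in> vec.span {b2}"
      by (auto simp: vec.span_insert)
    then obtain d where "P *v axis k 1 - c *s b1 = d *s b2"
      by (auto simp: vec.span_singleton)
    then show ?thesis
      by (metis add.commute diff_eq_eq)
  qed
  then obtain c d where cd: "\<And>k. P *v axis k 1 = c k *s b1 + d k *s b2"
    by metis
  define c1 c2 :: "complex^'n" where "c1 = (\<chi> k. c k)" and "c2 = (\<chi> k. d k)"
  have nth: "P $ i $ k = b1 $ i * c1 $ k + b2 $ i * c2 $ k" for i k
    using arg_cong[OF cd[of k], of "\<lambda>v. v $ i"]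
    by (simp add: matrix_vector_mult_def axis_def c1_def c2_def if_distrib[of "\<lambda>c. _ * c"] mult.commute cong: if_cong)
  have fix12: "P *v b1 = b1" "P *v b2 = b2"
    using projection_fix[OF P, of b1] projection_fix[OF P, of b2] vec.span_base[of b1 "{b1, b2}"] vec.span_base[of b2 "{b1, b2}"]
    unfolding span by simp_all
  define dot where "dot = (\<lambda>x y :: complex^'n. \<Sum>k\<in>UNIV. x $ k * y $ k)"
  have Pv: "P *v v = dot c1 v *s b1 + dot c2 v *s b2" for v
    by (simp add: vec_eq_iff matrix_vector_mult_def nth dot_def sum.distrib sum_distrib_right sum_distrib_left algebra_simps)
  have indep: "x = 0 \<and> y = 0" if "x *s b1 + y *s b2 = 0" for x y
  proof -
    have "b1 \<notin> vec.span {b2}" "b2 \<notin> vec.span {b1}"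
      using B(2) b by (auto simp: vec.dependent_def insert_Diff_if)
    then have n: "b1 \<noteq> t *s b2" "b2 \<noteq> t *s b1" for t
      by (auto simp: vec.span_singleton)
    have "x = 0"
    proof (rule ccontr)
      assume "x \<noteq> 0"
      then have "b1 = (- y / x) *s b2"
        using that by (simp add: vec_eq_iff field_simps eq_neg_iff_add_eq_0)
      with n show False by blast
    qed
    moreover have "y = 0"
    proof (rule ccontr)
      assume "y \<noteq> 0"
      then have "b2 = (- x / y) *s b1"
        using that by (simp add: vec_eq_iff field_simps eq_neg_iff_add_eq_0 add.commute)
      with n show False by blast
    qed
    ultimately show ?thesis by simp
  qed
  have "(dot c1 b1 - 1) *s b1 + dot c2 b1 *s b2 = 0" "dot c1 b2 *s b1 + (dot c2 b2 - 1) *s b2 = 0"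
    using Pv[of b1] Pv[of b2] fix12 by (simp_all add: vec_eq_iff algebra_simps)
  then have "dot c1 b1 = 1" "dot c2 b2 = 1"
    using indep by fastforce+
  then have "trace P = 2"
    by (simp add: trace_def nth sum.distrib dot_def mult.commute)
  with nth span show ?thesis
    using that by blast
qed

section \<open>From primitive maps to polynomials\<close>

lemma local_coord_chart0: "local_coord UNIV chart0"
  unfolding local_coord_def sphere_holomorphic_on_def
proof (intro conjI ballI)
  show "inj chart0"
    by (simp add: inj_def chart0_def)
  fix z :: complex
  show "\<exists>V g. open V \<and> z \<in> V \<and> V \<subseteq> UNIV \<and> g holomorphic_on V \<and>
      ((\<forall>w\<in>V. chart0 w = chart0 (g w)) \<or> (\<forall>w\<in>V. chart0 w = chart1 (g w)))"
    by (intro exI[of _ UNIV] exI[of _ "\<lambda>w. w"]) auto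
qed simp

lemma local_coord_chart1: "local_coord UNIV chart1"
  unfolding local_coord_def sphere_holomorphic_on_def
proof (intro conjI ballI)
  show "inj chart1"
    by (auto simp: inj_def chart1_def)
  fix z :: complex
  show "\<exists>V g. open V \<and> z \<in> V \<and> V \<subseteq> UNIV \<and> g holomorphic_on V \<and>
      ((\<forall>w\<in>V. chart1 w = chart0 (g w)) \<or> (\<forall>w\<in>V. chart1 w = chart1 (g w)))"
    by (intro exI[of _ UNIV] exI[of _ "\<lambda>w. w"]) auto
qed simp

lemma chart1_eq_chart0: "w \<noteq> 0 \<Longrightarrow> chart1 w = chart0 (1 / w)"
  by (simp add: chart0_def chart1_def)

lemma rsphere_cases:
  obtains z where "x = chart0 z" | "x = chart1 0"
  by (cases x) (auto simp: chart0_def chart1_def)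

lemma smooth_grass_map_differentiable:
  assumes "smooth_grass_map k \<psi>" "c \<in> {chart0, chart1}"
  shows "(\<lambda>z. orth_proj (\<psi> (c z))) differentiable (at z)"
proof -
  have "smooth_on UNIV (\<lambda>z. orth_proj (\<psi> (c z)))"
    using assms unfolding smooth_grass_map_def by blast
  then have "C_k_on (Suc 0) UNIV (\<lambda>z. orth_proj (\<psi> (c z)))"
    unfolding smooth_on_def by blast
  then have "(\<lambda>z. orth_proj (\<psi> (c z))) differentiable_on UNIV"
    by simp
  then show ?thesis
    by (simp add: differentiable_on_def)
qed

lemma rank_one_decomposition:
  fixes P :: "complex^'n^'n"
  assumes P: "projection P L" and L: "vec.dim L = 1"
  obtains b c :: "complex^'n" where "\<And>i k. P $ i $ k = b $ i * c $ k" "trace P = 1"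
proof -
  have sub: "vec.subspace L"
  proof -
    have "L = {v. P *v v = v}"
      using projection_fix[OF P] by auto
    then show ?thesis
      by (auto simp: vec.subspace_def matrix_vector_right_distrib vector_scalar_commute)
  qed
  obtain B where B: "B \<subseteq> L" "vec.independent B" "L \<subseteq> vec.span B" "card B = 1"
    using vec.basis_exists[of L] L by metis
  then obtain b where b: "B = {b}"
    by (auto simp: card_1_singleton_iff)
  have span: "L = vec.span {b}"
    using B b vec.span_subspace[OF _ _ sub] by blast
  have b0: "b \<noteq> 0"
    using B(2) b by (auto simp: vec.dependent_single)
  have "\<exists>c. P *v axis k 1 = c *s b" for k
    using projection_in[OF P, of "axis k 1"] unfolding span by (auto simp: vec.span_singleton)
  then obtain c where c: "\<And>k. P *v axis k 1 = c k *s b"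
    by metis
  define c1 :: "complex^'n" where "c1 = (\<chi> k. c k)"
  have nth: "P $ i $ k = b $ i * c1 $ k" for i k
    using arg_cong[OF c[of k], of "\<lambda>v. v $ i"]
    by (simp add: matrix_vector_mult_def axis_def c1_def if_distrib[of "\<lambda>c. _ * c"] mult.commute cong: if_cong)
  have "P *v b = b"
    using projection_fix[OF P, of b] vec.span_base[of b "{b}"] unfolding span by simp
  then have "(\<Sum>k\<in>UNIV. c1 $ k * b $ k) *s b = b"
    by (simp add: vec_eq_iff matrix_vector_mult_def nth sum_distrib_right sum_distrib_left algebra_simps)
  then have "((\<Sum>k\<in>UNIV. c1 $ k * b $ k) - 1) *s b = 0"
    by (simp add: vec_eq_iff algebra_simps)
  then have "(\<Sum>k\<in>UNIV. c1 $ k * b $ k) = 1"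
    using b0 by (auto simp: vec_eq_iff)
  then have "trace P = 1"
    by (simp add: trace_def nth mult.commute)
  with nth show ?thesis
    using that by blast
qed

text \<open>The indices of P are interchanged against the rank-one matrix of G because the conjugate
  of G spans the line; the Frobenius norm is insensitive to this.\<close>

lemma frob_line:
  fixes G :: "'n::finite \<Rightarrow> complex poly"
  assumes G: "nonvanishing G" and P: "\<And>w a b. P w $ a $ b * pker G G w w = poly (G b) w * cnj (poly (G a) w)"
    and D: "has_wirt_mat P A B z"
  shows "frob A = fubini G z"
proof -
  have "P w $ a $ b = poly (G b) w * cnj (poly (G a) w) / pker G G w w" for w a b
    using P[of w a b] pker_nonzero[OF G] by (simp add: field_simps)
  then have "has_wirt (\<lambda>w. poly (G b) w * cnj (poly (G a) w) / pker G G w w) (A $ a $ b) (B $ a $ b) z" for a b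
    using D by (simp add: has_wirt_mat_def)
  from has_wirt_unique(1)[OF this has_wirt_rank_one[OF G]]
  have "A $ a $ b = (poly (vderiv G b) z * pker G G z z - poly (G b) z * pker (vderiv G) G z z) * cnj (poly (G a) z) / (pker G G z z)\<^sup>2" for a b .
  then have "frob A = (\<Sum>a\<in>UNIV. \<Sum>b\<in>UNIV. (cmod ((poly (vderiv G b) z * pker G G z z - poly (G b) z * pker (vderiv G) G z z) * cnj (poly (G a) z) / (pker G G z z)\<^sup>2))\<^sup>2)"
    by (simp add: frob_def)
  also have "\<dots> = fubini G z"
    by (subst sum.swap) (rule rank_one_norm[OF G])
  finally show ?thesis .
qed

text \<open>Half of \<open>minors\<close> is the rank-one projection of W. The squared norm of its
  \<partial>-derivative is \<open>fubini W\<close> on the one hand and, by the isometry of the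
  Pluecker embedding, (1 / 4) * 4 times that of A on the other.\<close>

lemma frob_plane:
  fixes W :: "'n::finite \<times> 'n \<Rightarrow> complex poly"
  assumes W: "nonvanishing W" and M: "\<And>w I J. minors (P w) I J * pker W W w w = 2 * (poly (W I) w * cnj (poly (W J) w))"
    and D: "has_wirt_mat P A B z"
    and P: "P z ** P z = P z" "adj (P z) = P z" "trace (P z) = 2" and A: "A ** P z = A" "P z ** A = 0"
  shows "frob A = fubini W z"
proof -
  let ?X = "\<lambda>I J. (A $ fst I $ fst J * P z $ snd I $ snd J + P z $ fst I $ fst J * A $ snd I $ snd J)
      - (A $ fst I $ snd J * P z $ snd I $ fst J + P z $ fst I $ snd J * A $ snd I $ fst J)"
  have d: "has_wirt (\<lambda>w. P w $ a $ b) (A $ a $ b) (B $ a $ b) z" for a b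
    using D by (simp add: has_wirt_mat_def)
  have m: "has_wirt (\<lambda>w. (1 / 2) * minors (P w) I J) ((1 / 2) * ?X I J)
     ((1 / 2) * ((B $ fst I $ fst J * P z $ snd I $ snd J + P z $ fst I $ fst J * B $ snd I $ snd J)
      - (B $ fst I $ snd J * P z $ snd I $ fst J + P z $ fst I $ snd J * B $ snd I $ fst J))) z" for I J
    unfolding minors_def by (intro has_wirt_cmult has_wirt_diff has_wirt_mult d)
  have e: "(\<lambda>w. (1 / 2) * minors (P w) I J) = (\<lambda>w. poly (W I) w * cnj (poly (W J) w) / pker W W w w)" for I J
    by (rule ext) (use M[of _ I J] pker_nonzero[OF W] in \<open>simp add: field_simps\<close>)
  have X: "(1 / 2) * ?X I J = (poly (vderiv W I) z * pker W W z z - poly (W I) z * pker (vderiv W) W z z) * cnj (poly (W J) z) / (pker W W z z)\<^sup>2" for I J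
    by (rule has_wirt_unique(1)[OF m[unfolded e] has_wirt_rank_one[OF W]])
  have "(\<Sum>I\<in>UNIV. \<Sum>J\<in>UNIV. (cmod ((1 / 2) * ?X I J))\<^sup>2) = fubini W z"
    unfolding X by (rule rank_one_norm[OF W])
  moreover have "(cmod ((1 / 2) * ?X I J))\<^sup>2 = (1 / 4) * (cmod (?X I J))\<^sup>2" for I J
    unfolding norm_mult power_mult_distrib by (simp add: power2_eq_square)
  ultimately have "(1 / 4) * (\<Sum>I\<in>UNIV. \<Sum>J\<in>UNIV. (cmod (?X I J))\<^sup>2) = fubini W z"
    by (simp only: sum_distrib_left)
  moreover have "(\<Sum>I\<in>UNIV. \<Sum>J\<in>UNIV. (cmod (?X I J))\<^sup>2) = 4 * frob A"
  proof -
    have "(\<Sum>I\<in>UNIV. g I) = (\<Sum>i\<in>UNIV. \<Sum>j\<in>UNIV. g (i, j))" for g :: "'n \<times> 'n \<Rightarrow> real"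
      by (simp add: sum.cartesian_product flip: UNIV_Times_UNIV)
    then show ?thesis
      unfolding pluecker_norm[OF P A, symmetric] by simp
  qed
  ultimately show ?thesis
    by simp
qed

section \<open>Primitive maps with holomorphic first component\<close>

locale primitive_sphere =
  fixes \<psi>0 \<psi>1 \<psi>2 :: "rsphere \<Rightarrow> (complex^5) set" and \<Psi>
  assumes \<Psi>: "\<Psi> = (\<lambda>x. [\<psi>0 x, \<psi>1 x, \<psi>2 x])"
    and prim: "primitive [2, 2, 1] \<Psi>"
    and hol: "holomorphic_grass_map 2 \<psi>0"
begin

definition "P0 c w = orth_proj (\<psi>0 (c w))"
definition "P1 c w = orth_proj (\<psi>1 (c w))"
definition "P2 c w = orth_proj (\<psi>2 (c w))"

lemma flag: "[\<psi>0 x, \<psi>1 x, \<psi>2 x] \<in> flag_manifold [2, 2, 1]"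
  using prim by (simp add: primitive_def smooth_flag_map_def \<Psi>)

lemmas proj = flag_projections[OF flag]

lemma projections: "projection (P0 c w) (\<psi>0 (c w))" "projection (P1 c w) (\<psi>1 (c w))" "projection (P2 c w) (\<psi>2 (c w))"
  unfolding P0_def P1_def P2_def by (rule proj)+

lemma smooth: "smooth_grass_map 2 \<psi>0" "smooth_grass_map 2 \<psi>1" "smooth_grass_map 1 \<psi>2"
proof -
  have "\<forall>i<length [2, 2, 1]. smooth_grass_map ([2, 2, 1] ! i) (\<lambda>x. \<Psi> x ! i)"
    using prim by (simp add: primitive_def smooth_flag_map_def)
  from this[rule_format, of 0] this[rule_format, of 1] this[rule_format, of 2]
  show "smooth_grass_map 2 \<psi>0" "smooth_grass_map 2 \<psi>1" "smooth_grass_map 1 \<psi>2"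
    by (simp_all add: \<Psi>)
qed

lemma differentiable:
  assumes "c \<in> {chart0, chart1}"
  shows "P0 c differentiable (at z)" "P2 c differentiable (at z)"
  using smooth_grass_map_differentiable[OF smooth(1) assms] smooth_grass_map_differentiable[OF smooth(3) assms]
  by (simp_all add: P0_def[abs_def] P2_def[abs_def])

text \<open>The condition that is not immediate is A2 P2 = 0, antiholomorphy of psi_2. Its
  psi_2-component vanishes for any projection, its psi_1-component by primitivity, and its
  psi_0-component, which primitivity permits cyclically, because psi_0 is holomorphic.\<close>

lemma point:
  assumes c: "c \<in> {chart0, chart1}"
  shows "primitive_point (P0 c) (P1 c) (P2 c) z UNIV (del_z_mat (P0 c) z) (del_zbar_mat (P0 c) z)
    (del_z_mat (P2 c) z) (del_zbar_mat (P2 c) z)"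
proof -
  define A0 B0 A2 B2 where "A0 = del_z_mat (P0 c) z" and "B0 = del_zbar_mat (P0 c) z"
    and "A2 = del_z_mat (P2 c) z" and "B2 = del_zbar_mat (P2 c) z"
  have D0: "has_wirt_mat (P0 c) A0 B0 z" and D2: "has_wirt_mat (P2 c) A2 B2 z"
    unfolding A0_def B0_def A2_def B2_def using differentiable[OF c] by (intro differentiable_has_wirt_mat; simp)+
  have pr: "P0 c w ** P0 c w = P0 c w" "P2 c w ** P2 c w = P2 c w" "adj (P0 c w) = P0 c w" "adj (P2 c w) = P2 c w"
    "P0 c w ** P2 c w = 0" "P0 c w + P1 c w + P2 c w = mat 1" for w
    using projections[of c w] proj(4,7)[of "c w"] by (simp_all add: projection_def P0_def P1_def P2_def)
  have p20: "P2 c w ** P0 c w = 0" for w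
  proof -
    have "P2 c w ** P0 c w = adj (P0 c w ** P2 c w)"
      by (simp only: adj_mult pr(3,4))
    then show ?thesis
      by (simp add: pr adj_zero)
  qed
  have lc: "local_coord UNIV c"
    using c local_coord_chart0 local_coord_chart1 by blast
  have e0: "B0 = B0 ** P0 c z + P0 c z ** B0" "A0 = A0 ** P0 c z + P0 c z ** A0"
    using has_wirt_mat_unique[OF D0] has_wirt_mat_mult[OF D0 D0] unfolding pr by blast+
  have e2: "A2 = A2 ** P2 c z + P2 c z ** A2"
    using has_wirt_mat_unique[OF D2] has_wirt_mat_mult[OF D2 D2] unfolding pr by blast
  have corner: "P ** X ** P = 0" if "P ** P = P" "X = X ** P + P ** X" for P X :: "complex^5^5"
  proof -
    have "P ** X ** P = P ** (X ** P + P ** X) ** P"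
      using that(2) by simp
    also have "\<dots> = P ** X ** (P ** P) + (P ** P) ** X ** P"
      by (simp add: matrix_add_ldistrib matrix_add_rdistrib matrix_mul_assoc)
    finally show ?thesis
      by (simp add: that(1))
  qed
  have "(mat 1 - P0 c z) ** B0 ** P0 c z = 0"
    using hol lc unfolding holomorphic_grass_map_def B0_def P0_def[abs_def] by blast
  then have B0P0: "B0 ** P0 c z = 0"
    unfolding matrix_sub_rdistrib corner[OF pr(1) e0(1)] by simp
  have "has_wirt_mat (P0 c) (adj B0) (adj A0) z"
    using has_wirt_mat_adj[OF D0] unfolding pr(3) .
  from has_wirt_mat_unique(1)[OF this D0] have adjB0: "adj B0 = A0" .
  have "P0 c z ** A0 = adj (B0 ** P0 c z)"
    unfolding adj_mult pr(3) adjB0 ..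
  then have P0A0: "P0 c z ** A0 = 0"
    unfolding B0P0 adj_zero .
  have A0P0: "A0 ** P0 c z = A0"
    using e0(2)[symmetric] unfolding P0A0 by simp
  have dc: "del_z_comp \<Psi> c z i j = 0" if "i < 3" "j < 3" "i \<noteq> j" "j \<noteq> Suc i mod 3" for i j
  proof -
    have len: "length [2, 2, 1 :: nat] = 3"
      by simp
    have "\<forall>i<3. \<forall>j<3. i \<noteq> j \<and> j \<noteq> Suc i mod 3 \<longrightarrow> del_z_comp \<Psi> c z i j = 0"
      using prim lc unfolding primitive_def len by blast
    then show ?thesis
      using that by blast
  qed
  have "P2 c z ** A0 ** P0 c z = 0"
    using dc[of 0 2] by (simp add: del_z_comp_def \<Psi> A0_def P0_def[abs_def] P2_def)
  then have P2A0: "P2 c z ** A0 = 0"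
    by (simp add: A0P0 flip: matrix_mul_assoc)
  have "P1 c z ** A2 ** P2 c z = 0"
    using dc[of 2 1] by (simp add: del_z_comp_def \<Psi> A2_def P1_def P2_def[abs_def])
  moreover have "P2 c z ** A2 ** P2 c z = 0"
    by (rule corner[OF pr(2) e2])
  moreover have "P0 c z ** A2 ** P2 c z = 0"
  proof -
    have "has_wirt_mat (\<lambda>_. 0) (A0 ** P2 c z + P0 c z ** A2) (B0 ** P2 c z + P0 c z ** B2) z"
      using has_wirt_mat_mult[OF D0 D2] unfolding pr(5) .
    from has_wirt_mat_unique(1)[OF this has_wirt_mat_const]
    have "A0 ** P2 c z + P0 c z ** A2 = 0" .
    moreover have "A0 ** P2 c z = 0"
      by (subst A0P0[symmetric]) (simp add: pr flip: matrix_mul_assoc)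
    ultimately show ?thesis
      by simp
  qed
  ultimately have "(P0 c z + P1 c z + P2 c z) ** A2 ** P2 c z = 0"
    by (simp add: matrix_add_rdistrib)
  then have A2P2: "A2 ** P2 c z = 0"
    by (simp add: pr)
  have "P1 c w = mat 1 - P0 c w - P2 c w" for w
    using pr(6)[of w] by (simp add: algebra_simps)
  then show ?thesis
    unfolding A0_def[symmetric] B0_def[symmetric] A2_def[symmetric] B2_def[symmetric]
    by unfold_locales (simp_all add: pr p20 D0 D2 B0P0 A2P2 P2A0)
qed

lemma chart_limit:
  assumes "F chart0 differentiable (at 0)" "\<And>z. F chart1 differentiable (at z)"
    and F: "\<And>c z. F c z = orth_proj (\<phi> (c z) :: (complex^5) set)"
  shows "((\<lambda>z. F chart0 z $ a $ b) \<longlongrightarrow> F chart1 0 $ a $ b) at_infinity"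
proof -
  have "(\<lambda>z. F chart1 z $ a $ b) differentiable (at 0)"
    by (intro differentiable_vec_nth assms)
  then have "isCont (\<lambda>z. F chart1 z $ a $ b) 0"
    by (rule differentiable_imp_continuous_within)
  from tendsto_reciprocal_at_infinity[OF this]
  show ?thesis
  proof (rule Lim_transform_eventually)
    show "\<forall>\<^sub>F z in at_infinity. F chart1 (1 / z) $ a $ b = F chart0 z $ a $ b"
      unfolding eventually_at_infinity
    proof (intro exI[of _ 1] allI impI)
      fix x :: complex assume "1 \<le> cmod x"
      then have "x \<noteq> 0"
        by auto
      then show "F chart1 (1 / x) $ a $ b = F chart0 x $ a $ b"
        by (simp add: F chart1_eq_chart0)
    qed
  qed
qed

lemma limits:
  "((\<lambda>z. P0 chart0 z $ a $ b) \<longlongrightarrow> P0 chart1 0 $ a $ b) at_infinity"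
  "((\<lambda>z. P2 chart0 z $ a $ b) \<longlongrightarrow> P2 chart1 0 $ a $ b) at_infinity"
  using chart_limit[of P0 \<psi>0] chart_limit[of P2 \<psi>2] differentiable by (simp_all add: P0_def P2_def)

lemma decomposition0: "\<exists>b1 b2 c1 c2. \<forall>i k. P0 c w $ i $ k = b1 $ i * c1 $ k + b2 $ i * (c2 :: complex^5) $ k"
  by (rule rank_two_decomposition[OF projections(1) proj(8), of c w]) meson

lemma decomposition2: "\<exists>b c1. \<forall>i k. P2 c w $ i $ k = b $ i * (c1 :: complex^5) $ k"
  by (rule rank_one_decomposition[OF projections(3) proj(10), of c w]) meson

lemma traces: "trace (P0 c w) = 2" "trace (P2 c w) = 1"
proof -
  show "trace (P0 c w) = 2"
    by (rule rank_two_decomposition[OF projections(1) proj(8), of c w])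
  show "trace (P2 c w) = 1"
    by (rule rank_one_decomposition[OF projections(3) proj(10), of c w])
qed

lemma hermitian: "P0 c w $ j $ i = cnj (P0 c w $ i $ j)" "P2 c w $ j $ i = cnj (P2 c w $ i $ j)"
  using projections(1,3)[of c w] unfolding projection_def by (metis adj_nth)+

lemma minors_rank1: "minors (P0 c w) I J * minors (P0 c w) K M = minors (P0 c w) I M * minors (P0 c w) K J"
proof -
  obtain b1 b2 c1 c2 where "\<And>i k. P0 c w $ i $ k = b1 $ i * c1 $ k + b2 $ i * c2 $ k"
    using decomposition0[of c w] by meson
  then have "minors (P0 c w) I J = (b1 $ fst I * b2 $ snd I - b2 $ fst I * b1 $ snd I) * (c1 $ fst J * c2 $ snd J - c2 $ fst J * c1 $ snd J)" for I J
    by (simp add: minors_def algebra_simps)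
  then show ?thesis
    by simp
qed

text \<open>Contracting one pair of indices gives (tr P) P - P P = 2 P - P, so the plane is
  recovered from its minors.\<close>

lemma minors_trace: "(\<Sum>K\<in>UNIV. minors (P0 c w) K K) = 2" "(\<Sum>j\<in>UNIV. minors (P0 c w) (i, j) (k, j)) = P0 c w $ i $ k"
proof -
  have PP: "(\<Sum>j\<in>UNIV. P0 c w $ i $ j * P0 c w $ j $ k) = P0 c w $ i $ k" for i k
  proof -
    have "P0 c w ** P0 c w = P0 c w"
      using projections(1)[of c w] by (simp add: projection_def)
    from arg_cong[OF this, of "\<lambda>X. X $ i $ k"] show ?thesis
      by (simp add: matrix_matrix_mult_def)
  qed
  have tr: "(\<Sum>j\<in>UNIV. P0 c w $ j $ j) = 2"
    using traces(1)[of c w] by (simp add: trace_def)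
  show *: "(\<Sum>j\<in>UNIV. minors (P0 c w) (i, j) (k, j)) = P0 c w $ i $ k" for i k
    by (simp add: minors_def sum_subtractf PP tr flip: sum_distrib_left)
  have "(\<Sum>K\<in>UNIV. minors (P0 c w) K K) = (\<Sum>i\<in>UNIV. \<Sum>j\<in>UNIV. minors (P0 c w) (i, j) (i, j))"
    by (simp add: sum.cartesian_product flip: UNIV_Times_UNIV)
  then show "(\<Sum>K\<in>UNIV. minors (P0 c w) K K) = 2"
    by (simp add: * tr)
qed

text \<open>Transposition conjugates the projection, so the antiholomorphic line psi_2 becomes a
  holomorphic one. The \<partial>-bar relation comes from B2 = B2 P2, which keeps the row direction
  of the rank-one matrix.\<close>

lemma line2: "holomorphic_line (\<lambda>z I J. P2 chart0 z $ J $ I) (\<lambda>I J. P2 chart1 0 $ J $ I)"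
proof
  fix z I J K M
  interpret primitive_point "P0 chart0" "P1 chart0" "P2 chart0" z UNIV "del_z_mat (P0 chart0) z" "del_zbar_mat (P0 chart0) z"
    "del_z_mat (P2 chart0) z" "del_zbar_mat (P2 chart0) z"
    by (rule point) simp
  obtain b c where bc: "\<And>i k. P2 chart0 z $ i $ k = b $ i * c $ k"
    using decomposition2[of chart0 z] by meson
  show "P2 chart0 z $ J $ I * P2 chart0 z $ M $ K = P2 chart0 z $ M $ I * P2 chart0 z $ J $ K"
    by (simp add: bc)
  show "P2 chart0 z $ I $ J = cnj (P2 chart0 z $ J $ I)"
    by (rule hermitian)
  show "(\<lambda>z. P2 chart0 z $ J $ I) differentiable at z"
    by (intro differentiable_vec_nth differentiable) simp
  have w: "has_wirt (\<lambda>z. P2 chart0 z $ J $ I) (del_z_mat (P2 chart0) z $ J $ I) (del_zbar_mat (P2 chart0) z $ J $ I) z" for J I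
    using D2 by (simp add: has_wirt_mat_def)
  define \<beta> where "\<beta> = (\<lambda>J. \<Sum>m\<in>UNIV. del_zbar_mat (P2 chart0) z $ J $ m * b $ m)"
  have "del_zbar_mat (P2 chart0) z $ J $ I = \<beta> J * c $ I" for J I
    using arg_cong[OF prod2(2), of "\<lambda>X. X $ J $ I"]
    by (simp add: matrix_matrix_mult_def bc \<beta>_def sum_distrib_right mult.assoc)
  then show "P2 chart0 z $ J $ J * del_zbar (\<lambda>z. P2 chart0 z $ J $ I) z = P2 chart0 z $ J $ I * del_zbar (\<lambda>z. P2 chart0 z $ J $ J) z"
    using has_wirt_del(2)[OF w] by (simp add: bc)
next
  fix z
  show "\<exists>J. P2 chart0 z $ J $ J \<noteq> 0"
    using traces(2)[of chart0 z] by (metis (no_types, lifting) sum.neutral trace_def zero_neq_one)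
next
  fix I J
  show "((\<lambda>z. P2 chart0 z $ J $ I) \<longlongrightarrow> P2 chart1 0 $ J $ I) at_infinity"
    by (rule limits)
next
  show "\<exists>J. P2 chart1 0 $ J $ J \<noteq> 0"
    using traces(2)[of chart1 0] by (metis (no_types, lifting) sum.neutral trace_def zero_neq_one)
qed

text \<open>B0 = P0 B0 keeps the columns of \<partial>-bar P0 in the plane, so \<partial>-bar of the
  minors remains proportional to the same bivector \<open>b\<close>.\<close>

lemma line0: "holomorphic_line (\<lambda>z I J. minors (P0 chart0 z) I J) (\<lambda>I J. minors (P0 chart1 0) I J)"
proof
  fix z I J K M
  interpret primitive_point "P0 chart0" "P1 chart0" "P2 chart0" z UNIV "del_z_mat (P0 chart0) z" "del_zbar_mat (P0 chart0) z"
    "del_z_mat (P2 chart0) z" "del_zbar_mat (P2 chart0) z"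
    by (rule point) simp
  show "minors (P0 chart0 z) I J * minors (P0 chart0 z) K M = minors (P0 chart0 z) I M * minors (P0 chart0 z) K J"
    by (rule minors_rank1)
  show "minors (P0 chart0 z) J I = cnj (minors (P0 chart0 z) I J)"
    by (simp add: minors_def flip: hermitian)
  have w: "has_wirt (\<lambda>z. P0 chart0 z $ i $ k) (del_z_mat (P0 chart0) z $ i $ k) (del_zbar_mat (P0 chart0) z $ i $ k) z" for i k
    using D0 by (simp add: has_wirt_mat_def)
  let ?B = "del_zbar_mat (P0 chart0) z" and ?A = "del_z_mat (P0 chart0) z" and ?P = "P0 chart0 z"
  have m: "has_wirt (\<lambda>z. minors (P0 chart0 z) I J)
     ((?A $ fst I $ fst J * ?P $ snd I $ snd J + ?P $ fst I $ fst J * ?A $ snd I $ snd J)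
      - (?A $ fst I $ snd J * ?P $ snd I $ fst J + ?P $ fst I $ snd J * ?A $ snd I $ fst J))
     ((?B $ fst I $ fst J * ?P $ snd I $ snd J + ?P $ fst I $ fst J * ?B $ snd I $ snd J)
      - (?B $ fst I $ snd J * ?P $ snd I $ fst J + ?P $ fst I $ snd J * ?B $ snd I $ fst J)) z" for I J
    unfolding minors_def by (intro has_wirt_diff has_wirt_mult w)
  then show "(\<lambda>z. minors (P0 chart0 z) I J) differentiable at z"
    by (rule has_wirt_differentiable)
  obtain b1 b2 c1 c2 where bc: "\<And>i k. P0 chart0 z $ i $ k = b1 $ i * c1 $ k + b2 $ i * c2 $ k"
    using decomposition0[of chart0 z] by meson
  define \<beta>1 where "\<beta>1 = (\<lambda>k. \<Sum>m\<in>UNIV. c1 $ m * ?B $ m $ k)"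
  define \<beta>2 where "\<beta>2 = (\<lambda>k. \<Sum>m\<in>UNIV. c2 $ m * ?B $ m $ k)"
  have B: "?B $ i $ k = b1 $ i * \<beta>1 k + b2 $ i * \<beta>2 k" for i k
    using arg_cong[OF prod0(2), of "\<lambda>X. X $ i $ k"]
    by (simp add: matrix_matrix_mult_def bc \<beta>1_def \<beta>2_def sum_distrib_left sum.distrib algebra_simps)
  show "minors (P0 chart0 z) J J * del_zbar (\<lambda>z. minors (P0 chart0 z) I J) z = minors (P0 chart0 z) I J * del_zbar (\<lambda>z. minors (P0 chart0 z) J J) z"
  proof -
    define b where "b = (\<lambda>I. b1 $ fst I * b2 $ snd I - b2 $ fst I * b1 $ snd I)"
    define c where "c = c1 $ fst J * c2 $ snd J - c2 $ fst J * c1 $ snd J"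
    define \<gamma> where "\<gamma> = \<beta>1 (fst J) * c2 $ snd J + c1 $ fst J * \<beta>2 (snd J) - \<beta>1 (snd J) * c2 $ fst J - c1 $ snd J * \<beta>2 (fst J)"
    have "minors (P0 chart0 z) I J = b I * c" for I
      by (simp add: minors_def bc b_def c_def algebra_simps)
    moreover have "del_zbar (\<lambda>z. minors (P0 chart0 z) I J) z = b I * \<gamma>" for I
      unfolding has_wirt_del(2)[OF m] by (simp add: B bc b_def \<gamma>_def algebra_simps)
    ultimately show ?thesis
      by simp
  qed
next
  fix z
  show "\<exists>J. minors (P0 chart0 z) J J \<noteq> 0"
    using minors_trace(1)[of chart0 z] by (metis (no_types, lifting) sum.neutral zero_neq_numeral)
next
  fix I J
  show "((\<lambda>z. minors (P0 chart0 z) I J) \<longlongrightarrow> minors (P0 chart1 0) I J) at_infinity"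
    unfolding minors_def by (intro tendsto_intros limits)
next
  show "\<exists>J. minors (P0 chart1 0) J J \<noteq> 0"
    using minors_trace(1)[of chart1 0] by (metis (no_types, lifting) sum.neutral zero_neq_numeral)
qed

end

section \<open>Affine changes of coordinate\<close>

definition vaff :: "real \<Rightarrow> complex \<Rightarrow> ('a \<Rightarrow> complex poly) \<Rightarrow> 'a \<Rightarrow> complex poly" where
  "vaff r s W i = pcompose (W i) [:- s / of_real r, 1 / of_real r:]"

lemma poly_vaff: "poly (vaff r s W i) z = poly (W i) ((z - s) / of_real r)"
  by (simp add: vaff_def poly_pcompose diff_divide_distrib)

lemma poly_vderiv_vaff: "poly (vderiv (vaff r s W) i) z = poly (vderiv W i) ((z - s) / of_real r) / of_real r"
  by (simp add: vaff_def vderiv_def pderiv_pcompose poly_pcompose pderiv_pCons diff_divide_distrib)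

lemma nonvanishing_vaff: "nonvanishing W \<Longrightarrow> nonvanishing (vaff r s W)"
  by (simp add: nonvanishing_def poly_vaff)

lemma dlog_vaff: "dlog (vaff r s W) z = dlog W ((z - s) / of_real r) / of_real r"
  by (simp add: dlog_def pker_def poly_vaff poly_vderiv_vaff sum_divide_distrib mult.commute[of "of_real r"])

lemma degenerate_vaff:
  assumes "degenerate (vaff r s W) z" "r \<noteq> 0"
  shows "degenerate W ((z - s) / of_real r)"
proof -
  have m: "mat_poly (vaff r s W) z = mat_poly W ((z - s) / of_real r)"
    by (simp add: mat_poly_def poly_vaff)
  have d: "mat_poly (vderiv W) ((z - s) / of_real r) *v x = of_real r *s (mat_poly (vderiv (vaff r s W)) z *v x)" for x
    using assms(2) by (simp add: vec_eq_iff matrix_vector_mult_def mat_poly_def poly_vderiv_vaff sum_distrib_left)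
  obtain y where y: "\<And>x. \<exists>t v. mat_poly (vderiv (vaff r s W)) z *v x = t *s y + mat_poly (vaff r s W) z *v v"
    using assms(1) unfolding degenerate_def by blast
  show ?thesis
    unfolding degenerate_def
  proof (intro exI[of _ y] allI)
    fix x
    obtain t v where "mat_poly (vderiv (vaff r s W)) z *v x = t *s y + mat_poly W ((z - s) / of_real r) *v v"
      using y[of x] unfolding m by blast
    then have "mat_poly (vderiv W) ((z - s) / of_real r) *v x = (of_real r * t) *s y + mat_poly W ((z - s) / of_real r) *v (of_real r *s v)"
      unfolding d vector_scalar_commute by (simp add: vector_add_ldistrib)
    then show "\<exists>t v. mat_poly (vderiv W) ((z - s) / of_real r) *v x = t *s y + mat_poly W ((z - s) / of_real r) *v v"
      by blast
  qed
qed

lemma span_eqI: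
  fixes S :: "(complex^'n) set"
  assumes "vec.subspace S" "S \<subseteq> vec.span B" "finite B" "card B \<le> vec.dim S"
  shows "S = vec.span B"
proof (rule vec.subspace_dim_equal[OF assms(1) vec.subspace_span assms(2)])
  have "vec.dim (vec.span B) \<le> card B"
    using assms(3) by (metis vec.dim_le_card' vec.dim_span)
  then show "vec.dim (vec.span B) \<le> vec.dim S"
    using assms(4) by simp
qed

section \<open>Polynomial representatives of primitive maps\<close>

context primitive_sphere
begin

lemma continuous_nth:
  assumes "c \<in> {chart0, chart1}"
  shows "continuous_on UNIV (\<lambda>w. P0 c w $ a $ b)" "continuous_on UNIV (\<lambda>w. P2 c w $ a $ b)"
  using differentiable_vec_nth[OF differentiable_vec_nth[OF differentiable(1)[OF assms]]]
    differentiable_vec_nth[OF differentiable_vec_nth[OF differentiable(2)[OF assms]]]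
  by (auto simp: continuous_on_eq_continuous_at intro!: differentiable_imp_continuous_within)

text \<open>W is the Pluecker vector of psi_0 and the conjugate of G spans psi_2; the factor 2 is
  the trace of \<open>minors\<close>, and the indices for P2 are interchanged because of the
  conjugation.\<close>

definition represented :: "(complex \<Rightarrow> rsphere) \<Rightarrow> (5 \<times> 5 \<Rightarrow> complex poly) \<Rightarrow> (5 \<Rightarrow> complex poly) \<Rightarrow> bool" where
  "represented c W G \<longleftrightarrow> nonvanishing W \<and> nonvanishing G \<and>
     (\<forall>w I J. minors (P0 c w) I J * pker W W w w = 2 * (poly (W I) w * cnj (poly (W J) w))) \<and>
     (\<forall>w a b. P2 c w $ a $ b * pker G G w w = poly (G b) w * cnj (poly (G a) w))"

lemma represented_exists: "\<exists>W G. represented chart0 W G"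
proof -
  interpret l0: holomorphic_line "\<lambda>z I J. minors (P0 chart0 z) I J" "\<lambda>I J. minors (P0 chart1 0) I J"
    by (rule line0)
  interpret l2: holomorphic_line "\<lambda>z I J. P2 chart0 z $ J $ I" "\<lambda>I J. P2 chart1 0 $ J $ I"
    by (rule line2)
  obtain W where W: "nonvanishing W" "\<And>z I J K. poly (W I) z * minors (P0 chart0 z) K J = poly (W K) z * minors (P0 chart0 z) I J"
    using l0.algebraic by blast
  obtain G where G: "nonvanishing G" "\<And>z I J K. poly (G I) z * P2 chart0 z $ J $ K = poly (G K) z * P2 chart0 z $ J $ I"
    using l2.algebraic by blast
  have "minors (P0 chart0 z) I J * pker W W z z = 2 * (poly (W I) z * cnj (poly (W J) z))" for z I J
    using l0.section_formula[OF W(2)] unfolding minors_trace(1) by simp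
  moreover have "P2 chart0 z $ a $ b * pker G G z z = poly (G b) z * cnj (poly (G a) z)" for z a b
    using l2.section_formula[OF G(2), of z a b] traces(2)[of chart0 z] by (simp add: trace_def)
  ultimately show ?thesis
    unfolding represented_def using W G by blast
qed

text \<open>Away from w = 0 this is the substitution z = 1 / w; continuity covers the point at
  infinity.\<close>

lemma represented_vrev:
  assumes "represented chart0 W G"
  shows "represented chart1 (vrev W) (vrev G)"
proof -
  have W: "nonvanishing W" and G: "nonvanishing G"
    and M: "\<And>w I J. minors (P0 chart0 w) I J * pker W W w w = 2 * (poly (W I) w * cnj (poly (W J) w))"
    and P: "\<And>w a b. P2 chart0 w $ a $ b * pker G G w w = poly (G b) w * cnj (poly (G a) w)"
    using assms by (auto simp: represented_def)
  have ker: "pker (vrev U) (vrev U) w w = (w ^ vdeg U * cnj (w ^ vdeg U)) * pker U U (1 / w) (1 / w)"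
    if "w \<noteq> 0" for w and U :: "'c::finite \<Rightarrow> complex poly"
    using that by (simp add: pker_def poly_vrev sum_distrib_left mult_ac)
  have "minors (P0 chart1 w) I J * pker (vrev W) (vrev W) w w = 2 * (poly (vrev W I) w * cnj (poly (vrev W J) w))" for w I J
  proof (rule eq_off_finite[where Z = "{0}" and f = "\<lambda>w. minors (P0 chart1 w) I J * pker (vrev W) (vrev W) w w"
        and g = "\<lambda>w. 2 * (poly (vrev W I) w * cnj (poly (vrev W J) w))"])
    show "continuous_on UNIV (\<lambda>w. minors (P0 chart1 w) I J * pker (vrev W) (vrev W) w w)"
      unfolding minors_def pker_def by (intro continuous_intros continuous_nth) auto
    show "continuous_on UNIV (\<lambda>w. 2 * (poly (vrev W I) w * cnj (poly (vrev W J) w)))"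
      by (intro continuous_intros)
    fix w :: complex assume "w \<notin> {0}"
    then have w: "w \<noteq> 0" by simp
    have "minors (P0 chart1 w) I J * pker (vrev W) (vrev W) w w =
        (w ^ vdeg W * cnj (w ^ vdeg W)) * (minors (P0 chart0 (1 / w)) I J * pker W W (1 / w) (1 / w))"
      unfolding ker[OF w] by (simp add: P0_def chart1_eq_chart0[OF w] mult_ac)
    then show "minors (P0 chart1 w) I J * pker (vrev W) (vrev W) w w = 2 * (poly (vrev W I) w * cnj (poly (vrev W J) w))"
      unfolding M poly_vrev[OF w] by (simp add: mult_ac)
  qed simp
  moreover have "P2 chart1 w $ a $ b * pker (vrev G) (vrev G) w w = poly (vrev G b) w * cnj (poly (vrev G a) w)" for w a b
  proof (rule eq_off_finite[where Z = "{0}" and f = "\<lambda>w. P2 chart1 w $ a $ b * pker (vrev G) (vrev G) w w"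
        and g = "\<lambda>w. poly (vrev G b) w * cnj (poly (vrev G a) w)"])
    show "continuous_on UNIV (\<lambda>w. P2 chart1 w $ a $ b * pker (vrev G) (vrev G) w w)"
      unfolding pker_def by (intro continuous_intros continuous_nth) auto
    show "continuous_on UNIV (\<lambda>w. poly (vrev G b) w * cnj (poly (vrev G a) w))"
      by (intro continuous_intros)
    fix w :: complex assume "w \<notin> {0}"
    then have w: "w \<noteq> 0" by simp
    have "P2 chart1 w $ a $ b * pker (vrev G) (vrev G) w w =
        (w ^ vdeg G * cnj (w ^ vdeg G)) * (P2 chart0 (1 / w) $ a $ b * pker G G (1 / w) (1 / w))"
      unfolding ker[OF w] by (simp add: P2_def chart1_eq_chart0[OF w] mult_ac)
    then show "P2 chart1 w $ a $ b * pker (vrev G) (vrev G) w w = poly (vrev G b) w * cnj (poly (vrev G a) w)"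
      unfolding P poly_vrev[OF w] by (simp add: mult_ac)
  qed simp
  ultimately show ?thesis
    unfolding represented_def using vrev_nonvanishing[OF W] vrev_nonvanishing[OF G] by blast
qed

lemma metric_eq:
  assumes "represented c W G" "c \<in> {chart0, chart1}"
  shows "flag_metric [2, 2, 1] \<Lambda> (tangent_comp \<Psi> c z X) (tangent_comp \<Psi> c z Y) =
    (\<Lambda> 0 1 * fubini W z + \<Lambda> 1 2 * fubini G z) * (X \<bullet> Y)"
proof -
  interpret primitive_point "P0 c" "P1 c" "P2 c" z UNIV "del_z_mat (P0 c) z" "del_zbar_mat (P0 c) z"
    "del_z_mat (P2 c) z" "del_zbar_mat (P2 c) z"
    by (rule point) (fact assms)
  have "frob (del_z_mat (P2 c) z) = fubini G z"
    by (rule frob_line[OF _ _ D2]) (use assms in \<open>auto simp: represented_def\<close>)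
  moreover have "frob (del_z_mat (P0 c) z) = fubini W z"
  proof (rule frob_plane[OF _ _ D0])
    show "nonvanishing W" "\<And>w I J. minors (P0 c w) I J * pker W W w w = 2 * (poly (W I) w * cnj (poly (W J) w))"
      using assms(1) by (auto simp: represented_def)
    show "P0 c z ** P0 c z = P0 c z" "adj (P0 c z) = P0 c z"
      using projections(1)[of c z] by (simp_all add: projection_def)
    show "trace (P0 c z) = 2"
      by (rule traces)
    show "del_z_mat (P0 c) z ** P0 c z = del_z_mat (P0 c) z"
      by (rule prod0(1)[symmetric])
    show "P0 c z ** del_z_mat (P0 c) z = 0"
      by (rule P0A0)
  qed
  ultimately show ?thesis
    using flag_metric_eq[of \<Psi> c 2 2 1 \<Lambda> X Y] by (simp add: \<Psi> P0_def P1_def P2_def)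
qed

text \<open>W inherits every linear property of the columns of \<open>minors\<close>, to which it is
  proportional. Contraction of the minors exhibits P0 as a multiple of W W^*, so vectors in the
  kernel of P0 are annihilated by W^*.\<close>

lemma represented_bivector:
  assumes "represented c W G" "c \<in> {chart0, chart1}"
  shows "W (b, a) = - W (a, b)"
    and "P0 c z $ i $ k * pker W W z z = 2 * (\<Sum>j\<in>UNIV. poly (W (i, j)) z * cnj (poly (W (k, j)) z))"
    and "P0 c z ** mat_poly W z = mat_poly W z"
    and "(\<And>i. (\<Sum>k\<in>UNIV. P0 c z $ i $ k * cnj (g k)) = 0) \<Longrightarrow> (\<Sum>b\<in>UNIV. poly (W (a, b)) z * g b) = 0"
proof -
  have W: "nonvanishing W"
    and M: "\<And>w I J. minors (P0 c w) I J * pker W W w w = 2 * (poly (W I) w * cnj (poly (W J) w))"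
    using assms by (auto simp: represented_def)
  obtain J where J: "\<And>z. poly (W (J z)) z \<noteq> 0"
    using W unfolding nonvanishing_def by metis
  have WM: "poly (W I) z = minors (P0 c z) I (J z) * (pker W W z z / (2 * cnj (poly (W (J z)) z)))" for I z
    using M[of z I "J z"] J[of z] by (simp add: field_simps)
  have anti: "poly (W (b, a)) z = - poly (W (a, b)) z" for a b z
    unfolding WM[of "(b, a)"] WM[of "(a, b)"] by (simp add: minors_def algebra_simps)
  have "poly (W (b, a)) = poly (- W (a, b))"
    by (rule ext) (use anti[of b a] in simp)
  then show "W (b, a) = - W (a, b)"
    by (simp only: poly_eq_poly_eq_iff)
  show P: "P0 c z $ i $ k * pker W W z z = 2 * (\<Sum>j\<in>UNIV. poly (W (i, j)) z * cnj (poly (W (k, j)) z))" for i k z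
    unfolding minors_trace(2)[symmetric, of c z i k] sum_distrib_right M sum_distrib_left ..
  have PP: "(\<Sum>j\<in>UNIV. P0 c z $ i $ j * P0 c z $ j $ k) = P0 c z $ i $ k" for i k
  proof -
    have "P0 c z ** P0 c z = P0 c z"
      using projections(1)[of c z] by (simp add: projection_def)
    from arg_cong[OF this, of "\<lambda>X. X $ i $ k"] show ?thesis
      by (simp add: matrix_matrix_mult_def)
  qed
  show "P0 c z ** mat_poly W z = mat_poly W z"
  proof -
    have "(\<Sum>k\<in>UNIV. P0 c z $ i $ k * poly (W (k, j)) z) = poly (W (i, j)) z" for i j
    proof -
      have "(\<Sum>k\<in>UNIV. P0 c z $ i $ k * minors (P0 c z) (k, j) K) = minors (P0 c z) (i, j) K" for K
      proof -
        have "(\<Sum>k\<in>UNIV. P0 c z $ i $ k * minors (P0 c z) (k, j) K) =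
          (\<Sum>k\<in>UNIV. P0 c z $ i $ k * P0 c z $ k $ fst K) * P0 c z $ j $ snd K
          - (\<Sum>k\<in>UNIV. P0 c z $ i $ k * P0 c z $ k $ snd K) * P0 c z $ j $ fst K"
          unfolding minors_def sum_distrib_right sum_subtractf[symmetric]
          by (intro sum.cong refl) (simp add: algebra_simps)
        then show ?thesis
          by (simp add: PP minors_def)
      qed
      then show ?thesis
        unfolding WM[of "(_, j)"] mult.assoc[symmetric] sum_distrib_right[symmetric] by simp
    qed
    then show ?thesis
      by (simp add: vec_eq_iff matrix_matrix_mult_def mat_poly_def)
  qed
  assume g: "\<And>i. (\<Sum>k\<in>UNIV. P0 c z $ i $ k * cnj (g k)) = 0"
  \<comment> \<open>The contraction of g with the first index of W. Since P0 is a multiple of W W^*,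
    applying W to cnj y gives 0, and pairing with g gives |y|^2 = 0.\<close>
  define y where "y = (\<lambda>j. \<Sum>k\<in>UNIV. poly (W (k, j)) z * g k)"
  have "(\<Sum>j\<in>UNIV. poly (W (i, j)) z * cnj (y j)) = 0" for i
  proof -
    have "2 * (\<Sum>j\<in>UNIV. poly (W (i, j)) z * cnj (y j)) =
        2 * (\<Sum>j\<in>UNIV. \<Sum>k\<in>UNIV. poly (W (i, j)) z * cnj (poly (W (k, j)) z) * cnj (g k))"
      by (simp add: y_def sum_distrib_left mult.assoc)
    also have "\<dots> = (\<Sum>k\<in>UNIV. 2 * (\<Sum>j\<in>UNIV. poly (W (i, j)) z * cnj (poly (W (k, j)) z)) * cnj (g k))"
      by (subst sum.swap) (simp add: sum_distrib_left sum_distrib_right mult.assoc)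
    also have "\<dots> = (\<Sum>k\<in>UNIV. P0 c z $ i $ k * cnj (g k)) * pker W W z z"
      unfolding P[symmetric] sum_distrib_right by (intro sum.cong refl) (simp add: mult_ac)
    finally show ?thesis
      using g by simp
  qed
  then have "(\<Sum>i\<in>UNIV. g i * (\<Sum>j\<in>UNIV. poly (W (i, j)) z * cnj (y j))) = 0"
    by simp
  also have "(\<Sum>i\<in>UNIV. g i * (\<Sum>j\<in>UNIV. poly (W (i, j)) z * cnj (y j))) = (\<Sum>j\<in>UNIV. \<Sum>i\<in>UNIV. poly (W (i, j)) z * g i * cnj (y j))"
    by (subst sum.swap) (simp add: sum_distrib_left mult_ac)
  also have "\<dots> = herm (\<chi> j. y j) (\<chi> j. y j)"
    by (simp add: herm_def y_def sum_distrib_right)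
  finally have "(\<chi> j. y j) = 0"
    by (simp add: herm_eq_0_iff)
  then have "y a = 0"
    by (simp add: vec_eq_iff)
  have "(\<Sum>b\<in>UNIV. poly (W (a, b)) z * g b) = - y a"
    unfolding y_def sum_negf[symmetric] by (intro sum.cong refl) (subst anti, simp)
  with \<open>y a = 0\<close> show "(\<Sum>b\<in>UNIV. poly (W (a, b)) z * g b) = 0"
    by simp
qed

text \<open>The two relations are P2 P0 = 0 and A2 P0 = 0, read in a row where the component of G is
  nonzero: the conjugate of G and, modulo it, that of G' are orthogonal to psi_0.\<close>

lemma represented_annihilates:
  assumes "represented c W G" "c \<in> {chart0, chart1}"
  shows "(\<Sum>b\<in>UNIV. poly (W (a, b)) z * poly (G b) z) = 0"
    and "(\<Sum>b\<in>UNIV. poly (W (a, b)) z * poly (vderiv G b) z) = 0"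
proof -
  interpret primitive_point "P0 c" "P1 c" "P2 c" z UNIV "del_z_mat (P0 c) z" "del_zbar_mat (P0 c) z"
    "del_z_mat (P2 c) z" "del_zbar_mat (P2 c) z"
    by (rule point) (fact assms)
  have G: "nonvanishing G"
    and P: "\<And>w a b. P2 c w $ a $ b * pker G G w w = poly (G b) w * cnj (poly (G a) w)"
    using assms by (auto simp: represented_def)
  obtain a0 where a0: "poly (G a0) z \<noteq> 0"
    using G by (auto simp: nonvanishing_def)
  have conj: "(\<Sum>k\<in>UNIV. P0 c z $ i $ k * cnj (x k)) = 0" if "\<And>i. (\<Sum>k\<in>UNIV. x k * P0 c z $ k $ i) = 0" for x i
    using arg_cong[OF that[of i], of cnj] by (simp add: mult.commute flip: hermitian)
  have g0: "(\<Sum>k\<in>UNIV. poly (G k) z * P0 c z $ k $ i) = 0" for i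
  proof -
    have "P2 c z ** P0 c z = 0"
      using proj by simp
    from arg_cong[OF this, of "\<lambda>X. X $ a0 $ i"]
    have "pker G G z z * (\<Sum>k\<in>UNIV. P2 c z $ a0 $ k * P0 c z $ k $ i) = 0"
      by (simp add: matrix_matrix_mult_def)
    then have "(\<Sum>k\<in>UNIV. (P2 c z $ a0 $ k * pker G G z z) * P0 c z $ k $ i) = 0"
      unfolding sum_distrib_left by (simp only: mult_ac)
    then have "cnj (poly (G a0) z) * (\<Sum>k\<in>UNIV. poly (G k) z * P0 c z $ k $ i) = 0"
      unfolding P by (simp add: sum_distrib_left mult_ac)
    then show ?thesis
      using a0 by simp
  qed
  show "(\<Sum>b\<in>UNIV. poly (W (a, b)) z * poly (G b) z) = 0"
    by (rule represented_bivector(4)[OF assms conj[OF g0]])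
  have "(\<Sum>k\<in>UNIV. poly (vderiv G k) z * P0 c z $ k $ i) = 0" for i
  proof -
    have e: "P2 c w $ a $ b = poly (G b) w * cnj (poly (G a) w) / pker G G w w" for w a b
      using P[of w a b] pker_nonzero[OF G] by (simp add: field_simps)
    have "has_wirt (\<lambda>w. poly (G b) w * cnj (poly (G a) w) / pker G G w w) (del_z_mat (P2 c) z $ a $ b) (del_zbar_mat (P2 c) z $ a $ b) z" for a b
      using D2 unfolding has_wirt_mat_def e by blast
    from has_wirt_unique(1)[OF this has_wirt_rank_one[OF G]]
    have A: "del_z_mat (P2 c) z $ a $ b = (poly (vderiv G b) z * pker G G z z - poly (G b) z * pker (vderiv G) G z z) * cnj (poly (G a) z) / (pker G G z z)\<^sup>2" for a b .
    have "(\<Sum>k\<in>UNIV. del_z_mat (P2 c) z $ a0 $ k * P0 c z $ k $ i) = 0"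
      using arg_cong[OF A2P0, of "\<lambda>X. X $ a0 $ i"] by (simp add: matrix_matrix_mult_def)
    then have "cnj (poly (G a0) z) / (pker G G z z)\<^sup>2 * (\<Sum>k\<in>UNIV. (poly (vderiv G k) z * pker G G z z - poly (G k) z * pker (vderiv G) G z z) * P0 c z $ k $ i) = 0"
      unfolding A by (simp add: sum_distrib_left mult_ac)
    then have "(\<Sum>k\<in>UNIV. (poly (vderiv G k) z * pker G G z z - poly (G k) z * pker (vderiv G) G z z) * P0 c z $ k $ i) = 0"
      using a0 pker_nonzero[OF G] by simp
    then have "pker G G z z * (\<Sum>k\<in>UNIV. poly (vderiv G k) z * P0 c z $ k $ i) - pker (vderiv G) G z z * (\<Sum>k\<in>UNIV. poly (G k) z * P0 c z $ k $ i) = 0"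
      by (simp add: sum_distrib_left sum_subtractf[symmetric] algebra_simps)
    then show ?thesis
      using pker_nonzero[OF G] by (simp add: g0)
  qed
  from represented_bivector(4)[OF assms conj[OF this]]
  show "(\<Sum>b\<in>UNIV. poly (W (a, b)) z * poly (vderiv G b) z) = 0" .
qed

text \<open>The conjugate of n is orthogonal to psi_0 at all finite points and by continuity at
  infinity, so psi_0 lies in a fixed hyperplane unless n = 0.\<close>

lemma represented_full:
  assumes rep: "represented chart0 W G" and full: "linearly_full \<psi>0" and n: "\<And>z. mat_poly W z *v n = 0"
  shows "n = 0"
proof (rule ccontr)
  assume n0: "n \<noteq> 0"
  define m where "m = (\<chi> k. cnj (n $ k))"
  have nz: "nonvanishing W"
    using rep by (simp add: represented_def)
  have "(\<Sum>k\<in>UNIV. P0 chart0 z $ i $ k * m $ k) = 0" for z i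
  proof -
    have "(\<Sum>k\<in>UNIV. P0 chart0 z $ i $ k * m $ k) * pker W W z z = (\<Sum>k\<in>UNIV. (P0 chart0 z $ i $ k * pker W W z z) * m $ k)"
      unfolding sum_distrib_right by (intro sum.cong refl) (simp add: mult_ac)
    also have "\<dots> = (\<Sum>k\<in>UNIV. \<Sum>j\<in>UNIV. 2 * (poly (W (i, j)) z * (cnj (poly (W (k, j)) z) * m $ k)))"
      using represented_bivector(2)[OF rep] by (simp add: sum_distrib_left sum_distrib_right mult_ac)
    also have "\<dots> = (\<Sum>j\<in>UNIV. 2 * (poly (W (i, j)) z * (\<Sum>k\<in>UNIV. cnj (poly (W (k, j)) z) * m $ k)))"
      by (subst sum.swap) (simp add: sum_distrib_left)
    also have "\<dots> = 0"
    proof -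
      have "(\<Sum>k\<in>UNIV. cnj (poly (W (k, j)) z) * m $ k) = 0" for j
      proof -
      have "(\<Sum>k\<in>UNIV. cnj (poly (W (k, j)) z) * m $ k) = cnj (- (\<Sum>k\<in>UNIV. poly (W (j, k)) z * n $ k))"
        unfolding sum_negf[symmetric] cnj_sum
        by (intro sum.cong refl) (subst represented_bivector(1)[OF rep], simp_all add: m_def)
      moreover have "(\<Sum>k\<in>UNIV. poly (W (j, k)) z * n $ k) = 0"
        using arg_cong[OF n[of z], of "\<lambda>v. v $ j"] by (simp add: matrix_vector_mult_def mat_poly_def)
      ultimately show ?thesis
        by (simp only: complex_cnj_zero neg_0_equal_iff_equal minus_zero)
      qed
      then show ?thesis
        by simp
    qed
    finally show ?thesis
      using pker_nonzero[OF nz] by simp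
  qed
  then have P0: "P0 chart0 z *v m = 0" for z
    by (simp add: vec_eq_iff matrix_vector_mult_def)
  have P1: "(\<Sum>k\<in>UNIV. P0 chart1 w $ i $ k * m $ k) = 0" for w i
  proof (rule eq_off_finite[where Z = "{0}" and f = "\<lambda>w. \<Sum>k\<in>UNIV. P0 chart1 w $ i $ k * m $ k" and g = "\<lambda>_. 0"])
    show "continuous_on UNIV (\<lambda>w. \<Sum>k\<in>UNIV. P0 chart1 w $ i $ k * m $ k)"
      by (intro continuous_intros continuous_nth) simp
    fix w :: complex assume "w \<notin> {0}"
    then show "(\<Sum>k\<in>UNIV. P0 chart1 w $ i $ k * m $ k) = 0"
      using arg_cong[OF P0[of "1 / w"], of "\<lambda>v. v $ i"] by (simp add: P0_def chart1_eq_chart0 matrix_vector_mult_def)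
  qed auto
  then have P1: "P0 chart1 w *v m = 0" for w
    by (simp add: vec_eq_iff matrix_vector_mult_def)
  define H where "H = {v. herm v m = 0}"
  have orth: "v \<in> H" if "v \<in> \<psi>0 (c z)" "P0 c z *v m = 0" for v c z
  proof -
    have "P0 c z *v v = v"
      by (rule projection_fix[THEN iffD1, OF projections(1)[of c z] that(1)])
    then have "herm v m = herm (P0 c z *v v) m"
      by simp
    also have "\<dots> = herm v (P0 c z *v m)"
      using projections(1)[of c z] by (simp add: herm_adj projection_def)
    finally show ?thesis
      by (simp add: H_def that(2)) (simp add: herm_def)
  qed
  have "\<psi>0 x \<subseteq> H" for x
    by (cases rule: rsphere_cases[of x]) (use orth[OF _ P0] orth[OF _ P1] in auto)
  moreover have "vec.subspace H"
    by (auto simp: H_def vec.subspace_def herm_add_left herm_scale_left) (simp add: herm_def)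
  moreover have "m \<notin> H"
    using n0 by (auto simp: H_def herm_eq_0_iff m_def vec_eq_iff)
  ultimately show False
    using full unfolding linearly_full_def by blast
qed

text \<open>A sparse set is not the whole plane, so at some point the second fundamental form has
  image psi_1, of dimension two. Modulo the plane it is W' W^* up to scale, and a degenerate W would
  confine its image to a line.\<close>

lemma represented_nondegenerate:
  assumes rep: "represented chart0 W G" and gauss: "is_gauss_bundle \<psi>0 \<psi>1"
  shows "\<exists>z. \<not> degenerate W z"
proof -
  have "{z \<in> UNIV. (*v) (second_ff \<psi>0 chart0 z) ` \<psi>0 (chart0 z) \<noteq> \<psi>1 (chart0 z)} sparse_in UNIV"
    using gauss local_coord_chart0 unfolding is_gauss_bundle_def by blast
  moreover have "\<not> (UNIV :: complex set) sparse_in UNIV"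
    unfolding sparse_in_def using islimpt_UNIV by blast
  ultimately have "{z \<in> UNIV. (*v) (second_ff \<psi>0 chart0 z) ` \<psi>0 (chart0 z) \<noteq> \<psi>1 (chart0 z)} \<noteq> UNIV"
    by auto
  then obtain z where z: "(*v) (second_ff \<psi>0 chart0 z) ` \<psi>0 (chart0 z) = \<psi>1 (chart0 z)"
    by blast
  interpret primitive_point "P0 chart0" "P1 chart0" "P2 chart0" z UNIV "del_z_mat (P0 chart0) z" "del_zbar_mat (P0 chart0) z"
    "del_z_mat (P2 chart0) z" "del_zbar_mat (P2 chart0) z"
    by (rule point) simp
  let ?P = "P0 chart0 z" and ?A = "del_z_mat (P0 chart0) z"
  have W: "nonvanishing W"
    using rep by (simp add: represented_def)
  have ff: "second_ff \<psi>0 chart0 z = (mat 1 - ?P) ** ?A ** ?P"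
    by (simp add: second_ff_def P0_def[abs_def])
  have PW: "?P ** mat_poly W z = mat_poly W z"
    by (rule represented_bivector(3)[OF rep]) simp
  define h where "h = pker W W z z"
  define e where "e = pker (vderiv W) W z z / h"
  have h: "h \<noteq> 0"
    using pker_nonzero[OF W] by (simp add: h_def)
  \<comment> \<open>Derivative of P0 = 2 W W^* / |W|^2; the second term, from the norm, stays in the
    plane and disappears under \<open>mat 1 - ?P\<close>.\<close>
  have A: "?A *v x = (2 / h) *s (mat_poly (vderiv W) z *v (adj (mat_poly W z) *v x)) - e *s (?P *v x)" for x
  proof -
    have eq: "P0 chart0 w $ i $ k = (\<Sum>j\<in>UNIV. 2 * (poly (W (i, j)) w * cnj (poly (W (k, j)) w) / pker W W w w))" for w i k
    proof -
      have "P0 chart0 w $ i $ k = 2 * (\<Sum>j\<in>UNIV. poly (W (i, j)) w * cnj (poly (W (k, j)) w)) / pker W W w w"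
        using represented_bivector(2)[OF rep, of w i k] pker_nonzero[OF W, of w] by (simp add: field_simps)
      then show ?thesis
        by (simp add: sum_distrib_left sum_divide_distrib)
    qed
    have "\<exists>q. has_wirt (\<lambda>w. \<Sum>j\<in>UNIV. 2 * (poly (W (i, j)) w * cnj (poly (W (k, j)) w) / pker W W w w))
      (\<Sum>j\<in>UNIV. 2 * ((poly (vderiv W (i, j)) z * pker W W z z - poly (W (i, j)) z * pker (vderiv W) W z z) * cnj (poly (W (k, j)) z) / (pker W W z z)\<^sup>2)) q z" for i k
      by (rule exI, rule has_wirt_sum, rule has_wirt_cmult, rule has_wirt_rank_one[OF W])
    moreover have "has_wirt (\<lambda>w. P0 chart0 w $ i $ k) (?A $ i $ k) (del_zbar_mat (P0 chart0) z $ i $ k) z" for i k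
      using D0 by (simp add: has_wirt_mat_def)
    ultimately have "?A $ i $ k = (\<Sum>j\<in>UNIV. 2 * ((poly (vderiv W (i, j)) z * pker W W z z - poly (W (i, j)) z * pker (vderiv W) W z z) * cnj (poly (W (k, j)) z) / (pker W W z z)\<^sup>2))" for i k
      unfolding eq using has_wirt_unique(1) by blast
    also have "(\<Sum>j\<in>UNIV. 2 * ((poly (vderiv W (i, j)) z * pker W W z z - poly (W (i, j)) z * pker (vderiv W) W z z) * cnj (poly (W (k, j)) z) / (pker W W z z)\<^sup>2))
       = (2 / h) * (\<Sum>j\<in>UNIV. poly (vderiv W (i, j)) z * cnj (poly (W (k, j)) z)) - e * (?P $ i $ k)" for i k
      unfolding eq[of z] sum_distrib_left sum_subtractf[symmetric]
      by (intro sum.cong refl) (use h in \<open>simp add: h_def e_def field_simps power2_eq_square\<close>)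
    finally have "?A = (\<chi> i k. (2 / h) * (mat_poly (vderiv W) z ** adj (mat_poly W z)) $ i $ k - e * (?P $ i $ k))"
      by (simp add: vec_eq_iff mat_poly_def matrix_matrix_mult_def adj_nth)
    then have "?A $ i $ k = (2 / h) * (mat_poly (vderiv W) z ** adj (mat_poly W z)) $ i $ k - e * (?P $ i $ k)" for i k
      by (simp add: vec_eq_iff)
    then have "(\<Sum>k\<in>UNIV. ?A $ i $ k * x $ k) = (2 / h) * (\<Sum>k\<in>UNIV. (mat_poly (vderiv W) z ** adj (mat_poly W z)) $ i $ k * x $ k)
        - e * (\<Sum>k\<in>UNIV. ?P $ i $ k * x $ k)" for i
      unfolding sum_distrib_left sum_subtractf[symmetric]
      by (intro sum.cong refl) (simp add: left_diff_distrib mult.assoc)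
    then have "?A *v x = (2 / h) *s ((mat_poly (vderiv W) z ** adj (mat_poly W z)) *v x) - e *s (?P *v x)"
      by (simp add: vec_eq_iff matrix_vector_mult_def)
    then show ?thesis
      by (simp add: matrix_vector_mul_assoc)
  qed
  have "\<not> degenerate W z"
  proof
    assume "degenerate W z"
    then obtain y where y: "\<And>x. \<exists>t v. mat_poly (vderiv W) z *v x = t *s y + mat_poly W z *v v"
      unfolding degenerate_def by blast
    define y' where "y' = (mat 1 - ?P) *v y"
    have kill: "(mat 1 - ?P) *v (?P *v x) = 0" for x
      using proj(1) by (simp add: matrix_vector_mul_assoc matrix_sub_rdistrib)
    have "second_ff \<psi>0 chart0 z *v x \<in> vec.span {y'}" for x
    proof -
      obtain t v where tv: "mat_poly (vderiv W) z *v (adj (mat_poly W z) *v (?P *v x)) = t *s y + mat_poly W z *v v"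
        using y by blast
      have "mat_poly W z *v v = ?P *v (mat_poly W z *v v)"
        by (simp add: matrix_vector_mul_assoc PW)
      then have "(mat 1 - ?P) *v (mat_poly W z *v v) = 0"
        using kill by metis
      then have "second_ff \<psi>0 chart0 z *v x = (2 / h * t) *s y'"
        unfolding ff matrix_vector_mul_assoc[symmetric] A tv
        by (simp add: matrix_vector_mult_diff_distrib vector_scalar_commute matrix_vector_right_distrib kill y'_def)
      then show ?thesis
        by (simp add: vec.span_base vec.span_scale)
    qed
    then have "\<psi>1 (chart0 z) \<subseteq> vec.span {y'}"
      unfolding z[symmetric] by (rule image_subsetI)
    then have "vec.dim (\<psi>1 (chart0 z)) \<le> card {y'}"
      by (metis finite.emptyI finite_insert vec.dim_le_card)
    then show False
      using primitive_sphere.proj(9)[OF primitive_sphere_axioms, of "chart0 z"] by simp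
  qed
  then show ?thesis ..
qed

end

text \<open>The Veronese conic in the frame u_0, u_1, u_2; \<open>polar\<close> below is the last
  member of its Veronese sequence, orthogonal to the conic and its derivative.\<close>

definition conic :: "(nat \<Rightarrow> complex^'n) \<Rightarrow> complex \<Rightarrow> complex^'n" where
  "conic u z = u 0 + (of_real (sqrt 2) * z) *s u 1 + z\<^sup>2 *s u 2"

definition polar :: "(nat \<Rightarrow> complex^'n) \<Rightarrow> complex \<Rightarrow> complex^'n" where
  "polar u z = u 2 - (of_real (sqrt 2) * cnj z) *s u 1 + (cnj z)\<^sup>2 *s u 0"

context primitive_sphere
begin

text \<open>In the affine coordinate r z + s, where the metric is round, both kernels become powers
  of 1 + z * cnj v; rigidity applies there, and W and G are then translated back into psi_0 and
  psi_2.\<close>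

theorem normal_form:
  assumes metric: "invariant_metric [2, 2, 1] \<Lambda>" "has_constant_curvature [2, 2, 1] \<Lambda> \<Psi> \<kappa>"
    and full: "linearly_full \<psi>0" and gauss: "is_gauss_bundle \<psi>0 \<psi>1"
  obtains u r s where "orthonormal_upto 5 u" "r > 0"
    "\<And>z. \<psi>0 (Fin z) = vec.span {conic u (of_real r * z + s), u 3 + (of_real r * z + s) *s u 4}"
    "\<And>z. \<psi>2 (Fin z) = vec.span {polar u (of_real r * z + s)}"
proof -
  obtain W G where rep: "represented chart0 W G"
    using represented_exists by blast
  have W: "nonvanishing W" and G: "nonvanishing G"
    and P2: "\<And>z a b. P2 chart0 z $ a $ b * pker G G z z = poly (G b) z * cnj (poly (G a) z)"
    using rep by (auto simp: represented_def)
  have L: "\<Lambda> 0 1 > 0" "\<Lambda> 1 2 > 0"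
    using metric(1) by (simp_all add: invariant_metric_def)
  have f: "\<exists>f. \<forall>z. f z > 0 \<and> f z = \<Lambda> 0 1 * fubini W z + \<Lambda> 1 2 * fubini G z \<and> conformal_curvature f z = \<kappa>"
    if rep: "represented c W G" and c: "c \<in> {chart0, chart1}" for c W G
  proof -
    have "local_coord UNIV c"
      using c local_coord_chart0 local_coord_chart1 by blast
    then obtain f where f: "\<And>z. f z > 0"
      "\<And>z X Y. flag_metric [2, 2, 1] \<Lambda> (tangent_comp \<Psi> c z X) (tangent_comp \<Psi> c z Y) = f z * (X \<bullet> Y)"
      "\<And>z. conformal_curvature f z = \<kappa>"
      using metric(2) unfolding has_constant_curvature_def by (metis UNIV_I)
    have "f z = \<Lambda> 0 1 * fubini W z + \<Lambda> 1 2 * fubini G z" for z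
      using f(2)[of z 1 1] unfolding metric_eq[OF rep c] by simp
    then show ?thesis
      using f by blast
  qed
  obtain f where "\<forall>z. f z > 0 \<and> f z = \<Lambda> 0 1 * fubini W z + \<Lambda> 1 2 * fubini G z \<and> conformal_curvature f z = \<kappa>"
    using f[OF rep insertI1] by (elim exE)
  then have f0: "\<And>z. f z > 0" "\<And>z. f z = \<Lambda> 0 1 * fubini W z + \<Lambda> 1 2 * fubini G z" "\<And>z. conformal_curvature f z = \<kappa>"
    by blast+
  have inf: "\<Lambda> 0 1 * fubini (vrev W) 0 + \<Lambda> 1 2 * fubini (vrev G) 0 > 0"
    using f[OF represented_vrev[OF rep]] by (metis insertCI)
  obtain r s a b where ab: "a > 0" "b > 0" and r: "r > 0"
    and dl: "\<And>z. of_real a * dlog W z + of_real b * dlog G z =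
      2 * of_real r * cnj (of_real r * z + s) / of_real (1 + (cmod (of_real r * z + s))\<^sup>2)"
    by (rule constant_curvature_dlog[OF W G L f0(2,1,3) inf], rule that, assumption, assumption, assumption, assumption)
  have inv: "(of_real r * z + s - s) / of_real r = z" and forth: "of_real r * ((z - s) / of_real r) + s = z" for z
    using r by simp_all
  let ?W = "vaff r s W" and ?G = "vaff r s G"
  have dl': "of_real a * dlog ?W z + of_real b * dlog ?G z = 2 * cnj z / of_real (1 + (cmod z)\<^sup>2)" for z
  proof -
    have "of_real a * dlog ?W z + of_real b * dlog ?G z =
        (of_real a * dlog W ((z - s) / of_real r) + of_real b * dlog G ((z - s) / of_real r)) / of_real r"
      by (simp add: dlog_vaff add_divide_distrib)
    also have "\<dots> = 2 * cnj z / of_real (1 + (cmod z)\<^sup>2)"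
    proof -
      have "2 * t * y / x / t = 2 * y / x" if "t \<noteq> 0" for t x y :: complex
        using that by simp
      then show ?thesis
        unfolding dl forth using r by simp
    qed
    finally show ?thesis .
  qed
  obtain c0 d0 where c0: "c0 > 0" and kW: "\<And>z v. pker ?W ?W z v = of_real c0 * (1 + z * cnj v) ^ d0"
    using kernel_power[OF nonvanishing_vaff[OF W] nonvanishing_vaff[OF G] ab dl'] by auto
  \<comment> \<open>\<open>kernel_power\<close> concludes for its first vector only, so it is used
    again with W and G exchanged.\<close>
  have dl'': "of_real b * dlog ?G z + of_real a * dlog ?W z = 2 * cnj z / of_real (1 + (cmod z)\<^sup>2)" for z
    using dl'[of z] by (simp add: add.commute)
  obtain c1 d1 where c1: "c1 > 0" and kG: "\<And>z v. pker ?G ?G z v = of_real c1 * (1 + z * cnj v) ^ d1"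
    using kernel_power[OF nonvanishing_vaff[OF G] nonvanishing_vaff[OF W] ab(2,1) dl''] by auto
  have c: "chart0 \<in> {chart0, chart1}"
    by simp
  have anti: "?W (y, x) = - ?W (x, y)" for x y
    using represented_bivector(1)[OF rep c, of y x] by (simp add: vaff_def pcompose_uminus)
  have WG: "(\<Sum>y\<in>UNIV. poly (?W (x, y)) z * poly (?G y) z) = 0" for x z
    using represented_annihilates(1)[OF rep c] by (simp add: poly_vaff)
  have WG': "(\<Sum>y\<in>UNIV. poly (?W (x, y)) z * poly (vderiv ?G y) z) = 0" for x z
    using represented_annihilates(2)[OF rep c, of x "(z - s) / of_real r"]
    by (simp add: poly_vaff poly_vderiv_vaff flip: sum_divide_distrib)
  have n0: "n = 0" if n: "\<And>z. mat_poly ?W z *v n = 0" for n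
  proof (rule represented_full[OF rep full])
    fix z
    have "mat_poly ?W (of_real r * z + s) = mat_poly W z"
      using r by (simp add: mat_poly_def poly_vaff)
    then show "mat_poly W z *v n = 0"
      using n by metis
  qed
  obtain z0 where z0: "\<not> degenerate W z0"
    using represented_nondegenerate[OF rep gauss] by blast
  have nondeg: "\<exists>z. \<not> degenerate ?W z"
  proof (intro exI notI)
    assume "degenerate ?W (of_real r * z0 + s)"
    from degenerate_vaff[OF this] z0 show False
      using r by simp
  qed
  have "\<exists>u k m. orthonormal_upto 5 u \<and>
      (\<forall>z a. poly (?G a) z = m * (cnj (u 2 $ a) - of_real (sqrt 2) * z * cnj (u 1 $ a) + z\<^sup>2 * cnj (u 0 $ a))) \<and>
      (\<forall>z a b. poly (?W (a, b)) z = k *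
        ((u 0 $ a + of_real (sqrt 2) * z * u 1 $ a + z\<^sup>2 * u 2 $ a) * (u 3 $ b + z * u 4 $ b)
        - (u 0 $ b + of_real (sqrt 2) * z * u 1 $ b + z\<^sup>2 * u 2 $ b) * (u 3 $ a + z * u 4 $ a)))"
    (is "\<exists>u k m. ?P u k m")
    by (rule bivector_rigidity[OF anti WG WG' kW c0 kG c1 n0 nondeg]) blast+
  then obtain u k m where u: "orthonormal_upto 5 u"
    and Gu: "\<And>z a. poly (?G a) z = m * (cnj (u 2 $ a) - of_real (sqrt 2) * z * cnj (u 1 $ a) + z\<^sup>2 * cnj (u 0 $ a))"
    and Wu: "\<And>z a b. poly (?W (a, b)) z = k *
      ((u 0 $ a + of_real (sqrt 2) * z * u 1 $ a + z\<^sup>2 * u 2 $ a) * (u 3 $ b + z * u 4 $ b)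
      - (u 0 $ b + of_real (sqrt 2) * z * u 1 $ b + z\<^sup>2 * u 2 $ b) * (u 3 $ a + z * u 4 $ a))"
    by (elim exE conjE) blast

  have sub: "vec.subspace (\<psi>0 (chart0 z))" "vec.subspace (\<psi>2 (chart0 z))" for z
    using smooth(1,3) by (auto simp: smooth_grass_map_def grassmannian_def)
  have "\<psi>0 (chart0 z) = vec.span {conic u (of_real r * z + s), u 3 + (of_real r * z + s) *s u 4}" for z
  proof (rule span_eqI[OF sub(1)])
    define F H where "F = conic u (of_real r * z + s)" and "H = u 3 + (of_real r * z + s) *s u 4"
    have Wz: "poly (W (a, b)) z = k * (F $ a * H $ b - F $ b * H $ a)" for a b
      using Wu[of a b "of_real r * z + s"]
      by (simp only: poly_vaff inv F_def H_def conic_def vector_add_component vector_smult_component)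
    show "\<psi>0 (chart0 z) \<subseteq> vec.span {F, H}"
    proof
      fix x assume "x \<in> \<psi>0 (chart0 z)"
      then have x: "P0 chart0 z *v x = x"
        by (rule projection_fix[THEN iffD1, OF projections(1)[of chart0 z]])
      have P: "P0 chart0 z $ i $ l = (2 / pker W W z z) * (\<Sum>j\<in>UNIV. poly (W (i, j)) z * cnj (poly (W (l, j)) z))" for i l
        using represented_bivector(2)[OF rep c, of z i l] pker_nonzero[OF W] by (simp add: field_simps)
      \<comment> \<open>Coefficients of x along F and H, read off from x = P0 x with P0 = 2 W W^* /
        |W|^2 and W = k F ^ H.\<close>
      define p q where "p = (2 / pker W W z z) * k * (\<Sum>l\<in>UNIV. \<Sum>j\<in>UNIV. H $ j * cnj (poly (W (l, j)) z) * x $ l)"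
        and "q = (2 / pker W W z z) * k * (\<Sum>l\<in>UNIV. \<Sum>j\<in>UNIV. F $ j * cnj (poly (W (l, j)) z) * x $ l)"
      have "x $ i = p * F $ i - q * H $ i" for i
      proof -
        have "x $ i = (\<Sum>l\<in>UNIV. P0 chart0 z $ i $ l * x $ l)"
          using arg_cong[OF x, of "\<lambda>v. v $ i"] by (simp add: matrix_vector_mult_def)
        also have "\<dots> = p * F $ i - q * H $ i"
          unfolding P Wz[of i] p_def q_def sum_distrib_left sum_distrib_right sum_subtractf[symmetric]
          by (intro sum.cong refl) (simp only: algebra_simps)
        finally show ?thesis .
      qed
      then have "x = p *s F - q *s H"
        by (simp add: vec_eq_iff)
      then show "x \<in> vec.span {F, H}"
        by (simp add: vec.span_base vec.span_scale vec.span_diff)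
    qed
    show "card {F, H} \<le> vec.dim (\<psi>0 (chart0 z))"
      using proj(8)[of "chart0 z"] by (simp add: card_insert_if)
  qed simp
  moreover have "\<psi>2 (chart0 z) = vec.span {polar u (of_real r * z + s)}" for z
  proof (rule span_eqI[OF sub(2)])
    define M where "M = polar u (of_real r * z + s)"
    have Gz: "cnj (poly (G a) z) = cnj m * M $ a" for a
      using Gu[of a "of_real r * z + s"] r by (simp add: poly_vaff M_def polar_def)
    show "\<psi>2 (chart0 z) \<subseteq> vec.span {M}"
    proof
      fix x assume "x \<in> \<psi>2 (chart0 z)"
      then have x: "P2 chart0 z *v x = x"
        by (rule projection_fix[THEN iffD1, OF projections(3)[of chart0 z]])
      have P: "P2 chart0 z $ i $ l = (poly (G l) z * cnj m / pker G G z z) * M $ i" for i l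
        using P2[of z i l] pker_nonzero[OF G] unfolding Gz by (simp add: field_simps)
      have "x $ i = (\<Sum>l\<in>UNIV. (poly (G l) z * cnj m / pker G G z z) * x $ l) * M $ i" for i
      proof -
        have "x $ i = (\<Sum>l\<in>UNIV. P2 chart0 z $ i $ l * x $ l)"
          using arg_cong[OF x, of "\<lambda>v. v $ i"] by (simp add: matrix_vector_mult_def)
        also have "\<dots> = (\<Sum>l\<in>UNIV. (poly (G l) z * cnj m / pker G G z z) * x $ l) * M $ i"
          unfolding P sum_distrib_right by (intro sum.cong refl) (simp only: mult_ac)
        finally show ?thesis .
      qed
      then obtain t where "\<And>i. x $ i = t * M $ i"
        by blast
      then have "x = t *s M"
        by (simp add: vec_eq_iff)
      then show "x \<in> vec.span {M}"
        by (simp add: vec.span_base vec.span_scale)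
    qed
    show "card {M} \<le> vec.dim (\<psi>2 (chart0 z))"
      using proj(10)[of "chart0 z"] by simp
  qed simp
  ultimately show ?thesis
    using that[OF u r] by (simp add: chart0_def)
qed

end

section \<open>Smoothness of the model\<close>

text \<open>A class of smooth functions that is closed under the Wirtinger derivatives, so that
  membership implies \<open>C\<^sup>k\<close> for all \<open>k\<close> by coinduction.\<close>

inductive tame :: "(complex \<Rightarrow> complex) \<Rightarrow> bool" where
  const: "tame (\<lambda>_. c)"
| ident: "tame (\<lambda>z. z)"
| conj: "tame cnj"
| add: "tame f \<Longrightarrow> tame g \<Longrightarrow> tame (\<lambda>z. f z + g z)"
| mult: "tame f \<Longrightarrow> tame g \<Longrightarrow> tame (\<lambda>z. f z * g z)"
| recip: "tame (\<lambda>z. inverse (1 + z * cnj z))"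

lemma tame_power: "tame f \<Longrightarrow> tame (\<lambda>z. f z ^ n)"
  by (induction n) (auto intro: tame.intros)

lemma tame_cmult: "tame f \<Longrightarrow> tame (\<lambda>z. c * f z)"
  by (rule tame.mult[OF tame.const])

lemma tame_minus: "tame f \<Longrightarrow> tame (\<lambda>z. - f z)"
  using tame_cmult[of f "- 1"] by simp

lemma tame_diff: "tame f \<Longrightarrow> tame g \<Longrightarrow> tame (\<lambda>z. f z - g z)"
  using tame.add[OF _ tame_minus, of f g] by simp

lemma tame_divide: "tame f \<Longrightarrow> tame (\<lambda>z. f z / (1 + z * cnj z) ^ n)"
  using tame.mult[OF _ tame_power[OF tame.recip, of n], of f] by (simp add: divide_inverse power_inverse)

lemma one_plus_norm_nonzero: "1 + z * cnj z \<noteq> 0"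
proof -
  have "1 + z * cnj z = of_real (1 + (cmod z)\<^sup>2)"
    by (simp only: of_real_add of_real_1 complex_norm_square)
  moreover have "1 + (cmod z)\<^sup>2 > 0"
    by (simp add: add_pos_nonneg)
  ultimately show ?thesis
    using of_real_eq_0_iff by (metis less_irrefl)
qed

lemma has_wirt_ident: "has_wirt (\<lambda>z. z) 1 0 z"
  by (rule has_wirt_field) (rule DERIV_ident)

lemma has_wirt_conj: "has_wirt cnj 0 1 z"
  using has_wirt_cnj[OF has_wirt_ident] by simp

lemma has_wirt_power:
  assumes "has_wirt f p q z"
  shows "has_wirt (\<lambda>w. f w ^ n) (of_nat n * f z ^ (n - 1) * p) (of_nat n * f z ^ (n - 1) * q) z"
  using has_wirt_compose[OF assms, of "\<lambda>x. x ^ n" "of_nat n * f z ^ (n - 1)"]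
  by (simp add: DERIV_power[OF DERIV_ident, of n, simplified])

lemma has_wirt_one_plus_norm: "has_wirt (\<lambda>z. 1 + z * cnj z) (cnj z) z z"
  using has_wirt_add[OF has_wirt_const has_wirt_mult[OF has_wirt_ident has_wirt_conj], of 1 z] by simp

lemma tame_cnj: "tame f \<Longrightarrow> tame (\<lambda>z. cnj (f z))"
proof (induction rule: tame.induct)
  case recip
  then show ?case
    using tame.recip by (simp add: mult.commute)
qed (auto intro: tame.intros)

lemma tame_has_wirt:
  assumes "tame f"
  shows "\<exists>p q. tame p \<and> tame q \<and> (\<forall>z. has_wirt f (p z) (q z) z)"
  using assms
proof induction
  case (const c)
  show ?case
    by (intro exI[of _ "\<lambda>_. 0"]) (simp add: has_wirt_const tame.const)
next
  case ident
  show ?case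
    by (intro exI[of _ "\<lambda>_. 1"] exI[of _ "\<lambda>_. 0"]) (simp add: has_wirt_ident tame.const)
next
  case conj
  show ?case
    by (intro exI[of _ "\<lambda>_. 0"] exI[of _ "\<lambda>_. 1"]) (simp add: has_wirt_conj tame.const)
next
  case (add f g)
  then obtain p q p' q' where "tame p" "tame q" "tame p'" "tame q'"
    "\<And>z. has_wirt f (p z) (q z) z" "\<And>z. has_wirt g (p' z) (q' z) z"
    by blast
  then show ?case
    by (intro exI[of _ "\<lambda>z. p z + p' z"] exI[of _ "\<lambda>z. q z + q' z"] conjI allI has_wirt_add tame.add)
next
  case (mult f g)
  then obtain p q p' q' where "tame p" "tame q" "tame p'" "tame q'"
    "\<And>z. has_wirt f (p z) (q z) z" "\<And>z. has_wirt g (p' z) (q' z) z"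
    by blast
  with mult show ?case
    by (intro exI[of _ "\<lambda>z. p z * g z + f z * p' z"] exI[of _ "\<lambda>z. q z * g z + f z * q' z"]
        conjI allI has_wirt_mult tame.add tame.mult)
next
  case recip
  have "tame (\<lambda>z. - cnj z / (1 + z * cnj z)\<^sup>2)" "tame (\<lambda>z. - z / (1 + z * cnj z)\<^sup>2)"
    by (intro tame_divide tame_minus tame.ident tame.conj)+
  then show ?case
    using has_wirt_inverse[OF has_wirt_one_plus_norm one_plus_norm_nonzero] by blast
qed

lemma tame_continuous: "tame f \<Longrightarrow> continuous_on S f"
  by (rule continuous_at_imp_continuous_on) (meson tame_has_wirt has_wirt_continuous)

definition tame_mat :: "(complex \<Rightarrow> complex^'n^'m) \<Rightarrow> bool" where
  "tame_mat F \<longleftrightarrow> (\<forall>a b. tame (\<lambda>z. F z $ a $ b))"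

lemma tame_mat_has_wirt:
  assumes "tame_mat F"
  obtains A B where "tame_mat A" "tame_mat B" "\<And>z. has_wirt_mat F (A z) (B z) z"
proof -
  have "\<forall>a b. \<exists>p q. tame p \<and> tame q \<and> (\<forall>z. has_wirt (\<lambda>z. F z $ a $ b) (p z) (q z) z)"
    using assms tame_has_wirt unfolding tame_mat_def by blast
  then obtain p q where pq: "\<And>a b. tame (p a b)" "\<And>a b. tame (q a b)"
    "\<And>a b z. has_wirt (\<lambda>z. F z $ a $ b) (p a b z) (q a b z) z"
    by metis
  show ?thesis
    by (rule that[of "\<lambda>z. \<chi> a b. p a b z" "\<lambda>z. \<chi> a b. q a b z"])
      (simp_all add: tame_mat_def has_wirt_mat_def pq)
qed

lemma tame_mat_smooth:
  fixes F :: "complex \<Rightarrow> complex^'n^'n"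
  assumes "tame_mat F"
  shows "smooth_on UNIV F"
proof -
  have "C_k_on k UNIV F" if "tame_mat F" for k and F :: "complex \<Rightarrow> complex^'n^'n"
    using that
  proof (induction k arbitrary: F)
    case 0
    then have "continuous_on UNIV (\<lambda>z. \<chi> a b. F z $ a $ b)"
      by (intro continuous_on_vec_lambda tame_continuous) (simp add: tame_mat_def)
    then show ?case
      by simp
  next
    case (Suc k)
    obtain A B where AB: "tame_mat A" "tame_mat B" "\<And>z. has_wirt_mat F (A z) (B z) z"
      using tame_mat_has_wirt[OF Suc.prems] by blast
    have "F differentiable_on UNIV"
      unfolding differentiable_on_def differentiable_def using has_wirt_mat_differentiable[OF AB(3)] by auto
    moreover have "tame_mat (\<lambda>z. frechet_derivative F (at z) v)" for v
      unfolding has_wirt_mat_frechet[OF AB(3)] tame_mat_def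
    proof (intro allI)
      fix a b
      show "tame (\<lambda>z. (mat v ** A z + mat (cnj v) ** B z) $ a $ b)"
        using AB(1,2) by (simp add: mat_mult_nth tame_mat_def tame.add tame_cmult)
    qed
    ultimately show ?case
      using Suc.IH by simp
  qed
  then show ?thesis
    using assms by (simp add: smooth_on_def)
qed

section \<open>Projections onto lines\<close>

definition outer :: "complex^'n \<Rightarrow> complex^'n \<Rightarrow> complex^'n^'n" where
  "outer v w = (\<chi> a b. v $ a * cnj (w $ b))"

lemma outer_mult: "outer v w ** outer x y = outer (herm x w *s v) y"
  by (simp add: vec_eq_iff outer_def matrix_matrix_mult_def herm_def sum_distrib_left sum_distrib_right mult_ac)

lemma outer_vec: "outer v w *v x = herm x w *s v"
  by (simp add: vec_eq_iff outer_def matrix_vector_mult_def herm_def sum_distrib_left sum_distrib_right mult_ac)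

lemma adj_outer: "adj (outer v w) = outer w v"
  by (simp add: vec_eq_iff outer_def adj_nth mult.commute)

definition line_proj :: "complex^'n \<Rightarrow> complex^'n^'n" where
  "line_proj v = outer (inverse (herm v v) *s v) v"

lemma line_proj_nth: "line_proj v $ a $ b = v $ a * cnj (v $ b) / herm v v"
  by (simp add: line_proj_def outer_def field_simps)

lemma line_proj_vec: "line_proj v *v x = (herm x v / herm v v) *s v"
  by (simp add: line_proj_def outer_vec vec_eq_iff field_simps)

lemma line_proj_orthogonal: "herm w v = 0 \<Longrightarrow> line_proj v ** line_proj w = 0"
proof -
  assume "herm w v = 0"
  then have "line_proj v *v (line_proj w *v x) = 0" for x
    by (simp add: line_proj_vec herm_scale_left)
  then show ?thesis
    by (simp add: matrix_eq matrix_vector_mul_assoc)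
qed

lemma projection_line:
  assumes "v \<noteq> 0"
  shows "projection (line_proj v) (vec.span {v})"
proof -
  have h: "herm v v \<noteq> 0"
    using assms by (simp add: herm_eq_0_iff)
  have "line_proj v *v (line_proj v *v x) = line_proj v *v x" for x
    using h by (simp add: line_proj_vec herm_scale_left)
  then have "line_proj v ** line_proj v = line_proj v"
    by (simp add: matrix_eq matrix_vector_mul_assoc)
  moreover have "adj (line_proj v) = line_proj v"
    by (simp add: vec_eq_iff adj_nth line_proj_nth herm_cnj)
  moreover have "range ((*v) (line_proj v)) = vec.span {v}"
  proof (intro equalityI subsetI)
    fix x assume "x \<in> vec.span {v}"
    then obtain c where "x = c *s v"
      by (auto simp: vec.span_singleton)
    then have "line_proj v *v x = x"
      using h by (simp add: line_proj_vec herm_scale_left)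
    then show "x \<in> range ((*v) (line_proj v))"
      by (metis rangeI)
  qed (auto simp: line_proj_vec vec.span_base vec.span_scale)
  ultimately show ?thesis
    by (simp add: projection_def)
qed

lemma projection_add:
  assumes P: "projection P L" and Q: "projection Q M" and PQ: "P ** Q = 0"
  shows "projection (P + Q) (L + M)"
proof -
  have QP: "Q ** P = 0"
    using arg_cong[OF PQ, of adj] P Q by (simp add: adj_mult projection_def adj_zero)
  have "(P + Q) ** (P + Q) = P + Q" "adj (P + Q) = P + Q"
    using P Q PQ QP by (simp_all add: projection_def matrix_add_rdistrib matrix_add_ldistrib adj_add)
  moreover have "range ((*v) (P + Q)) = L + M"
  proof (intro equalityI subsetI)
    fix x assume "x \<in> range ((*v) (P + Q))"
    then show "x \<in> L + M"
      using projection_in[OF P] projection_in[OF Q] by (auto simp: matrix_vector_mult_add_rdistrib intro: set_plus_intro)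
  next
    fix x assume "x \<in> L + M"
    then obtain y w where x: "x = y + w" "y \<in> L" "w \<in> M"
      by (auto elim: set_plus_elim)
    then have y: "P *v y = y" and w: "Q *v w = w"
      using projection_fix[OF P] projection_fix[OF Q] by auto
    have "Q *v y = 0" "P *v w = 0"
      by (subst y[symmetric], simp add: matrix_vector_mul_assoc QP, subst w[symmetric], simp add: matrix_vector_mul_assoc PQ)
    then have "(P + Q) *v x = x"
      using y w by (simp add: x matrix_vector_mult_add_rdistrib matrix_vector_right_distrib)
    then show "x \<in> range ((*v) (P + Q))"
      by (metis rangeI)
  qed
  ultimately show ?thesis
    by (simp add: projection_def)
qed

lemma span_scale_eq:
  fixes v :: "complex^'n"
  assumes "c \<noteq> 0"
  shows "vec.span {c *s v} = vec.span {v}"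
proof -
  have "k *s v = (k / c) *s (c *s v)" for k
    using assms by simp
  then have "vec.span {v} \<subseteq> vec.span {c *s v}"
    unfolding vec.span_singleton by blast
  moreover have "vec.span {c *s v} \<subseteq> vec.span {v}"
    unfolding vec.span_singleton by auto
  ultimately show ?thesis
    by blast
qed

lemma line_grassmannian: "v \<noteq> 0 \<Longrightarrow> vec.span {v} \<in> grassmannian 1"
  by (simp add: grassmannian_def vec.dim_insert) 

text \<open>The components of the derivatives along s itself do not move the line:
  \<open>\<alpha> + cnj \<alpha>'\<close> is \<partial> log |s|^2, so they cancel against the
  derivative of the norm and only the transversal parts remain.\<close>

lemma line_proj_wirt:
  fixes s :: "complex \<Rightarrow> complex^'n"
  assumes s: "\<And>a. has_wirt (\<lambda>w. s w $ a) (\<alpha> * s z $ a + \<beta> * t $ a) (\<alpha>' * s z $ a + \<beta>' * t' $ a) z"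
    and h: "\<And>w. herm (s w) (s w) = (1 + w * cnj w) ^ d" and \<alpha>: "\<alpha> + cnj \<alpha>' = of_nat d * cnj z / (1 + z * cnj z)"
  shows "has_wirt_mat (\<lambda>w. line_proj (s w))
     (outer ((\<beta> / (1 + z * cnj z) ^ d) *s t) (s z) + outer (s z) ((\<beta>' / (1 + z * cnj z) ^ d) *s t'))
     (outer ((\<beta>' / (1 + z * cnj z) ^ d) *s t') (s z) + outer (s z) ((\<beta> / (1 + z * cnj z) ^ d) *s t)) z"
  unfolding has_wirt_mat_def line_proj_nth h
proof (intro allI)
  fix a b
  define N where "N = 1 + z * cnj z"
  have N: "N \<noteq> 0" and N': "cnj N = N"
    using one_plus_norm_nonzero by (simp_all add: N_def mult.commute)
  have \<alpha>1: "\<alpha> = of_nat d * cnj z / N - cnj \<alpha>'" 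
    using \<alpha> by (simp add: N_def eq_diff_eq)
  \<comment> \<open>For d = 0 the truncated exponent \<open>d - 1\<close> is harmless, as both sides
    vanish.\<close>
  have dN: "of_nat d * N ^ (d - 1) = of_nat d * N ^ d / N"
    using N by (cases d) simp_all
  have "has_wirt (\<lambda>w. s w $ a * cnj (s w $ b) / (1 + w * cnj w) ^ d)
     ((((\<alpha> * s z $ a + \<beta> * t $ a) * cnj (s z $ b) + s z $ a * cnj (\<alpha>' * s z $ b + \<beta>' * t' $ b)) * N ^ d
        - s z $ a * cnj (s z $ b) * (of_nat d * N ^ (d - 1) * cnj z)) / (N ^ d)\<^sup>2)
     ((((\<alpha>' * s z $ a + \<beta>' * t' $ a) * cnj (s z $ b) + s z $ a * cnj (\<alpha> * s z $ b + \<beta> * t $ b)) * N ^ d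
        - s z $ a * cnj (s z $ b) * (of_nat d * N ^ (d - 1) * z)) / (N ^ d)\<^sup>2) z"
    unfolding N_def
    by (intro has_wirt_divide has_wirt_mult has_wirt_cnj has_wirt_power s has_wirt_one_plus_norm)
      (simp add: one_plus_norm_nonzero)
  then show "has_wirt (\<lambda>w. s w $ a * cnj (s w $ b) / (1 + w * cnj w) ^ d)
     ((outer ((\<beta> / (1 + z * cnj z) ^ d) *s t) (s z) + outer (s z) ((\<beta>' / (1 + z * cnj z) ^ d) *s t')) $ a $ b)
     ((outer ((\<beta>' / (1 + z * cnj z) ^ d) *s t') (s z) + outer (s z) ((\<beta> / (1 + z * cnj z) ^ d) *s t)) $ a $ b) z"
    by (rule has_wirt_eq; unfold N_def[symmetric] dN \<alpha>1)
      (use N in \<open>simp_all add: outer_def N' power2_eq_square field_simps\<close>)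
qed

section \<open>Gauss bundles of lines\<close>

text \<open>Any coordinate is locally a standard chart after a holomorphic map, which inherits
  injectivity and so has nonvanishing derivative; statements about all coordinates thereby reduce to
  the two charts.\<close>

lemma local_coord_chart:
  assumes "local_coord U c" "z \<in> U"
  obtains V \<gamma> c0 where "open V" "z \<in> V" "V \<subseteq> U" "c0 \<in> {chart0, chart1}" "\<And>w. w \<in> V \<Longrightarrow> c w = c0 (\<gamma> w)"
    "\<gamma> holomorphic_on V" "\<And>w. w \<in> V \<Longrightarrow> deriv \<gamma> w \<noteq> 0"
proof -
  have "sphere_holomorphic_on c U" "inj_on c U"
    using assms(1) by (auto simp: local_coord_def)
  then obtain V \<gamma> where V: "open V" "z \<in> V" "V \<subseteq> U" "\<gamma> holomorphic_on V"
    "(\<forall>w\<in>V. c w = chart0 (\<gamma> w)) \<or> (\<forall>w\<in>V. c w = chart1 (\<gamma> w))"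
    using assms(2) unfolding sphere_holomorphic_on_def by meson
  then obtain c0 where c0: "c0 \<in> {chart0, chart1}" "\<And>w. w \<in> V \<Longrightarrow> c w = c0 (\<gamma> w)"
    by auto
  have "inj_on c V"
    using \<open>inj_on c U\<close> V(3) by (rule inj_on_subset)
  then have "inj_on \<gamma> V"
    using c0(2) unfolding inj_on_def by metis
  then have "deriv \<gamma> w \<noteq> 0" if "w \<in> V" for w
    by (rule holomorphic_injective_imp_regular[OF V(4,1) _ that])
  with V c0 show ?thesis
    using that by blast
qed

lemma outer_zero: "outer 0 v = 0" "outer v 0 = 0"
  by (simp_all add: outer_def vec_eq_iff)

lemma orth_proj_line: "v \<noteq> 0 \<Longrightarrow> orth_proj (vec.span {v}) = line_proj v"
  by (rule orth_proj_eqI) (rule projection_line)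

lemma mat_vector_mult: "(mat c ** A) *v x = c *s (A *v (x :: complex^'n))"
  by (simp add: vec_eq_iff matrix_vector_mult_def mat_mult_nth sum_distrib_left mult.assoc)

lemma mat_vec: "mat c *v x = c *s (x :: complex^'n)"
  using mat_vector_mult[of c "mat 1" x] by simp

lemma smooth_grass_map_line:
  fixes t :: "(complex \<Rightarrow> rsphere) \<Rightarrow> complex \<Rightarrow> complex^'n"
  assumes \<phi>: "\<And>c w. c \<in> {chart0, chart1} \<Longrightarrow> \<phi> (c w) = vec.span {t c w}"
    and h: "\<And>c w. c \<in> {chart0, chart1} \<Longrightarrow> herm (t c w) (t c w) = (1 + w * cnj w) ^ d"
    and t: "\<And>c a. c \<in> {chart0, chart1} \<Longrightarrow> tame (\<lambda>w. t c w $ a)"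
  shows "smooth_grass_map 1 \<phi>"
proof -
  have nz: "t c w \<noteq> 0" if "c \<in> {chart0, chart1}" for c w
    using h[OF that, of w] one_plus_norm_nonzero[of w] by (metis herm_eq_0_iff power_not_zero)
  have "\<phi> x \<in> grassmannian 1" for x
    by (cases rule: rsphere_cases[of x]) (simp_all add: \<phi> line_grassmannian nz del: One_nat_def)
  moreover have "smooth_on UNIV (\<lambda>w. orth_proj (\<phi> (c w)))" if c: "c \<in> {chart0, chart1}" for c
  proof -
    have "tame (\<lambda>w. t c w $ a * cnj (t c w $ b) / (1 + w * cnj w) ^ d)" for a b
      by (intro tame_divide tame.mult tame_cnj t c)
    then have "tame_mat (\<lambda>w. line_proj (t c w))"
      unfolding tame_mat_def line_proj_nth h[OF c] by blast
    then show ?thesis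
      unfolding \<phi>[OF c] orth_proj_line[OF nz[OF c]] by (rule tame_mat_smooth)
  qed
  ultimately show ?thesis
    unfolding smooth_grass_map_def by blast
qed

text \<open>By the form of the derivative in the last hypothesis, the second fundamental form sends
  s to a nonzero multiple of t at every point. A change of coordinate only multiplies it by the
  nonzero \<open>deriv \<gamma>\<close>, so the exceptional set is empty.\<close>

lemma is_gauss_bundle_line:
  fixes s t :: "(complex \<Rightarrow> rsphere) \<Rightarrow> complex \<Rightarrow> complex^'n"
  assumes \<psi>: "\<And>c w. c \<in> {chart0, chart1} \<Longrightarrow> \<psi> (c w) = vec.span {s c w}"
    and \<phi>: "\<And>c w. c \<in> {chart0, chart1} \<Longrightarrow> \<phi> (c w) = vec.span {t c w}"
    and smooth: "smooth_grass_map 1 \<phi>"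
    and s: "\<And>c w. c \<in> {chart0, chart1} \<Longrightarrow> s c w \<noteq> 0"
    and orth: "\<And>c w. c \<in> {chart0, chart1} \<Longrightarrow> herm (t c w) (s c w) = 0"
    and D: "\<And>c w. c \<in> {chart0, chart1} \<Longrightarrow> \<exists>b x B. b \<noteq> 0 \<and>
      has_wirt_mat (\<lambda>w. line_proj (s c w)) (outer (b *s t c w) (s c w) + outer (s c w) x) B w"
  shows "is_gauss_bundle \<psi> \<phi>"
  unfolding is_gauss_bundle_def
proof (intro conjI allI impI)
  show "\<exists>k. smooth_grass_map k \<phi>"
    using smooth by blast
  fix U c assume lc: "local_coord U c"
  have "(*v) (second_ff \<psi> c z) ` \<psi> (c z) = \<phi> (c z)" if z: "z \<in> U" for z
  proof -
    obtain V \<gamma> c0 where V: "open V" "z \<in> V" "V \<subseteq> U" and c0: "c0 \<in> {chart0, chart1}"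
      and c: "\<And>w. w \<in> V \<Longrightarrow> c w = c0 (\<gamma> w)" and \<gamma>: "\<gamma> holomorphic_on V" "\<And>w. w \<in> V \<Longrightarrow> deriv \<gamma> w \<noteq> 0"
      using local_coord_chart[OF lc z] by metis
    let ?s = "s c0 (\<gamma> z)" and ?t = "t c0 (\<gamma> z)"
    obtain b x B where b: "b \<noteq> 0"
      and B: "has_wirt_mat (\<lambda>w. line_proj (s c0 w)) (outer (b *s ?t) ?s + outer ?s x) B (\<gamma> z)"
      using D[OF c0] by blast
    have d: "(\<gamma> has_field_derivative deriv \<gamma> z) (at z)"
      using \<gamma>(1) V by (simp add: holomorphic_derivI)
    have P: "orth_proj (\<psi> (c w)) = line_proj (s c0 (\<gamma> w))" if "w \<in> V" for w
      using c[OF that] \<psi>[OF c0] orth_proj_line[OF s[OF c0]] by simp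
    have A: "del_z_mat (\<lambda>w. orth_proj (\<psi> (c w))) z = mat (deriv \<gamma> z) ** (outer (b *s ?t) ?s + outer ?s x)"
      by (rule has_wirt_mat_del(1)[OF has_wirt_mat_transform[OF has_wirt_mat_precompose[OF B d] V(1,2)]]) (simp add: P)
    have h: "herm ?s ?s \<noteq> 0"
      using s[OF c0] by (simp add: herm_eq_0_iff)
    have Ps: "line_proj ?s *v ?s = ?s" and Pt: "line_proj ?s *v ?t = 0"
      using h orth[OF c0] by (simp_all add: line_proj_vec)
    have "second_ff \<psi> c z *v ?s = (deriv \<gamma> z * herm ?s ?s * b) *s ?t"
      unfolding second_ff_def A P[OF V(2)] matrix_vector_mul_assoc[symmetric] Ps
      by (simp add: mat_vector_mult mat_vec mult_ac matrix_vector_mult_add_rdistrib outer_vec matrix_vector_mult_diff_rdistrib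
          vector_scalar_commute matrix_vector_right_distrib vec.scale_right_distrib Ps Pt vector_smult_assoc)
    then have "(*v) (second_ff \<psi> c z) ` vec.span {?s} = vec.span {(deriv \<gamma> z * herm ?s ?s * b) *s ?t}"
      by (auto simp: vec.span_singleton vector_scalar_commute image_iff)
    also have "\<dots> = vec.span {?t}"
      using b h \<gamma>(2)[OF V(2)] by (intro span_scale_eq) simp
    finally show ?thesis
      using c[OF V(2)] \<psi>[OF c0] \<phi>[OF c0] by simp
  qed
  then have "{z \<in> U. (*v) (second_ff \<psi> c z) ` \<psi> (c z) \<noteq> \<phi> (c z)} = {}"
    by blast
  then show "{z \<in> U. (*v) (second_ff \<psi> c z) ` \<psi> (c z) \<noteq> \<phi> (c z)} sparse_in U"
    by (simp only: sparse_in_empty)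
qed

text \<open>Around each point both bundles agree with the image of the second fundamental form,
  except possibly at the point itself, where continuity of the projections decides.\<close>

lemma is_gauss_bundle_unique:
  fixes \<phi> \<phi>' :: "rsphere \<Rightarrow> (complex^'n) set"
  assumes "is_gauss_bundle \<psi> \<phi>" "is_gauss_bundle \<psi> \<phi>'"
  shows "\<phi> = \<phi>'"
proof
  fix x
  obtain k k' where k: "smooth_grass_map k \<phi>" "smooth_grass_map k' \<phi>'"
    using assms unfolding is_gauss_bundle_def by blast
  obtain c z where x: "x = c z" and c: "c \<in> {chart0, chart1}"
    by (cases rule: rsphere_cases[of x]) auto
  have "local_coord UNIV c"
    using c local_coord_chart0 local_coord_chart1 by blast
  then have "{w \<in> UNIV. (*v) (second_ff \<psi> c w) ` \<psi> (c w) \<noteq> \<phi> (c w)} sparse_in UNIV"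
    "{w \<in> UNIV. (*v) (second_ff \<psi> c w) ` \<psi> (c w) \<noteq> \<phi>' (c w)} sparse_in UNIV"
    using assms unfolding is_gauss_bundle_def by blast+
  then have "\<forall>\<^sub>F w in at z. (*v) (second_ff \<psi> c w) ` \<psi> (c w) = \<phi> (c w)"
    "\<forall>\<^sub>F w in at z. (*v) (second_ff \<psi> c w) ` \<psi> (c w) = \<phi>' (c w)"
    by (simp_all add: sparse_in_eventually_iff)
  then have ev: "\<forall>\<^sub>F w in at z. orth_proj (\<phi> (c w)) = orth_proj (\<phi>' (c w))"
    by eventually_elim simp
  have "isCont (\<lambda>w. orth_proj (\<phi> (c w))) z" "isCont (\<lambda>w. orth_proj (\<phi>' (c w))) z"
    using smooth_grass_map_differentiable[OF k(1) c] smooth_grass_map_differentiable[OF k(2) c]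
    by (auto intro: differentiable_imp_continuous_within)
  then have "((\<lambda>w. orth_proj (\<phi> (c w))) \<longlongrightarrow> orth_proj (\<phi> (c z))) (at z)"
    "((\<lambda>w. orth_proj (\<phi>' (c w))) \<longlongrightarrow> orth_proj (\<phi>' (c z))) (at z)"
    by (simp_all add: isCont_def)
  then have eq: "orth_proj (\<phi> x) = orth_proj (\<phi>' x)"
    unfolding x using tendsto_unique[OF at_neq_bot] tendsto_cong[OF ev] by blast
  have "vec.subspace (\<phi> x)" "vec.subspace (\<phi>' x)"
    using k by (simp_all add: smooth_grass_map_def grassmannian_def)
  from this[THEN projection_orth_proj] show "\<phi> x = \<phi>' x"
    unfolding eq projection_def by blast
qed

lemma gauss_bundle_eq: "is_gauss_bundle \<psi> \<phi> \<Longrightarrow> gauss_bundle \<psi> = \<phi>"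
  unfolding gauss_bundle_def by (rule the_equality) (auto intro: is_gauss_bundle_unique)

section \<open>The Veronese frame\<close>

text \<open>With \<open>conic\<close> and \<open>polar\<close> this is the unnormalized Frenet frame
  of the Veronese conic; \<open>ruling\<close> and \<open>coruling\<close> form that of the line in
  u_3, u_4. The scaling keeps the entries polynomial in z and cnj z.\<close>

definition mid :: "(nat \<Rightarrow> complex^'n) \<Rightarrow> complex \<Rightarrow> complex^'n" where
  "mid u z = (1 - z * cnj z) *s u 1 + (of_real (sqrt 2) * z) *s u 2 - (of_real (sqrt 2) * cnj z) *s u 0"

definition ruling :: "(nat \<Rightarrow> complex^'n) \<Rightarrow> complex \<Rightarrow> complex^'n" where
  "ruling u z = u 3 + z *s u 4"

definition coruling :: "(nat \<Rightarrow> complex^'n) \<Rightarrow> complex \<Rightarrow> complex^'n" where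
  "coruling u z = u 4 - cnj z *s u 3"

lemma csqrt2: "complex_of_real (sqrt 2) * complex_of_real (sqrt 2) = 2" "complex_of_real (sqrt 2) * (complex_of_real (sqrt 2) * x) = 2 * x"
  "(complex_of_real (sqrt 2))\<^sup>2 = 2"
proof -
  have *: "complex_of_real (sqrt 2) * complex_of_real (sqrt 2) = 2"
    by (simp flip: of_real_mult)
  then show "complex_of_real (sqrt 2) * complex_of_real (sqrt 2) = 2" "(complex_of_real (sqrt 2))\<^sup>2 = 2"
    by (simp_all add: power2_eq_square)
  show "complex_of_real (sqrt 2) * (complex_of_real (sqrt 2) * x) = 2 * x"
    using * by (simp flip: mult.assoc)
qed

context
  fixes u :: "nat \<Rightarrow> complex^5"
  assumes on: "orthonormal_upto 5 u"
begin

lemma herm_frame: "i < 5 \<Longrightarrow> j < 5 \<Longrightarrow> herm (u i) (u j) = (if i = j then 1 else 0)"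
  using on by (simp add: orthonormal_upto_def)

lemmas herm_expand = conic_def mid_def polar_def ruling_def coruling_def herm_add_left herm_add_right herm_diff_left
  herm_diff_right herm_scale_left herm_scale_right herm_frame

lemma frame_norm:
  "herm (conic u z) (conic u z) = (1 + z * cnj z)\<^sup>2" "herm (mid u z) (mid u z) = (1 + z * cnj z)\<^sup>2"
  "herm (polar u z) (polar u z) = (1 + z * cnj z)\<^sup>2" "herm (ruling u z) (ruling u z) = 1 + z * cnj z"
  "herm (coruling u z) (coruling u z) = 1 + z * cnj z"
  by (simp_all add: herm_expand[unfolded One_nat_def] power2_eq_square algebra_simps csqrt2)

lemma frame_orth:
  "herm (conic u z) (mid u z) = 0" "herm (conic u z) (polar u z) = 0" "herm (conic u z) (ruling u z) = 0"
  "herm (conic u z) (coruling u z) = 0" "herm (mid u z) (polar u z) = 0" "herm (mid u z) (ruling u z) = 0"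
  "herm (mid u z) (coruling u z) = 0" "herm (polar u z) (ruling u z) = 0" "herm (polar u z) (coruling u z) = 0"
  "herm (ruling u z) (coruling u z) = 0"
  by (simp_all add: herm_expand[unfolded One_nat_def] power2_eq_square algebra_simps csqrt2)

lemma frame_orth':
  "herm (mid u z) (conic u z) = 0" "herm (polar u z) (conic u z) = 0" "herm (ruling u z) (conic u z) = 0"
  "herm (coruling u z) (conic u z) = 0" "herm (polar u z) (mid u z) = 0" "herm (ruling u z) (mid u z) = 0"
  "herm (coruling u z) (mid u z) = 0" "herm (ruling u z) (polar u z) = 0" "herm (coruling u z) (polar u z) = 0"
  "herm (coruling u z) (ruling u z) = 0"
  using frame_orth[THEN arg_cong[of _ _ cnj]] by (simp_all add: herm_cnj)

lemma frame_nonzero: "conic u z \<noteq> 0" "mid u z \<noteq> 0" "polar u z \<noteq> 0" "ruling u z \<noteq> 0" "coruling u z \<noteq> 0"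
  using frame_norm[of z] one_plus_norm_nonzero[of z] by (auto simp flip: herm_eq_0_iff)

text \<open>Five orthogonal nonzero vectors in \<complex>^5; normalizing them gives a complete
  frame.\<close>

lemma frame_complete:
  "line_proj (conic u z) + line_proj (mid u z) + line_proj (polar u z) + line_proj (ruling u z) + line_proj (coruling u z) = mat 1"
proof -
  define f where "f = (\<lambda>i. [conic u z, mid u z, polar u z, ruling u z, coruling u z] ! i)"
  define h where "h = (\<lambda>i. \<Sum>a\<in>UNIV. (cmod (f i $ a))\<^sup>2)"
  define w where "w = (\<lambda>i. of_real (1 / sqrt (h i)) *s f i)"
  have five: "i \<in> {0, 1, 2, 3, 4}" if "i < 5" for i :: nat
    using that by auto
  have f0: "f i \<noteq> 0" if "i < 5" for i
    using five[OF that] frame_nonzero by (auto simp: f_def)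
  have h: "h i > 0" if "i < 5" for i
    unfolding h_def by (rule herm_self_pos[OF f0[OF that]])
  have hf: "herm (f i) (f i) = of_real (h i)" for i
    unfolding h_def by (rule herm_self)
  have ff: "herm (f i) (f j) = 0" if "i < 5" "j < 5" "i \<noteq> j" for i j
    using five[OF that(1)] five[OF that(2)] that(3) frame_orth frame_orth' by (auto simp: f_def)
  have sq: "complex_of_real (1 / sqrt (h i)) * of_real (1 / sqrt (h i)) = 1 / of_real (h i)" if "i < 5" for i
    using h[OF that] by (simp flip: of_real_mult)
  have "orthonormal_upto 5 w"
    unfolding orthonormal_upto_def
  proof (intro allI impI)
    fix i j :: nat assume ij: "i < 5" "j < 5"
    show "herm (w i) (w j) = (if i = j then 1 else 0)"
    proof (cases "i = j")
      case True
      have "herm (w i) (w i) = (complex_of_real (1 / sqrt (h i)) * of_real (1 / sqrt (h i))) * herm (f i) (f i)"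
        by (simp add: w_def herm_scale_left herm_scale_right)
      then show ?thesis
        unfolding sq[OF ij(1)] hf using True h[OF ij(1)] by simp
    qed (simp add: w_def herm_scale_left herm_scale_right ff ij)
  qed
  then have "orthonormal_upto CARD(5) w"
    by simp
  from orthonormal_complete[OF this]
  have c: "(\<Sum>i<5. w i $ a * cnj (w i $ b)) = (if a = b then 1 else 0)" for a b
    by simp
  have "line_proj (f i) $ a $ b = w i $ a * cnj (w i $ b)" if "i < 5" for i a b
  proof -
    have "w i $ a * cnj (w i $ b) = (complex_of_real (1 / sqrt (h i)) * of_real (1 / sqrt (h i))) * (f i $ a * cnj (f i $ b))"
      by (simp add: w_def)
    then show ?thesis
      unfolding sq[OF that] line_proj_nth hf by simp
  qed
  then have "(\<Sum>i<5. line_proj (f i) $ a $ b) = (if a = b then 1 else 0)" for a b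
    using c by simp
  moreover have "(\<Sum>i<5. g i) = g 0 + g 1 + g 2 + g 3 + g (4 :: nat)" for g :: "nat \<Rightarrow> complex"
    by (simp add: eval_nat_numeral)
  ultimately show ?thesis
    by (simp add: vec_eq_iff mat_def f_def)
qed

lemma combination: "N \<noteq> 0 \<Longrightarrow> a * x + b * y = r * N \<Longrightarrow> a / N * x + b / N * y = (r :: complex)"
  by (simp add: field_simps)

text \<open>A Frenet equation in the shape expected by \<open>line_proj_wirt\<close>; the zero
  multiples on the \<partial>-bar side express holomorphy.\<close>

lemma conic_wirt:
  "has_wirt (\<lambda>w. conic u w $ a) (2 * cnj z / (1 + z * cnj z) * conic u z $ a + of_real (sqrt 2) / (1 + z * cnj z) * mid u z $ a)
     (0 * conic u z $ a + 0 * mid u z $ a) z"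
proof -
  have "has_wirt (\<lambda>w. u 0 $ a + (of_real (sqrt 2) * w) * u 1 $ a + w\<^sup>2 * u 2 $ a) (of_real (sqrt 2) * u 1 $ a + 2 * z * u 2 $ a) 0 z"
    by (rule has_wirt_field) (auto intro!: derivative_eq_intros)
  moreover have "2 * cnj z / (1 + z * cnj z) * conic u z $ a + of_real (sqrt 2) / (1 + z * cnj z) * mid u z $ a
      = of_real (sqrt 2) * u 1 $ a + 2 * z * u 2 $ a"
    by (rule combination[OF one_plus_norm_nonzero]) (simp add: conic_def mid_def algebra_simps power2_eq_square csqrt2)
  ultimately show ?thesis
    by (simp add: conic_def)
qed

lemma ruling_wirt:
  "has_wirt (\<lambda>w. ruling u w $ a) (cnj z / (1 + z * cnj z) * ruling u z $ a + 1 / (1 + z * cnj z) * coruling u z $ a)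
     (0 * ruling u z $ a + 0 * coruling u z $ a) z"
proof -
  have "has_wirt (\<lambda>w. u 3 $ a + w * u 4 $ a) (u 4 $ a) 0 z"
    by (rule has_wirt_field) (auto intro!: derivative_eq_intros)
  moreover have "cnj z / (1 + z * cnj z) * ruling u z $ a + 1 / (1 + z * cnj z) * coruling u z $ a = u 4 $ a"
    by (rule combination[OF one_plus_norm_nonzero]) (simp add: ruling_def coruling_def algebra_simps)
  ultimately show ?thesis
    by (simp add: ruling_def)
qed

lemma mid_wirt:
  "has_wirt (\<lambda>w. mid u w $ a) (cnj z / (1 + z * cnj z) * mid u z $ a + of_real (sqrt 2) / (1 + z * cnj z) * polar u z $ a)
     (z / (1 + z * cnj z) * mid u z $ a + - of_real (sqrt 2) / (1 + z * cnj z) * conic u z $ a) z"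
proof -
  have "has_wirt (\<lambda>w. (1 - w * cnj w) * u 1 $ a + (of_real (sqrt 2) * w) * u 2 $ a - (of_real (sqrt 2) * cnj w) * u 0 $ a)
     (- cnj z * u 1 $ a + of_real (sqrt 2) * u 2 $ a) (- z * u 1 $ a - of_real (sqrt 2) * u 0 $ a) z"
    by (rule has_wirt_eq, (rule has_wirt_diff has_wirt_add has_wirt_mult has_wirt_const has_wirt_ident has_wirt_conj)+) simp_all
  moreover have "cnj z / (1 + z * cnj z) * mid u z $ a + of_real (sqrt 2) / (1 + z * cnj z) * polar u z $ a
      = - cnj z * u 1 $ a + of_real (sqrt 2) * u 2 $ a"
    by (rule combination[OF one_plus_norm_nonzero]) (simp add: polar_def mid_def algebra_simps power2_eq_square csqrt2)
  moreover have "z / (1 + z * cnj z) * mid u z $ a + - of_real (sqrt 2) / (1 + z * cnj z) * conic u z $ a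
      = - z * u 1 $ a - of_real (sqrt 2) * u 0 $ a"
    by (rule combination[OF one_plus_norm_nonzero]) (simp add: conic_def mid_def algebra_simps power2_eq_square csqrt2)
  ultimately show ?thesis
    by (simp add: mid_def left_diff_distrib)
qed

lemma polar_wirt:
  "has_wirt (\<lambda>w. polar u w $ a) (0 * polar u z $ a + 0 * mid u z $ a)
     (2 * z / (1 + z * cnj z) * polar u z $ a + - of_real (sqrt 2) / (1 + z * cnj z) * mid u z $ a) z"
proof -
  have "has_wirt (\<lambda>w. u 2 $ a - (of_real (sqrt 2) * cnj w) * u 1 $ a + (cnj w)\<^sup>2 * u 0 $ a)
     0 (2 * cnj z * u 0 $ a - of_real (sqrt 2) * u 1 $ a) z"
    by (rule has_wirt_eq, (rule has_wirt_diff has_wirt_add has_wirt_mult has_wirt_const has_wirt_ident has_wirt_conj has_wirt_power)+) simp_all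
  moreover have "2 * z / (1 + z * cnj z) * polar u z $ a + - of_real (sqrt 2) / (1 + z * cnj z) * mid u z $ a
      = 2 * cnj z * u 0 $ a - of_real (sqrt 2) * u 1 $ a"
    by (rule combination[OF one_plus_norm_nonzero]) (simp add: polar_def mid_def algebra_simps power2_eq_square csqrt2)
  ultimately show ?thesis
    by (simp add: polar_def)
qed

lemma line_proj_conic_wirt: "has_wirt_mat (\<lambda>w. line_proj (conic u w))
    (outer ((of_real (sqrt 2) / (1 + z * cnj z) / (1 + z * cnj z)\<^sup>2) *s mid u z) (conic u z))
    (outer (conic u z) ((of_real (sqrt 2) / (1 + z * cnj z) / (1 + z * cnj z)\<^sup>2) *s mid u z)) z"
  using line_proj_wirt[where d = 2, OF conic_wirt frame_norm(1), of z] by (simp add: outer_zero)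

lemma line_proj_ruling_wirt: "has_wirt_mat (\<lambda>w. line_proj (ruling u w))
    (outer ((1 / (1 + z * cnj z) / (1 + z * cnj z)) *s coruling u z) (ruling u z))
    (outer (ruling u z) ((1 / (1 + z * cnj z) / (1 + z * cnj z)) *s coruling u z)) z"
  using line_proj_wirt[where d = 1, OF ruling_wirt, of z] by (simp add: outer_zero frame_norm)

lemma line_proj_polar_wirt: "has_wirt_mat (\<lambda>w. line_proj (polar u w))
    (outer (polar u z) ((- of_real (sqrt 2) / (1 + z * cnj z) / (1 + z * cnj z)\<^sup>2) *s mid u z))
    (outer ((- of_real (sqrt 2) / (1 + z * cnj z) / (1 + z * cnj z)\<^sup>2) *s mid u z) (polar u z)) z"
  using line_proj_wirt[where d = 2, OF polar_wirt frame_norm(3), of z] by (simp add: outer_zero)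

lemma line_proj_mid_wirt: "\<exists>x B. has_wirt_mat (\<lambda>w. line_proj (mid u w))
    (outer ((of_real (sqrt 2) / (1 + z * cnj z) / (1 + z * cnj z)\<^sup>2) *s polar u z) (mid u z) + outer (mid u z) x) B z"
  by (rule exI, rule exI, rule line_proj_wirt[where d = 2, OF mid_wirt frame_norm(2)]) (simp add: mult.commute)

end

section \<open>The model curve\<close>

text \<open>Multiplying the curves at 1 / w by their top power of w reverses the coefficients, so
  near infinity the model has the same form with the basis reversed within \<complex>^3 and within
  \<complex>^2.\<close>

definition flipped :: "nat \<Rightarrow> complex^5" where
  "flipped r = basis5 (if r = 0 then 2 else if r = 2 then 0 else if r = 3 then 4 else if r = 4 then 3 else r)"

definition chart_basis :: "(complex \<Rightarrow> rsphere) \<Rightarrow> nat \<Rightarrow> complex^5" where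
  "chart_basis c = (if c = chart0 then basis5 else flipped)"

lemma chart_basis: "chart_basis chart0 = basis5" "chart_basis chart1 = flipped"
proof -
  have "chart0 0 \<noteq> chart1 0"
    by (simp add: chart0_def chart1_def)
  then show "chart_basis chart0 = basis5" "chart_basis chart1 = flipped"
    by (auto simp: chart_basis_def)
qed

lemma herm_basis5: "i < 5 \<Longrightarrow> j < 5 \<Longrightarrow> herm (basis5 i) (basis5 j) = (if i = j then 1 else 0)"
proof -
  assume ij: "i < 5" "j < 5"
  have "i \<in> {0, 1, 2, 3, 4}" "j \<in> {0, 1, 2, 3, 4}"
    using ij by auto
  then have eq: "(of_nat i :: 5) = of_nat j \<longleftrightarrow> i = j"
    by auto
  have "axis k 1 $ a * cnj (axis l 1 $ a) = (if a = k then (if k = l then 1 else 0) else (0 :: complex))" for k l a :: 5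
    by (auto simp: axis_def)
  then show ?thesis
    by (simp add: herm_def basis5_def eq)
qed

lemma chart_basis_orthonormal: "c \<in> {chart0, chart1} \<Longrightarrow> orthonormal_upto 5 (chart_basis c)"
proof -
  have "orthonormal_upto 5 basis5"
    by (simp add: orthonormal_upto_def herm_basis5)
  moreover have "orthonormal_upto 5 flipped"
    unfolding orthonormal_upto_def flipped_def
  proof (intro allI impI)
    fix i j :: nat assume ij: "i < 5" "j < 5"
    show "herm (basis5 (if i = 0 then 2 else if i = 2 then 0 else if i = 3 then 4 else if i = 4 then 3 else i))
        (basis5 (if j = 0 then 2 else if j = 2 then 0 else if j = 3 then 4 else if j = 4 then 3 else j)) = (if i = j then 1 else 0)"
      by (subst herm_basis5) (use ij in auto)
  qed
  ultimately show "c \<in> {chart0, chart1} \<Longrightarrow> orthonormal_upto 5 (chart_basis c)"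
    by (auto simp: chart_basis)
qed

fun mid_line :: "rsphere \<Rightarrow> (complex^5) set" where
  "mid_line (Fin z) = vec.span {mid basis5 z}"
| "mid_line Infty = vec.span {basis5 1}"

fun polar_line :: "rsphere \<Rightarrow> (complex^5) set" where
  "polar_line (Fin z) = vec.span {polar basis5 z}"
| "polar_line Infty = vec.span {basis5 0}"

fun coruling_line :: "rsphere \<Rightarrow> (complex^5) set" where
  "coruling_line (Fin z) = vec.span {coruling basis5 z}"
| "coruling_line Infty = vec.span {basis5 3}"

lemma span_eq_scaled: "x = k *s y \<Longrightarrow> k \<noteq> 0 \<Longrightarrow> vec.span {y} = vec.span {x :: complex^'n}"
  by (simp add: span_scale_eq)

lemma veronese_Fin: "veronese 2 basis5 (Fin w) = vec.span {conic basis5 w}"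
  "veronese 1 (\<lambda>r. basis5 (3 + r)) (Fin w) = vec.span {ruling basis5 w}"
proof -
  have "(\<Sum>r\<le>2. g r) = g 0 + g 1 + g 2" "(\<Sum>r\<le>1. g r) = g 0 + g 1" for g :: "nat \<Rightarrow> complex^5"
    by (simp_all add: numeral_2_eq_2)
  then show "veronese 2 basis5 (Fin w) = vec.span {conic basis5 w}"
    "veronese 1 (\<lambda>r. basis5 (3 + r)) (Fin w) = vec.span {ruling basis5 w}"
    unfolding veronese.simps by (simp_all add: conic_def ruling_def)
qed

lemma flip_scale:
  assumes w: "w \<noteq> 0"
  shows "conic flipped w = w\<^sup>2 *s conic basis5 (1 / w)" "mid flipped w = (- (w * cnj w)) *s mid basis5 (1 / w)"
    "polar flipped w = (cnj w)\<^sup>2 *s polar basis5 (1 / w)" "ruling flipped w = w *s ruling basis5 (1 / w)"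
    "coruling flipped w = (- cnj w) *s coruling basis5 (1 / w)"
  using w by (simp_all add: vec_eq_iff conic_def mid_def polar_def ruling_def coruling_def flipped_def field_simps power2_eq_square)

lemma model_charts:
  assumes "c \<in> {chart0, chart1}"
  shows "veronese 2 basis5 (c w) = vec.span {conic (chart_basis c) w}"
    and "veronese 1 (\<lambda>r. basis5 (3 + r)) (c w) = vec.span {ruling (chart_basis c) w}"
    and "mid_line (c w) = vec.span {mid (chart_basis c) w}"
    and "polar_line (c w) = vec.span {polar (chart_basis c) w}"
    and "coruling_line (c w) = vec.span {coruling (chart_basis c) w}"
proof -
  have "veronese 2 basis5 (chart1 w) = vec.span {conic flipped w} \<and>
      veronese 1 (\<lambda>r. basis5 (3 + r)) (chart1 w) = vec.span {ruling flipped w} \<and>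
      mid_line (chart1 w) = vec.span {mid flipped w} \<and> polar_line (chart1 w) = vec.span {polar flipped w} \<and>
      coruling_line (chart1 w) = vec.span {coruling flipped w}"
  proof (cases "w = 0")
    case True
    then show ?thesis
      by (simp add: chart1_def conic_def mid_def polar_def ruling_def coruling_def flipped_def)
  next
    case False
    have c: "chart1 w = Fin (1 / w)"
      using False by (simp add: chart1_def)
    show ?thesis
      unfolding c veronese_Fin mid_line.simps polar_line.simps coruling_line.simps
      by (intro conjI; rule span_eq_scaled, rule flip_scale[OF False]) (use False in simp_all)
  qed
  note A1 = this
  have A0: "veronese 2 basis5 (chart0 w) = vec.span {conic basis5 w} \<and>
      veronese 1 (\<lambda>r. basis5 (3 + r)) (chart0 w) = vec.span {ruling basis5 w} \<and>
      mid_line (chart0 w) = vec.span {mid basis5 w} \<and> polar_line (chart0 w) = vec.span {polar basis5 w} \<and>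
      coruling_line (chart0 w) = vec.span {coruling basis5 w}"
    unfolding chart0_def veronese_Fin mid_line.simps polar_line.simps coruling_line.simps by (intro conjI refl)
  from assms consider "c = chart0" | "c = chart1"
    by blast
  then have "veronese 2 basis5 (c w) = vec.span {conic (chart_basis c) w} \<and>
      veronese 1 (\<lambda>r. basis5 (3 + r)) (c w) = vec.span {ruling (chart_basis c) w} \<and>
      mid_line (c w) = vec.span {mid (chart_basis c) w} \<and> polar_line (c w) = vec.span {polar (chart_basis c) w} \<and>
      coruling_line (c w) = vec.span {coruling (chart_basis c) w}"
  proof cases
    case 1
    show ?thesis
      unfolding 1 chart_basis by (rule A0)
  next
    case 2
    show ?thesis
      unfolding 2 chart_basis by (rule A1)
  qed
  then show "veronese 2 basis5 (c w) = vec.span {conic (chart_basis c) w}"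
    "veronese 1 (\<lambda>r. basis5 (3 + r)) (c w) = vec.span {ruling (chart_basis c) w}"
    "mid_line (c w) = vec.span {mid (chart_basis c) w}"
    "polar_line (c w) = vec.span {polar (chart_basis c) w}"
    "coruling_line (c w) = vec.span {coruling (chart_basis c) w}"
    by blast+
qed

lemma tame_frame: "tame (\<lambda>w. mid u w $ a)" "tame (\<lambda>w. polar u w $ a)" "tame (\<lambda>w. coruling u w $ a)"
  unfolding mid_def polar_def coruling_def vector_add_component vector_minus_component vector_smult_component
  by (intro tame_diff tame.add tame.mult tame.const tame.ident tame.conj tame_power)+

lemma gauss_bundles:
  "gauss_bundle (veronese 2 basis5) = mid_line" "gauss_bundle mid_line = polar_line"
  "gauss_bundle (veronese 1 (\<lambda>r. basis5 (3 + r))) = coruling_line"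
proof -
  note on = chart_basis_orthonormal
  have N: "1 + w * cnj w \<noteq> 0" for w
    by (rule one_plus_norm_nonzero)
  have k: "complex_of_real (sqrt 2) / (1 + w * cnj w) / (1 + w * cnj w)\<^sup>2 \<noteq> 0" "1 / (1 + w * cnj w) / (1 + w * cnj w) \<noteq> 0" for w
    using N[of w] by simp_all
  have s1: "smooth_grass_map 1 mid_line"
  proof (rule smooth_grass_map_line[where t = "\<lambda>c. mid (chart_basis c)" and d = 2])
    fix c :: "complex \<Rightarrow> rsphere" and w a assume c: "c \<in> {chart0, chart1}"
    show "mid_line (c w) = vec.span {mid (chart_basis c) w}"
      by (rule model_charts[OF c])
    show "herm (mid (chart_basis c) w) (mid (chart_basis c) w) = (1 + w * cnj w) ^ 2"
      by (rule frame_norm[OF on[OF c]])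
    show "tame (\<lambda>w. mid (chart_basis c) w $ a)"
      by (rule tame_frame)
  qed
  have s2: "smooth_grass_map 1 polar_line"
  proof (rule smooth_grass_map_line[where t = "\<lambda>c. polar (chart_basis c)" and d = 2])
    fix c :: "complex \<Rightarrow> rsphere" and w a assume c: "c \<in> {chart0, chart1}"
    show "polar_line (c w) = vec.span {polar (chart_basis c) w}"
      by (rule model_charts[OF c])
    show "herm (polar (chart_basis c) w) (polar (chart_basis c) w) = (1 + w * cnj w) ^ 2"
      by (rule frame_norm[OF on[OF c]])
    show "tame (\<lambda>w. polar (chart_basis c) w $ a)"
      by (rule tame_frame)
  qed
  have s3: "smooth_grass_map 1 coruling_line"
  proof (rule smooth_grass_map_line[where t = "\<lambda>c. coruling (chart_basis c)" and d = 1])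
    fix c :: "complex \<Rightarrow> rsphere" and w a assume c: "c \<in> {chart0, chart1}"
    show "coruling_line (c w) = vec.span {coruling (chart_basis c) w}"
      by (rule model_charts[OF c])
    show "herm (coruling (chart_basis c) w) (coruling (chart_basis c) w) = (1 + w * cnj w) ^ 1"
      using frame_norm(5)[OF on[OF c]] by simp
    show "tame (\<lambda>w. coruling (chart_basis c) w $ a)"
      by (rule tame_frame)
  qed
  have "is_gauss_bundle (veronese 2 basis5) mid_line"
  proof (rule is_gauss_bundle_line[where s = "\<lambda>c. conic (chart_basis c)" and t = "\<lambda>c. mid (chart_basis c)"])
    fix c :: "complex \<Rightarrow> rsphere" and w assume c: "c \<in> {chart0, chart1}"
    show "veronese 2 basis5 (c w) = vec.span {conic (chart_basis c) w}" "mid_line (c w) = vec.span {mid (chart_basis c) w}"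
      by (rule model_charts[OF c])+
    show "conic (chart_basis c) w \<noteq> 0"
      by (rule frame_nonzero[OF on[OF c]])
    show "herm (mid (chart_basis c) w) (conic (chart_basis c) w) = 0"
      by (rule frame_orth'[OF on[OF c]])
    show "\<exists>b x B. b \<noteq> 0 \<and> has_wirt_mat (\<lambda>w. line_proj (conic (chart_basis c) w))
        (outer (b *s mid (chart_basis c) w) (conic (chart_basis c) w) + outer (conic (chart_basis c) w) x) B w"
    proof -
      have "has_wirt_mat (\<lambda>w. line_proj (conic (chart_basis c) w)) (outer ((of_real (sqrt 2) / (1 + w * cnj w) / (1 + w * cnj w)\<^sup>2) *s mid (chart_basis c) w) (conic (chart_basis c) w) + outer (conic (chart_basis c) w) 0)
          (outer (conic (chart_basis c) w) ((of_real (sqrt 2) / (1 + w * cnj w) / (1 + w * cnj w)\<^sup>2) *s mid (chart_basis c) w)) w"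
        using line_proj_conic_wirt[OF on[OF c], of w] unfolding outer_zero add_0_right .
      then show ?thesis
        using k(1)[of w] by blast
    qed
  qed (rule s1)
  then show "gauss_bundle (veronese 2 basis5) = mid_line"
    by (rule gauss_bundle_eq)
  have "is_gauss_bundle mid_line polar_line"
  proof (rule is_gauss_bundle_line[where s = "\<lambda>c. mid (chart_basis c)" and t = "\<lambda>c. polar (chart_basis c)"])
    fix c :: "complex \<Rightarrow> rsphere" and w assume c: "c \<in> {chart0, chart1}"
    show "mid_line (c w) = vec.span {mid (chart_basis c) w}" "polar_line (c w) = vec.span {polar (chart_basis c) w}"
      by (rule model_charts[OF c])+
    show "mid (chart_basis c) w \<noteq> 0"
      by (rule frame_nonzero[OF on[OF c]])
    show "herm (polar (chart_basis c) w) (mid (chart_basis c) w) = 0"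
      by (rule frame_orth'[OF on[OF c]])
    show "\<exists>b x B. b \<noteq> 0 \<and> has_wirt_mat (\<lambda>w. line_proj (mid (chart_basis c) w))
        (outer (b *s polar (chart_basis c) w) (mid (chart_basis c) w) + outer (mid (chart_basis c) w) x) B w"
      using line_proj_mid_wirt[OF on[OF c], of w] k(1)[of w] by blast
  qed (rule s2)
  then show "gauss_bundle mid_line = polar_line"
    by (rule gauss_bundle_eq)
  have "is_gauss_bundle (veronese 1 (\<lambda>r. basis5 (3 + r))) coruling_line"
  proof (rule is_gauss_bundle_line[where s = "\<lambda>c. ruling (chart_basis c)" and t = "\<lambda>c. coruling (chart_basis c)"])
    fix c :: "complex \<Rightarrow> rsphere" and w assume c: "c \<in> {chart0, chart1}"
    show "veronese 1 (\<lambda>r. basis5 (3 + r)) (c w) = vec.span {ruling (chart_basis c) w}" "coruling_line (c w) = vec.span {coruling (chart_basis c) w}"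
      by (rule model_charts[OF c])+
    show "ruling (chart_basis c) w \<noteq> 0"
      by (rule frame_nonzero[OF on[OF c]])
    show "herm (coruling (chart_basis c) w) (ruling (chart_basis c) w) = 0"
      by (rule frame_orth'[OF on[OF c]])
    show "\<exists>b x B. b \<noteq> 0 \<and> has_wirt_mat (\<lambda>w. line_proj (ruling (chart_basis c) w))
        (outer (b *s coruling (chart_basis c) w) (ruling (chart_basis c) w) + outer (ruling (chart_basis c) w) x) B w"
    proof -
      have "has_wirt_mat (\<lambda>w. line_proj (ruling (chart_basis c) w)) (outer ((1 / (1 + w * cnj w) / (1 + w * cnj w)) *s coruling (chart_basis c) w) (ruling (chart_basis c) w) + outer (ruling (chart_basis c) w) 0)
          (outer (ruling (chart_basis c) w) ((1 / (1 + w * cnj w) / (1 + w * cnj w)) *s coruling (chart_basis c) w)) w"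
        using line_proj_ruling_wirt[OF on[OF c], of w] unfolding outer_zero add_0_right .
      then show ?thesis
        using k(2)[of w] by blast
    qed
  qed (rule s3)
  then show "gauss_bundle (veronese 1 (\<lambda>r. basis5 (3 + r))) = coruling_line"
    by (rule gauss_bundle_eq)
qed

lemma model_curve_eq:
  "model_curve x = [veronese 2 basis5 x + veronese 1 (\<lambda>r. basis5 (3 + r)) x, mid_line x + coruling_line x, polar_line x]"
proof -
  have "(gauss_bundle ^^ 2) (veronese 2 basis5) = polar_line"
    by (simp add: numeral_2_eq_2 gauss_bundles[unfolded numeral_2_eq_2])
  then show ?thesis
    by (simp add: model_curve_def veronese_seq_def Let_def gauss_bundles[simplified])
qed

lemma model_chart:
  assumes "c \<in> {chart0, chart1}"
  shows "model_curve (c w) = [vec.span {conic (chart_basis c) w} + vec.span {ruling (chart_basis c) w},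
    vec.span {mid (chart_basis c) w} + vec.span {coruling (chart_basis c) w}, vec.span {polar (chart_basis c) w}]"
  unfolding model_curve_eq model_charts[OF assms] ..

lemma trace_outer: "trace (outer v w) = herm v w"
  by (simp add: trace_def outer_def herm_def)

lemma frob_outer2:
  assumes "herm c l = 0"
  shows "of_real (frob (outer x c + outer y l)) = herm c c * herm x x + herm l l * herm y y"
proof -
  have lc: "herm l c = 0"
    using assms herm_cnj[of c l] by simp
  have "(outer x c + outer y l) ** adj (outer x c + outer y l) = outer (herm c c *s x) x + outer (herm l l *s y) y"
    by (simp add: adj_add adj_outer matrix_add_rdistrib matrix_add_ldistrib outer_mult assms lc outer_zero)
  then show ?thesis
    unfolding trace_adj[symmetric] by (simp add: trace_add trace_outer herm_scale_left)
qed

lemma frob_scale: "frob (mat d ** A) = (cmod d)\<^sup>2 * frob A"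
  by (simp add: frob_def mat_mult_nth norm_mult power_mult_distrib sum_distrib_left)

section \<open>Curvature of the model\<close>

context
  fixes u :: "nat \<Rightarrow> complex^5"
  assumes on: "orthonormal_upto 5 u"
begin

definition "plane w = line_proj (conic u w) + line_proj (ruling u w)"

definition "plane_del z =
  outer ((of_real (sqrt 2) / (1 + z * cnj z) / (1 + z * cnj z)\<^sup>2) *s mid u z) (conic u z)
  + outer ((1 / (1 + z * cnj z) / (1 + z * cnj z)) *s coruling u z) (ruling u z)"

definition "polar_del z = outer (polar u z) ((- of_real (sqrt 2) / (1 + z * cnj z) / (1 + z * cnj z)\<^sup>2) *s mid u z)"

lemma plane_wirt: "has_wirt_mat plane (plane_del z) (adj (plane_del z)) z"
  using has_wirt_mat_add[OF line_proj_conic_wirt[OF on] line_proj_ruling_wirt[OF on]]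
  by (simp add: plane_def[abs_def] plane_del_def adj_add adj_outer)

lemma polar_del_wirt: "has_wirt_mat (\<lambda>w. line_proj (polar u w)) (polar_del z) (adj (polar_del z)) z"
  using line_proj_polar_wirt[OF on] by (simp add: polar_del_def adj_outer)

lemma projection_plane: "projection (plane w) (vec.span {conic u w} + vec.span {ruling u w})"
  unfolding plane_def
  by (intro projection_add projection_line frame_nonzero[OF on] line_proj_orthogonal frame_orth'[OF on])

lemma projection_complement:
  "projection (mat 1 - plane w - line_proj (polar u w)) (vec.span {mid u w} + vec.span {coruling u w})"
proof -
  have "mat 1 - plane w - line_proj (polar u w) = line_proj (mid u w) + line_proj (coruling u w)"
    unfolding plane_def frame_complete[OF on, of w, symmetric] by simp
  moreover have "projection (line_proj (mid u w) + line_proj (coruling u w)) (vec.span {mid u w} + vec.span {coruling u w})"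
    by (intro projection_add projection_line frame_nonzero[OF on] line_proj_orthogonal frame_orth'[OF on])
  ultimately show ?thesis
    by simp
qed

lemma plane_products:
  "line_proj (polar u z) ** plane z = 0" "adj (plane_del z) ** plane z = 0" "polar_del z ** line_proj (polar u z) = 0"
  "line_proj (polar u z) ** plane_del z = 0"
  by (simp_all add: plane_def plane_del_def polar_del_def line_proj_def adj_add adj_outer matrix_add_rdistrib matrix_add_ldistrib
      outer_mult outer_zero herm_scale_left herm_scale_right herm_minus_left herm_minus_right frame_orth[OF on] frame_orth'[OF on])

text \<open>In units of 1 / (1 + |z|^2)^2 the conic and the line contribute 2 and 1 to psi_0, and
  the polar curve contributes 2: the origin of the weights 3 and 2 in the curvature.\<close>

lemma frob_plane_del: "frob (plane_del z) = 3 / (1 + (cmod z)\<^sup>2)\<^sup>2"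
  and frob_polar_del: "frob (polar_del z) = 2 / (1 + (cmod z)\<^sup>2)\<^sup>2"
proof -
  define N where "N = 1 + z * cnj z"
  have N: "N \<noteq> 0" and cN: "cnj N = N"
    using one_plus_norm_nonzero[of z] by (simp_all add: N_def mult.commute)
  have NR: "N = of_real (1 + (cmod z)\<^sup>2)"
    by (simp only: N_def of_real_add of_real_1 complex_norm_square)
  note norms = frame_norm[OF on, of z, folded N_def]
  have "of_real (frob (plane_del z)) = 3 / N\<^sup>2"
    unfolding plane_del_def frob_outer2[OF frame_orth(3)[OF on]] N_def[symmetric]
    using N by (simp add: herm_scale_left herm_scale_right norms cN field_simps power2_eq_square csqrt2)
  also have "\<dots> = of_real (3 / (1 + (cmod z)\<^sup>2)\<^sup>2)"
    unfolding NR by simp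
  finally show "frob (plane_del z) = 3 / (1 + (cmod z)\<^sup>2)\<^sup>2"
    unfolding of_real_eq_iff .
  define k where "k = - complex_of_real (sqrt 2) / N / N\<^sup>2"
  have kk: "k * cnj k = 2 / (N\<^sup>2 * N\<^sup>2 * N\<^sup>2)"
    using N by (simp add: k_def cN field_simps power2_eq_square csqrt2)
  have "of_real (frob (outer (polar u z) (k *s mid u z) + outer 0 (0 :: complex^5))) =
      herm (k *s mid u z) (k *s mid u z) * herm (polar u z) (polar u z) + herm 0 (0 :: complex^5) * herm 0 (0 :: complex^5)"
    by (rule frob_outer2) (simp add: herm_def)
  also have "\<dots> = (k * cnj k) * herm (mid u z) (mid u z) * herm (polar u z) (polar u z)"
    by (simp add: herm_scale_left herm_scale_right herm_eq_0_iff)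
  also have "\<dots> = 2 / N\<^sup>2"
  proof -
    have "2 / (x * x * x) * x * x = 2 / x" if "x \<noteq> 0" for x :: complex
      using that by (simp add: field_simps)
    then show ?thesis
      unfolding kk norms using N by (metis power_not_zero)
  qed
  finally have "of_real (frob (polar_del z)) = 2 / N\<^sup>2"
    by (simp add: outer_zero polar_del_def k_def N_def)
  also have "\<dots> = of_real (2 / (1 + (cmod z)\<^sup>2)\<^sup>2)"
    unfolding NR by simp
  finally show "frob (polar_del z) = 2 / (1 + (cmod z)\<^sup>2)\<^sup>2"
    unfolding of_real_eq_iff .
qed

end

lemma mat_left_commute: "(A :: complex^'n^'n) ** (mat c ** B) = mat c ** (A ** (B :: complex^'n^'n))"
  unfolding matrix_mul_assoc mat_commute[of A] ..

text \<open>log f = log C + log |\<gamma>'|^2 - 2 log (1 + |\<gamma>|^2). The second term is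
  harmonic, and \<partial>\<partial>-bar of the last is - 2 f / C, so K = 4 / C.\<close>

lemma conformal_curvature_pullback:
  assumes V: "open V" "z \<in> V" and \<gamma>: "\<gamma> holomorphic_on V" "\<And>w. w \<in> V \<Longrightarrow> deriv \<gamma> w \<noteq> 0" and C: "C > 0"
    and f: "\<And>w. w \<in> V \<Longrightarrow> f w = C * (cmod (deriv \<gamma> w))\<^sup>2 / (1 + (cmod (\<gamma> w))\<^sup>2)\<^sup>2"
  shows "conformal_curvature f z = 4 / C"
proof -
  let ?g = "deriv \<gamma>"
  define N where "N = (\<lambda>w. 1 + \<gamma> w * cnj (\<gamma> w))"
  have N: "N w \<noteq> 0" for w
    using one_plus_norm_nonzero by (simp add: N_def)
  have NR: "N w = of_real (1 + (cmod (\<gamma> w))\<^sup>2)" for w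
    by (simp only: N_def of_real_add of_real_1 complex_norm_square)
  have d: "has_wirt \<gamma> (?g w) 0 w" and d2: "has_wirt ?g (deriv ?g w) 0 w" if "w \<in> V" for w
    using that \<gamma>(1) V(1) by (auto intro!: has_wirt_field holomorphic_derivI holomorphic_deriv)
  have dN: "has_wirt N (?g w * cnj (\<gamma> w)) (\<gamma> w * cnj (?g w)) w" if "w \<in> V" for w
    unfolding N_def using has_wirt_add[OF has_wirt_const has_wirt_mult[OF d[OF that] has_wirt_cnj[OF d[OF that]]]] by simp
  \<comment> \<open>This is \<partial>-bar log f.\<close>
  define L where "L = (\<lambda>w. cnj (deriv ?g w / ?g w) - 2 * (\<gamma> w * cnj (?g w) / N w))"
  have fw: "complex_of_real (f w) = of_real C * (?g w * cnj (?g w)) / (N w)\<^sup>2" if "w \<in> V" for w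
    by (simp add: f[OF that] NR flip: complex_norm_square)
  have pos: "1 + (cmod (\<gamma> w))\<^sup>2 > 0" for w
    by (simp add: add_pos_nonneg)
  have fpos: "f w > 0" if "w \<in> V" for w
    using C \<gamma>(2)[OF that] pos[of w] by (simp add: f[OF that])
  have ln: "\<exists>p. has_wirt (\<lambda>w. of_real (ln (f w))) p (L w) w" if w: "w \<in> V" for w
  proof -
    define p where "p = ((of_real C * (deriv ?g w * cnj (?g w) + ?g w * cnj 0)) * (N w)\<^sup>2 - of_real C * (?g w * cnj (?g w)) * (of_nat 2 * N w ^ (2 - 1) * (?g w * cnj (\<gamma> w)))) / ((N w)\<^sup>2)\<^sup>2"
    define q where "q = ((of_real C * (0 * cnj (?g w) + ?g w * cnj (deriv ?g w))) * (N w)\<^sup>2 - of_real C * (?g w * cnj (?g w)) * (of_nat 2 * N w ^ (2 - 1) * (\<gamma> w * cnj (?g w)))) / ((N w)\<^sup>2)\<^sup>2"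
    have "has_wirt (\<lambda>w. of_real C * (?g w * cnj (?g w)) / (N w)\<^sup>2) p q w"
      unfolding p_def q_def
      by (intro has_wirt_divide has_wirt_cmult has_wirt_mult has_wirt_cnj has_wirt_power d2 dN w) (simp add: N)
    then have "has_wirt (\<lambda>w. of_real (f w)) p q w"
      by (rule has_wirt_transform[OF _ V(1) w]) (simp add: fw)
    from has_wirt_ln[OF this fpos[OF w]]
    have "has_wirt (\<lambda>w. of_real (ln (f w))) (p / of_real (f w)) (q / of_real (f w)) w" .
    moreover have "q / of_real (f w) = L w"
      unfolding fw[OF w] q_def L_def using C \<gamma>(2)[OF w] N[of w] by (simp add: field_simps power2_eq_square)
    ultimately show ?thesis
      by auto
  qed
  have "has_wirt (\<lambda>w. deriv ?g w / ?g w) (deriv (\<lambda>w. deriv ?g w / ?g w) z) 0 z"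
  proof -
    have "(\<lambda>w. deriv ?g w / ?g w) holomorphic_on V"
      using \<gamma> V(1) by (intro holomorphic_intros holomorphic_deriv) auto
    then show ?thesis
      using V by (auto intro!: has_wirt_field holomorphic_derivI)
  qed
  from has_wirt_cnj[OF this]
  have l1: "\<exists>q. has_wirt (\<lambda>w. cnj (deriv ?g w / ?g w)) 0 q z"
    by auto
  define r where "r = ((?g z * cnj (?g z)) * N z - \<gamma> z * cnj (?g z) * (?g z * cnj (\<gamma> z))) / (N z)\<^sup>2"
  have "\<exists>q. has_wirt (\<lambda>w. \<gamma> w * cnj (?g w) / N w) r q z"
    by (rule exI, rule has_wirt_eq, rule has_wirt_divide[OF has_wirt_mult[OF d[OF V(2)] has_wirt_cnj[OF d2[OF V(2)]]] dN[OF V(2)] N])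
      (simp_all add: r_def)
  then obtain q1 q2 where "has_wirt (\<lambda>w. cnj (deriv ?g w / ?g w)) 0 q1 z" "has_wirt (\<lambda>w. \<gamma> w * cnj (?g w) / N w) r q2 z"
    using l1 by blast
  then have "has_wirt L (0 - 2 * r) (q1 - 2 * q2) z"
    unfolding L_def by (intro has_wirt_diff has_wirt_cmult)
  then have "has_wirt (\<lambda>w. del_zbar (\<lambda>w. of_real (ln (f w))) w) (0 - 2 * r) (q1 - 2 * q2) z"
  proof (rule has_wirt_transform[OF _ V])
    fix w assume "w \<in> V"
    from ln[OF this] show "L w = del_zbar (\<lambda>w. of_real (ln (f w))) w"
      by (auto dest: has_wirt_del)
  qed
  then have "del_z (del_zbar (\<lambda>w. of_real (ln (f w)))) z = - 2 * r"
    using has_wirt_del(1) by fastforce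
  moreover have "r = ?g z * cnj (?g z) / (N z)\<^sup>2"
    by (simp add: r_def N_def algebra_simps)
  moreover have "?g z * cnj (?g z) / (N z)\<^sup>2 = of_real (f z / C)"
    using fw[OF V(2)] C by simp
  ultimately have "del_z (del_zbar (\<lambda>w. of_real (ln (f w)))) z = of_real (- 2 * (f z / C))"
    by (simp only: of_real_mult of_real_minus of_real_numeral)
  then have "Re (del_z (del_zbar (\<lambda>w. of_real (ln (f w)))) z) = - 2 * (f z / C)"
    by (simp only: Re_complex_of_real)
  moreover have "- 2 / x * (- 2 * (x / C)) = 4 / C" if "x > 0" for x :: real
    using that by simp
  ultimately show ?thesis
    unfolding conformal_curvature_def using fpos[OF V(2)] by (simp only:)
qed

theorem model_curvature:
  assumes \<Lambda>: "invariant_metric [2, 2, 1] \<Lambda>"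
  shows "has_constant_curvature [2, 2, 1] \<Lambda> model_curve (4 / (3 * \<Lambda> 0 1 + 2 * \<Lambda> 1 2))"
  unfolding has_constant_curvature_def
proof (intro allI impI)
  fix U c assume lc: "local_coord U c"
  define C where "C = 3 * \<Lambda> 0 1 + 2 * \<Lambda> 1 2"
  have C: "C > 0"
    using \<Lambda> by (simp add: C_def invariant_metric_def add_pos_pos)
  define P where "P = (\<lambda>i w. orth_proj (model_curve (c w) ! i))"
  define f where "f = (\<lambda>z. \<Lambda> 0 1 * frob (del_z_mat (P 0) z) + \<Lambda> 1 2 * frob (del_z_mat (P 2) z))"
  have "f z > 0 \<and> (\<forall>X Y. flag_metric [2, 2, 1] \<Lambda> (tangent_comp model_curve c z X) (tangent_comp model_curve c z Y) = f z * (X \<bullet> Y)) \<and>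
      conformal_curvature f z = 4 / C" if z: "z \<in> U" for z
  proof -
    obtain V \<gamma> c0 where V: "open V" "z \<in> V" "V \<subseteq> U" and c0: "c0 \<in> {chart0, chart1}"
      and c: "\<And>w. w \<in> V \<Longrightarrow> c w = c0 (\<gamma> w)" and \<gamma>: "\<gamma> holomorphic_on V" "\<And>w. w \<in> V \<Longrightarrow> deriv \<gamma> w \<noteq> 0"
      using local_coord_chart[OF lc z] by metis
    define u where "u = chart_basis c0"
    have on: "orthonormal_upto 5 u"
      unfolding u_def by (rule chart_basis_orthonormal[OF c0])
    have P: "P 0 w = plane u (\<gamma> w)" "P 1 w = mat 1 - plane u (\<gamma> w) - line_proj (polar u (\<gamma> w))" "P 2 w = line_proj (polar u (\<gamma> w))"
      if "w \<in> V" for w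
      unfolding P_def c[OF that] model_chart[OF c0] u_def[symmetric]
      by (simp_all add: orth_proj_eqI[OF projection_plane[OF on]] orth_proj_eqI[OF projection_complement[OF on]]
          orth_proj_line frame_nonzero[OF on])
    have pp: "primitive_point (P 0) (P 1) (P 2) w V (mat (deriv \<gamma> w) ** plane_del u (\<gamma> w)) (mat (cnj (deriv \<gamma> w)) ** adj (plane_del u (\<gamma> w)))
        (mat (deriv \<gamma> w) ** polar_del u (\<gamma> w)) (mat (cnj (deriv \<gamma> w)) ** adj (polar_del u (\<gamma> w)))" if w: "w \<in> V" for w
    proof
      have d: "(\<gamma> has_field_derivative deriv \<gamma> w) (at w)"
        using \<gamma>(1) V(1) w by (simp add: holomorphic_derivI)
      show "has_wirt_mat (P 0) (mat (deriv \<gamma> w) ** plane_del u (\<gamma> w)) (mat (cnj (deriv \<gamma> w)) ** adj (plane_del u (\<gamma> w))) w"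
        by (rule has_wirt_mat_transform[OF has_wirt_mat_precompose[OF plane_wirt[OF on] d] V(1) w]) (simp add: P)
      show "has_wirt_mat (P 2) (mat (deriv \<gamma> w) ** polar_del u (\<gamma> w)) (mat (cnj (deriv \<gamma> w)) ** adj (polar_del u (\<gamma> w))) w"
        by (rule has_wirt_mat_transform[OF has_wirt_mat_precompose[OF polar_del_wirt[OF on] d] V(1) w]) (simp add: P)
      show "mat (cnj (deriv \<gamma> w)) ** adj (plane_del u (\<gamma> w)) ** P 0 w = 0" "mat (deriv \<gamma> w) ** polar_del u (\<gamma> w) ** P 2 w = 0"
        by (simp_all add: P w plane_products[OF on] flip: matrix_mul_assoc)
      show "P 2 w ** (mat (deriv \<gamma> w) ** plane_del u (\<gamma> w)) = 0"
        by (simp add: P w mat_left_commute[of "line_proj (polar u (\<gamma> w))"] plane_products[OF on])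
      fix v assume v: "v \<in> V"
      show "P 0 v ** P 0 v = P 0 v" "adj (P 0 v) = P 0 v" "P 2 v ** P 2 v = P 2 v" "adj (P 2 v) = P 2 v"
        using projection_plane[OF on] projection_line[OF frame_nonzero(3)[OF on]] unfolding P[OF v] projection_def by blast+
      show "P 2 v ** P 0 v = 0" "P 1 v = mat 1 - P 0 v - P 2 v"
        by (simp_all only: P[OF v] plane_products[OF on])
    qed (use V w in auto)
    have del: "del_z_mat (P 0) w = mat (deriv \<gamma> w) ** plane_del u (\<gamma> w)" "del_z_mat (P 2) w = mat (deriv \<gamma> w) ** polar_del u (\<gamma> w)"
      if "w \<in> V" for w
      using primitive_point.D0[OF pp[OF that]] primitive_point.D2[OF pp[OF that]] by (simp_all only: has_wirt_mat_del)
    have f: "f w = C * (cmod (deriv \<gamma> w))\<^sup>2 / (1 + (cmod (\<gamma> w))\<^sup>2)\<^sup>2" if "w \<in> V" for w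
      unfolding f_def del[OF that] frob_scale frob_plane_del[OF on] frob_polar_del[OF on] C_def
      by (simp add: add_divide_distrib algebra_simps)
    have "1 + (cmod (\<gamma> z))\<^sup>2 > 0"
      by (simp add: add_pos_nonneg)
    then have "f z > 0"
      using C \<gamma>(2)[OF V(2)] by (simp add: f[OF V(2)])
    moreover have "flag_metric [2, 2, 1] \<Lambda> (tangent_comp model_curve c z X) (tangent_comp model_curve c z Y) = f z * (X \<bullet> Y)" for X Y
      unfolding f_def del[OF V(2)] by (rule primitive_point.flag_metric_eq[OF pp[OF V(2)]]) (simp_all add: P_def)
    moreover have "conformal_curvature f z = 4 / C"
      by (rule conformal_curvature_pullback[OF V(1,2) \<gamma> C f])
    ultimately show ?thesis
      by blast
  qed
  then show "\<exists>f. \<forall>z\<in>U. f z > 0 \<and>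
      (\<forall>X Y. flag_metric [2, 2, 1] \<Lambda> (tangent_comp model_curve c z X) (tangent_comp model_curve c z Y) = f z * (X \<bullet> Y)) \<and>
      conformal_curvature f z = 4 / (3 * \<Lambda> 0 1 + 2 * \<Lambda> 1 2)"
    unfolding C_def by blast
qed

section \<open>Congruence\<close>

fun affine_sphere :: "complex \<Rightarrow> complex \<Rightarrow> rsphere \<Rightarrow> rsphere" where
  "affine_sphere a b (Fin z) = Fin (a * z + b)"
| "affine_sphere a b Infty = Infty"

lemma affine_sphere_holomorphic:
  assumes a: "a \<noteq> 0" and c: "c \<in> {chart0, chart1}"
  shows "sphere_holomorphic_on (affine_sphere a b \<circ> c) UNIV"
proof -
  have "\<exists>V g. open V \<and> z \<in> V \<and> g holomorphic_on V \<and>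
      ((\<forall>w\<in>V. affine_sphere a b (chart0 w) = chart0 (g w)) \<or> (\<forall>w\<in>V. affine_sphere a b (chart0 w) = chart1 (g w)))" for z
    by (intro exI[of _ UNIV] exI[of _ "\<lambda>w. a * w + b"]) (auto simp: chart0_def intro!: holomorphic_intros)
  moreover have "\<exists>V g. open V \<and> z \<in> V \<and> g holomorphic_on V \<and>
      ((\<forall>w\<in>V. affine_sphere a b (chart1 w) = chart0 (g w)) \<or> (\<forall>w\<in>V. affine_sphere a b (chart1 w) = chart1 (g w)))" for z
  \<comment> \<open>At a + b z = 0 the image point is \<open>Fin 0\<close>, which
    \<open>chart1\<close> misses; there the map is read in \<open>chart0\<close>.\<close>
  proof (cases "a + b * z = 0")
    case True
    then have "z \<noteq> 0"
      using a by auto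
    then show ?thesis
      by (intro exI[of _ "- {0}"] exI[of _ "\<lambda>w. a / w + b"])
        (auto simp: chart0_def chart1_def intro!: holomorphic_intros)
  next
    case False
    have "open {w. a + b * w \<noteq> 0}"
      by (intro open_Collect_neq continuous_intros)
    moreover have "affine_sphere a b (chart1 w) = chart1 (w / (a + b * w))" if "a + b * w \<noteq> 0" for w
      using that by (simp add: chart1_def add_divide_distrib)
    moreover have "(\<lambda>w. w / (a + b * w)) holomorphic_on {w. a + b * w \<noteq> 0}"
      by (intro holomorphic_intros) auto
    ultimately show ?thesis
      using False by (intro exI[of _ "{w. a + b * w \<noteq> 0}"] exI[of _ "\<lambda>w. w / (a + b * w)"]) simp
  qed
  ultimately show ?thesis
    using c unfolding sphere_holomorphic_on_def by auto
qed

lemma affine_sphere_biholomorphism: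
  assumes a: "a \<noteq> 0"
  shows "biholomorphism (affine_sphere a b)"
proof -
  have "affine_sphere a b (affine_sphere (1 / a) (- b / a) x) = x" "affine_sphere (1 / a) (- b / a) (affine_sphere a b x) = x" for x
    using a by (cases x; simp add: field_simps)+
  then have c: "affine_sphere a b \<circ> affine_sphere (1 / a) (- b / a) = id" "affine_sphere (1 / a) (- b / a) \<circ> affine_sphere a b = id"
    by (simp_all add: fun_eq_iff)
  then have "bij (affine_sphere a b)"
    using o_bij by blast
  moreover have "inv (affine_sphere a b) = affine_sphere (1 / a) (- b / a)"
    by (rule inv_unique_comp[OF c])
  moreover have "1 / a \<noteq> 0"
    using a by simp
  ultimately show ?thesis
    using affine_sphere_holomorphic[OF a] affine_sphere_holomorphic[OF \<open>1 / a \<noteq> 0\<close>]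
    unfolding biholomorphism_def by simp
qed

lemma outer_complete:
  fixes u :: "nat \<Rightarrow> complex^5"
  assumes "orthonormal_upto 5 u"
  shows "outer (u 0) (u 0) + outer (u 1) (u 1) + outer (u 2) (u 2) + outer (u 3) (u 3) + outer (u 4) (u 4) = mat 1"
proof -
  have "(\<Sum>i<CARD(5). u i $ a * cnj (u i $ b)) = (if a = b then 1 else 0)" for a b
    by (rule orthonormal_complete) (use assms in simp)
  moreover have "(\<Sum>i<CARD(5). g i) = g 0 + g 1 + g 2 + g 3 + g (4 :: nat)" for g :: "nat \<Rightarrow> complex"
    by (simp add: eval_nat_numeral)
  ultimately show ?thesis
    by (simp add: vec_eq_iff mat_def outer_def)
qed

lemma unitary_frame:
  fixes u :: "nat \<Rightarrow> complex^5"
  assumes on: "orthonormal_upto 5 u"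
  obtains U where "unitary U" "\<And>k. k < 5 \<Longrightarrow> U *v basis5 k = u k"
proof -
  define U where "U = outer (u 0) (basis5 0) + outer (u 1) (basis5 1) + outer (u 2) (basis5 2) + outer (u 3) (basis5 3) + outer (u 4) (basis5 4)"
  have onb: "orthonormal_upto 5 basis5"
    by (simp add: orthonormal_upto_def herm_basis5)
  have h: "herm (u i) (u j) = (if i = j then 1 else 0)" if "i < 5" "j < 5" for i j
    using on that by (simp add: orthonormal_upto_def)
  have aU: "adj U = outer (basis5 0) (u 0) + outer (basis5 1) (u 1) + outer (basis5 2) (u 2) + outer (basis5 3) (u 3) + outer (basis5 4) (u 4)"
    by (simp add: U_def adj_add adj_outer)
  have "U ** adj U = mat 1"
    unfolding aU outer_complete[OF on, symmetric]
    by (simp add: U_def matrix_add_ldistrib matrix_add_rdistrib outer_mult outer_zero herm_basis5[unfolded One_nat_def])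
  moreover have "adj U ** U = mat 1"
    unfolding aU outer_complete[OF onb, symmetric]
    by (simp add: U_def matrix_add_ldistrib matrix_add_rdistrib outer_mult outer_zero h[unfolded One_nat_def])
  ultimately have "unitary U"
    by (simp add: unitary_def)
  moreover have "U *v basis5 k = u k" if "k < 5" for k
  proof -
    have "k \<in> {0, 1, 2, 3, 4}"
      using that by auto
    then show ?thesis
      by (auto simp: U_def matrix_vector_mult_add_rdistrib outer_vec herm_basis5)
  qed
  ultimately show ?thesis
    using that by blast
qed

lemma span_pair: "vec.span {a, b} = vec.span {a} + vec.span {b :: complex^'n}"
proof (intro equalityI subsetI)
  fix x assume "x \<in> vec.span {a, b}"
  then obtain k j where "x - k *s a = j *s b"
    unfolding vec.span_insert[of a "{b}"] vec.span_singleton by blast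
  then have "x = k *s a + j *s b"
    by (simp add: algebra_simps)
  then show "x \<in> vec.span {a} + vec.span {b}"
    by (auto simp: set_plus_def vec.span_singleton)
next
  fix x assume "x \<in> vec.span {a} + vec.span {b}"
  then obtain k j where "x = k *s a + j *s b"
    by (auto simp: set_plus_def vec.span_singleton)
  then show "x \<in> vec.span {a, b}"
    by (simp add: vec.span_base vec.span_scale vec.span_add)
qed

lemma image_span_line: "(*v) U ` vec.span {v} = vec.span {U *v (v :: complex^'n)}"
  by (auto simp: vec.span_singleton vector_scalar_commute image_iff)

lemma image_set_plus: "(*v) U ` (L + M) = (*v) U ` L + (*v) U ` (M :: (complex^'n) set)"
proof (intro equalityI subsetI)
  fix x assume "x \<in> (*v) U ` (L + M)"
  then obtain y w where yw: "y \<in> L" "w \<in> M" "x = U *v (y + w)"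
    by (auto simp: set_plus_def)
  show "x \<in> (*v) U ` L + (*v) U ` M"
    unfolding yw(3) matrix_vector_right_distrib by (intro set_plus_intro imageI yw)
next
  fix x assume "x \<in> (*v) U ` L + (*v) U ` M"
  then obtain y w where "y \<in> L" "w \<in> M" "x = U *v y + U *v w"
    by (auto simp: set_plus_def)
  then have "x = U *v (y + w)" "y + w \<in> L + M"
    by (auto simp: matrix_vector_right_distrib intro: set_plus_intro)
  then show "x \<in> (*v) U ` (L + M)"
    by blast
qed

lemma image_frame:
  "U *v conic u w = conic (\<lambda>k. U *v u k) w" "U *v mid u w = mid (\<lambda>k. U *v u k) w" "U *v polar u w = polar (\<lambda>k. U *v u k) w"
  "U *v ruling u w = ruling (\<lambda>k. U *v u k) w" "U *v coruling u w = coruling (\<lambda>k. U *v u k) w"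
  by (simp_all add: conic_def mid_def polar_def ruling_def coruling_def matrix_vector_right_distrib matrix_vector_mult_diff_distrib
      vector_scalar_commute)

lemma isCont_plane: "orthonormal_upto 5 u \<Longrightarrow> isCont (plane u) z"
  by (rule has_derivative_continuous[OF has_wirt_mat_differentiable[OF plane_wirt]])

lemma isCont_polar: "orthonormal_upto 5 u \<Longrightarrow> isCont (\<lambda>w. line_proj (polar u w)) z"
  for u :: "nat \<Rightarrow> complex^5"
  by (rule has_derivative_continuous[OF has_wirt_mat_differentiable[OF polar_del_wirt]])

context primitive_sphere
begin

text \<open>The normal form describes finite points only. At infinity the comparison passes to
  \<open>chart1\<close> and uses continuity of the projections onto psi_0 and psi_2.\<close>

theorem congruent_model:
  assumes metric: "invariant_metric [2, 2, 1] \<Lambda>" "has_constant_curvature [2, 2, 1] \<Lambda> \<Psi> \<kappa>"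
    and full: "linearly_full \<psi>0" and gauss: "is_gauss_bundle \<psi>0 \<psi>1"
  shows "unitarily_congruent \<Psi> model_curve"
proof -
  obtain u r s where u: "orthonormal_upto 5 u" and r: "r > 0"
    and \<psi>0: "\<And>z. \<psi>0 (Fin z) = vec.span {conic u (of_real r * z + s), u 3 + (of_real r * z + s) *s u 4}"
    and \<psi>2: "\<And>z. \<psi>2 (Fin z) = vec.span {polar u (of_real r * z + s)}"
    using normal_form[OF metric full gauss] by metis
  obtain U where U: "unitary U" and Uu: "\<And>k. k < 5 \<Longrightarrow> U *v basis5 k = u k"
    using unitary_frame[OF u] by metis
  define v where "v = (\<lambda>c k. U *v chart_basis c k)"
  have v0: "conic (v chart0) w = conic u w" "polar (v chart0) w = polar u w" "ruling (v chart0) w = ruling u w" for w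
    by (simp_all add: v_def chart_basis conic_def polar_def ruling_def Uu)
  have iso: "herm (U *v x) (U *v y) = herm x y" for x y
    using U unfolding herm_adj unitary_def by (simp add: matrix_vector_mul_assoc)
  have on: "orthonormal_upto 5 (v c)" if "c \<in> {chart0, chart1}" for c
    using chart_basis_orthonormal[OF that] by (simp add: orthonormal_upto_def v_def iso)
  have img: "map ((`) ((*v) U)) (model_curve (c w)) = [vec.span {conic (v c) w} + vec.span {ruling (v c) w},
      vec.span {mid (v c) w} + vec.span {coruling (v c) w}, vec.span {polar (v c) w}]" if "c \<in> {chart0, chart1}" for c w
    unfolding model_chart[OF that] v_def by (simp add: image_set_plus image_span_line image_frame)
  \<comment> \<open>It suffices to compare the projections for psi_0 and psi_2, since the three add
    up to the identity.\<close>
  have key: "\<Psi> x = map ((`) ((*v) U)) (model_curve (c w))"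
    if c: "c \<in> {chart0, chart1}" and P: "orth_proj (\<psi>0 x) = plane (v c) w" "orth_proj (\<psi>2 x) = line_proj (polar (v c) w)" for x c w
  proof -
    have "orth_proj (\<psi>1 x) = mat 1 - orth_proj (\<psi>0 x) - orth_proj (\<psi>2 x)"
      unfolding proj(7)[of x, symmetric] by simp
    then have P1: "orth_proj (\<psi>1 x) = mat 1 - plane (v c) w - line_proj (polar (v c) w)"
      unfolding P .
    have "L = M" if "projection P L" "projection P M" for P and L M :: "(complex^5) set"
      using that unfolding projection_def by blast
    then have "\<psi>0 x = vec.span {conic (v c) w} + vec.span {ruling (v c) w}"
      "\<psi>1 x = vec.span {mid (v c) w} + vec.span {coruling (v c) w}" "\<psi>2 x = vec.span {polar (v c) w}"
      using proj(1-3)[of x] projection_plane[OF on[OF c], of w] projection_complement[OF on[OF c], of w]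
        projection_line[OF frame_nonzero(3)[OF on[OF c]], of w] unfolding P P1 by blast+
    then show ?thesis
      unfolding img[OF c] by (simp add: \<Psi>)
  qed
  have c0: "chart0 \<in> {chart0, chart1}" and c1: "chart1 \<in> {chart0, chart1}"
    by simp_all
  have fin: "\<Psi> (Fin z) = map ((`) ((*v) U)) (model_curve (Fin (of_real r * z + s)))" for z
  proof -
    let ?w = "of_real r * z + s"
    have "\<psi>0 (Fin z) = vec.span {conic (v chart0) ?w} + vec.span {ruling (v chart0) ?w}"
      unfolding \<psi>0 span_pair v0 by (simp add: ruling_def)
    then have "orth_proj (\<psi>0 (Fin z)) = plane (v chart0) ?w"
      using orth_proj_eqI[OF projection_plane[OF on[OF c0]]] by simp
    moreover have "orth_proj (\<psi>2 (Fin z)) = line_proj (polar (v chart0) ?w)"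
      unfolding \<psi>2 v0[symmetric] by (rule orth_proj_line[OF frame_nonzero(3)[OF on[OF c0]]])
    ultimately have "\<Psi> (Fin z) = map ((`) ((*v) U)) (model_curve (chart0 ?w))"
      by (rule key[OF c0])
    then show ?thesis
      by (simp only: chart0_def)
  qed
  \<comment> \<open>The affine map r z + s in the coordinate w = 1 / z at infinity; it fixes
    0.\<close>
  define g where "g = (\<lambda>w. w / (of_real r + s * w))"
  have chart: "orth_proj (\<psi>0 (chart1 w)) = plane (v chart1) (g w)" "orth_proj (\<psi>2 (chart1 w)) = line_proj (polar (v chart1) (g w))"
    if w: "w \<noteq> 0" "of_real r + s * w \<noteq> 0" for w
  proof -
    have "Fin (of_real r * (1 / w) + s) = chart1 (g w)"
      using w by (simp add: chart1_def g_def add_divide_distrib)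
    then have "\<Psi> (chart1 w) = map ((`) ((*v) U)) (model_curve (chart1 (g w)))"
      using fin[of "1 / w"] w by (simp add: chart1_def)
    then have "\<psi>0 (chart1 w) = vec.span {conic (v chart1) (g w)} + vec.span {ruling (v chart1) (g w)}"
      "\<psi>2 (chart1 w) = vec.span {polar (v chart1) (g w)}"
      unfolding img[OF c1] by (simp_all add: \<Psi>)
    then show "orth_proj (\<psi>0 (chart1 w)) = plane (v chart1) (g w)" "orth_proj (\<psi>2 (chart1 w)) = line_proj (polar (v chart1) (g w))"
      by (simp_all add: orth_proj_eqI[OF projection_plane[OF on[OF c1]]] orth_proj_line frame_nonzero[OF on[OF c1]])
  qed
  have ne: "of_real r + s * 0 \<noteq> (0 :: complex)"
    using r by simp
  have "((\<lambda>w. of_real r + s * w) \<longlongrightarrow> of_real r + s * 0) (at 0)"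
    by (intro tendsto_intros)
  from tendsto_imp_eventually_ne[OF this ne]
  have ev: "\<forall>\<^sub>F w in at 0. w \<noteq> 0 \<and> of_real r + s * w \<noteq> 0"
    by (rule eventually_conj[OF eventually_neq_at_within])
  have g: "isCont g 0" "g 0 = 0"
    using ne unfolding g_def by (auto intro!: continuous_intros)
  have limit: "F 0 = Q 0" if F: "isCont F 0" and Q: "isCont Q (0 :: complex)" and eq: "\<And>w. w \<noteq> 0 \<Longrightarrow> of_real r + s * w \<noteq> 0 \<Longrightarrow> F w = Q (g w)"
    for F Q :: "complex \<Rightarrow> complex^5^5"
  proof -
    have "isCont (\<lambda>w. Q (g w)) 0"
      by (rule isCont_o2[OF g(1)]) (simp add: g(2) Q)
    then have "((\<lambda>w. Q (g w)) \<longlongrightarrow> Q 0) (at 0)"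
      by (simp add: isCont_def g(2))
    moreover have "\<forall>\<^sub>F w in at 0. F w = Q (g w)"
      using ev by eventually_elim (use eq in blast)
    ultimately have "(F \<longlongrightarrow> Q 0) (at 0)"
      by (simp add: tendsto_cong)
    moreover have "(F \<longlongrightarrow> F 0) (at 0)"
      using F by (simp add: isCont_def)
    ultimately show ?thesis
      using tendsto_unique[OF at_neq_bot] by blast
  qed
  have "P0 chart1 0 = plane (v chart1) 0"
    by (rule limit[OF differentiable_imp_continuous_within[OF differentiable(1)[OF c1]] isCont_plane[OF on[OF c1]]])
      (simp add: P0_def chart)
  moreover have "P2 chart1 0 = line_proj (polar (v chart1) 0)"
    by (rule limit[OF differentiable_imp_continuous_within[OF differentiable(2)[OF c1]] isCont_polar[OF on[OF c1]]])
      (simp add: P2_def chart)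
  ultimately have "\<Psi> (chart1 0) = map ((`) ((*v) U)) (model_curve (chart1 0))"
    unfolding P0_def P2_def by (rule key[OF c1])
  then have inf: "\<Psi> Infty = map ((`) ((*v) U)) (model_curve Infty)"
    by (simp add: chart1_def)
  have "\<Psi> x = map ((`) ((*v) U)) (model_curve (affine_sphere (of_real r) s x))" for x
    by (cases x) (simp_all only: affine_sphere.simps fin inf)
  moreover have "biholomorphism (affine_sphere (of_real r) s)"
    using r by (intro affine_sphere_biholomorphism) simp
  ultimately show ?thesis
    unfolding unitarily_congruent_def using U by blast
qed

end

theorem theorem4p1:
  fixes \<psi>\<^sub>0 \<psi>\<^sub>1 \<psi>\<^sub>2 :: "rsphere \<Rightarrow> (complex^5) set"
    and \<Psi> :: "rsphere \<Rightarrow> (complex^5) set list"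
  assumes "\<Psi> = (\<lambda>x. [\<psi>\<^sub>0 x, \<psi>\<^sub>1 x, \<psi>\<^sub>2 x])"
    and "primitive [2, 2, 1] \<Psi>"
    and "immersion [2, 2, 1] \<Psi>"
    and "\<exists>\<Lambda> \<kappa>. invariant_metric [2, 2, 1] \<Lambda> \<and> has_constant_curvature [2, 2, 1] \<Lambda> \<Psi> \<kappa>"
    and "holomorphic_grass_map 2 \<psi>\<^sub>0"
    and "linearly_full \<psi>\<^sub>0"
    and "is_gauss_bundle \<psi>\<^sub>0 \<psi>\<^sub>1"
    and "is_gauss_bundle \<psi>\<^sub>1 \<psi>\<^sub>2"
  shows "unitarily_congruent \<Psi> model_curve \<and>
    (\<forall>\<Lambda> l\<^sub>0 l\<^sub>1 l\<^sub>2. invariant_metric [2, 2, 1] \<Lambda> \<and>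
       l\<^sub>0 = metric_param [2, 2, 1] \<Lambda> 0 \<and>
       l\<^sub>1 = metric_param [2, 2, 1] \<Lambda> 1 \<and>
       l\<^sub>2 = metric_param [2, 2, 1] \<Lambda> 2 \<longrightarrow>
       has_constant_curvature [2, 2, 1] \<Lambda> model_curve (4 / (3 * l\<^sub>0 + 2 * l\<^sub>1)))"
proof -
  interpret primitive_sphere \<psi>\<^sub>0 \<psi>\<^sub>1 \<psi>\<^sub>2 \<Psi>
    by unfold_locales (fact assms)+
  obtain \<Lambda> \<kappa> where "invariant_metric [2, 2, 1] \<Lambda>" "has_constant_curvature [2, 2, 1] \<Lambda> \<Psi> \<kappa>"
    using assms(4) by blast
  then have "unitarily_congruent \<Psi> model_curve"
    using assms(6,7) by (rule congruent_model)
  moreover have "has_constant_curvature [2, 2, 1] \<Lambda> model_curve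
      (4 / (3 * metric_param [2, 2, 1] \<Lambda> 0 + 2 * metric_param [2, 2, 1] \<Lambda> 1))" if "invariant_metric [2, 2, 1] \<Lambda>" for \<Lambda>
  proof -
    have "metric_param [2, 2, 1] \<Lambda> 0 = \<Lambda> 0 1" "metric_param [2, 2, 1] \<Lambda> 1 = \<Lambda> 1 2"
      by (simp_all add: metric_param_def numeral_2_eq_2)
    then show ?thesis
      using model_curvature[OF that] by (simp only:)
  qed
  ultimately show ?thesis
    by blast
qed

end
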